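(* Let $K$ and $L$ be infinite countable compact metric spaces. Then $C(K)\widehat{\otimes}_\pi C(L)$ is isomorphic to exactly one of the spaces $C(\omega^{\omega^\xi})\widehat{\otimes}_\pi C(\omega^{\omega^\zeta})$, where $\zeta\leqslant\xi<\omega_1$ are ordinals.
   Context: For a compact Hausdorff space $K$, $C(K)$ is the Banach space of continuous scalar-valued functions on $K$ with the supremum norm (scalars are $\mathbb{R}$ or $\mathbb{C}$). For an ordinal $\alpha$, $[0,\alpha]$ is the interval of ordinals $\{\eta:0\leqslant\eta\leqslant\alpha\}$ with the order topology and $C(\alpha)$ denotes $C([0,\alpha])$. $\omega$ is the first infinite ordinal, $\omega_1$ the first uncountable ordinal, and powers are ordinal powers. $X\widehat{\otimes}_\pi Y$ is the completed projective tensor product of the Banach spaces $X,Y$. "Isomorphic" means linearly homeomorphic. *)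

theory Defs
  imports "HOL-Analysis.Analysis" "HOL-Library.Poly_Mapping"
begin

section \<open>Countable ordinals\<close>

text \<open>
  The cardinal successor of \<open>natLeq\<close> is a well-order of type \<open>\<omega>\<^sub>1\<close>. The elements of its field,
  ordered by it, therefore represent the ordinals below \<open>\<omega>\<^sub>1\<close>: an element stands for the order
  type of the set of its predecessors.
\<close>

typedef countable_ordinal = "Field (cardSuc natLeq)"
proof -
  have "infinite (Field (cardSuc natLeq))"
    using cardSuc_finite[OF natLeq_Card_order] Field_natLeq by simp
  then show ?thesis
    by (metis ex_in_conv finite.emptyI)
qed

lemma Well_order_cardSuc_natLeq: "Well_order (cardSuc natLeq)"
  using cardSuc_Card_order[OF natLeq_Card_order] card_order_on_def by blast

instantiation countable_ordinal :: wellorder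
begin

definition less_eq_countable_ordinal :: "countable_ordinal \<Rightarrow> countable_ordinal \<Rightarrow> bool" where
  "a \<le> b \<longleftrightarrow> (Rep_countable_ordinal a, Rep_countable_ordinal b) \<in> cardSuc natLeq"

definition less_countable_ordinal :: "countable_ordinal \<Rightarrow> countable_ordinal \<Rightarrow> bool" where
  "a < b \<longleftrightarrow> a \<le> b \<and> \<not> b \<le> a" for a b :: countable_ordinal

instance
proof
  note wo = Well_order_cardSuc_natLeq[unfolded order_on_defs]
  show "a < b \<longleftrightarrow> a \<le> b \<and> \<not> b \<le> a" for a b :: countable_ordinal
    by (rule less_countable_ordinal_def)
  show refl: "a \<le> a" for a :: countable_ordinal
    using wo Rep_countable_ordinal[of a]
    by (auto simp: less_eq_countable_ordinal_def refl_on_def)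
  show "a \<le> c" if "a \<le> b" "b \<le> c" for a b c :: countable_ordinal
    using that wo unfolding less_eq_countable_ordinal_def trans_def by blast
  show antisym: "a = b" if "a \<le> b" "b \<le> a" for a b :: countable_ordinal
    using that wo Rep_countable_ordinal_inject[of a b]
    unfolding less_eq_countable_ordinal_def antisym_def by blast
  show total: "a \<le> b \<or> b \<le> a" for a b :: countable_ordinal
  proof (cases "a = b")
    case True
    then show ?thesis using refl by simp
  next
    case False
    then show ?thesis
      using wo Rep_countable_ordinal[of a] Rep_countable_ordinal[of b]
        Rep_countable_ordinal_inject[of a b]
      unfolding less_eq_countable_ordinal_def total_on_def by blast
  qed
  show "P a" if step: "\<And>x. (\<And>y. y < x \<Longrightarrow> P y) \<Longrightarrow> P x" for P and a :: countable_ordinal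
  proof -
    have "wf (inv_image (cardSuc natLeq - Id) Rep_countable_ordinal)"
      using wo by (intro wf_inv_image) blast
    then show ?thesis
    proof (induction a rule: wf_induct_rule)
      case (less x)
      show ?case
      proof (rule step)
        fix y assume "y < x"
        then show "P y"
          using less[of y] Rep_countable_ordinal_inject[of y x]
          by (auto simp: less_countable_ordinal_def less_eq_countable_ordinal_def in_inv_image)
      qed
    qed
  qed
qed

end

instantiation countable_ordinal :: linorder_topology
begin

definition open_countable_ordinal :: "countable_ordinal set \<Rightarrow> bool" where
  "open_countable_ordinal =
    generate_topology (range (\<lambda>a. {..<a}) \<union> range (\<lambda>a. {a<..}))"

instance
  by standard (rule open_countable_ordinal_def)

end

context
  includes cardinal_syntax
begin

lemma countable_lessThan_ordinal: "countable {..<a :: countable_ordinal}"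
proof -
  let ?r = "cardSuc natLeq" and ?a = "Rep_countable_ordinal a"
  have "|underS ?r ?a| <o ?r"
    using cardSuc_Card_order[OF natLeq_Card_order] Rep_countable_ordinal[of a]
    by (intro card_of_underS)
  then have "|underS ?r ?a| \<le>o natLeq"
    using cardSuc_ordLeq_ordLess[OF natLeq_Card_order card_of_Card_order] by blast
  then have "|underS ?r ?a| \<le>o |UNIV :: nat set|"
    using card_of_nat ordIso_symmetric ordLeq_ordIso_trans by blast
  then have "countable (underS ?r ?a)"
    unfolding countable_def using card_of_ordLeq[of "underS ?r ?a" "UNIV :: nat set"] by blast
  moreover have "Rep_countable_ordinal ` {..<a} \<subseteq> underS ?r ?a"
    by (auto simp: underS_def less_countable_ordinal_def less_eq_countable_ordinal_def)
  ultimately have "countable (Rep_countable_ordinal ` {..<a})"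
    using countable_subset by blast
  then show ?thesis
    by (rule countable_image_inj_on) (simp add: inj_on_def Rep_countable_ordinal_inject)
qed

lemma uncountable_UNIV_ordinal: "uncountable (UNIV :: countable_ordinal set)"
proof
  let ?r = "cardSuc natLeq"
  assume "countable (UNIV :: countable_ordinal set)"
  then have "countable (range Rep_countable_ordinal)"
    by (rule countable_image)
  then have "countable (Field ?r)"
    using type_definition.Rep_range[OF type_definition_countable_ordinal] by simp
  then have "|Field ?r| \<le>o |UNIV :: nat set|"
    unfolding countable_def using card_of_ordLeq[of "Field ?r" "UNIV :: nat set"] by blast
  then have "|Field ?r| \<le>o natLeq"
    using card_of_nat ordLeq_ordIso_trans by blast
  moreover have "|Field ?r| =o ?r"
    by (rule card_of_Field_ordIso[OF cardSuc_Card_order[OF natLeq_Card_order]])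
  ultimately have "?r \<le>o natLeq"
    using ordIso_ordLeq_trans ordIso_symmetric by blast
  then show False
    using cardSuc_greater[OF natLeq_Card_order] not_ordLess_ordLeq by blast
qed

end

lemma ex_ordinal_upper_bound:
  fixes A :: "countable_ordinal set"
  assumes "countable A"
  shows "\<exists>b. \<forall>a\<in>A. a < b"
proof (rule ccontr)
  assume *: "\<nexists>b. \<forall>a\<in>A. a < b"
  have "UNIV \<subseteq> (\<Union>a\<in>A. insert a {..<a})"
  proof
    fix b
    from * obtain a where "a \<in> A" "\<not> a < b" by blast
    then show "b \<in> (\<Union>a\<in>A. insert a {..<a})" by (auto simp: not_less le_less)
  qed
  then show False
    using assms uncountable_UNIV_ordinal countable_lessThan_ordinal
    by (metis countable_UN countable_insert countable_subset)
qed

definition ord_succ :: "countable_ordinal \<Rightarrow> countable_ordinal" where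
  "ord_succ a = (LEAST b. a < b)"

text \<open>
  Countable sets, in particular those arising at the limit stages of \<open>ord_iterate\<close> below, have an
  upper bound by \<open>ex_ordinal_upper_bound\<close>, so that \<open>ord_sup\<close> is their supremum.
\<close>

definition ord_sup :: "countable_ordinal set \<Rightarrow> countable_ordinal" where
  "ord_sup A = (LEAST b. \<forall>a\<in>A. a \<le> b)"

instantiation countable_ordinal :: zero_neq_one
begin

definition zero_countable_ordinal :: countable_ordinal where
  "0 = (LEAST b :: countable_ordinal. True)"

definition one_countable_ordinal :: countable_ordinal where
  "1 = ord_succ 0"

lemma less_ord_succ: "a < ord_succ a"
  unfolding ord_succ_def using ex_ordinal_upper_bound[of "{a}"] by (auto intro: LeastI_ex)

instance
  by standard (metis less_ord_succ less_irrefl one_countable_ordinal_def)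

end

definition ord_omega :: countable_ordinal where
  "ord_omega = (LEAST a. infinite {..<a})"

function ord_iterate ::
  "(countable_ordinal \<Rightarrow> countable_ordinal) \<Rightarrow> countable_ordinal \<Rightarrow> countable_ordinal \<Rightarrow> countable_ordinal"
where
  "ord_iterate f z b =
    (if b = 0 then z
     else if \<exists>c. b = ord_succ c then f (ord_iterate f z (THE c. b = ord_succ c))
     else ord_sup ((\<lambda>c. ord_iterate f z c) ` {..<b}))"
  by pat_completeness auto

lemma ord_succ_inject: "ord_succ a = ord_succ b \<longleftrightarrow> a = b"
proof -
  have "ord_succ a < ord_succ b" if "a < b" for a b
  proof -
    have "ord_succ a \<le> b"
      unfolding ord_succ_def using that by (rule Least_le)
    then show ?thesis using less_ord_succ[of b] by simp
  qed
  then show ?thesis by (metis less_irrefl linorder_cases)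
qed

termination ord_iterate
proof (relation "inv_image {(a, b). a < b} (\<lambda>(f, z, b). b)")
  show "wf (inv_image {(a, b). a < b} (\<lambda>(f, z, b :: countable_ordinal). b))"
    by (intro wf_inv_image wf)
next
  fix f and z b :: countable_ordinal
  assume "\<exists>c. b = ord_succ c"
  then obtain c where "b = ord_succ c" by blast
  moreover from this have "(THE c. b = ord_succ c) = c"
    by (auto simp: ord_succ_inject)
  ultimately show "((f, z, THE c. b = ord_succ c), f, z, b)
      \<in> inv_image {(a, b). a < b} (\<lambda>(f, z, b). b)"
    using less_ord_succ[of c] by (simp add: in_inv_image)
qed auto

declare ord_iterate.simps [simp del]

lemma ord_iterate_0: "ord_iterate f z 0 = z"
  by (simp add: ord_iterate.simps)

lemma ord_iterate_succ: "ord_iterate f z (ord_succ c) = f (ord_iterate f z c)"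
proof -
  have "0 \<le> c" unfolding zero_countable_ordinal_def by (rule Least_le) simp
  then have "ord_succ c \<noteq> 0" using less_ord_succ[of c] by auto
  then show ?thesis
    by (subst ord_iterate.simps) (auto simp: ord_succ_inject)
qed

lemma ord_iterate_limit:
  assumes "b \<noteq> 0" "\<nexists>c. b = ord_succ c"
  shows "ord_iterate f z b = ord_sup (ord_iterate f z ` {..<b})"
  using assms by (subst ord_iterate.simps) simp

definition ord_add :: "countable_ordinal \<Rightarrow> countable_ordinal \<Rightarrow> countable_ordinal" where
  "ord_add a = ord_iterate ord_succ a"

definition ord_mult :: "countable_ordinal \<Rightarrow> countable_ordinal \<Rightarrow> countable_ordinal" where
  "ord_mult a = ord_iterate (\<lambda>x. ord_add x a) 0"

definition ord_power :: "countable_ordinal \<Rightarrow> countable_ordinal \<Rightarrow> countable_ordinal" where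
  "ord_power a = ord_iterate (\<lambda>x. ord_mult x a) 1"


section \<open>Normed spaces with a carrier, and isomorphism\<close>

text \<open>
  The spaces below depend on sets and on ordinals, so they cannot be types of class
  \<open>real_normed_vector\<close>. The scalar field \<open>'k\<close> is meant to be \<^typ>\<open>real\<close> or \<^typ>\<open>complex\<close>.
\<close>

record ('k, 'v) nspace =
  vecs :: "'v set"
  vadd :: "'v \<Rightarrow> 'v \<Rightarrow> 'v"
  vscale :: "'k \<Rightarrow> 'v \<Rightarrow> 'v"
  vnorm :: "'v \<Rightarrow> real"

text \<open>
  The locale \<open>Metric_space\<close> requires distances to be nonnegative and symmetric also outside the
  carrier, hence the case distinction.
\<close>

definition vdist :: "('k::real_normed_field, 'v) nspace \<Rightarrow> 'v \<Rightarrow> 'v \<Rightarrow> real" where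
  "vdist X x y =
    (if x \<in> vecs X \<and> y \<in> vecs X then vnorm X (vadd X x (vscale X (-1) y)) else 0)"

definition norm_topology :: "('k::real_normed_field, 'v) nspace \<Rightarrow> 'v topology" where
  "norm_topology X = Metric_space.mtopology (vecs X) (vdist X)"

definition linear_map ::
  "('k::real_normed_field, 'v) nspace \<Rightarrow> ('k, 'w) nspace \<Rightarrow> ('v \<Rightarrow> 'w) \<Rightarrow> bool"
where
  "linear_map X Y T \<longleftrightarrow>
    T \<in> vecs X \<rightarrow> vecs Y \<and>
    (\<forall>x\<in>vecs X. \<forall>y\<in>vecs X. T (vadd X x y) = vadd Y (T x) (T y)) \<and>
    (\<forall>c. \<forall>x\<in>vecs X. T (vscale X c x) = vscale Y c (T x))"

definition linearly_homeomorphic ::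
  "('k::real_normed_field, 'v) nspace \<Rightarrow> ('k, 'w) nspace \<Rightarrow> bool"
where
  "linearly_homeomorphic X Y \<longleftrightarrow>
    (\<exists>T. linear_map X Y T \<and> homeomorphic_map (norm_topology X) (norm_topology Y) T)"


section \<open>Spaces of continuous functions\<close>

text \<open>
  A function on \<open>K\<close> is represented by its extension by zero to the whole type; continuity is only
  required on \<open>K\<close>. If \<open>K\<close> is an interval \<open>{0..\<alpha>}\<close> of ordinals, its subspace topology is its order
  topology, since intervals are order-convex.
\<close>

definition continuous_functions ::
  "'a::topological_space set \<Rightarrow> ('k::real_normed_field, 'a \<Rightarrow> 'k) nspace"
where
  "continuous_functions K =
    \<lparr> vecs = {f. continuous_on K f \<and> (\<forall>x. x \<notin> K \<longrightarrow> f x = 0)},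
      vadd = (\<lambda>f g x. f x + g x),
      vscale = (\<lambda>c f x. c * f x),
      vnorm = (\<lambda>f. SUP x\<in>K. norm (f x)) \<rparr>"


section \<open>The completed projective tensor product\<close>

text \<open>
  The vectors of the free vector space on \<open>X \<times> Y\<close> are the finitely supported families of scalars
  indexed by \<open>X \<times> Y\<close>; the algebraic tensor product is its quotient by the span of the bilinearity
  relations.
\<close>

definition free_space ::
  "('k::real_normed_field, 'v) nspace \<Rightarrow> ('k, 'w) nspace \<Rightarrow> ('v \<times> 'w \<Rightarrow>\<^sub>0 'k) set"
where
  "free_space X Y = {u. Poly_Mapping.keys u \<subseteq> vecs X \<times> vecs Y}"

definition free_scale :: "'k::real_normed_field \<Rightarrow> ('p \<Rightarrow>\<^sub>0 'k) \<Rightarrow> ('p \<Rightarrow>\<^sub>0 'k)" where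
  "free_scale c u = Poly_Mapping.map (\<lambda>a. c * a) u"

definition free_gen :: "'v \<Rightarrow> 'w \<Rightarrow> ('v \<times> 'w \<Rightarrow>\<^sub>0 'k::real_normed_field)" where
  "free_gen x y = Poly_Mapping.single (x, y) 1"

inductive_set bilinear_relations ::
  "('k::real_normed_field, 'v) nspace \<Rightarrow> ('k, 'w) nspace \<Rightarrow> ('v \<times> 'w \<Rightarrow>\<^sub>0 'k) set"
  for X Y
where
  zero: "0 \<in> bilinear_relations X Y"
| add: "u \<in> bilinear_relations X Y \<Longrightarrow> v \<in> bilinear_relations X Y \<Longrightarrow>
    u + v \<in> bilinear_relations X Y"
| scale: "u \<in> bilinear_relations X Y \<Longrightarrow> free_scale c u \<in> bilinear_relations X Y"
| add_left: "x \<in> vecs X \<Longrightarrow> x' \<in> vecs X \<Longrightarrow> y \<in> vecs Y \<Longrightarrow>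
    free_gen (vadd X x x') y - (free_gen x y + free_gen x' y) \<in> bilinear_relations X Y"
| add_right: "x \<in> vecs X \<Longrightarrow> y \<in> vecs Y \<Longrightarrow> y' \<in> vecs Y \<Longrightarrow>
    free_gen x (vadd Y y y') - (free_gen x y + free_gen x y') \<in> bilinear_relations X Y"
| scale_left: "x \<in> vecs X \<Longrightarrow> y \<in> vecs Y \<Longrightarrow>
    free_gen (vscale X c x) y - free_scale c (free_gen x y) \<in> bilinear_relations X Y"
| scale_right: "x \<in> vecs X \<Longrightarrow> y \<in> vecs Y \<Longrightarrow>
    free_gen x (vscale Y c y) - free_scale c (free_gen x y) \<in> bilinear_relations X Y"

definition tensor_rel ::
  "('k::real_normed_field, 'v) nspace \<Rightarrow> ('k, 'w) nspace \<Rightarrow>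
   (('v \<times> 'w \<Rightarrow>\<^sub>0 'k) \<times> ('v \<times> 'w \<Rightarrow>\<^sub>0 'k)) set"
where
  "tensor_rel X Y =
    {(u, v). u \<in> free_space X Y \<and> v \<in> free_space X Y \<and> u - v \<in> bilinear_relations X Y}"

text \<open>
  The projective norm of a tensor is the infimum of \<open>\<Sum> \<parallel>x\<^sub>i\<parallel> \<parallel>y\<^sub>i\<parallel>\<close> over its representations
  \<open>\<Sum> x\<^sub>i \<otimes> y\<^sub>i\<close> as a finite sum of elementary tensors.
\<close>

definition algebraic_tensor ::
  "('k::real_normed_field, 'v) nspace \<Rightarrow> ('k, 'w) nspace \<Rightarrow> ('k, ('v \<times> 'w \<Rightarrow>\<^sub>0 'k) set) nspace"
where
  "algebraic_tensor X Y =
    \<lparr> vecs = free_space X Y // tensor_rel X Y,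
      vadd = (\<lambda>A B. \<Union>u\<in>A. \<Union>v\<in>B. tensor_rel X Y `` {u + v}),
      vscale = (\<lambda>c A. \<Union>u\<in>A. tensor_rel X Y `` {free_scale c u}),
      vnorm = (\<lambda>A. Inf {\<Sum>(x, y)\<leftarrow>ps. vnorm X x * vnorm Y y | ps.
        set ps \<subseteq> vecs X \<times> vecs Y \<and> (\<Sum>(x, y)\<leftarrow>ps. free_gen x y) \<in> A}) \<rparr>"

definition cauchy_seqs :: "('k::real_normed_field, 'v) nspace \<Rightarrow> (nat \<Rightarrow> 'v) set" where
  "cauchy_seqs X = {s. Metric_space.MCauchy (vecs X) (vdist X) s}"

definition cauchy_rel ::
  "('k::real_normed_field, 'v) nspace \<Rightarrow> ((nat \<Rightarrow> 'v) \<times> (nat \<Rightarrow> 'v)) set"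
where
  "cauchy_rel X = {(s, t). s \<in> cauchy_seqs X \<and> t \<in> cauchy_seqs X \<and>
     (\<lambda>n. vdist X (s n) (t n)) \<longlonglongrightarrow> 0}"

definition completion :: "('k::real_normed_field, 'v) nspace \<Rightarrow> ('k, (nat \<Rightarrow> 'v) set) nspace" where
  "completion X =
    \<lparr> vecs = cauchy_seqs X // cauchy_rel X,
      vadd = (\<lambda>A B. \<Union>s\<in>A. \<Union>t\<in>B. cauchy_rel X `` {\<lambda>n. vadd X (s n) (t n)}),
      vscale = (\<lambda>c A. \<Union>s\<in>A. cauchy_rel X `` {\<lambda>n. vscale X c (s n)}),
      vnorm = (\<lambda>A. the_elem ((\<lambda>s. lim (\<lambda>n. vnorm X (s n))) ` A)) \<rparr>"

definition projective_tensor ::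
  "('k::real_normed_field, 'v) nspace \<Rightarrow> ('k, 'w) nspace \<Rightarrow>
   ('k, (nat \<Rightarrow> ('v \<times> 'w \<Rightarrow>\<^sub>0 'k) set) set) nspace"
  (infixl \<open>\<otimes>\<^sub>\<pi>\<close> 70)
where
  "X \<otimes>\<^sub>\<pi> Y = completion (algebraic_tensor X Y)"

definition C_omega :: "countable_ordinal \<Rightarrow> ('k::real_normed_field, countable_ordinal \<Rightarrow> 'k) nspace"
where
  "C_omega \<xi> = continuous_functions {0..ord_power ord_omega (ord_power ord_omega \<xi>)}"

end

theory Submission
 imports Defs
begin

text \<open>
  Let the Cantor--Bendixson rank of \<open>K\<close> lie between \<open>\<omega>^\<xi>\<close> and a finite multiple of it. Pelczynski's
  decomposition method, applied to the functions that vanish on a derivative of \<open>K\<close>, shows that \<open>C(K)\<close>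
  depends on \<open>\<xi>\<close> only, whence the existence of the pair of exponents.

  For uniqueness, an isomorphism of \<open>C(K) \<otimes> C(L)\<close> with \<open>C(K') \<otimes> C(L')\<close> turns the points of \<open>K \<times> L\<close> into
  bounded bilinear forms on \<open>C(K') \<times> C(L')\<close>. Taking weak limits of such forms again and again while keeping
  a fixed amount of mass moving off to infinity is possible only a number of times controlled by the class
  of \<open>L'\<close> (or \<open>K'\<close>): otherwise one form would be large on many disjoint bumps, against the cotype of the
  dual of \<open>C(K')\<close>. If the class of \<open>K\<close> exceeds those of \<open>K'\<close> and \<open>L'\<close>, then the forms attached to two
  points of \<open>K\<close> come so close that these points cannot be separated. If the class of \<open>L\<close> exceeds that
  of \<open>L'\<close>, then on an infinite rectangle in \<open>K \<times> L\<close> all forms are determined by finitely many functions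
  on \<open>L'\<close>. There, averaging over random signs, \<open>C(K')\<close> does not notice the signs of a Walsh matrix,
  whereas the projective norm of \<open>C(K) \<otimes> C(L)\<close> does.
\<close>

subsection \<open>Ordinal arithmetic\<close>

text \<open>Escape of mass is measured in one variable of the forms. When the class of
  \<open>K\<close> exceeds both targets, symmetrised forms give finite nets for both variables, so
  that forms at neighbouring points are close in norm. When only the class of \<open>L'\<close> is
  exceeded, nothing restrains the variable in C(K'), and the contradiction has to be quantitative.
  On an n by n part of the rectangle a tensor of signs pairs with itself to n^2. Modulo a net of
  fixed size it is seen by finitely many copies of C(K') only. The dual of C(K') is of type L1,
  where Khinchine's inequality compares averages over product signs with a Hilbert-Schmidt norm, and
  this norm ignores multiplication by the Walsh matrix. As a form on a product of two sup-normed
  spaces that matrix has norm at most n^(3/2), which bounds the same average on the side of K and L.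
  Hence n^2 would be at most a constant times n^(3/2). No measures or duals are constructed: a
  finite clopen partition turns finitely many functionals into vectors of a finite-dimensional
  L1.\<close>

lemma ord_zero_le [simp]: "(0::countable_ordinal) \<le> a"
 unfolding zero_countable_ordinal_def by (rule Least_le) simp

lemma ord_not_less_zero [simp]: "\<not> a < (0::countable_ordinal)"
 by (simp add: not_less)

lemma ord_gr_zero: "0 < a \<longleftrightarrow> a \<noteq> (0::countable_ordinal)"
 by (metis ord_zero_le order_le_less less_irrefl)

lemma ord_succ_le_iff: "ord_succ a \<le> b \<longleftrightarrow> a < b"
 by (metis Least_le less_ord_succ less_le_trans ord_succ_def)

lemma less_ord_succ_iff: "a < ord_succ b \<longleftrightarrow> a \<le> b"
 by (metis linorder_not_le ord_succ_le_iff)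

lemma ord_succ_less_iff [simp]: "ord_succ a < ord_succ b \<longleftrightarrow> a < b"
 by (simp add: less_ord_succ_iff ord_succ_le_iff)

lemma ord_succ_neq_zero [simp]: "ord_succ a \<noteq> 0"
 by (metis less_ord_succ ord_not_less_zero)

lemma ord_sup_upper: "countable A ==> a \<in> A ==> a \<le> ord_sup A"
 unfolding ord_sup_def
 using LeastI_ex[of "\<lambda>b. \<forall>a\<in>A. a \<le> b"] ex_ordinal_upper_bound[of A] by (meson less_imp_le)

lemma ord_sup_least: "(\<And>a. a \<in> A ==> a \<le> b) ==> ord_sup A \<le> b"
 unfolding ord_sup_def by (rule Least_le) blast

lemma less_ord_sup_iff: "countable A ==> x < ord_sup A \<longleftrightarrow> (\<exists>a\<in>A. x < a)"
 by (meson linorder_not_le ord_sup_least ord_sup_upper order_less_le_trans)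

definition ord_limit :: "countable_ordinal => bool" where
 "ord_limit b \<longleftrightarrow> b \<noteq> 0 \<and> (\<nexists>c. b = ord_succ c)"

lemma ord_limit_succ: "ord_limit b ==> c < b ==> ord_succ c < b"
 by (metis ord_limit_def ord_succ_le_iff order_le_less)

lemma ord_limitI: "b \<noteq> 0 ==> (\<And>c. c < b ==> \<exists>d<b. c < d) ==> ord_limit b"
 unfolding ord_limit_def by (metis less_ord_succ less_ord_succ_iff not_less)

lemma ord_cases [case_names zero succ limit]:
 "(b = 0 ==> P) ==> (\<And>c. b = ord_succ c ==> P) ==> (ord_limit b ==> P) ==> P"
 unfolding ord_limit_def by blast

lemma ord_induct [case_names zero succ limit]:
 assumes "P 0" "\<And>c. P c ==> P (ord_succ c)" "\<And>b. ord_limit b ==> (\<And>c. c < b ==> P c) ==> P b"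
 shows "P (b :: countable_ordinal)"
proof (induction b rule: less_induct)
 case (less b)
 show ?case
  by (cases b rule: ord_cases) (use assms less less_ord_succ in blast)+
qed

text \<open>A limit stage is described by the ordinals below it. Later limit cases then become
  manipulations of existential quantifiers, and equations follow from
  \<open>ord_eqI\<close>.\<close>

lemma less_ord_iterate_limit:
 assumes "ord_limit b"
 shows "x < ord_iterate f z b \<longleftrightarrow> (\<exists>c<b. x < ord_iterate f z c)"
proof -
 have "ord_iterate f z b = ord_sup (ord_iterate f z ` {..<b})"
  using assms ord_iterate_limit unfolding ord_limit_def by blast
 then show ?thesis
  by (auto simp: less_ord_sup_iff countable_lessThan_ordinal)
qed

lemma ord_iterate_strict_mono:
 assumes "\<And>x. z \<le> x ==> x < f x"
 shows "z \<le> ord_iterate f z b" "a < b ==> ord_iterate f z a < ord_iterate f z b"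
proof -
 \<comment> \<open>The two claims need a joint induction, since \<open>f\<close> is assumed
   inflationary only from \<open>z\<close> on.\<close>
 have "z \<le> ord_iterate f z b \<and> (\<forall>a<b. ord_iterate f z a < ord_iterate f z b)"
 proof (induction b rule: ord_induct)
  case zero
  then show ?case by (simp add: ord_iterate_0)
 next
  case (succ c)
  then show ?case
   using assms[of "ord_iterate f z c"]
   by (auto simp: ord_iterate_succ less_ord_succ_iff le_less intro: less_trans)
 next
  case (limit b)
  have s: "ord_iterate f z a < ord_iterate f z b" if "a < b" for a
   using less_ord_iterate_limit[OF limit(1)] limit.IH[OF ord_limit_succ[OF limit(1) that]]
    ord_limit_succ[OF limit(1) that] less_ord_succ by blast
  moreover have "0 < b" using limit(1) by (simp add: ord_gr_zero ord_limit_def)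
  ultimately show ?case
   by (metis less_imp_le ord_iterate_0)
 qed
 then show "z \<le> ord_iterate f z b" "a < b ==> ord_iterate f z a < ord_iterate f z b" by auto
qed

lemma ord_add_0 [simp]: "ord_add a 0 = a"
 and ord_add_succ: "ord_add a (ord_succ b) = ord_succ (ord_add a b)"
 by (simp_all add: ord_add_def ord_iterate_0 ord_iterate_succ)

lemma less_ord_add_limit: "ord_limit b ==> x < ord_add a b \<longleftrightarrow> (\<exists>c<b. x < ord_add a c)"
 unfolding ord_add_def by (rule less_ord_iterate_limit)

lemma ord_add_less_mono: "b < c ==> ord_add a b < ord_add a c"
 and ord_le_add: "a \<le> ord_add a b"
 unfolding ord_add_def using ord_iterate_strict_mono[of a ord_succ] less_ord_succ by auto

lemma ord_add_less_cancel [simp]: "ord_add a b < ord_add a c \<longleftrightarrow> b < c"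
 by (metis linorder_neqE ord_add_less_mono order_less_asym)

lemma ord_add_le_cancel [simp]: "ord_add a b \<le> ord_add a c \<longleftrightarrow> b \<le> c"
 by (simp add: linorder_not_less[symmetric])

lemma ord_less_add: "b \<noteq> 0 ==> a < ord_add a b"
 by (metis ord_add_0 ord_add_less_mono ord_gr_zero)

lemma ord_limit_add: "ord_limit b ==> ord_limit (ord_add a b)"
proof (rule ord_limitI)
 assume b: "ord_limit b"
 show "ord_add a b \<noteq> 0"
  using b ord_less_add[of b a] unfolding ord_limit_def by force
 fix c assume "c < ord_add a b"
 then obtain d where "d < b" "c < ord_add a d" using less_ord_add_limit[OF b] by blast
 then show "\<exists>d<ord_add a b. c < d" using ord_add_less_mono by blast
qed

lemma ord_eqI: "(\<And>x. x < a \<longleftrightarrow> x < b) ==> a = (b::countable_ordinal)"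
 by (metis less_irrefl linorder_cases)

lemma ord_add_assoc: "ord_add (ord_add a b) c = ord_add a (ord_add b c)"
proof (induction c rule: ord_induct)
 case (limit c)
 have "x < ord_add (ord_add a b) c \<longleftrightarrow> x < ord_add a (ord_add b c)" for x
 proof -
  have "x < ord_add (ord_add a b) c \<longleftrightarrow> (\<exists>d<c. x < ord_add a (ord_add b d))"
   using less_ord_add_limit[OF limit(1)] limit.IH by auto
  \<comment> \<open>The sums \<open>ord_add b d\<close> with \<open>d < c\<close> are cofinal below
    the limit \<open>ord_add b c\<close>.\<close>
  also have "\<dots> \<longleftrightarrow> (\<exists>e<ord_add b c. x < ord_add a e)"
   using less_ord_add_limit[OF limit(1), of _ b]
   by (metis ord_add_less_cancel order_less_trans)
  also have "\<dots> \<longleftrightarrow> x < ord_add a (ord_add b c)"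
   using less_ord_add_limit[OF ord_limit_add[OF limit(1)]] by simp
  finally show ?thesis .
 qed
 then show ?case by (rule ord_eqI)
qed (simp_all add: ord_add_succ)

text \<open>Replaces ordinal subtraction. Derivatives decrease, so an index \<open>h\<close> below a
  sum may be enlarged to one of the form \<open>ord_add a c\<close>; this also covers
  \<open>h\<close> below \<open>a\<close>.\<close>

lemma less_ord_addE: "h < ord_add a b ==> b \<noteq> 0 ==> \<exists>c<b. h \<le> ord_add a c"
proof (cases b rule: ord_cases)
 case (succ c)
 then show "h < ord_add a b ==> ?thesis"
  using less_ord_succ by (auto simp: ord_add_succ less_ord_succ_iff)
next
 case limit
 then show "h < ord_add a b ==> ?thesis"
  using less_ord_add_limit less_imp_le by blast
qed simp

lemma ord_zero_add [simp]: "ord_add 0 a = a"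
proof (induction a rule: ord_induct)
 case (limit b)
 then show ?case
  by (intro ord_eqI) (metis less_ord_add_limit less_ord_succ ord_limit_succ order_less_trans)
qed (simp_all add: ord_add_succ)

section \<open>Products, finite ordinals and omega\<close>

lemma ord_mult_0 [simp]: "ord_mult a 0 = 0"
 and ord_mult_succ: "ord_mult a (ord_succ b) = ord_add (ord_mult a b) a"
 by (simp_all add: ord_mult_def ord_iterate_0 ord_iterate_succ)

primrec ord_of_nat :: "nat => countable_ordinal" where
 "ord_of_nat 0 = 0"
| "ord_of_nat (Suc n) = ord_succ (ord_of_nat n)"

lemma ord_of_nat_less: "m < n ==> ord_of_nat m < ord_of_nat n"
 by (induction n) (auto simp: less_ord_succ_iff less_Suc_eq le_less)

lemma finite_below_ord_of_nat: "finite {..<ord_of_nat n}"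
proof (induction n)
 case (Suc n)
 have "{..<ord_of_nat (Suc n)} = insert (ord_of_nat n) {..<ord_of_nat n}"
  by (auto simp: less_ord_succ_iff)
 then show ?case using Suc by simp
qed (simp add: lessThan_def)

lemma ord_limit_infinite: "ord_limit b ==> infinite {..<b}"
proof
 assume b: "ord_limit b" and fin: "finite {..<b}"
 have "0 \<in> {..<b}" using b by (simp add: ord_limit_def ord_gr_zero)
 then have "Max {..<b} \<in> {..<b}" using fin by (intro Max_in) auto
 then have "ord_succ (Max {..<b}) \<in> {..<b}" using ord_limit_succ[OF b] by blast
 then show False using Max_ge[OF fin] less_ord_succ by (metis linorder_not_less)
qed

text \<open>Ordinals below \<open>ord_omega\<close> have finitely many predecessors, so by
  \<open>ord_limit_infinite\<close> no limit is among them and induction meets only successors of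
  finite ordinals. That some ordinal has infinitely many predecessors comes from an upper bound of
  the finite ones.\<close>

lemma less_ord_omega_iff: "a < ord_omega \<longleftrightarrow> (\<exists>n. a = ord_of_nat n)"
proof -
 have ex: "\<exists>b :: countable_ordinal. infinite {..<b}"
 proof -
  obtain b where b: "\<And>n. ord_of_nat n < b"
   using ex_ordinal_upper_bound[of "range ord_of_nat"] by auto
  have "inj ord_of_nat"
   by (metis injI less_irrefl linorder_neqE_nat ord_of_nat_less)
  then have "infinite (range ord_of_nat)" by (simp add: finite_image_iff)
  moreover have "range ord_of_nat \<subseteq> {..<b}" using b by auto
  ultimately show ?thesis using infinite_super by blast
 qed
 then have inf: "infinite {..<ord_omega}"
  unfolding ord_omega_def by (rule LeastI_ex)
 have fin: "finite {..<a}" if "a < ord_omega" for a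
  using that not_less_Least unfolding ord_omega_def by blast
 show ?thesis
 proof
  assume "\<exists>n. a = ord_of_nat n"
  then show "a < ord_omega"
   using inf finite_below_ord_of_nat
   by (metis finite_subset lessThan_subset_iff linorder_not_le)
 next
  show "\<exists>n. a = ord_of_nat n" if "a < ord_omega"
   using that
  proof (induction a rule: ord_induct)
   case zero
   then show ?case by (metis ord_of_nat.simps(1))
  next
   case (succ c)
   then show ?case by (metis less_ord_succ ord_of_nat.simps(2) order_less_trans)
  next
   case (limit b)
   then show ?case using fin ord_limit_infinite by blast
  qed
 qed
qed

lemma ord_limit_omega: "ord_limit ord_omega"
proof (rule ord_limitI)
 show "ord_omega \<noteq> 0"
  using less_ord_omega_iff[of 0] ord_of_nat.simps(1) by (metis ord_not_less_zero)
 fix c assume "c < ord_omega"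
 then obtain n where "c = ord_of_nat n" using less_ord_omega_iff by blast
 then show "\<exists>d<ord_omega. c < d"
  using less_ord_succ less_ord_omega_iff ord_of_nat.simps(2) by metis
qed

abbreviation ord_nmult :: "countable_ordinal => nat => countable_ordinal" where
 "ord_nmult a n \<equiv> ord_mult a (ord_of_nat n)"

lemma ord_nmult_Suc: "ord_nmult a (Suc n) = ord_add (ord_nmult a n) a"
 by (simp add: ord_mult_succ)

lemma less_ord_mult_omega: "x < ord_mult a ord_omega \<longleftrightarrow> (\<exists>n. x < ord_nmult a n)"
 unfolding ord_mult_def using less_ord_iterate_limit[OF ord_limit_omega] less_ord_omega_iff by metis

lemma ord_mult_less_mono: "a \<noteq> 0 ==> b < c ==> ord_mult a b < ord_mult a c"
 unfolding ord_mult_def using ord_iterate_strict_mono(2)[of 0 "\<lambda>x. ord_add x a"] ord_less_add by auto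

lemma ord_nmult_1 [simp]: "ord_nmult a (Suc 0) = a"
 by (simp add: ord_mult_succ)

lemma less_ord_mult_omega_self: "a \<noteq> 0 ==> a < ord_mult a ord_omega"
 by (metis less_ord_mult_omega lessI ord_mult_less_mono ord_nmult_1 ord_of_nat_less)

section \<open>Powers of omega\<close>

definition omega_pow :: "countable_ordinal => countable_ordinal" where
 "omega_pow = ord_power ord_omega"

lemma omega_pow_0 [simp]: "omega_pow 0 = 1"
 and omega_pow_succ: "omega_pow (ord_succ a) = ord_mult (omega_pow a) ord_omega"
 by (simp_all add: omega_pow_def ord_power_def ord_iterate_0 ord_iterate_succ)

lemma less_omega_pow_limit: "ord_limit b ==> x < omega_pow b \<longleftrightarrow> (\<exists>c<b. x < omega_pow c)"
 unfolding omega_pow_def ord_power_def by (rule less_ord_iterate_limit)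

lemma ord_one_le_iff: "1 \<le> a \<longleftrightarrow> a \<noteq> (0::countable_ordinal)"
 by (simp add: one_countable_ordinal_def ord_succ_le_iff ord_gr_zero)

lemma omega_pow_less_mono: "a < b ==> omega_pow a < omega_pow b"
 and omega_pow_ge_one: "1 \<le> omega_pow a"
proof -
 have *: "1 \<le> x ==> x < ord_mult x ord_omega" for x
  by (simp add: less_ord_mult_omega_self ord_one_le_iff)
 show "a < b ==> omega_pow a < omega_pow b" "1 \<le> omega_pow a"
  unfolding omega_pow_def ord_power_def using ord_iterate_strict_mono[OF *] by simp_all
qed

lemma omega_pow_neq_zero [simp]: "omega_pow a \<noteq> 0"
 using omega_pow_ge_one[of a] ord_one_le_iff by blast

lemma omega_pow_pos [simp]: "0 < omega_pow a"
 by (simp add: ord_gr_zero)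

lemma omega_pow_less_iff [simp]: "omega_pow a < omega_pow b \<longleftrightarrow> a < b"
 by (metis linorder_neqE omega_pow_less_mono order_less_asym)

lemma omega_pow_le_iff [simp]: "omega_pow a \<le> omega_pow b \<longleftrightarrow> a \<le> b"
 by (simp add: linorder_not_less[symmetric])

lemma omega_pow_ge_self: "a \<le> omega_pow a"
proof (induction a rule: less_induct)
 case (less a)
 show ?case
 proof (rule ccontr)
  assume "\<not> a \<le> omega_pow a"
  then have "omega_pow a < a" by simp
  then show False using less[of "omega_pow a"] omega_pow_less_iff[of "omega_pow a" a] by simp
 qed
qed

lemma less_omega_pow_succ: "x < omega_pow (ord_succ a) \<longleftrightarrow> (\<exists>n. x < ord_nmult (omega_pow a) n)"
 by (simp add: omega_pow_succ less_ord_mult_omega)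

text \<open>\<open>x\<close> is the leading exponent of the Cantor normal form of \<open>a\<close>.
  The least \<open>b\<close> with \<open>a < omega_pow b\<close> is not 0 because \<open>a\<close>
  is at least 1, and not a limit because \<open>omega_pow\<close> is continuous there, so it is the
  successor of \<open>x\<close>.\<close>

lemma omega_pow_bracket:
 assumes "a \<noteq> 0"
 obtains x n where "omega_pow x \<le> a" "a < ord_nmult (omega_pow x) n"
proof -
 define b where "b = (LEAST b. a < omega_pow b)"
 have ex: "a < omega_pow (ord_succ a)"
  using omega_pow_ge_self less_ord_succ order_less_le_trans by blast
 have b: "a < omega_pow b" and nb: "\<And>c. c < b ==> omega_pow c \<le> a"
  unfolding b_def using LeastI[of "\<lambda>b. a < omega_pow b", OF ex] not_less_Least by force+
 show thesis
 proof (cases b rule: ord_cases)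
  case zero
  then show ?thesis
   using b assms by (simp add: ord_one_le_iff[symmetric])
 next
  case (succ c)
  then show ?thesis
   using that[of c] nb less_ord_succ b less_omega_pow_succ by blast
 next
  case limit
  then show ?thesis using less_omega_pow_limit[OF limit] b nb by (meson not_less)
 qed
qed

lemma ord_nmult_le_omega_pow_succ: "ord_nmult (omega_pow a) n \<le> omega_pow (ord_succ a)"
 by (meson less_omega_pow_succ linorder_not_le order_less_irrefl)

subsection \<open>Cantor--Bendixson derivatives\<close>

text \<open>One clause replaces the usual three cases, which come back as \<open>CB_0\<close>,
  \<open>CB_succ\<close> and \<open>CB_limit\<close>. Membership in \<open>K\<close> is imposed at
  every stage, so that the definition makes sense for sets that are not closed, such as
  \<open>K \<inter> U\<close>.\<close>

function CB :: "'a::topological_space set => countable_ordinal => 'a set" where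
 "CB K g = {x \<in> K. \<forall>h. h < g --> x islimpt CB K h}"
 by pat_completeness auto
termination
 by (relation "inv_image {(a, b). a < b} snd") (auto intro: wf)

declare CB.simps [simp del]

lemma CB_iff:
 "x \<in> CB K g \<longleftrightarrow> x \<in> K \<and> (\<forall>h<g. x islimpt CB K h)"
 by (subst CB.simps) auto

lemma CB_subset: "CB K g \<subseteq> K"
 by (auto simp: CB_iff[of _ K g])

lemma CB_antimono: "g \<le> h ==> CB K h \<subseteq> CB K g"
 by (meson CB_iff order_less_le_trans subsetI)

lemma CB_0 [simp]: "CB K 0 = K"
 by (auto simp: CB_iff[of _ K 0])

lemma CB_succ:
 "CB K (ord_succ g) = {x \<in> K. x islimpt CB K g}"
proof (intro set_eqI iffI)
 fix x assume "x \<in> CB K (ord_succ g)"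
 then show "x \<in> {x \<in> K. x islimpt CB K g}"
  using less_ord_succ[of g] by (simp add: CB_iff[of x K "ord_succ g"])
next
 fix x assume x: "x \<in> {x \<in> K. x islimpt CB K g}"
 have "x islimpt CB K h" if "h < ord_succ g" for h
  using x that islimpt_subset[OF _ CB_antimono[of h g K]] by (simp add: less_ord_succ_iff)
 then show "x \<in> CB K (ord_succ g)"
  using x by (simp add: CB_iff[of x K "ord_succ g"])
qed

lemma CB_limit:
 assumes "ord_limit g"
 shows "CB K g = (\<Inter>h\<in>{..<g}. CB K h)"
proof
 show "CB K g \<subseteq> (\<Inter>h\<in>{..<g}. CB K h)"
  by (intro INT_greatest CB_antimono) simp
 show "(\<Inter>h\<in>{..<g}. CB K h) \<subseteq> CB K g"
 proof
  fix x assume x: "x \<in> (\<Inter>h\<in>{..<g}. CB K h)"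
  have "0 < g" using assms by (simp add: ord_limit_def ord_gr_zero)
  then have "x \<in> K" using x CB_subset by blast
  moreover have "x islimpt CB K h" if "h < g" for h
   using x ord_limit_succ[OF assms that] CB_succ by blast
  ultimately show "x \<in> CB K g" by (simp add: CB_iff[of _ K g])
 qed
qed

lemma CB_empty [simp]: "CB {} g = {}"
 using CB_subset by blast

lemma compact_CB:
 fixes K :: "'a::t2_space set"
 assumes "compact K"
 shows "compact (CB K g)"
proof -
 have "closed (CB K g)"
  unfolding closed_limpt
 proof (intro allI impI)
  fix x assume x: "x islimpt CB K g"
  have "x \<in> K"
   using x compact_imp_closed[OF assms] islimpt_subset[OF x CB_subset]
   by (simp add: closed_limpt)
  moreover have "x islimpt CB K h" if "h < g" for h
   using islimpt_subset[OF x CB_antimono] that by simp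
  ultimately show "x \<in> CB K g" by (simp add: CB_iff[of x K g])
 qed
 then show ?thesis
  using assms CB_subset
  by (metis compact_Int_closed inf.absorb_iff2)
qed

lemma islimpt_Int_open: "open U ==> x \<in> U ==> x islimpt S \<inter> U \<longleftrightarrow> x islimpt S"
 by (metis eventually_at_topological inf_le1 islimpt_Int_eventually islimpt_subset)

lemma CB_Int_open:
 assumes "open U"
 shows "CB (K \<inter> U) g = CB K g \<inter> U"
proof (induction g rule: less_induct)
 case (less g)
 have "x \<in> CB (K \<inter> U) g \<longleftrightarrow> x \<in> CB K g \<inter> U" for x
  using less islimpt_Int_open[OF assms]
  by (auto simp: CB_iff[of _ "K \<inter> U" g] CB_iff[of _ K g])
 then show ?case by blast
qed

lemma homeomorphism_islimpt:
 assumes hom: "homeomorphism K L f k" and "x \<in> K" "S \<subseteq> K" "x islimpt S"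
 shows "f x islimpt f ` S"
proof (rule islimptI)
 fix T assume T: "f x \<in> T" "open T"
 have "continuous_on K f" using hom by (simp add: homeomorphism_def)
 then obtain A where A: "open A" "A \<inter> K = f -` T \<inter> K"
  using T(2) continuous_on_open_invariant by metis
 have "x \<in> A" using A(2) T(1) assms(2) by blast
 then obtain y where "y \<in> S" "y \<in> A" "y \<noteq> x"
  using assms(4) A(1) by (meson islimptE)
 then show "\<exists>y\<in>f ` S. y \<in> T \<and> y \<noteq> f x"
  using A(2) assms hom unfolding homeomorphism_def by (metis IntI Int_iff image_eqI subsetD vimageE)
qed

text \<open>Lets intervals of ordinals, whose type carries no metric, be exchanged for metric models
  with the same derivatives.\<close>

lemma homeomorphism_CB:
 assumes "homeomorphism K L f k"
 shows "CB L g = f ` CB K g"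
proof (induction g rule: less_induct)
 case (less g)
 have k: "homeomorphism L K k f" using assms homeomorphism_sym by blast
 have fK: "f ` K = L" and kf: "\<And>x. x \<in> K ==> k (f x) = x"
  using assms by (auto simp: homeomorphism_def)
 have kcb: "k ` CB L h = CB K h" if "h < g" for h
  using less[OF that] kf CB_subset[of K h] by (force simp: image_image)
 have lim: "f x islimpt CB L h \<longleftrightarrow> x islimpt CB K h"
  if "x \<in> K" "h < g" for x h
 proof
  assume "f x islimpt CB L h"
  then have "k (f x) islimpt k ` CB L h"
   using that fK by (intro homeomorphism_islimpt[OF k _ CB_subset]) auto
  then show "x islimpt CB K h" using kcb kf that by simp
 next
  assume "x islimpt CB K h"
  then have "f x islimpt f ` CB K h"
   by (intro homeomorphism_islimpt[OF assms that(1) CB_subset])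
  then show "f x islimpt CB L h" using less[OF that(2)] by simp
 qed
 have "y \<in> CB L g \<longleftrightarrow> y \<in> f ` CB K g" for y
  using lim fK by (auto simp: CB_iff[of _ L g] CB_iff[of _ K g] image_iff)
 then show ?case by blast
qed

text \<open>Derivation is an iteration, so orders add. In units of \<open>omega_pow \<xi>\<close>,
  the multiple \<open>ord_nmult\<close> therefore counts how often that derivative is
  repeated.\<close>

lemma CB_add:
 "CB (CB K a) b = CB K (ord_add a b)"
proof (induction b rule: less_induct)
 case (less b)
 show ?case
 proof (cases "b = 0")
  case False
  have "x \<in> CB (CB K a) b \<longleftrightarrow> x \<in> CB K (ord_add a b)" for x
  proof
   assume "x \<in> CB (CB K a) b"
   then have x: "x \<in> K" "\<And>h. h < b ==> x islimpt CB K (ord_add a h)"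
    using less CB_subset[of K a]
    by (auto simp: CB_iff[of x "CB K a" b])
   have "x islimpt CB K h" if h: "h < ord_add a b" for h
    using less_ord_addE[OF h False] x(2) islimpt_subset CB_antimono by metis
   then show "x \<in> CB K (ord_add a b)"
    using x by (simp add: CB_iff[of x K "ord_add a b"])
  next
   assume x: "x \<in> CB K (ord_add a b)"
   then have "x \<in> CB K a"
    using CB_antimono ord_le_add by blast
   moreover have "x islimpt CB (CB K a) h" if "h < b" for h
    using x that less by (simp add: CB_iff[of x K "ord_add a b"])
   ultimately show "x \<in> CB (CB K a) b"
    by (simp add: CB_iff[of x "CB K a" b])
  qed
  then show ?thesis by blast
 qed simp
qed

text \<open>Compactness of both halves is, in a Hausdorff space, the same as being relatively clopen
  in a compact \<open>K\<close>. In this form unions, preimages and pieces of pieces need no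
  subspace topologies.\<close>

definition clopen_in :: "'a::topological_space set => 'a set => bool" where
 "clopen_in K A \<longleftrightarrow> A \<subseteq> K \<and> compact A \<and> compact (K - A)"

lemma clopen_in_self: "compact K ==> clopen_in K K"
 by (simp add: clopen_in_def)

lemma clopen_in_empty: "compact K ==> clopen_in K {}"
 by (simp add: clopen_in_def)

lemma clopen_in_Diff_self: "clopen_in K A ==> clopen_in K (K - A)"
 by (simp add: clopen_in_def double_diff)

lemma clopen_in_Un:
 fixes K :: "'a::t2_space set"
 shows "clopen_in K A ==> clopen_in K B ==> clopen_in K (A \<union> B)"
 unfolding clopen_in_def by (simp add: compact_Un Diff_Un compact_Int compact_imp_closed compact_Int_closed)

lemma clopen_in_Int:
 fixes K :: "'a::t2_space set"
 assumes "clopen_in K A" "clopen_in K B"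
 shows "clopen_in K (A \<inter> B)"
proof -
 have "clopen_in K (K - ((K - A) \<union> (K - B)))"
  by (intro clopen_in_Diff_self clopen_in_Un assms)
 moreover have "K - ((K - A) \<union> (K - B)) = A \<inter> B" using assms by (auto simp: clopen_in_def)
 ultimately show ?thesis by simp
qed

lemma clopen_in_Diff:
 fixes K :: "'a::t2_space set"
 assumes "clopen_in K A" "clopen_in K B"
 shows "clopen_in K (A - B)"
proof -
 have "A - B = A \<inter> (K - B)" using assms by (auto simp: clopen_in_def)
 then show ?thesis using assms clopen_in_Int clopen_in_Diff_self by metis
qed

lemma clopen_in_UN:
 fixes K :: "'a::t2_space set"
 shows "finite I ==> compact K ==> (\<And>i. i \<in> I ==> clopen_in K (A i)) ==> clopen_in K (\<Union>i\<in>I. A i)"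
 by (induction I rule: finite_induct) (auto intro: clopen_in_Un clopen_in_empty)

lemma clopen_in_trans:
 fixes K :: "'a::t2_space set"
 assumes "clopen_in K A" "clopen_in A B"
 shows "clopen_in K B"
proof -
 have "K - B = (K - A) \<union> (A - B)" using assms by (auto simp: clopen_in_def)
 then show ?thesis using assms by (auto simp: clopen_in_def compact_Un)
qed

lemma clopen_in_subset:
 fixes K :: "'a::t2_space set"
 assumes "clopen_in K A" "B \<subseteq> K" "compact B"
 shows "clopen_in B (A \<inter> B)"
proof -
 have "B - A \<inter> B = B \<inter> (K - A)" using assms by auto
 then show ?thesis
  using assms by (auto simp: clopen_in_def compact_Int)
qed

lemma clopen_in_open:
 fixes K :: "'a::t2_space set"
 assumes "clopen_in K A"
 shows "open (- (K - A))" "A = K \<inter> - (K - A)"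
 using assms by (auto simp: clopen_in_def compact_imp_closed simp del: Compl_Diff_eq)

lemma CB_clopen:
 fixes K :: "'a::t2_space set"
 assumes "clopen_in K A"
 shows "CB A g = CB K g \<inter> A"
 using CB_Int_open[OF clopen_in_open(1)[OF assms], of K g] clopen_in_open(2)[OF assms]
  CB_subset[of K g] by auto

text \<open>Baire: without isolated points, \<open>K\<close> would be a countable union of nowhere
  dense singletons.\<close>

lemma compact_countable_isolated:
 fixes K :: "'a::metric_space set"
 assumes "compact K" "countable K" "K \<noteq> {}"
 shows "\<exists>x\<in>K. \<not> x islimpt K"
proof (rule ccontr)
 assume *: "\<not> ?thesis"
 let ?X = "top_of_set K"
 have cm: "completely_metrizable_space ?X"
  using assms(1) by (intro locally_compact_imp_completely_metrizable_space metrizable_space_subtopology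
    compact_imp_locally_compact_space) (auto simp: metrizable_space_euclidean compact_space_subtopology)
 have "?X interior_of {x} = {}" if "x \<in> K" for x
 proof (rule ccontr)
  assume "?X interior_of {x} \<noteq> {}"
  then have "openin ?X {x}"
   by (metis interior_of_subset openin_interior_of subset_singletonD)
  then obtain U where U: "open U" "{x} = K \<inter> U" by (auto simp: openin_open)
  have "x islimpt K \<inter> U" using islimpt_Int_open[OF U(1)] U(2) * that by blast
  then show False using U(2) by (metis finite.emptyI finite_insert islimpt_finite)
 qed
 then have "?X interior_of \<Union>((\<lambda>x. {x}) ` K) = {}"
  using assms cm by (intro Baire_category_alt) (auto simp: closedin_closed_subset)
 then have "?X interior_of K = {}" by simp
 then show False
  using assms(3) by (metis interior_of_topspace topspace_euclidean_subtopology)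
qed

lemma CB_no_perfect:
 fixes K :: "'a::metric_space set"
 assumes "compact K" "countable K" "CB K g \<noteq> {}"
 shows "\<exists>x. x \<in> CB K g \<and> x \<notin> CB K (ord_succ g)"
 using compact_countable_isolated[OF compact_CB[OF assms(1)] _ assms(3)]
  countable_subset[OF CB_subset assms(2)] CB_succ by blast

text \<open>Choosing at every stage a point that leaves there would inject the uncountably many
  ordinals into \<open>K\<close>.\<close>

lemma CB_eventually_empty:
 fixes K :: "'a::metric_space set"
 assumes "compact K" "countable K"
 shows "\<exists>g. CB K g = {}"
proof (rule ccontr)
 assume "\<nexists>g. CB K g = {}"
 then obtain x where x: "\<And>g. x g \<in> CB K g \<and> x g \<notin> CB K (ord_succ g)"
  using CB_no_perfect[OF assms] by metis
 have "x g \<noteq> x h" if "g < h" for g h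
  using x[of g] x[of h] CB_antimono[of "ord_succ g" h K] that
  by (auto simp: ord_succ_le_iff)
 then have "inj x" by (metis injI linorder_neqE)
 moreover have "countable (range x)"
  using x CB_subset by (blast intro: countable_subset[OF _ assms(2)])
 ultimately show False
  using uncountable_UNIV_ordinal countable_image_inj_on by blast
qed

text \<open>Finite intersection property. The first empty derivative thus never has a limit index,
  which is why \<open>CB_top\<close> finds a last nonempty one.\<close>

lemma CB_limit_empty:
 fixes K :: "'a::t2_space set"
 assumes "compact K" "ord_limit g" "CB K g = {}"
 shows "\<exists>h<g. CB K h = {}"
proof (rule ccontr)
 assume *: "\<not> ?thesis"
 have "K \<inter> (\<Inter>h\<in>{..<g}. CB K h) \<noteq> {}"
 proof (rule compact_imp_fip_image[OF assms(1)])
  show "closed (CB K h)" for h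
   by (intro compact_imp_closed compact_CB assms)
  fix I assume I: "finite I" "I \<subseteq> {..<g}"
  have g0: "0 < g" using assms(2) by (simp add: ord_limit_def ord_gr_zero)
  \<comment> \<open>Inserting 0 keeps the maximum meaningful when \<open>I\<close> is empty.\<close>
  define m where "m = Max (insert 0 I)"
  have "m \<in> insert 0 I" unfolding m_def using I by (intro Max_in) auto
  then have "m < g" using I g0 by auto
  have "CB K m \<subseteq> CB K h" if "h \<in> I" for h
   using that I by (intro CB_antimono) (simp add: m_def)
  then show "K \<inter> (\<Inter>h\<in>I. CB K h) \<noteq> {}"
   using * \<open>m < g\<close> CB_subset[of K m] by blast
 qed
 then show False using assms CB_limit[OF assms(2)] by blast
qed

lemma CB_rank:
 fixes K :: "'a::metric_space set"
 assumes "compact K" "countable K" "x \<in> K"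
 obtains g where "x \<in> CB K g" "x \<notin> CB K (ord_succ g)"
proof -
 define b where "b = (LEAST b. x \<notin> CB K b)"
 have ex: "\<exists>b. x \<notin> CB K b"
  using CB_eventually_empty[OF assms(1,2)] by blast
 have b: "x \<notin> CB K b" and nb: "\<And>c. c < b ==> x \<in> CB K c"
  unfolding b_def using LeastI_ex[OF ex] not_less_Least by blast+
 show thesis
 proof (cases b rule: ord_cases)
  case zero
  then show ?thesis using b assms by simp
 next
  case (succ c)
  then show ?thesis using that[of c] b nb less_ord_succ by blast
 next
  case limit
  then show ?thesis using b nb CB_limit by blast
 qed
qed

lemma compact_CB_succ_empty:
 fixes K :: "'a::t2_space set"
 assumes "compact K" "CB K (ord_succ g) = {}"
 shows "finite (CB K g)"
 using finite_not_islimpt_in_compact[OF assms(1), of "CB K g"] assms(2)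
  CB_subset[of K g] by (auto simp: CB_succ Int_absorb1)

lemma CB_top:
 fixes K :: "'a::metric_space set"
 assumes "compact K" "countable K" "K \<noteq> {}"
 obtains g where "CB K g \<noteq> {}" "CB K (ord_succ g) = {}"
proof -
 define b where "b = (LEAST b. CB K b = {})"
 have b: "CB K b = {}" and nb: "\<And>c. c < b ==> CB K c \<noteq> {}"
  unfolding b_def using LeastI_ex[OF CB_eventually_empty[OF assms(1,2)]] not_less_Least
  by blast+
 show thesis
 proof (cases b rule: ord_cases)
  case zero
  then show ?thesis using b assms by simp
 next
  case (succ c)
  then show ?thesis using that[of c] b nb less_ord_succ by blast
 next
  case limit
  then show ?thesis using b nb CB_limit_empty[OF assms(1)] by blast
 qed
qed

text \<open>A countable compact space has no perfect part, so lower ranks accumulate at every point.\<close>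

lemma infinite_exact_rank:
 fixes K :: "'a::metric_space set"
 assumes "compact K" "countable K" "x \<in> CB K h" "g < h" "open U" "x \<in> U"
 shows "infinite {y \<in> U. y \<in> CB K g \<and> y \<notin> CB K (ord_succ g)}"
proof
 let ?I = "{y \<in> U. y \<in> CB K g \<and> y \<notin> CB K (ord_succ g)}"
 assume fin: "finite ?I"
 have xs: "x \<in> CB K (ord_succ g)"
  using assms(3,4) CB_antimono by (metis in_mono ord_succ_le_iff)
 \<comment> \<open>Finite sets are closed, and \<open>x\<close> itself is not removed because its
   rank exceeds \<open>g\<close>.\<close>
 let ?U = "U - ?I"
 have U': "open ?U" "x \<in> ?U" using open_Diff[OF assms(5) finite_imp_closed[OF fin]] assms xs by blast+
 then obtain e where e: "e > 0" "cball x e \<subseteq> ?U" by (meson open_contains_cball)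
 let ?V = "cball x e"
 \<comment> \<open>The closure of this piece is compact and countable. A point isolated in it must
   lie in the piece itself and is then isolated in \<open>CB K g\<close>: it has rank exactly
   \<open>g\<close>, although all such points of \<open>U\<close> were removed.\<close>
 let ?P = "CB K g \<inter> ball x e"
 let ?C = "closure ?P"
 have CC: "?C \<subseteq> CB K g \<inter> cball x e"
  using compact_imp_closed[OF compact_CB[OF assms(1)]]
  by (intro closure_minimal) auto
 have cC: "compact ?C"
  using compact_Int_closed[OF compact_CB[OF assms(1)], of ?C g] CC
  by (simp add: Int_absorb1)
 have "x \<in> CB K g" using xs CB_antimono[OF less_imp_le[OF less_ord_succ]] by (rule rev_subsetD)
 then have "x \<in> ?C" using e closure_subset[of ?P] by auto
 then have ne: "?C \<noteq> {}" by (metis empty_iff)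
 have cntC: "countable ?C"
  by (rule countable_subset[OF _ assms(2)]) (use CC CB_subset[of K g] in auto)
 obtain y where y: "y \<in> ?C" "\<not> y islimpt ?C"
  using compact_countable_isolated[OF cC cntC ne] by (rule bexE)
 have "\<not> y islimpt ?P" using y(2) islimpt_subset[OF _ closure_subset, of y ?P] by argo
 then have yP: "y \<in> ?P" using y(1) by (simp add: closure_def)
 then have "\<not> y islimpt CB K g"
  using \<open>\<not> y islimpt ?P\<close> islimpt_Int_open[of "ball x e" y] by auto
 then have yI: "y \<notin> CB K (ord_succ g)" by (simp add: CB_succ)
 have "y \<in> cball x e" using yP by simp
 then have "y \<in> U" "y \<notin> ?I" using e(2) by (meson DiffD1 DiffD2 subsetD)+
 then show False using yP yI by simp
qed

section \<open>Derivatives of intervals of ordinals\<close>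

lemma ord_limit_omega_pow:
 assumes "g \<noteq> 0"
 shows "ord_limit (omega_pow g)"
proof (rule ord_limitI)
 fix c assume c: "c < omega_pow g"
 show "\<exists>d<omega_pow g. c < d"
 proof (cases g rule: ord_cases)
  case (succ h)
  then obtain n where "c < ord_nmult (omega_pow h) n" using c less_omega_pow_succ by blast
  moreover have "ord_nmult (omega_pow h) n < omega_pow g"
   unfolding succ less_omega_pow_succ
   by (rule exI[of _ "Suc n"]) (simp add: ord_mult_less_mono ord_of_nat_less less_ord_succ)
  ultimately show ?thesis by blast
 next
  case limit
  then show ?thesis using c less_omega_pow_limit omega_pow_less_iff by blast
 qed (use assms in simp)
qed simp

lemma ord_greaterThanAtMost_open: "open {c<..x :: countable_ordinal}"
proof -
 have "{c<..x} = {c<..<ord_succ x}" by (auto simp: less_ord_succ_iff)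
 then show ?thesis by simp
qed

lemma ord_islimptI:
 assumes "\<And>c. c < x ==> \<exists>y\<in>S. c < y \<and> y < x" "x \<noteq> (0::countable_ordinal)"
 shows "x islimpt S"
proof (rule islimptI)
 fix T assume T: "x \<in> T" "open T"
 have "0 < x" using assms(2) by (simp add: ord_gr_zero)
 then obtain c where "c < x" "{c<..x} \<subseteq> T" using open_left[OF T(2,1)] by blast
 then show "\<exists>y\<in>S. y \<in> T \<and> y \<noteq> x"
  using assms(1)[of c] by force
qed

text \<open>The induction needs the translation by \<open>a\<close>: the points
  \<open>ord_add a (ord_nmult (omega_pow g) (Suc n))\<close> are again translates of
  \<open>omega_pow g\<close>, and they increase to
  \<open>ord_add a (omega_pow (ord_succ g))\<close>.\<close>

lemma add_omega_pow_mem_CB: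
 "ord_add a (omega_pow g) \<le> b ==> ord_add a (omega_pow g) \<in> CB {0..b} g"
proof (induction g arbitrary: a rule: ord_induct)
 case zero
 then show ?case by simp
next
 case (succ g)
 let ?x = "ord_add a (omega_pow (ord_succ g))"
 have "?x islimpt CB {0..b} g"
 proof (rule ord_islimptI)
  fix c assume "c < ?x"
  then obtain d where d: "d < omega_pow (ord_succ g)" "c < ord_add a d"
   using less_ord_add_limit ord_limit_omega_pow by (metis ord_succ_neq_zero)
  then obtain n where n: "d < ord_nmult (omega_pow g) n" using less_omega_pow_succ by blast
  let ?y = "ord_add (ord_add a (ord_nmult (omega_pow g) n)) (omega_pow g)"
  have y: "?y = ord_add a (ord_nmult (omega_pow g) (Suc n))"
   by (simp add: ord_add_assoc ord_mult_succ)
  have "ord_nmult (omega_pow g) (Suc n) < omega_pow (ord_succ g)"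
   unfolding less_omega_pow_succ
   by (rule exI[of _ "Suc (Suc n)"]) (auto intro!: ord_mult_less_mono simp: less_ord_succ)
  then have yx: "?y < ?x" unfolding y by (rule ord_add_less_mono)
  have "d < ord_nmult (omega_pow g) (Suc n)"
   by (rule order_less_trans[OF n]) (intro ord_mult_less_mono ord_of_nat_less, simp_all)
  then have "c < ?y" unfolding y using d(2) ord_add_less_mono by (metis order_less_trans)
  moreover have "?y \<in> CB {0..b} g"
   using succ.prems yx by (intro succ.IH) simp
  ultimately show "\<exists>y\<in>CB {0..b} g. c < y \<and> y < ?x" using yx by blast
 next
  show "?x \<noteq> 0" using ord_less_add[OF omega_pow_neq_zero] by (metis ord_not_less_zero)
 qed
 then show ?case using succ.prems by (simp add: CB_succ)
next
 case (limit g)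
 let ?x = "ord_add a (omega_pow g)"
 have g0: "g \<noteq> 0" using limit(1) by (simp add: ord_limit_def)
 have "?x islimpt CB {0..b} h" if h: "h < g" for h
 proof (rule ord_islimptI)
  fix c assume "c < ?x"
  then obtain d where d: "d < omega_pow g" "c < ord_add a d"
   using less_ord_add_limit ord_limit_omega_pow[OF g0] by metis
  then obtain h' where h': "h' < g" "d < omega_pow h'"
   using less_omega_pow_limit[OF limit(1)] by blast
  \<comment> \<open>\<open>h\<close> secures the rank of the new point, \<open>h'\<close> its
    position beyond \<open>c\<close>.\<close>
  let ?m = "max h h'"
  let ?y = "ord_add a (omega_pow ?m)"
  have m: "?m < g" using h h' by simp
  have yx: "?y < ?x" using m by (intro ord_add_less_mono) simp
  have "omega_pow h' \<le> omega_pow ?m" by simp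
  then have "c < ?y" using d(2) h'(2) ord_add_less_mono
   by (metis order_less_le_trans order_less_trans)
  moreover have "?y \<in> CB {0..b} ?m"
   by (rule limit.IH[OF m order_trans[OF less_imp_le[OF yx] limit.prems]])
  then have "?y \<in> CB {0..b} h" by (rule rev_subsetD) (simp add: CB_antimono)
  ultimately show "\<exists>y\<in>CB {0..b} h. c < y \<and> y < ?x" using yx by blast
 next
  show "?x \<noteq> 0" using ord_less_add[OF omega_pow_neq_zero] by (metis ord_not_less_zero)
 qed
 then show ?case using limit.prems by (simp add: CB_iff[of ?x _ g])
qed

text \<open>The left end \<open>a\<close> is excluded since its own rank may be large. At a
  successor, \<open>x\<close> falls into one block of length \<open>omega_pow g\<close>. Inside the
  block the induction hypothesis applies; at its right end, the half-open block is a neighbourhood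
  of \<open>x\<close> that meets \<open>CB {0..b} g\<close> in no other point.\<close>

lemma not_mem_CB_omega_pow:
 "a < x ==> x < ord_add a (omega_pow g) ==> x \<notin> CB {0..b} g"
proof (induction g arbitrary: a x rule: ord_induct)
 case zero
 then show ?case by (simp add: one_countable_ordinal_def ord_add_succ less_ord_succ_iff)
next
 case (succ g)
 let ?N = "\<lambda>n. ord_add a (ord_nmult (omega_pow g) n)"
 obtain d where d: "d < omega_pow (ord_succ g)" "x < ord_add a d"
  using less_ord_add_limit ord_limit_omega_pow succ.prems(2) by (metis ord_succ_neq_zero)
 then obtain n where "d < ord_nmult (omega_pow g) n" using less_omega_pow_succ by blast
 then have ex: "x \<le> ?N n" using d(2) ord_add_less_mono by (metis less_imp_le order_less_trans)
 define n where "n = (LEAST n. x \<le> ?N n)"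
 have n: "x \<le> ?N n" and nn: "\<And>m. m < n ==> ?N m < x"
  unfolding n_def using LeastI[of "\<lambda>n. x \<le> ?N n", OF ex] not_less_Least by fastforce+
 have "n \<noteq> 0" using n succ.prems(1) by (metis linorder_not_le ord_add_0 ord_mult_0 ord_of_nat.simps(1))
 then obtain m where m: "n = Suc m" using not0_implies_Suc by blast
 let ?a = "?N m"
 have a: "?a < x" "x \<le> ord_add ?a (omega_pow g)"
  using nn[of m] n m by (simp_all add: ord_add_assoc ord_mult_succ)
 show ?case
 proof (cases "x = ord_add ?a (omega_pow g)")
  case True
  have "\<not> x islimpt CB {0..b} g"
  proof
   assume "x islimpt CB {0..b} g"
   then obtain y where "y \<in> CB {0..b} g" "y \<in> {?a<..x}" "y \<noteq> x"
    using islimptE ord_greaterThanAtMost_open a(1) by (metis greaterThanAtMost_iff order_refl)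
   then show False using succ.IH[of ?a y] True by (simp add: le_less)
  qed
  then show ?thesis by (simp add: CB_succ)
 next
  case False
  then have "x \<notin> CB {0..b} g" using succ.IH[OF a(1)] a(2) by simp
  moreover have "CB {0..b} (ord_succ g) \<subseteq> CB {0..b} g"
   by (intro CB_antimono less_imp_le less_ord_succ)
  ultimately show ?thesis by blast
 qed
next
 case (limit g)
 have g0: "g \<noteq> 0" using limit(1) by (simp add: ord_limit_def)
 obtain d where d: "d < omega_pow g" "x < ord_add a d"
  using less_ord_add_limit ord_limit_omega_pow[OF g0] limit.prems(2) by metis
 then obtain h' where h': "h' < g" "d < omega_pow h'"
  using less_omega_pow_limit[OF limit(1)] by blast
 then have "x < ord_add a (omega_pow h')" using d(2) ord_add_less_mono by (metis order_less_trans)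
 then have "x \<notin> CB {0..b} h'" using limit.IH[OF h'(1) limit.prems(1)] by blast
 then show ?case using CB_antimono[OF less_imp_le[OF h'(1)]] by blast
qed

lemma CB_omega_pow:
 assumes "g \<noteq> 0"
 shows "CB {0..omega_pow g} g = {omega_pow g}"
proof
 show "{omega_pow g} \<subseteq> CB {0..omega_pow g} g"
  using add_omega_pow_mem_CB[of 0 g "omega_pow g"] by simp
 show "CB {0..omega_pow g} g \<subseteq> {omega_pow g}"
 proof
  fix x assume x: "x \<in> CB {0..omega_pow g} g"
  then have le: "x \<le> omega_pow g" using CB_subset by fastforce
  \<comment> \<open>The point 0 is out of reach of \<open>not_mem_CB_omega_pow\<close> with left end
    0, but it is isolated.\<close>
  have "x \<noteq> 0"
  proof
   assume "x = 0"
   then have "x islimpt {0..omega_pow g}"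
    using x assms CB_iff[of x "{0..omega_pow g}" g] ord_gr_zero[of g]
    by (metis CB_0)
   moreover have "{..<ord_succ 0} = {0}" by (auto simp: less_ord_succ_iff intro: antisym)
   then have "open {0::countable_ordinal}" by (metis open_lessThan)
   ultimately show False using \<open>x = 0\<close> by (metis islimptE singletonD singletonI)
  qed
  then show "x \<in> {omega_pow g}"
   using not_mem_CB_omega_pow[of 0 x g "omega_pow g"] x le
   by (auto simp: ord_gr_zero le_less)
 qed
qed

text \<open>Induction on the right end: a member of the cover that contains \<open>x\<close> reaches
  down to some \<open>c < x\<close>, and \<open>{0..c}\<close> is already covered.\<close>

lemma compact_ord_interval: "compact {0..b :: countable_ordinal}"
proof (rule compactI)
 fix \<C> assume C: "\<forall>t\<in>\<C>. open t" "{0..b} \<subseteq> \<Union>\<C>"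
 have "x \<le> b ==> \<exists>D\<subseteq>\<C>. finite D \<and> {0..x} \<subseteq> \<Union>D" for x
 proof (induction x rule: less_induct)
  case (less x)
  then obtain t where t: "t \<in> \<C>" "x \<in> t" using C(2) by fastforce
  show ?case
  proof (cases "x = 0")
   case True
   then show ?thesis using t by (intro exI[of _ "{t}"]) simp
  next
   case False
   then obtain c where c: "c < x" "{c<..x} \<subseteq> t"
    using open_left[of t x 0] C(1) t by (auto simp: ord_gr_zero)
   have "c \<le> b" using c(1) less.prems by simp
   then obtain D where "D \<subseteq> \<C>" "finite D" "{0..c} \<subseteq> \<Union>D" using less.IH[OF c(1)] by blast
   moreover have "{0..x} \<subseteq> {0..c} \<union> {c<..x}" by auto
   ultimately show ?thesis using t c by (intro exI[of _ "insert t D"]) auto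
  qed
 qed
 then show "\<exists>C'\<subseteq>\<C>. finite C' \<and> {0..b} \<subseteq> \<Union>C'" by blast
qed

lemma countable_ord_interval: "countable {0..b :: countable_ordinal}"
 by (rule countable_subset[OF _ countable_lessThan_ordinal[of "ord_succ b"]]) (auto simp: less_ord_succ_iff)

text \<open>Ordinal intervals are countable and zero-dimensional, hence embed into the Hilbert cube by the
 indicators of their clopen initial segments.\<close>

lemma ord_interval_homeomorphic_metric:
 "\<exists>(K :: (nat => real) set) f k. homeomorphism {0..b :: countable_ordinal} K f k"
proof -
 let ?e = "from_nat_into {0..b}"
 define f :: "countable_ordinal => nat => real" where "f x n = of_bool (x \<le> ?e n)" for x n
 have "continuous_on {0..b} f"
 proof (rule continuous_on_coordinatewise_then_product)
  fix n
  have "{..?e n} = {..<ord_succ (?e n)}" by (auto simp: less_ord_succ_iff)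
  then have "open {..?e n}" by (metis open_lessThan)
  then have "continuous_on ({..?e n} \<union> {?e n<..}) (\<lambda>x. f x n)"
   by (intro continuous_on_open_Un) (auto simp: f_def intro!: continuous_on_eq[OF continuous_on_const])
  then show "continuous_on {0..b} (\<lambda>x. f x n)"
   by (rule continuous_on_subset) auto
 qed
 moreover have "inj_on f {0..b}"
 proof (rule inj_onI)
  fix x y assume xy: "x \<in> {0..b}" "y \<in> {0..b}" "f x = f y"
  have *: "?e ` UNIV = {0..b}" using countable_ord_interval by (intro range_from_nat_into) auto
  obtain m n where "x = ?e m" "y = ?e n" using xy(1,2) * by (metis imageE)
  moreover have "f x m = f y m" "f x n = f y n" using xy(3) by simp_all
  ultimately show "x = y" by (auto simp: f_def of_bool_def split: if_splits)
 qed
 ultimately show ?thesis using homeomorphism_compact[OF compact_ord_interval] by metis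
qed

lemma ex_metric_model:
 obtains K :: "(nat => real) set" and f k t where
  "homeomorphism {0..omega_pow (omega_pow \<xi>)} K f k" "compact K" "countable K"
  "CB K (omega_pow \<xi>) = {t}"
proof -
 let ?J = "{0..omega_pow (omega_pow \<xi>)}"
 obtain K :: "(nat => real) set" and f k where h: "homeomorphism ?J K f k"
  using ord_interval_homeomorphic_metric by blast
 have K: "f ` ?J = K" "continuous_on ?J f" using h by (simp_all add: homeomorphism_def)
 have "compact K" "countable K"
  using compact_continuous_image[OF K(2) compact_ord_interval] K(1)
   countable_image[OF countable_ord_interval, of f] by auto
 moreover have "CB K (omega_pow \<xi>) = {f (omega_pow (omega_pow \<xi>))}"
  using homeomorphism_CB[OF h] CB_omega_pow[OF omega_pow_neq_zero] by simp
 ultimately show thesis using that h by blast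
qed

subsection \<open>Countable compact metric spaces\<close>

lemma clopen_sublevel:
 fixes K :: "'a::metric_space set" and f :: "'a => real"
 assumes "compact K" "continuous_on K f" "r \<notin> f ` K"
 shows "clopen_in K {x \<in> K. f x < r}"
proof -
 have 1: "{x \<in> K. f x < r} = {x \<in> K. f x \<le> r}" "K - {x \<in> K. f x < r} = {x \<in> K. r \<le> f x}"
  using assms(3) by force+
 have "closed {x \<in> K. f x \<le> r}" "closed {x \<in> K. r \<le> f x}"
  using assms(1,2) compact_imp_closed by (auto intro!: continuous_on_closed_Collect_le continuous_on_const)
 moreover have "{x \<in> K. f x \<le> r} = K \<inter> {x \<in> K. f x \<le> r}" "{x \<in> K. r \<le> f x} = K \<inter> {x \<in> K. r \<le> f x}"
  by auto
 ultimately have "compact {x \<in> K. f x \<le> r}" "compact {x \<in> K. r \<le> f x}"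
  using compact_Int_closed[OF assms(1)] by metis+
 then show ?thesis unfolding clopen_in_def 1(2) by (simp add: 1(1))
qed

lemma ex_avoiding_real:
 assumes "countable (C :: real set)" "0 < e"
 shows "\<exists>r. 0 < r \<and> r < e \<and> r \<notin> C"
proof -
 have "uncountable {0<..<e}" using assms(2) uncountable_open_interval by blast
 then have "\<not> {0<..<e} \<subseteq> C" using assms(1) countable_subset by blast
 then show ?thesis by auto
qed

text \<open>As \<open>K\<close> is countable, there are arbitrarily small radii that are not the
  distance of any point of \<open>K\<close> from \<open>E\<close>, and sublevel sets at such radii
  are clopen. Intersecting the first \<open>n\<close> of them makes the sequence decrease and start
  with \<open>K\<close>.\<close>

lemma clopen_nbhd_seq:
 fixes K :: "'a::metric_space set"
 assumes "compact K" "countable K" "E \<subseteq> K" "E \<noteq> {}"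
 obtains H where "H 0 = K" "\<And>n. clopen_in K (H n)" "\<And>n. E \<subseteq> H n" "decseq H"
  "\<And>n x. x \<in> H (Suc n) ==> infdist x E < 1 / Suc n"
proof -
 let ?f = "\<lambda>x. infdist x E"
 have "\<exists>r. 0 < r \<and> r < 1 / Suc n \<and> r \<notin> ?f ` K" for n
  using assms(2) by (intro ex_avoiding_real) auto
 then obtain r where r: "\<And>n. 0 < r n" "\<And>n. r n < 1 / Suc n" "\<And>n. r n \<notin> ?f ` K"
  by metis
 define H where "H n = {x \<in> K. \<forall>i<n. ?f x < r i}" for n
 have cf: "continuous_on K ?f" by (intro continuous_intros)
 have "clopen_in K (H n)" for n
 proof (induction n)
  case 0
  then show ?case by (simp add: H_def clopen_in_self assms)
 next
  case (Suc n)
  have "H (Suc n) = H n \<inter> {x \<in> K. ?f x < r n}" by (auto simp: H_def less_Suc_eq)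
  then show ?case using Suc clopen_sublevel[OF assms(1) cf r(3)[of n]] clopen_in_Int by metis
 qed
 moreover have "E \<subseteq> H n" for n using assms(3) r(1) by (auto simp: H_def)
 moreover have "decseq H" by (auto simp: decseq_def H_def)
 moreover have "?f x < 1 / Suc n" if "x \<in> H (Suc n)" for n x
  using that r(2)[of n] by (force simp: H_def)
 ultimately show thesis using that[of H] by (simp add: H_def)
qed

lemma nbhd_seq_avoids:
 fixes K :: "'a::metric_space set"
 assumes "decseq H" "\<And>n x. x \<in> H (Suc n) ==> infdist x E < 1 / real (Suc n)"
  and "compact N" "N \<inter> E = {}" "closed E" "E \<noteq> {}"
 shows "\<exists>n. \<forall>m\<ge>n. N \<inter> H m = {}"
proof (cases "N = {}")
 case False
 have "continuous_on N (\<lambda>x. infdist x E)" by (intro continuous_intros)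
 then obtain x where x: "x \<in> N" "\<And>y. y \<in> N ==> infdist x E \<le> infdist y E"
  using continuous_attains_inf[OF assms(3) False] by blast
 then have "0 < infdist x E"
  using assms(4-6) by (metis disjoint_iff infdist_nonneg in_closed_iff_infdist_zero order_le_less)
 then obtain n where "1 / real (Suc n) < infdist x E" using nat_approx_posE by blast
 then have "N \<inter> H (Suc n) = {}" using x assms(2)[of _ n] by fastforce
 then have "N \<inter> H m = {}" if "m \<ge> Suc n" for m using assms(1) that by (fastforce simp: decseq_def)
 then show ?thesis by blast
qed auto

text \<open>The differences are rings around \<open>E\<close>, along which embeddings and functions
  are later cut up and glued.\<close>

lemma nbhd_seq_Diff:
 assumes "decseq H" "H 0 = K" "\<And>n x. x \<in> H (Suc n) ==> infdist x E < 1 / real (Suc n)"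
  and "\<And>n. E \<subseteq> H n" "closed E" "E \<noteq> {}"
 shows "(\<Union>i. H i - H (Suc i)) = K - E" "disjoint_family (\<lambda>i. H i - H (Suc i))"
proof -
 show "(\<Union>i. H i - H (Suc i)) = K - E"
 proof
  have "H i \<subseteq> K" for i using decseqD[OF assms(1), of 0 i] assms(2) by simp
  then show "(\<Union>i. H i - H (Suc i)) \<subseteq> K - E" using assms(4) by blast
  show "K - E \<subseteq> (\<Union>i. H i - H (Suc i))"
  proof
   fix x assume x: "x \<in> K - E"
   then obtain n where "\<forall>m\<ge>n. {x} \<inter> H m = {}"
    using nbhd_seq_avoids[OF assms(1,3), of "{x}"] assms(5,6) by auto
   then have ex: "\<exists>n. x \<notin> H n" by auto
   define n where "n = (LEAST n. x \<notin> H n)"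
   have n: "x \<notin> H n" "\<And>m. m < n ==> x \<in> H m"
    unfolding n_def using LeastI_ex[OF ex] not_less_Least by blast+
   have "n \<noteq> 0" using x assms(2) n(1) by (cases n) auto
   then obtain m where "n = Suc m" using not0_implies_Suc by blast
   then show "x \<in> (\<Union>i. H i - H (Suc i))" using n(1) n(2)[of m] by auto
  qed
 qed
 have "(H i - H (Suc i)) \<inter> (H j - H (Suc j)) = {}" if "i < j" for i j
  using decseqD[OF assms(1) Suc_leI[OF that]] by blast
 then show "disjoint_family (\<lambda>i. H i - H (Suc i))"
  unfolding disjoint_family_on_def by (metis inf_commute linorder_neqE_nat)
qed

lemma clopen_nbhd:
 fixes K :: "'a::metric_space set"
 assumes "compact K" "countable K" "x \<in> K" "open U" "x \<in> U"
 obtains A where "clopen_in K A" "x \<in> A" "A \<subseteq> U"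
proof -
 obtain e where e: "e > 0" "ball x e \<subseteq> U" using assms by (meson open_contains_ball)
 have "countable ((\<lambda>y. dist x y) ` K)" using assms(2) by simp
 then obtain r where r: "0 < r" "r < e" "r \<notin> (\<lambda>y. dist x y) ` K" using ex_avoiding_real e(1) by blast
 have "clopen_in K {y \<in> K. dist x y < r}"
  by (rule clopen_sublevel[OF assms(1) _ r(3)]) (intro continuous_intros)
 then show thesis using that[of "{y \<in> K. dist x y < r}"] assms(3) r e by (auto simp: subset_iff)
qed

lemma continuous_within_clopen:
 fixes G :: "'a::metric_space set"
 assumes "clopen_in G A" "y \<in> A" "continuous_on A f" "\<And>z. z \<in> A ==> g z = f z"
 shows "continuous (at y within G) g"
proof -
 have "continuous_on A g" using assms(3,4) by (metis continuous_on_cong)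
 then have "continuous (at y within A) g" using assms(2) by (simp add: continuous_on_eq_continuous_within)
 moreover have "at y within A = at y within G"
  using clopen_in_open[OF assms(1)] assms(2) by (intro at_within_nhd[of y "- (G - A)"]) auto
 ultimately show ?thesis by simp
qed

lemma continuous_within_clopenI:
 fixes g :: "'a::metric_space => 'b::metric_space"
 assumes "\<And>e. 0 < e ==> \<exists>A. clopen_in G A \<and> x \<in> A \<and> (\<forall>y\<in>A. dist (g y) (g x) < e)"
 shows "continuous (at x within G) g"
 unfolding continuous_within tendsto_iff eventually_at_topological
proof (intro allI impI)
 fix e :: real assume "0 < e"
 then obtain A where A: "clopen_in G A" "x \<in> A" "\<forall>y\<in>A. dist (g y) (g x) < e" using assms by blast
 show "\<exists>S. open S \<and> x \<in> S \<and> (\<forall>y\<in>S. y \<noteq> x --> y \<in> G --> dist (g y) (g x) < e)"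
  using clopen_in_open[OF A(1)] A by (intro exI[of _ "- (G - A)"]) auto
qed

text \<open>The left inverse \<open>r\<close> lives on all of \<open>N\<close>. Hence composition
  with \<open>r\<close> embeds C(G) into C(N) and composition with \<open>j\<close> leads back: C(G)
  is complemented in C(N).\<close>

definition retract_emb ::
 "'a::topological_space set => 'b::topological_space set => ('a => 'b) => ('b => 'a) => bool" where
 "retract_emb G N j r \<longleftrightarrow> j ` G \<subseteq> N \<and> r ` N \<subseteq> G \<and> continuous_on G j \<and> continuous_on N r \<and>
  (\<forall>x\<in>G. r (j x) = x)"

lemma clopen_vimage:
 fixes r :: "'b::t2_space => 'a::t2_space"
 assumes "compact N" "continuous_on N r" "r ` N \<subseteq> G" "clopen_in G A"
 shows "clopen_in N {y \<in> N. r y \<in> A}"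
proof -
 have eq: "N - {y \<in> N. r y \<in> A} = {y \<in> N. r y \<in> G - A}" using assms(3) by auto
 have c: "compact {y \<in> N. r y \<in> B}" if "compact B" for B
 proof -
  have "closed (N \<inter> r -` B)"
   using that assms(1) by (intro continuous_closed_preimage[OF assms(2)]) (auto intro: compact_imp_closed)
  then have "compact (N \<inter> (N \<inter> r -` B))" by (rule compact_Int_closed[OF assms(1)])
  moreover have "{y \<in> N. r y \<in> B} = N \<inter> (N \<inter> r -` B)" by auto
  ultimately show ?thesis by simp
 qed
 show ?thesis
  unfolding clopen_in_def eq using c[of A] c[of "G - A"] assms(4) by (simp only: clopen_in_def) blast
qed

lemma retract_emb_restrict:
 fixes G :: "'a::t2_space set" and H :: "'b::t2_space set"
 assumes "retract_emb G N j r" "clopen_in G A" "clopen_in H N"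
 shows "clopen_in H {y \<in> N. r y \<in> A}" "retract_emb A {y \<in> N. r y \<in> A} j r"
proof -
 have "clopen_in N {y \<in> N. r y \<in> A}"
  using assms by (intro clopen_vimage[of _ _ G]) (auto simp: retract_emb_def clopen_in_def)
 then show "clopen_in H {y \<in> N. r y \<in> A}" using assms(3) clopen_in_trans by blast
 have "A \<subseteq> G" using assms(2) by (simp add: clopen_in_def)
 then show "retract_emb A {y \<in> N. r y \<in> A} j r"
  using assms(1) unfolding retract_emb_def
  by (auto intro: continuous_on_subset)
qed

lemma retract_emb_Un:
 fixes G :: "'a::t2_space set" and N :: "'b::t2_space set"
 assumes "retract_emb G N j r" "retract_emb G' N' j' r'" "G \<inter> G' = {}" "N \<inter> N' = {}"
  and "compact G" "compact G'" "compact N" "compact N'"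
 shows "\<exists>j r. retract_emb (G \<union> G') (N \<union> N') j r"
proof -
 let ?j = "\<lambda>x. if x \<in> G then j x else j' x" and ?r = "\<lambda>y. if y \<in> N then r y else r' y"
 have "continuous_on G ?j" "continuous_on G' ?j" "continuous_on N ?r" "continuous_on N' ?r"
  using assms(1-4) unfolding retract_emb_def by (auto cong: continuous_on_cong elim!: continuous_on_eq)
 then have "continuous_on (G \<union> G') ?j" "continuous_on (N \<union> N') ?r"
  using compact_imp_closed[OF assms(5)] compact_imp_closed[OF assms(6)] compact_imp_closed[OF assms(7)]
   compact_imp_closed[OF assms(8)] continuous_on_closed_Un by blast+
 then have "retract_emb (G \<union> G') (N \<union> N') ?j ?r"
  using assms(1-4) unfolding retract_emb_def by (auto simp: image_subset_iff disjoint_iff)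
 then show ?thesis by blast
qed

text \<open>The set \<open>N\<close> avoids \<open>CB H g\<close>, so functions carried by it vanish
  on that derivative, and room remains for further sets ever closer to \<open>b\<close>. It is made
  a predicate of \<open>g\<close> because the induction uses all smaller ranks through
  \<open>retract_emb_simple\<close>; the \<open>itself\<close> arguments fix the two types of
  points.\<close>

definition embeds_near ::
 "'a::metric_space itself => 'b::metric_space itself => countable_ordinal => bool" where
 "embeds_near _ _ g \<longleftrightarrow> (\<forall>(G :: 'a set) (H :: 'b set) b V.
  compact G \<and> countable G \<and> compact H \<and> countable H \<and> CB G g = {} \<and>
  b \<in> CB H g \<and> open V \<and> b \<in> V -->
  (\<exists>N j r. clopen_in H N \<and> N \<subseteq> V \<and> N \<inter> CB H g = {} \<and> retract_emb G N j r))"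

text \<open>Each set found is compact and avoids \<open>b\<close>, so it misses some later clopen
  neighbourhood of \<open>b\<close>, in which the next one is chosen. This makes the family disjoint
  and lets it shrink to \<open>b\<close>.\<close>

lemma embeds_near_seq:
 fixes A :: "nat => 'a::metric_space set" and H :: "'b::metric_space set"
 assumes emb: "embeds_near TYPE('a) TYPE('b) g"
  and A: "\<And>i. compact (A i)" "\<And>i. countable (A i)" "\<And>i. CB (A i) g = {}"
  and H: "compact H" "countable H" "b \<in> CB H g" "open V" "b \<in> V"
 obtains N j r where "\<And>i::nat. clopen_in H (N i)" "\<And>i. N i \<subseteq> V" "\<And>i. N i \<inter> CB H g = {}"
  "\<And>i. retract_emb (A i) (N i) (j i) (r i)" "\<And>i. N i \<subseteq> ball b (1 / real (Suc i))" "disjoint_family N"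
proof -
 have bH: "b \<in> H" using H(3) CB_subset by blast
 then have sub: "{b} \<subseteq> H" "{b} \<noteq> {}" by auto
 obtain M where M: "M 0 = H" "\<And>n. clopen_in H (M n)" "\<And>n. {b} \<subseteq> M n" "decseq M"
  "\<And>n x. x \<in> M (Suc n) ==> infdist x {b} < 1 / real (Suc n)"
  by (rule clopen_nbhd_seq[OF H(1,2) sub], rule that)
 \<comment> \<open>\<open>m\<close> is the neighbourhood in which the search starts and
   \<open>k\<close> a later one that \<open>N\<close> misses; the recursion \<open>t\<close> below
   hands \<open>k\<close> on as the next \<open>m\<close>.\<close>
 define Q where "Q i m N j r k \<longleftrightarrow> k > m \<and> clopen_in H N \<and>
   N \<subseteq> V \<inter> M m \<inter> ball b (1 / real (Suc i)) - M k \<and>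
   N \<inter> CB H g = {} \<and> retract_emb (A i) N j r" for i m N j r and k :: nat
 have "\<exists>N j r k. Q i m N j r k" for i m
 proof -
  let ?V = "V \<inter> - (H - M m) \<inter> ball b (1 / real (Suc i))"
  have "open ?V" "b \<in> ?V" using H clopen_in_open[OF M(2)[of m]] M(3)[of m] by auto
  then obtain N j r where N: "clopen_in H N" "N \<subseteq> ?V" "N \<inter> CB H g = {}"
   "retract_emb (A i) N j r"
   using emb A H unfolding embeds_near_def by metis
  have "compact N" "N \<subseteq> H" using N(1) by (auto simp: clopen_in_def)
  have "N \<inter> {b} = {}" using N(3) H(3) by auto
  then obtain n where "\<forall>m\<ge>n. N \<inter> M m = {}"
   using nbhd_seq_avoids[OF M(4,5) \<open>compact N\<close>] by auto
  then have "N \<inter> M (max n (Suc m)) = {}" by simp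
  then show ?thesis
   unfolding Q_def using N \<open>N \<subseteq> H\<close> by (intro exI[of _ N] exI[of _ j] exI[of _ r] exI[of _ "max n (Suc m)"]) auto
 qed
 then obtain N where "\<And>i m. \<exists>j r k. Q i m (N i m) j r k" by metis
 then obtain j where "\<And>i m. \<exists>r k. Q i m (N i m) (j i m) r k" by metis
 then obtain r where "\<And>i m. \<exists>k. Q i m (N i m) (j i m) (r i m) k" by metis
 then obtain k where k: "\<And>i m. Q i m (N i m) (j i m) (r i m) (k i m)" by metis
 have N: "k i m > m" "clopen_in H (N i m)"
  "N i m \<subseteq> V \<inter> M m \<inter> ball b (1 / real (Suc i)) - M (k i m)"
  "N i m \<inter> CB H g = {}" "retract_emb (A i) (N i m) (j i m) (r i m)" for i m
  using k[of i m] unfolding Q_def by blast+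
 define t where "t = rec_nat 0 (\<lambda>i m. k i m)"
 have t: "t (Suc i) = k i (t i)" for i by (simp add: t_def)
 have "strict_mono t" using N(1) t by (simp add: strict_mono_Suc_iff)
 have "N i (t i) \<inter> N l (t l) = {}" if "i < l" for i l
 proof -
  have "t (Suc i) \<le> t l" using \<open>strict_mono t\<close> that by (simp add: strict_mono_less_eq Suc_leI)
  then have "M (t l) \<subseteq> M (t (Suc i))" using M(4) by (simp add: decseq_def)
  then show ?thesis using N(3)[of i "t i"] N(3)[of l "t l"] t by auto
 qed
 then have "disjoint_family (\<lambda>i. N i (t i))"
  unfolding disjoint_family_on_def by (metis inf_commute linorder_neqE_nat)
 then show thesis
  using N by (intro that[of "\<lambda>i. N i (t i)" "\<lambda>i. j i (t i)" "\<lambda>i. r i (t i)"]) blast+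
qed

text \<open>All points but \<open>x\<close> have rank below \<open>g\<close>, so the rings around
  \<open>x\<close> can be embedded into disjoint sets \<open>P i\<close> shrinking to
  \<open>b\<close>, and \<open>x\<close> is sent to \<open>b\<close>. Continuity at the exceptional
  points holds because the pieces shrink on both sides.\<close>

lemma retract_emb_simple:
 fixes G :: "'a::metric_space set" and H :: "'b::metric_space set"
 assumes emb: "embeds_near TYPE('a) TYPE('b) g"
  and G: "compact G" "countable G" "CB G g = {x}"
  and H: "compact H" "countable H" "b \<in> CB H g" "clopen_in H N" "b \<in> N"
 shows "\<exists>j r. retract_emb G N j r"
proof -
 have xG: "x \<in> G" using G(3) CB_subset by blast
 then have sub: "{x} \<subseteq> G" "{x} \<noteq> {}" by auto
 obtain M where M: "M 0 = G" "\<And>n. clopen_in G (M n)" "\<And>n. {x} \<subseteq> M n" "decseq M"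
  "\<And>n y. y \<in> M (Suc n) ==> infdist y {x} < 1 / real (Suc n)"
  by (rule clopen_nbhd_seq[OF G(1,2) sub], rule that)
 define A where "A i = M i - M (Suc i)" for i
 have Ac: "clopen_in G (A i)" for i unfolding A_def by (intro clopen_in_Diff M)
 have UA: "(\<Union>i. A i) = G - {x}" and dA: "disjoint_family A"
  using nbhd_seq_Diff[OF M(4,1,5,3)] unfolding A_def by auto
 have "CB (A i) g = {}" for i
  using CB_clopen[OF Ac] G(3) UA by auto
 moreover have "compact (A i)" "countable (A i)" for i
  using Ac[of i] countable_subset[OF _ G(2), of "A i"] by (auto simp: clopen_in_def)
 moreover have "open (- (H - N))" "b \<in> - (H - N)" using clopen_in_open[OF H(4)] H(5) by auto
 ultimately obtain P j r where P: "\<And>i::nat. clopen_in H (P i)" "\<And>i. P i \<subseteq> - (H - N)"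
  "\<And>i. P i \<inter> CB H g = {}" "\<And>i. retract_emb (A i) (P i) (j i) (r i)"
  "\<And>i. P i \<subseteq> ball b (1 / real (Suc i))" "disjoint_family P"
  using embeds_near_seq[OF emb, of A H b "- (H - N)"] H(1-3) by metis
 have PN: "P i \<subseteq> N" for i using P(1,2)[of i] by (auto simp: clopen_in_def)
 have Pj: "j i y \<in> P i" "r i (j i y) = y" if "y \<in> A i" for i y
  using P(4)[of i] that by (auto simp: retract_emb_def)
 have Pr: "r i z \<in> A i" if "z \<in> P i" for i z
  using P(4)[of i] that by (auto simp: retract_emb_def)
 define ix where "ix y = (THE i. y \<in> A i)" for y
 have ix: "ix y = i" if "y \<in> A i" for y i
  unfolding ix_def using dA that by (intro the_equality) (auto simp: disjoint_family_on_def)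
 define jx where "jx z = (THE i. z \<in> P i)" for z
 have jx: "jx z = i" if "z \<in> P i" for z i
  unfolding jx_def using P(6) that by (intro the_equality) (auto simp: disjoint_family_on_def)
 define J where "J y = (if y = x then b else j (ix y) y)" for y
 \<comment> \<open>Off the sets \<open>P i\<close> the retraction is constantly \<open>x\<close>.
   This is continuous because all but finitely many \<open>P i\<close> are mapped close to
   \<open>x\<close>.\<close>
 define R where "R z = (if \<exists>i. z \<in> P i then r (jx z) z else x)" for z
 have Ai: "\<exists>i. y \<in> A i" if "y \<in> G" "y \<noteq> x" for y using UA that by blast
 have xA: "x \<notin> A i" for i using UA by blast
 have JA: "J y = j i y" if "y \<in> A i" for y i using that xA ix by (auto simp: J_def)
 have RP: "R z = r i z" if "z \<in> P i" for z i using that jx by (auto simp: R_def)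
 have bP: "b \<notin> P i" for i using P(3)[of i] H(3) by auto
 have "J ` G \<subseteq> N"
 proof (intro image_subsetI)
  fix y assume y: "y \<in> G"
  show "J y \<in> N"
  proof (cases "y = x")
   case False
   then show ?thesis using Ai[OF y] JA Pj(1) PN by (metis subsetD)
  qed (simp add: J_def H(5))
 qed
 moreover have RG: "R ` N \<subseteq> G"
 proof (intro image_subsetI)
  fix z
  show "R z \<in> G"
  proof (cases "\<exists>i. z \<in> P i")
   case True
   then show ?thesis using RP Pr UA by (metis DiffD1 UN_I UNIV_I)
  qed (simp add: R_def xG)
 qed
 moreover have "R (J y) = y" if "y \<in> G" for y
 proof (cases "y = x")
  case True
  then show ?thesis using bP by (simp add: J_def R_def)
 next
  case False
  then obtain i where "y \<in> A i" using Ai \<open>y \<in> G\<close> by blast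
  then show ?thesis using JA Pj RP by metis
 qed
 moreover have "continuous_on G J"
  unfolding continuous_on_eq_continuous_within
 proof
  fix y assume y: "y \<in> G"
  show "continuous (at y within G) J"
  proof (cases "y = x")
   case True
   show ?thesis
   proof (rule continuous_within_clopenI)
    fix e :: real assume "0 < e"
    then obtain n where n: "1 / real (Suc n) < e" using nat_approx_posE by blast
    have "dist (J z) (J y) < e" if z: "z \<in> M n" for z
    proof (cases "z = x")
     case False
     have "z \<in> G" using z M(2)[of n] by (auto simp: clopen_in_def)
     then obtain i where i: "z \<in> A i" using Ai False by blast
     then have "i \<ge> n"
      using M(4) z by (metis A_def DiffD2 Suc_leI decseqD linorder_not_le subsetD)
     then have "1 / real (Suc i) \<le> 1 / real (Suc n)" by (simp add: frac_le)
     moreover have "dist b (J z) < 1 / real (Suc i)" using P(5)[of i] Pj(1)[OF i] JA[OF i] by auto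
     ultimately show ?thesis using n True by (simp add: J_def dist_commute)
    qed (use \<open>0 < e\<close> True in simp)
    then show "\<exists>A. clopen_in G A \<and> y \<in> A \<and> (\<forall>z\<in>A. dist (J z) (J y) < e)"
     using M(2,3)[of n] True by blast
   qed
  next
   case False
   then obtain i where "y \<in> A i" using Ai y by blast
   then show ?thesis
    using continuous_within_clopen[OF Ac[of i] _ _ JA] P(4)[of i] by (auto simp: retract_emb_def)
  qed
 qed
 moreover have "continuous_on N R"
  unfolding continuous_on_eq_continuous_within
 proof
  fix z assume z: "z \<in> N"
  have NH: "N \<subseteq> H" "compact N" using H(4) by (auto simp: clopen_in_def)
  have PcN: "clopen_in N (P i)" for i
   using clopen_in_subset[OF P(1) NH, of i] PN[of i] by (simp add: Int_absorb2)
  show "continuous (at z within N) R"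
  proof (cases "\<exists>i. z \<in> P i")
   case True
   then obtain i where "z \<in> P i" by blast
   then show ?thesis
    using continuous_within_clopen[OF PcN[of i] _ _ RP] P(4)[of i] by (auto simp: retract_emb_def)
  next
   case False
   then have Rz: "R z = x" by (simp add: R_def)
   show ?thesis
   proof (rule continuous_within_clopenI)
    fix e :: real assume "0 < e"
    then obtain n where n: "1 / real (Suc n) < e" using nat_approx_posE by blast
    let ?A = "N - (\<Union>i\<in>{..n}. P i)"
    have "clopen_in N ?A"
     by (intro clopen_in_Diff clopen_in_self clopen_in_UN PcN NH) auto
    moreover have "z \<in> ?A" using z False by blast
    moreover have "dist (R y) (R z) < e" if y: "y \<in> ?A" for y
    proof (cases "\<exists>i. y \<in> P i")
     case True
     then obtain i where i: "y \<in> P i" by blast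
     then have "Suc n \<le> i" using y by (meson DiffD2 UN_I atMost_iff not_less_eq_eq)
     then have "R y \<in> M (Suc n)"
      using M(4) RP[OF i] Pr[OF i] by (auto simp: A_def decseq_def)
     then show ?thesis using M(5)[of "R y" n] n Rz by (simp add: infdist_singleton)
    qed (use \<open>0 < e\<close> Rz in "simp add: R_def")
    ultimately show "\<exists>A. clopen_in N A \<and> z \<in> A \<and> (\<forall>y\<in>A. dist (R y) (R z) < e)" by blast
   qed
  qed
 qed
 ultimately show ?thesis unfolding retract_emb_def by blast
qed

text \<open>By compactness \<open>G\<close> is a finite union of clopen sets that each have a single
  point of top rank \<open>h < g\<close>. They are placed one after another: whatever clopen
  \<open>N\<close> is already occupied, \<open>b\<close> lies outside it, and
  \<open>infinite_exact_rank\<close> finds a point of rank exactly \<open>h\<close> in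
  \<open>V - N\<close>.\<close>

lemma embeds_near: "embeds_near TYPE('a::metric_space) TYPE('b::metric_space) g"
proof (induction g rule: less_induct)
 case (less g)
 show ?case
  unfolding embeds_near_def
 proof (intro allI impI, elim conjE)
  fix G :: "'a set" and H :: "'b set" and b V
  assume G: "compact G" "countable G" "CB G g = {}"
   and H: "compact H" "countable H" "b \<in> CB H g" and V: "open V" "b \<in> V"
  define simple where "simple A \<longleftrightarrow> clopen_in G A \<and> (\<exists>h<g. \<exists>x. CB A h = {x})" for A
  have cover: "\<exists>A. simple A \<and> x \<in> A" if x: "x \<in> G" for x
  proof -
   obtain h where h: "x \<in> CB G h" "x \<notin> CB G (ord_succ h)"
    using CB_rank[OF G(1,2) x] .
   have "h < g" using h(1) G(3) CB_antimono[of g h G] by force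
   have "\<not> x islimpt CB G h" using h(2) x by (simp add: CB_succ)
   then obtain U where U: "x \<in> U" "open U" "\<And>y. y \<in> CB G h ==> y \<in> U ==> y = x"
    by (auto simp: islimpt_def)
   then obtain A where A: "clopen_in G A" "x \<in> A" "A \<subseteq> U" using clopen_nbhd[OF G(1,2) x] by metis
   have "CB A h = {x}"
    unfolding CB_clopen[OF A(1)] using A(2,3) U(3) h(1) by blast
   then show ?thesis using A \<open>h < g\<close> unfolding simple_def by blast
  qed
  have fin: "\<exists>N j r. clopen_in H N \<and> N \<subseteq> V \<and> N \<inter> CB H g = {} \<and> retract_emb (\<Union>\<A>) N j r"
   if "finite \<A>" "\<forall>A\<in>\<A>. simple A" for \<A>
   using that
  proof (induction \<A> rule: finite_induct)
   case empty
   then show ?case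
    by (intro exI[of _ "{}"]) (simp add: retract_emb_def clopen_in_empty H)
  next
   case (insert A \<A>)
   then obtain N j r where N: "clopen_in H N" "N \<subseteq> V" "N \<inter> CB H g = {}"
    "retract_emb (\<Union>\<A>) N j r" by auto
   obtain h x where h: "h < g" "CB A h = {x}" "clopen_in G A"
    using insert.prems by (auto simp: simple_def)
   have UG: "clopen_in G (\<Union>\<A>)"
    using clopen_in_UN[OF insert.hyps(1) G(1), of id] insert.prems by (simp add: simple_def)
   have cN: "closed N" using N(1) by (simp add: clopen_in_def compact_imp_closed)
   have bN: "b \<in> V - N" using V N(3) H(3) by auto
   obtain c where c: "c \<in> V - N" "c \<in> CB H h" "c \<notin> CB H (ord_succ h)"
    using infinite_exact_rank[OF H h(1) open_Diff[OF V(1) cN] bN] not_finite_existsD by auto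
   have "closed (CB H (ord_succ h))"
    by (intro compact_imp_closed compact_CB H)
   then have oV: "open (V - N - CB H (ord_succ h))" using V(1) cN by (intro open_Diff)
   have cH: "c \<in> H" using c(2) CB_subset by blast
   \<comment> \<open>Avoiding \<open>CB H (ord_succ h)\<close> keeps the new set away from
     \<open>CB H g\<close>, since \<open>ord_succ h \<le> g\<close>.\<close>
   obtain N1 where N1: "clopen_in H N1" "c \<in> N1" "N1 \<subseteq> V - N - CB H (ord_succ h)"
    using clopen_nbhd[OF H(1,2) cH oV] c by blast
   obtain j1 r1 where e1: "retract_emb A N1 j1 r1"
    using retract_emb_simple[OF less(1)[OF h(1)] _ _ h(2) H(1,2) c(2) N1(1,2)] h(3) G(2) countable_subset
    unfolding clopen_in_def by blast
   \<comment> \<open>Only the part of \<open>A\<close> not yet embedded is added, so that the pieces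
     to be joined are disjoint.\<close>
   have cA: "clopen_in A (A - \<Union>\<A>)"
   proof -
    have "clopen_in A (\<Union>\<A> \<inter> A)" using clopen_in_subset[OF UG] h(3) by (simp add: clopen_in_def)
    then have "clopen_in A (A - (\<Union>\<A> \<inter> A))" by (rule clopen_in_Diff_self)
    moreover have "A - (\<Union>\<A> \<inter> A) = A - \<Union>\<A>" by blast
    ultimately show ?thesis by simp
   qed
   let ?N2 = "{y \<in> N1. r1 y \<in> A - \<Union>\<A>}"
   have e2: "clopen_in H ?N2" "retract_emb (A - \<Union>\<A>) ?N2 j1 r1"
    using retract_emb_restrict[OF e1 cA N1(1)] by blast+
   have "\<Union>\<A> \<inter> (A - \<Union>\<A>) = {}" "N \<inter> ?N2 = {}" using N1(3) by auto
   then obtain j' r' where e: "retract_emb (\<Union>\<A> \<union> (A - \<Union>\<A>)) (N \<union> ?N2) j' r'"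
    using retract_emb_Un[OF N(4) e2(2)] UG cA N(1) e2(1) unfolding clopen_in_def by metis
   have "\<Union>(insert A \<A>) = \<Union>\<A> \<union> (A - \<Union>\<A>)" by auto
   moreover have "?N2 \<inter> CB H g = {}"
    using N1(3) CB_antimono[of "ord_succ h" g H] h(1) by (auto simp: ord_succ_le_iff)
   ultimately show ?case
    using e N e2(1) N1(3)
    by (intro exI[of _ "N \<union> ?N2"] exI[of _ j'] exI[of _ r']) (auto intro: clopen_in_Un)
  qed
  obtain a where a: "\<And>x. x \<in> G ==> simple (a x) \<and> x \<in> a x" using cover by metis
  have oa: "open (- (G - a x))" if "x \<in> G" for x
   using a[OF that] clopen_in_open(1) unfolding simple_def by blast
  have cov: "G \<subseteq> (\<Union>x\<in>G. - (G - a x))"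
  proof
   fix x assume "x \<in> G"
   then show "x \<in> (\<Union>x\<in>G. - (G - a x))" using a[of x] by auto
  qed
  obtain C where C: "C \<subseteq> G" "finite C" "G \<subseteq> (\<Union>x\<in>C. - (G - a x))"
   by (rule compactE_image[OF G(1) oa cov], assumption, rule that)
  have aG: "a x \<subseteq> G" if "x \<in> C" for x
   using a[of x] that C(1) unfolding simple_def clopen_in_def by blast
  have "\<Union>(a ` C) = G"
  proof
   show "\<Union>(a ` C) \<subseteq> G" using aG by blast
   show "G \<subseteq> \<Union>(a ` C)" using C(3) by blast
  qed
  then show "\<exists>N j r. clopen_in H N \<and> N \<subseteq> V \<and> N \<inter> CB H g = {} \<and> retract_emb G N j r"
   using fin[of "a ` C"] C(1,2) a by (metis finite_imageI imageE subsetD)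
 qed
qed

text \<open>Around each point of \<open>K - E\<close> lies a clopen set within half its distance
  from \<open>E\<close>. The first of these sets that contains \<open>y\<close> decides the value at
  \<open>y\<close>, namely a point of \<open>E\<close> nearest to its centre. The map is locally
  constant off \<open>E\<close> and moves points near \<open>E\<close> only a little.\<close>

lemma clopen_retraction:
 fixes K :: "'a::metric_space set"
 assumes "compact K" "countable K" "E \<subseteq> K" "compact E" "E \<noteq> {}"
 obtains r where "continuous_on K r" "r ` K \<subseteq> E" "\<And>x. x \<in> E ==> r x = x"
proof -
 let ?x = "from_nat_into (K - E)"
 show thesis
 proof (cases "K - E = {}")
  case True
  then show ?thesis using that[of "\<lambda>x. x"] assms(3) by auto
 next
  case ne: False
  have x: "?x n \<in> K - E" for n using ne by (rule from_nat_into)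
  have surj: "\<exists>n. y = ?x n" if "y \<in> K - E" for y
   using that assms(2) from_nat_into_surj[of "K - E" y] by (metis countable_Diff)
  have pos: "0 < infdist (?x n) E" for n
   using x[of n] assms by (metis DiffD2 compact_imp_closed in_closed_iff_infdist_zero infdist_nonneg order_le_less)
  have "\<exists>B. clopen_in K B \<and> ?x n \<in> B \<and> B \<subseteq> ball (?x n) (infdist (?x n) E / 2)" for n
   using clopen_nbhd[OF assms(1,2), of "?x n" "ball (?x n) (infdist (?x n) E / 2)"] x[of n] pos[of n]
   by (metis DiffD1 centre_in_ball half_gt_zero open_ball)
  then obtain B where B: "\<And>n. clopen_in K (B n)" "\<And>n. ?x n \<in> B n"
   "\<And>n. B n \<subseteq> ball (?x n) (infdist (?x n) E / 2)" by metis
  have "\<exists>e\<in>E. dist (?x n) e = infdist (?x n) E" for n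
  proof -
   have "continuous_on E (dist (?x n))" by (intro continuous_intros)
   then obtain e where e: "e \<in> E" "\<And>y. y \<in> E ==> dist (?x n) e \<le> dist (?x n) y"
    using continuous_attains_inf[OF assms(4,5)] by blast
   then have "dist (?x n) e \<le> infdist (?x n) E"
    unfolding infdist_notempty[OF assms(5)] by (intro cINF_greatest assms(5))
   then show ?thesis using e(1) infdist_le[OF e(1), of "?x n"] by force
  qed
  then obtain p where p: "\<And>n. p n \<in> E" "\<And>n. dist (?x n) (p n) = infdist (?x n) E" by metis
  define ix where "ix y = (LEAST n. y \<in> B n)" for y
  define r where "r y = (if y \<in> E then y else p (ix y))" for y
  have ixB: "y \<in> B (ix y)" if "y \<in> K - E" for y
   unfolding ix_def using surj[OF that] B(2) by (metis LeastI_ex)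
  have BE: "B n \<inter> E = {}" for n
  proof -
   have False if "e \<in> B n" "e \<in> E" for e
    using that B(3)[of n] infdist_le[OF that(2), of "?x n"] infdist_nonneg[of "?x n" E] by fastforce
   then show ?thesis by blast
  qed
  \<comment> \<open>The centre is at most twice as far from \<open>E\<close> as \<open>y\<close> is.
    Its nearest point lies at that distance, and half of it leads from the centre back to
    \<open>y\<close>: together three times the distance of \<open>y\<close>.\<close>
  have near: "dist (r y) y \<le> 3 * infdist y E" if "y \<in> K - E" for y
  proof -
   let ?n = "ix y"
   have d: "dist (?x ?n) y < infdist (?x ?n) E / 2" using ixB[OF that] B(3)[of ?n] by auto
   have "infdist (?x ?n) E \<le> infdist y E + dist (?x ?n) y" by (rule infdist_triangle)
   then have "infdist (?x ?n) E \<le> 2 * infdist y E" using d by linarith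
   moreover have "dist (r y) y \<le> dist (?x ?n) (p ?n) + dist (?x ?n) y"
    using that dist_triangle[of "p ?n" y "?x ?n"] by (simp add: r_def dist_commute)
   ultimately show ?thesis using d p(2)[of ?n] by linarith
  qed
  have "continuous_on K r"
   unfolding continuous_on_eq_continuous_within
  proof
   fix y assume y: "y \<in> K"
   show "continuous (at y within K) r"
   proof (cases "y \<in> E")
    case True
    show ?thesis
     unfolding continuous_within_eps_delta
    proof (intro allI impI)
     fix e :: real assume "0 < e"
     have "dist (r z) (r y) < e" if z: "z \<in> K" "dist z y < e / 4" for z
     proof (cases "z \<in> E")
      case False
      have "infdist z E \<le> dist z y" using True by (rule infdist_le)
      then have "dist (r z) z \<le> 3 * dist z y" using near[of z] z False by simp
      then show ?thesis using z dist_triangle[of "r z" y z] True by (simp add: r_def)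
     qed (use z True \<open>0 < e\<close> in "simp add: r_def")
     then show "\<exists>d>0. \<forall>x'\<in>K. dist x' y < d --> dist (r x') (r y) < e"
      using \<open>0 < e\<close> by (intro exI[of _ "e / 4"]) auto
    qed
   next
    case False
    let ?n = "ix y"
    let ?A = "B ?n - (\<Union>i\<in>{..<?n}. B i)"
    have cA: "clopen_in K ?A" by (intro clopen_in_Diff clopen_in_UN B assms) auto
    have "y \<notin> B i" if "i < ?n" for i using that not_less_Least unfolding ix_def by blast
    then have "y \<in> ?A" using ixB y False by blast
    moreover have "r z = p ?n" if "z \<in> ?A" for z
    proof -
     have "ix z = ?n" unfolding ix_def[of z]
      using that by (intro Least_equality) (auto simp: not_less[symmetric])
     then show ?thesis using that BE by (auto simp: r_def)
    qed
    ultimately show ?thesis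
     by (intro continuous_within_clopen[OF cA _ continuous_on_const]) auto
   qed
  qed
  moreover have "r ` K \<subseteq> E" using p(1) by (auto simp: r_def)
  ultimately show ?thesis using that[of r] by (simp add: r_def)
 qed
qed

subsection \<open>Spaces of functions and the decomposition method\<close>

definition fun_subspace :: "('i => 'k::real_normed_field) set => bool" where
 "fun_subspace S \<longleftrightarrow> (\<lambda>_. 0) \<in> S \<and> (\<forall>f\<in>S. \<forall>g\<in>S. (\<lambda>x. f x + g x) \<in> S) \<and>
  (\<forall>c. \<forall>f\<in>S. (\<lambda>x. c * f x) \<in> S)"

text \<open>Stating the bound for every bound of \<open>f\<close> avoids suprema.\<close>

definition bounded_lin ::
 "('i => 'k::real_normed_field) set => ('j => 'k) set => (('i => 'k) => 'j => 'k) => bool"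
where
 "bounded_lin S T F \<longleftrightarrow> (\<forall>f\<in>S. F f \<in> T) \<and>
  (\<forall>f\<in>S. \<forall>g\<in>S. F (\<lambda>x. f x + g x) = (\<lambda>y. F f y + F g y)) \<and>
  (\<forall>c. \<forall>f\<in>S. F (\<lambda>x. c * f x) = (\<lambda>y. c * F f y)) \<and>
  (\<exists>C\<ge>0. \<forall>f\<in>S. \<forall>b. (\<forall>x. norm (f x) \<le> b) --> (\<forall>y. norm (F f y) \<le> C * b))"

definition fun_iso :: "('i => 'k::real_normed_field) set => ('j => 'k) set => bool" (infix \<open>\<simeq>\<close> 50) where
 "S \<simeq> T \<longleftrightarrow> (\<exists>F G. bounded_lin S T F \<and> bounded_lin T S G \<and> (\<forall>f\<in>S. G (F f) = f) \<and> (\<forall>g\<in>T. F (G g) = g))"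

text \<open>\<open>J \<circ> R\<close> is then a bounded projection of \<open>T\<close> onto a copy
  of \<open>S\<close>.\<close>

definition complemented ::
 "('i => 'k::real_normed_field) set => ('j => 'k) set => bool" (infix \<open>\<sqsubseteq>\<^sub>c\<close> 50) where
 "S \<sqsubseteq>\<^sub>c T \<longleftrightarrow> (\<exists>J R. bounded_lin S T J \<and> bounded_lin T S R \<and> (\<forall>f\<in>S. R (J f) = f))"

lemma bounded_linI:
 assumes "\<And>f. f \<in> S ==> F f \<in> T"
  and "\<And>f g. f \<in> S ==> g \<in> S ==> F (\<lambda>x. f x + g x) = (\<lambda>y. F f y + F g y)"
  and "\<And>c f. f \<in> S ==> F (\<lambda>x. c * f x) = (\<lambda>y. c * F f y)"
  and "0 \<le> C" "\<And>f b y. f \<in> S ==> (\<And>x. norm (f x) \<le> b) ==> norm (F f y) \<le> C * b"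
 shows "bounded_lin S T F"
 unfolding bounded_lin_def using assms by blast

lemma bounded_linD:
 assumes "bounded_lin S T F"
 shows "f \<in> S ==> F f \<in> T"
  and "f \<in> S ==> g \<in> S ==> F (\<lambda>x. f x + g x) = (\<lambda>y. F f y + F g y)"
  and "f \<in> S ==> F (\<lambda>x. c * f x) = (\<lambda>y. c * F f y)"
 using assms unfolding bounded_lin_def by blast+

lemma bounded_lin_bound:
 assumes "bounded_lin S T F"
 obtains C where "0 < C" "\<And>f b y. f \<in> S ==> (\<And>x. norm (f x) \<le> b) ==> norm (F f y) \<le> C * b"
proof -
 obtain C where C: "C \<ge> 0" "\<And>f b y. f \<in> S ==> (\<forall>x. norm (f x) \<le> b) ==> norm (F f y) \<le> C * b"
  using assms unfolding bounded_lin_def by blast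
 have "norm (F f y) \<le> (C + 1) * b" if "f \<in> S" "\<And>x. norm (f x) \<le> b" for f b y
 proof -
  have "0 \<le> b" using that(2) norm_ge_zero order_trans by blast
  then have "C * b \<le> (C + 1) * b" by (simp add: algebra_simps)
  then show ?thesis using C(2)[OF that(1), of b y] that(2) by force
 qed
 then show thesis using that[of "C + 1"] C(1) by simp
qed

lemma bounded_lin_compose:
 assumes F: "bounded_lin S T F" and G: "bounded_lin T U G"
 shows "bounded_lin S U (\<lambda>f. G (F f))"
proof -
 obtain C where C: "0 < C" "\<And>f b y. f \<in> S ==> (\<And>x. norm (f x) \<le> b) ==> norm (F f y) \<le> C * b"
  using bounded_lin_bound[OF F] by blast
 obtain D where D: "0 < D" "\<And>f b y. f \<in> T ==> (\<And>x. norm (f x) \<le> b) ==> norm (G f y) \<le> D * b"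
  using bounded_lin_bound[OF G] by blast
 show ?thesis
 proof (rule bounded_linI[where C = "D * C"])
  fix f b y assume "f \<in> S" "\<And>x. norm (f x) \<le> b"
  then show "norm (G (F f) y) \<le> D * C * b"
   using D(2)[of "F f" "C * b" y] C(2) bounded_linD(1)[OF F] by (simp add: mult.assoc)
 qed (use C D bounded_linD[OF F] bounded_linD[OF G] in simp_all)
qed

lemma bounded_lin_id: "bounded_lin S S (\<lambda>f. f)"
 by (rule bounded_linI[where C = 1]) auto

lemma fun_iso_refl [simp]: "S \<simeq> S"
 unfolding fun_iso_def using bounded_lin_id by blast

lemma fun_iso_sym: "S \<simeq> T ==> T \<simeq> S"
 unfolding fun_iso_def by blast

lemma fun_iso_trans [trans]: "S \<simeq> T ==> T \<simeq> U ==> S \<simeq> U"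
 unfolding fun_iso_def
proof (elim exE conjE)
 fix F G F' G'
 assume *: "bounded_lin S T F" "bounded_lin T S G" "\<forall>f\<in>S. G (F f) = f" "\<forall>g\<in>T. F (G g) = g"
  "bounded_lin T U F'" "bounded_lin U T G'" "\<forall>f\<in>T. G' (F' f) = f" "\<forall>g\<in>U. F' (G' g) = g"
 show "\<exists>F G. bounded_lin S U F \<and> bounded_lin U S G \<and> (\<forall>f\<in>S. G (F f) = f) \<and> (\<forall>g\<in>U. F (G g) = g)"
  using bounded_lin_compose[OF *(1,5)] bounded_lin_compose[OF *(6,2)] *
   bounded_linD(1)[OF *(1)] bounded_linD(1)[OF *(6)]
  by (intro exI[of _ "\<lambda>f. F' (F f)"] exI[of _ "\<lambda>f. G (G' f)"]) simp
qed

lemma complemented_trans: "S \<sqsubseteq>\<^sub>c T ==> T \<sqsubseteq>\<^sub>c U ==> S \<sqsubseteq>\<^sub>c U"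
 unfolding complemented_def
proof (elim exE conjE)
 fix F G F' G'
 assume *: "bounded_lin S T F" "bounded_lin T S G" "\<forall>f\<in>S. G (F f) = f"
  "bounded_lin T U F'" "bounded_lin U T G'" "\<forall>f\<in>T. G' (F' f) = f"
 show "\<exists>F G. bounded_lin S U F \<and> bounded_lin U S G \<and> (\<forall>f\<in>S. G (F f) = f)"
  using bounded_lin_compose[OF *(1,4)] bounded_lin_compose[OF *(5,2)] * bounded_linD(1)[OF *(1)]
  by (intro exI[of _ "\<lambda>f. F' (F f)"] exI[of _ "\<lambda>f. G (G' f)"]) simp
qed

lemma fun_iso_imp_complemented: "S \<simeq> T ==> S \<sqsubseteq>\<^sub>c T"
 unfolding fun_iso_def complemented_def by blast

text \<open>The natural isomorphisms between sums below merely rename coordinates.\<close>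

lemma fun_iso_reindex:
 assumes "bij \<phi>" "\<And>h. h \<circ> \<phi> \<in> T \<longleftrightarrow> h \<in> S"
 shows "S \<simeq> T"
proof -
 have i: "(h \<circ> inv \<phi>) \<circ> \<phi> = h" "(h' \<circ> \<phi>) \<circ> inv \<phi> = h'" for h h'
  using assms(1) by (auto simp: fun_eq_iff bij_is_inj bij_is_surj surj_f_inv_f)
 have "bounded_lin S T (\<lambda>h. h \<circ> \<phi>)"
  by (rule bounded_linI[where C = 1]) (auto simp: assms(2) fun_eq_iff)
 moreover have "bounded_lin T S (\<lambda>h. h \<circ> inv \<phi>)"
 proof (rule bounded_linI[where C = 1])
  fix f assume "f \<in> T"
  then show "f \<circ> inv \<phi> \<in> S" using assms(2)[of "f \<circ> inv \<phi>"] i(1)[of f] by simp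
 qed (auto simp: fun_eq_iff)
 ultimately show ?thesis unfolding fun_iso_def using i by blast
qed

section \<open>Direct sums and c0-sums\<close>

definition dsum ::
 "('i => 'k::real_normed_field) set => ('j => 'k) set => ('i + 'j => 'k) set" (infixr \<open>\<oplus>\<^sub>s\<close> 65) where
 "S \<oplus>\<^sub>s T = {h. (\<lambda>i. h (Inl i)) \<in> S \<and> (\<lambda>j. h (Inr j)) \<in> T}"

text \<open>The sup norms of the components tend to 0; this form avoids suprema.\<close>

definition c0_sum :: "('i => 'k::real_normed_field) set => (nat \<times> 'i => 'k) set" where
 "c0_sum S = {h. (\<forall>n. (\<lambda>i. h (n, i)) \<in> S) \<and> (\<forall>e>0. finite {n. \<exists>i. e < norm (h (n, i))})}"

lemma bounded_lin_dsum:
 assumes F: "bounded_lin S S' F" and G: "bounded_lin T T' G"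
 shows "bounded_lin (S \<oplus>\<^sub>s T) (S' \<oplus>\<^sub>s T') (\<lambda>h. case_sum (F (\<lambda>i. h (Inl i))) (G (\<lambda>j. h (Inr j))))"
proof -
 obtain C where C: "0 < C" "\<And>f b y. f \<in> S ==> (\<And>x. norm (f x) \<le> b) ==> norm (F f y) \<le> C * b"
  using bounded_lin_bound[OF F] by blast
 obtain D where D: "0 < D" "\<And>f b y. f \<in> T ==> (\<And>x. norm (f x) \<le> b) ==> norm (G f y) \<le> D * b"
  using bounded_lin_bound[OF G] by blast
 show ?thesis
 proof (rule bounded_linI[where C = "C + D"])
  fix h b y assume h: "h \<in> S \<oplus>\<^sub>s T" "\<And>x. norm (h x) \<le> b"
  have "0 \<le> b" using h(2) norm_ge_zero order_trans by blast
  then have "C * b \<le> (C + D) * b" "D * b \<le> (C + D) * b" using C(1) D(1) by (simp_all add: algebra_simps)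
  moreover have "norm (F (\<lambda>i. h (Inl i)) i) \<le> C * b" "norm (G (\<lambda>j. h (Inr j)) j) \<le> D * b" for i j
   using h by (auto simp: dsum_def intro: C(2) D(2))
  ultimately show "norm (case_sum (F (\<lambda>i. h (Inl i))) (G (\<lambda>j. h (Inr j))) y) \<le> (C + D) * b"
   by (cases y) (auto intro: order_trans)
 qed (use C D bounded_linD[OF F] bounded_linD[OF G] in "auto simp: dsum_def fun_eq_iff split: sum.splits")
qed

lemma dsum_cong:
 assumes "S \<simeq> S'" "T \<simeq> T'"
 shows "S \<oplus>\<^sub>s T \<simeq> S' \<oplus>\<^sub>s T'"
proof -
 obtain F F' where F: "bounded_lin S S' F" "bounded_lin S' S F'" "\<And>f. f \<in> S ==> F' (F f) = f" "\<And>f. f \<in> S' ==> F (F' f) = f"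
  using assms(1) unfolding fun_iso_def by blast
 obtain G G' where G: "bounded_lin T T' G" "bounded_lin T' T G'" "\<And>f. f \<in> T ==> G' (G f) = f" "\<And>f. f \<in> T' ==> G (G' f) = f"
  using assms(2) unfolding fun_iso_def by blast
 show ?thesis
  unfolding fun_iso_def
  by (intro exI conjI ballI, rule bounded_lin_dsum[OF F(1) G(1)], rule bounded_lin_dsum[OF F(2) G(2)])
   (auto simp: dsum_def F(3,4) G(3,4) fun_eq_iff split: sum.splits)
qed

lemma bounded_lin_c0_sum:
 assumes F: "bounded_lin S T F"
 shows "bounded_lin (c0_sum S) (c0_sum T) (\<lambda>h (n, j). F (\<lambda>i. h (n, i)) j)"
proof -
 obtain C where C: "0 < C" "\<And>f b y. f \<in> S ==> (\<And>x. norm (f x) \<le> b) ==> norm (F f y) \<le> C * b"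
  using bounded_lin_bound[OF F] by blast
 show ?thesis
 proof (rule bounded_linI[where C = C])
  fix h assume h: "h \<in> c0_sum S"
  have "finite {n. \<exists>j. e < norm (F (\<lambda>i. h (n, i)) j)}" if "0 < e" for e
  proof (rule finite_subset)
   show "finite {n. \<exists>i. e / C < norm (h (n, i))}"
    using h that C(1) unfolding c0_sum_def by (simp add: divide_pos_pos)
   have "norm (F (\<lambda>i. h (n, i)) j) \<le> e" if "\<forall>i. norm (h (n, i)) \<le> e / C" for n j
    using C(2)[of "\<lambda>i. h (n, i)" "e / C" j] C(1) that h by (auto simp: c0_sum_def)
   then show "{n. \<exists>j. e < norm (F (\<lambda>i. h (n, i)) j)} \<subseteq> {n. \<exists>i. e / C < norm (h (n, i))}"
    by (auto simp: not_le[symmetric])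
  qed
  then show "(\<lambda>(n, j). F (\<lambda>i. h (n, i)) j) \<in> c0_sum T"
   using h bounded_linD(1)[OF F] by (auto simp: c0_sum_def)
 qed (use C bounded_linD[OF F] in "auto simp: c0_sum_def fun_eq_iff")
qed

lemma c0_sum_cong:
 assumes "S \<simeq> T"
 shows "c0_sum S \<simeq> c0_sum T"
proof -
 obtain F F' where F: "bounded_lin S T F" "bounded_lin T S F'" "\<And>f. f \<in> S ==> F' (F f) = f" "\<And>f. f \<in> T ==> F (F' f) = f"
  using assms(1) unfolding fun_iso_def by blast
 show ?thesis
  unfolding fun_iso_def
  by (intro exI conjI ballI, rule bounded_lin_c0_sum[OF F(1)], rule bounded_lin_c0_sum[OF F(2)])
   (auto simp: c0_sum_def F(3,4) fun_eq_iff)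
qed

lemma fun_subspace_add: "fun_subspace S ==> f \<in> S ==> g \<in> S ==> (\<lambda>x. f x + g x) \<in> S"
 unfolding fun_subspace_def by blast

lemma fun_subspace_scale: "fun_subspace S ==> f \<in> S ==> (\<lambda>x. c * f x) \<in> S"
 unfolding fun_subspace_def by blast

lemma fun_subspace_diff:
 assumes "fun_subspace S" "f \<in> S" "g \<in> S"
 shows "(\<lambda>x. f x - g x) \<in> S"
proof -
 have "(\<lambda>x. f x + (- 1) * g x) \<in> S"
  by (rule fun_subspace_add[OF assms(1,2) fun_subspace_scale[OF assms(1,3)]])
 then show ?thesis by simp
qed

lemma dsum_comm: "S \<oplus>\<^sub>s T \<simeq> T \<oplus>\<^sub>s S"
proof (rule fun_iso_reindex)
 show "bij (case_sum Inr Inl :: 'b + 'a => 'a + 'b)"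
  by (rule o_bij[of "case_sum Inr Inl"]) (auto simp: fun_eq_iff split: sum.splits)
qed (auto simp: dsum_def)

lemma dsum_assoc: "(S \<oplus>\<^sub>s T) \<oplus>\<^sub>s U \<simeq> S \<oplus>\<^sub>s (T \<oplus>\<^sub>s U)"
proof (rule fun_iso_reindex)
 show "bij (case_sum (Inl \<circ> Inl) (case_sum (Inl \<circ> Inr) Inr) :: 'a + ('b + 'c) => ('a + 'b) + 'c)"
  by (rule o_bij[of "case_sum (case_sum Inl (Inr \<circ> Inl)) (Inr \<circ> Inr)"]) (auto simp: fun_eq_iff split: sum.splits)
qed (auto simp: dsum_def)

lemma c0_sum_dsum: "c0_sum (S \<oplus>\<^sub>s T) \<simeq> c0_sum S \<oplus>\<^sub>s c0_sum T"
proof (rule fun_iso_reindex)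
 let ?p = "case_sum (\<lambda>(n, i). (n, Inl i)) (\<lambda>(n, j). (n, Inr j)) :: nat \<times> 'a + nat \<times> 'b => nat \<times> ('a + 'b)"
 show "bij ?p"
  by (rule o_bij[of "\<lambda>(n, s). case_sum (\<lambda>i. Inl (n, i)) (\<lambda>j. Inr (n, j)) s"])
   (auto simp: fun_eq_iff split: sum.splits)
 fix h :: "nat \<times> ('a + 'b) => 'c"
 have "{n. \<exists>s. e < norm (h (n, s))} = {n. \<exists>i. e < norm (h (n, Inl i))} \<union> {n. \<exists>j. e < norm (h (n, Inr j))}" for e
  by (auto, metis sum.exhaust)
 then show "h \<circ> ?p \<in> c0_sum S \<oplus>\<^sub>s c0_sum T \<longleftrightarrow> h \<in> c0_sum (S \<oplus>\<^sub>s T)"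
  by (auto simp: dsum_def c0_sum_def)
qed

lemma dsum_c0_sum: "S \<oplus>\<^sub>s c0_sum S \<simeq> c0_sum S"
proof (rule fun_iso_sym, rule fun_iso_reindex)
 let ?p = "case_sum (\<lambda>i. (0, i)) (\<lambda>(n, i). (Suc n, i)) :: 'a + nat \<times> 'a => nat \<times> 'a"
 show "bij ?p"
  by (rule o_bij[of "\<lambda>(n, i). case n of 0 => Inl i | Suc m => Inr (m, i)"])
   (auto simp: fun_eq_iff split: sum.splits nat.splits)
 fix h :: "nat \<times> 'a => 'b"
 have sub: "{n. \<exists>i. e < norm (h (n, i))} \<subseteq> insert 0 (Suc ` {n. \<exists>i. e < norm (h (Suc n, i))})" for e
  by (auto simp: image_iff, metis not0_implies_Suc)
 have 1: "finite {n. \<exists>i. e < norm (h (n, i))}" if "finite {n. \<exists>i. e < norm (h (Suc n, i))}" for e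
  by (rule finite_subset[OF sub]) (use that in simp)
 have "Suc ` {n. \<exists>i. e < norm (h (Suc n, i))} \<subseteq> {n. \<exists>i. e < norm (h (n, i))}" for e by auto
 then have 2: "finite {n. \<exists>i. e < norm (h (Suc n, i))}" if "finite {n. \<exists>i. e < norm (h (n, i))}" for e
  by (rule finite_imageD[OF finite_subset[OF _ that]]) simp
 have 3: "(\<forall>n. (\<lambda>i. h (n, i)) \<in> S) \<longleftrightarrow> (\<lambda>i. h (0, i)) \<in> S \<and> (\<forall>n. (\<lambda>i. h (Suc n, i)) \<in> S)"
  by (metis not0_implies_Suc)
 show "h \<circ> ?p \<in> S \<oplus>\<^sub>s c0_sum S \<longleftrightarrow> h \<in> c0_sum S"
  using 1 2 by (auto simp: dsum_def c0_sum_def 3)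
qed

lemma c0_sum_c0_sum: "c0_sum (c0_sum S) \<simeq> c0_sum S"
proof (rule fun_iso_reindex)
 let ?p = "\<lambda>(m, i). (fst (prod_decode m), snd (prod_decode m), i) :: nat \<times> nat \<times> 'a"
 show "bij ?p"
  by (rule o_bij[of "\<lambda>(n, m, i). (prod_encode (n, m), i)"]) (auto simp: fun_eq_iff)
 fix h :: "nat \<times> nat \<times> 'a => 'b"
 define A where "A e = {(n, m). \<exists>i. e < norm (h (n, m, i))}" for e
 have A: "finite (A e) \<longleftrightarrow> finite {n. \<exists>x. e < norm (h (n, x))} \<and> (\<forall>n. finite {m. \<exists>i. e < norm (h (n, m, i))})" for e
 proof
  assume fin: "finite (A e)"
  have "{n. \<exists>x. e < norm (h (n, x))} = fst ` A e" by (force simp: A_def)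
  moreover have "{m. \<exists>i. e < norm (h (n, m, i))} \<subseteq> snd ` A e" for n by (force simp: A_def)
  ultimately show "finite {n. \<exists>x. e < norm (h (n, x))} \<and> (\<forall>n. finite {m. \<exists>i. e < norm (h (n, m, i))})"
   using fin finite_subset by (metis finite_imageI)
 next
  assume fin: "finite {n. \<exists>x. e < norm (h (n, x))} \<and> (\<forall>n. finite {m. \<exists>i. e < norm (h (n, m, i))})"
  have "A e \<subseteq> (SIGMA n : {n. \<exists>x. e < norm (h (n, x))}. {m. \<exists>i. e < norm (h (n, m, i))})"
   by (auto simp: A_def)
  then show "finite (A e)" using fin finite_subset by (metis (no_types, lifting) finite_SigmaI)
 qed
 have "prod_decode ` {m. \<exists>i. e < norm (h (fst (prod_decode m), snd (prod_decode m), i))} = A e" for e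
 proof
  show "A e \<subseteq> prod_decode ` {m. \<exists>i. e < norm (h (fst (prod_decode m), snd (prod_decode m), i))}"
  proof
   fix p assume "p \<in> A e"
   then show "p \<in> prod_decode ` {m. \<exists>i. e < norm (h (fst (prod_decode m), snd (prod_decode m), i))}"
    by (intro image_eqI[of _ _ "prod_encode p"]) (auto simp: A_def)
  qed
 qed (auto simp: A_def split: prod.splits, metis fst_conv snd_conv)
 then have B: "finite (A e) \<longleftrightarrow> finite {m. \<exists>i. e < norm (h (fst (prod_decode m), snd (prod_decode m), i))}" for e
  by (metis (no_types, lifting) finite_imageD finite_imageI inj_on_subset inj_prod_decode subset_UNIV)
 have C: "(\<forall>n. (\<lambda>i. h (fst (prod_decode n), snd (prod_decode n), i)) \<in> S) \<longleftrightarrow> (\<forall>n m. (\<lambda>i. h (n, m, i)) \<in> S)"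
  by (metis fst_conv prod_encode_inverse snd_conv)
 show "h \<circ> ?p \<in> c0_sum S \<longleftrightarrow> h \<in> c0_sum (c0_sum S)"
  using A B by (auto simp: c0_sum_def comp_def C)
qed

text \<open>\<open>Q\<close> is the kernel of \<open>R\<close>, and an element of \<open>T\<close>
  splits as \<open>J (R g)\<close> plus the remainder, which \<open>R\<close> annihilates.\<close>

lemma complemented_decomp:
 fixes S :: "('i => 'k::real_normed_field) set" and T :: "('j => 'k) set"
 assumes "S \<sqsubseteq>\<^sub>c T" "fun_subspace T"
 obtains Q :: "('j => 'k) set" where "T \<simeq> S \<oplus>\<^sub>s Q"
proof -
 obtain J R where J: "bounded_lin S T J" and R: "bounded_lin T S R" and RJ: "\<And>f. f \<in> S ==> R (J f) = f"
  using assms(1) unfolding complemented_def by blast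
 obtain C where C: "0 < C" "\<And>f b y. f \<in> S ==> (\<And>x. norm (f x) \<le> b) ==> norm (J f y) \<le> C * b"
  using bounded_lin_bound[OF J] by blast
 obtain D where D: "0 < D" "\<And>f b y. f \<in> T ==> (\<And>x. norm (f x) \<le> b) ==> norm (R f y) \<le> D * b"
  using bounded_lin_bound[OF R] by blast
 define Q where "Q = {g \<in> T. R g = (\<lambda>_. 0)}"
 note JD = bounded_linD[OF J] and RD = bounded_linD[OF R]
 have Rdiff: "R (\<lambda>x. f x - g x) = (\<lambda>y. R f y - R g y)" if "f \<in> T" "g \<in> T" for f g
 proof -
  have "(\<lambda>x. (- 1) * g x) \<in> T" using assms(2) that unfolding fun_subspace_def by blast
  then have "R (\<lambda>x. f x + (- 1) * g x) = (\<lambda>y. R f y + (- 1) * R g y)"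
   using RD(2)[OF that(1), of "\<lambda>x. (- 1) * g x"] RD(3)[OF that(2), of "- 1"] by metis
  then show ?thesis by simp
 qed
 let ?F = "\<lambda>g. case_sum (R g) (\<lambda>x. g x - J (R g) x)"
 let ?G = "\<lambda>h x. J (\<lambda>i. h (Inl i)) x + h (Inr x)"
 have bF: "bounded_lin T (S \<oplus>\<^sub>s Q) ?F"
 proof (rule bounded_linI[where C = "D + (1 + C * D)"])
  fix f assume f: "f \<in> T"
  have "(\<lambda>x. f x - J (R f) x) \<in> Q"
   using f RD(1) JD(1) RJ Rdiff fun_subspace_diff[OF assms(2)] by (simp add: Q_def)
  then show "?F f \<in> S \<oplus>\<^sub>s Q" using RD(1)[OF f] by (simp add: dsum_def)
 next
  fix f b y assume f: "f \<in> T" "\<And>x. norm (f x) \<le> b"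
  have b0: "0 \<le> b" using f(2) norm_ge_zero order_trans by blast
  have r: "norm (R f x) \<le> D * b" for x using D(2) f by blast
  then have "norm (J (R f) x) \<le> C * (D * b)" for x using C(2)[OF RD(1)[OF f(1)]] by blast
  then have "norm (f x - J (R f) x) \<le> b + C * (D * b)" for x
   by (intro order_trans[OF norm_triangle_ineq4] add_mono f(2))
  then have "norm (f x - J (R f) x) \<le> (1 + C * D) * b" for x
   by (simp add: algebra_simps)
  note nb = this
  have "0 \<le> D * b" "0 \<le> (1 + C * D) * b" using C D b0 by simp_all
  then show "norm (?F f y) \<le> (D + (1 + C * D)) * b"
  proof (cases y)
   case (Inl i)
   then show ?thesis using r[of i] \<open>0 \<le> (1 + C * D) * b\<close> by (simp add: distrib_right)
  next
   case (Inr x)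
   then show ?thesis
    using nb[of x] \<open>0 \<le> D * b\<close> by (simp add: distrib_right)
  qed
 next
  fix f g assume f: "f \<in> T" "g \<in> T"
  have "J (R (\<lambda>x. f x + g x)) = (\<lambda>y. J (R f) y + J (R g) y)"
   using RD(1,2) JD(2) f by simp
  then show "?F (\<lambda>x. f x + g x) = (\<lambda>y. ?F f y + ?F g y)"
   using RD(2)[OF f] by (intro ext) (simp add: algebra_simps split: sum.splits)
 next
  fix c f assume f: "f \<in> T"
  have "J (R (\<lambda>x. c * f x)) = (\<lambda>y. c * J (R f) y)"
   using RD(1,3) JD(3) f by simp
  then show "?F (\<lambda>x. c * f x) = (\<lambda>y. c * ?F f y)"
   using RD(3)[OF f] by (intro ext) (simp add: algebra_simps split: sum.splits)
 qed (use C D in simp)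
 have bG: "bounded_lin (S \<oplus>\<^sub>s Q) T ?G"
 proof (rule bounded_linI[where C = "C + 1"])
  fix h assume "h \<in> S \<oplus>\<^sub>s Q"
  then have "J (\<lambda>i. h (Inl i)) \<in> T" "(\<lambda>x. h (Inr x)) \<in> T"
   using JD(1) by (auto simp: dsum_def Q_def)
  then show "?G h \<in> T" by (rule fun_subspace_add[OF assms(2)])
 next
  fix h b y assume h: "h \<in> S \<oplus>\<^sub>s Q" "\<And>x. norm (h x) \<le> b"
  have "norm (J (\<lambda>i. h (Inl i)) y) \<le> C * b" using h by (intro C(2)) (auto simp: dsum_def)
  then show "norm (?G h y) \<le> (C + 1) * b"
   using norm_triangle_ineq[of "J (\<lambda>i. h (Inl i)) y" "h (Inr y)"] h(2)[of "Inr y"]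
   by (simp add: distrib_right)
 qed (use C JD in "auto simp: fun_eq_iff algebra_simps dsum_def")
 have "?G (?F f) = f" if "f \<in> T" for f by (simp add: fun_eq_iff)
 moreover have "?F (?G h) = h" if "h \<in> S \<oplus>\<^sub>s Q" for h
 proof -
  have h: "(\<lambda>i. h (Inl i)) \<in> S" "(\<lambda>x. h (Inr x)) \<in> T" "R (\<lambda>x. h (Inr x)) = (\<lambda>_. 0)"
   using that by (auto simp: dsum_def Q_def)
  have "R (?G h) = (\<lambda>i. h (Inl i))"
   using RD(2)[OF JD(1)[OF h(1)] h(2)] RJ[OF h(1)] h(3) by simp
  then show ?thesis by (intro ext) (simp split: sum.splits)
 qed
 ultimately have "T \<simeq> S \<oplus>\<^sub>s Q" unfolding fun_iso_def using bF bG by blast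
 then show thesis using that by blast
qed

text \<open>An infinite sum swallows one more summand. The first chain uses this for the copies of
  \<open>X\<close> to get \<open>Y \<simeq> X \<oplus>\<^sub>s Y\<close>. The second opens
  \<open>c0_sum X\<close> as a c0-sum of \<open>Y \<oplus>\<^sub>s P\<close>, swallows one
  \<open>Y\<close>, and closes it again to get
  \<open>X \<simeq> Y \<oplus>\<^sub>s X\<close>.\<close>

theorem pelczynski_decomposition:
 fixes X :: "('i => 'k::real_normed_field) set" and Y :: "('j => 'k) set"
 assumes "X \<sqsubseteq>\<^sub>c Y" "Y \<sqsubseteq>\<^sub>c X" "X \<simeq> c0_sum X" "fun_subspace X" "fun_subspace Y"
 shows "X \<simeq> Y"
proof -
 obtain Q :: "('j => 'k) set" where Q: "Y \<simeq> X \<oplus>\<^sub>s Q" by (rule complemented_decomp[OF assms(1,5)], rule that)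
 obtain P :: "('i => 'k) set" where P: "X \<simeq> Y \<oplus>\<^sub>s P" by (rule complemented_decomp[OF assms(2,4)], rule that)
 have "Y \<simeq> X \<oplus>\<^sub>s Q" by (rule Q)
 also have "\<dots> \<simeq> c0_sum X \<oplus>\<^sub>s Q" by (intro dsum_cong assms fun_iso_refl)
 also have "\<dots> \<simeq> (X \<oplus>\<^sub>s c0_sum X) \<oplus>\<^sub>s Q" by (intro dsum_cong fun_iso_refl fun_iso_sym[OF dsum_c0_sum])
 also have "\<dots> \<simeq> (c0_sum X \<oplus>\<^sub>s X) \<oplus>\<^sub>s Q" by (intro dsum_cong fun_iso_refl dsum_comm)
 also have "\<dots> \<simeq> c0_sum X \<oplus>\<^sub>s (X \<oplus>\<^sub>s Q)" by (rule dsum_assoc)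
 also have "\<dots> \<simeq> X \<oplus>\<^sub>s Y" by (intro dsum_cong fun_iso_sym[OF assms(3)] fun_iso_sym[OF Q])
 finally have Y: "Y \<simeq> X \<oplus>\<^sub>s Y" .
 have "X \<simeq> c0_sum X" by (rule assms(3))
 also have "\<dots> \<simeq> c0_sum (Y \<oplus>\<^sub>s P)" by (intro c0_sum_cong P)
 also have "\<dots> \<simeq> c0_sum Y \<oplus>\<^sub>s c0_sum P" by (rule c0_sum_dsum)
 also have "\<dots> \<simeq> (Y \<oplus>\<^sub>s c0_sum Y) \<oplus>\<^sub>s c0_sum P" by (intro dsum_cong fun_iso_refl fun_iso_sym[OF dsum_c0_sum])
 also have "\<dots> \<simeq> Y \<oplus>\<^sub>s (c0_sum Y \<oplus>\<^sub>s c0_sum P)" by (rule dsum_assoc)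
 also have "\<dots> \<simeq> Y \<oplus>\<^sub>s c0_sum (Y \<oplus>\<^sub>s P)" by (intro dsum_cong fun_iso_refl fun_iso_sym[OF c0_sum_dsum])
 also have "\<dots> \<simeq> Y \<oplus>\<^sub>s c0_sum X" by (intro dsum_cong fun_iso_refl c0_sum_cong fun_iso_sym[OF P])
 also have "\<dots> \<simeq> Y \<oplus>\<^sub>s X" by (intro dsum_cong fun_iso_refl fun_iso_sym[OF assms(3)])
 also have "\<dots> \<simeq> X \<oplus>\<^sub>s Y" by (rule dsum_comm)
 also have "\<dots> \<simeq> Y" by (rule fun_iso_sym[OF Y])
 finally show ?thesis .
qed

lemma fun_subspace_dsum: "fun_subspace S ==> fun_subspace T ==> fun_subspace (S \<oplus>\<^sub>s T)"
 unfolding fun_subspace_def dsum_def by auto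

lemma fun_subspace_c0_sum:
 assumes "fun_subspace S"
 shows "fun_subspace (c0_sum S)"
proof -
 have "finite {n. \<exists>i. e < norm (f (n, i) + g (n, i))}"
  if "\<forall>e>0. finite {n. \<exists>i. e < norm (f (n, i))}" "\<forall>e>0. finite {n. \<exists>i. e < norm (g (n, i))}" "0 < e"
  for f g :: "nat \<times> 'a => 'b" and e
 proof (rule finite_subset)
  show "finite ({n. \<exists>i. e / 2 < norm (f (n, i))} \<union> {n. \<exists>i. e / 2 < norm (g (n, i))})"
   using that(1,2) half_gt_zero[OF that(3)] by blast
  have "norm (f (n, i) + g (n, i)) \<le> e" if "norm (f (n, i)) \<le> e / 2" "norm (g (n, i)) \<le> e / 2" for n i
   using norm_triangle_ineq[of "f (n, i)" "g (n, i)"] that by linarith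
  then show "{n. \<exists>i. e < norm (f (n, i) + g (n, i))} \<subseteq>
    {n. \<exists>i. e / 2 < norm (f (n, i))} \<union> {n. \<exists>i. e / 2 < norm (g (n, i))}"
   by (force simp: not_le[symmetric])
 qed
 moreover have "finite {n. \<exists>i. e < norm (c * f (n, i))}"
  if "\<forall>e>0. finite {n. \<exists>i. e < norm (f (n, i))}" "0 < e" for f :: "nat \<times> 'a => 'b" and c e
 proof (cases "c = 0")
  case False
  then have "{n. \<exists>i. e < norm (c * f (n, i))} = {n. \<exists>i. e / norm c < norm (f (n, i))}"
   by (simp add: norm_mult divide_less_eq mult.commute)
  then show ?thesis using that False by simp
 qed (use that in simp)
 ultimately show ?thesis
  using assms unfolding fun_subspace_def c0_sum_def by auto
qed

subsection \<open>Isomorphism classes of spaces of continuous functions\<close>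

text \<open>With \<open>E\<close> a nonempty derivative of \<open>K\<close> these are the spaces
  isomorphic to their own c0-sums, to which the decomposition method applies; empty \<open>E\<close>
  gives all of C(K), normalised to 0 outside \<open>K\<close> as in
  \<open>continuous_functions\<close>.\<close>

definition cont_vanish :: "'a::topological_space set => 'a set => ('a => 'k::real_normed_field) set" where
 "cont_vanish K E = {f. continuous_on K f \<and> (\<forall>x. x \<notin> K --> f x = 0) \<and> (\<forall>x\<in>E. f x = 0)}"

abbreviation "cfun K \<equiv> cont_vanish K {}"

lemma fun_subspace_cont_vanish: "fun_subspace (cont_vanish K E)"
 unfolding fun_subspace_def cont_vanish_def by (auto intro: continuous_intros)

lemma continuous_on_clopen_cases:
 fixes K :: "'a::t2_space set"
 assumes "clopen_in K A" "continuous_on A f" "continuous_on (K - A) g"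
  "\<And>x. x \<in> A ==> h x = f x" "\<And>x. x \<in> K - A ==> h x = g x"
 shows "continuous_on K h"
proof -
 have "continuous_on A h" "continuous_on (K - A) h"
  using assms by (metis continuous_on_cong)+
 then have "continuous_on (A \<union> (K - A)) h"
  using assms(1) unfolding clopen_in_def by (intro continuous_on_closed_Un compact_imp_closed) auto
 moreover have "A \<union> (K - A) = K" using assms(1) by (auto simp: clopen_in_def)
 ultimately show ?thesis by simp
qed

definition glue :: "(nat => 'a set) => (nat => 'a => 'k::zero) => 'a => 'k" where
 "glue A f x = (if \<exists>m. x \<in> A m then f (THE m. x \<in> A m) x else 0)"

lemma glue_eq: "disjoint_family A ==> x \<in> A m ==> glue A f x = f m x"
proof -
 assume a: "disjoint_family A" "x \<in> A m"
 then have "(THE m. x \<in> A m) = m" by (intro the_equality) (auto simp: disjoint_family_on_def)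
 then show ?thesis using a by (auto simp: glue_def)
qed

lemma glue_0: "(\<And>m. x \<notin> A m) ==> glue A f x = 0"
 by (simp add: glue_def)

text \<open>At a point in none of the pieces the value is 0, and removing the finitely many pieces
  on which the functions are not small leaves a clopen neighbourhood of it.\<close>

lemma continuous_on_glue:
 fixes K :: "'a::metric_space set" and f :: "nat => 'a => 'k::real_normed_field"
 assumes K: "compact K" and A: "\<And>m. clopen_in K (A m)" "disjoint_family A"
  and f: "\<And>m. continuous_on (A m) (f m)" "\<And>e. 0 < e ==> finite {m. \<exists>x\<in>A m. e < norm (f m x)}"
 shows "continuous_on K (glue A f)"
 unfolding continuous_on_eq_continuous_within
proof
 fix x assume x: "x \<in> K"
 show "continuous (at x within K) (glue A f)"
 proof (cases "\<exists>m. x \<in> A m")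
  case True
  then obtain m where "x \<in> A m" by blast
  then show ?thesis
   by (intro continuous_within_clopen[OF A(1) _ f(1)[of m]]) (auto simp: glue_eq[OF A(2)])
 next
  case False
  then have gx: "glue A f x = 0" by (simp add: glue_0)
  show ?thesis
  proof (rule continuous_within_clopenI)
   fix e :: real assume "0 < e"
   define F where "F = {m. \<exists>x\<in>A m. e / 2 < norm (f m x)}"
   have F: "finite F" unfolding F_def using f(2)[of "e / 2"] \<open>0 < e\<close> by simp
   have "clopen_in K (K - (\<Union>m\<in>F. A m))"
    by (intro clopen_in_Diff_self clopen_in_UN F K A)
   moreover have "x \<in> K - (\<Union>m\<in>F. A m)" using x False by blast
   moreover have "dist (glue A f y) (glue A f x) < e" if "y \<in> K - (\<Union>m\<in>F. A m)" for y
   proof (cases "\<exists>m. y \<in> A m")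
    case True
    then obtain m where m: "y \<in> A m" by blast
    then have "m \<notin> F" using that by blast
    then have "norm (f m y) \<le> e / 2" using m by (auto simp: F_def not_less)
    then show ?thesis using gx glue_eq[OF A(2) m, of f] \<open>0 < e\<close> by simp
   qed (use gx \<open>0 < e\<close> in "simp add: glue_0")
   ultimately show "\<exists>A'. clopen_in K A' \<and> x \<in> A' \<and> (\<forall>y\<in>A'. dist (glue A f y) (glue A f x) < e)"
    by blast
  qed
 qed
qed

lemma norm_glue_le:
 "0 \<le> b ==> (\<And>m. x \<in> A m ==> norm (f m x) \<le> b) ==> disjoint_family A ==>
  norm (glue A f x :: 'k::real_normed_field) \<le> b"
 by (cases "\<exists>m. x \<in> A m") (auto simp: glue_eq glue_0)

abbreviation rank_ideal :: "'a::topological_space set => countable_ordinal => ('a => 'k::real_normed_field) set" where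
 "rank_ideal K g \<equiv> cont_vanish K (CB K g)"

text \<open>Off its derivative, \<open>K'\<close> consists of clopen rings of rank below
  \<open>g\<close>. Countably many copies of every ring fit into disjoint clopen subsets of
  \<open>K\<close> that avoid \<open>CB K g\<close> and shrink to one of its points
  \<open>e\<close>. Transplanting along the retractions gives \<open>J\<close>, pulling back along
  the embeddings gives \<open>R\<close>.\<close>

lemma complemented_c0_sum_rank_ideal:
 fixes K :: "'a::metric_space set" and K' :: "'b::metric_space set"
 assumes K: "compact K" "countable K" "CB K g \<noteq> {}"
  and K': "compact K'" "countable K'" "CB K' g \<noteq> {}"
 shows "c0_sum (rank_ideal K' g :: ('b => 'k::real_normed_field) set) \<sqsubseteq>\<^sub>c rank_ideal K g"
proof -
 let ?E = "CB K' g"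
 let ?Z' = "rank_ideal K' g :: ('b => 'k) set" and ?Z = "rank_ideal K g :: ('a => 'k) set"
 have clE: "closed ?E" by (intro compact_imp_closed compact_CB K')
 obtain H where H: "H 0 = K'" "\<And>n. clopen_in K' (H n)" "\<And>n. ?E \<subseteq> H n" "decseq H"
  "\<And>n x. x \<in> H (Suc n) ==> infdist x ?E < 1 / Suc n"
  by (rule clopen_nbhd_seq[OF K'(1,2) CB_subset K'(3)], rule that)
 define A where "A i = H i - H (Suc i)" for i
 have Ac: "clopen_in K' (A i)" for i unfolding A_def by (intro clopen_in_Diff H)
 have UA: "(\<Union>i. A i) = K' - ?E" and dA: "disjoint_family A"
  using nbhd_seq_Diff[OF H(4,1,5,3) clE K'(3)] unfolding A_def by auto
 have cbA: "CB (A i) g = {}" for i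
  using CB_clopen[OF Ac] UA by auto
 have cA: "compact (A i)" "countable (A i)" for i
  using Ac[of i] countable_subset[OF _ K'(2), of "A i"] by (auto simp: clopen_in_def)
 obtain e where e: "e \<in> CB K g" using K(3) by blast
 \<comment> \<open>Every ring is embedded infinitely often: \<open>m\<close> codes the pair of the
   number of a summand and the index of a ring.\<close>
 obtain N j r where N: "\<And>i::nat. clopen_in K (N i)" "\<And>i. N i \<inter> CB K g = {}"
  "\<And>i. retract_emb (A (snd (prod_decode i))) (N i) (j i) (r i)"
  "\<And>i. N i \<subseteq> ball e (1 / real (Suc i))" and dN: "disjoint_family N"
  by (rule embeds_near_seq[OF embeds_near, of "\<lambda>i. A (snd (prod_decode i))", OF cA cbA K(1,2) e open_UNIV UNIV_I],
    rule that)
 have NK: "N m \<subseteq> K" for m using N(1)[of m] by (simp add: clopen_in_def)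
 have jN: "j m x \<in> N m" "r m (j m x) = x" if "x \<in> A (snd (prod_decode m))" for m x
  using N(3)[of m] that by (auto simp: retract_emb_def)
 have rA: "r m z \<in> A (snd (prod_decode m))" if "z \<in> N m" for m z
  using N(3)[of m] that by (auto simp: retract_emb_def)
 have AK: "A i \<subseteq> K'" for i using Ac[of i] by (simp add: clopen_in_def)
 \<comment> \<open>A function vanishing on the derivative is at least \<open>d\<close> in norm only
   on a compact set away from it, and this set meets finitely many rings.\<close>
 have finA: "finite {i. \<exists>x\<in>A i. d < norm (f x)}" if "f \<in> ?Z'" "0 < d" for f :: "'b => 'k" and d
 proof -
  have f: "continuous_on K' f" "\<And>x. x \<in> ?E ==> f x = 0" using that by (auto simp: cont_vanish_def)
  have "closed (K' \<inter> (\<lambda>x. norm (f x)) -` {d..})"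
   by (intro continuous_closed_preimage compact_imp_closed[OF K'(1)] continuous_on_norm f closed_atLeast)
  then have "compact (K' \<inter> (K' \<inter> (\<lambda>x. norm (f x)) -` {d..}))" by (rule compact_Int_closed[OF K'(1)])
  moreover have "K' \<inter> (K' \<inter> (\<lambda>x. norm (f x)) -` {d..}) \<inter> ?E = {}" using f(2) that(2) by auto
  ultimately obtain n where n: "\<forall>m\<ge>n. K' \<inter> (K' \<inter> (\<lambda>x. norm (f x)) -` {d..}) \<inter> H m = {}"
   using nbhd_seq_avoids[OF H(4,5) _ _ clE K'(3)] by blast
  have "i < n" if "x \<in> A i" "d < norm (f x)" for i x
  proof (rule ccontr)
   assume "\<not> i < n"
   then have "x \<in> K' \<inter> (K' \<inter> (\<lambda>x. norm (f x)) -` {d..}) \<inter> H i" using that AK[of i] by (auto simp: A_def)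
   then show False using n \<open>\<not> i < n\<close> by (metis empty_iff linorder_not_less)
  qed
  then have "{i. \<exists>x\<in>A i. d < norm (f x)} \<subseteq> {..<n}" by auto
  then show ?thesis using finite_subset by blast
 qed
 \<comment> \<open>The sets \<open>N m\<close> shrink to \<open>e\<close>, where \<open>f\<close>
   vanishes; this gives the decay of the components of \<open>R f\<close>.\<close>
 have finN: "finite {m. \<exists>z\<in>N m. d < norm (f z)}" if f: "f \<in> ?Z" "0 < d" for f :: "'a => 'k" and d
 proof -
  have "continuous_on K f" "f e = 0" "e \<in> K"
   using f e CB_subset by (auto simp: cont_vanish_def)
  then obtain b where b: "b > 0" "\<And>z. z \<in> K ==> dist z e < b ==> dist (f z) (f e) < d"
   using f(2) unfolding continuous_on_iff by metis
  obtain n where n: "1 / real (Suc n) < b" using nat_approx_posE[OF b(1)] by blast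
  have "m < n" if "z \<in> N m" "d < norm (f z)" for m z
  proof (rule ccontr)
   assume "\<not> m < n"
   then have "1 / real (Suc m) \<le> 1 / real (Suc n)" by (simp add: frac_le)
   moreover have "dist z e < 1 / real (Suc m)" using that(1) N(4)[of m] by (auto simp: dist_commute)
   ultimately show False using b(2)[of z] n that NK[of m] \<open>f e = 0\<close> by force
  qed
  then have "{m. \<exists>z\<in>N m. d < norm (f z)} \<subseteq> {..<n}" by auto
  then show ?thesis using finite_subset by blast
 qed
 define J where "J h = glue N (\<lambda>m z. h (fst (prod_decode m), r m z))" for h :: "nat \<times> 'b => 'k"
 define R where "R f = (\<lambda>(n, x). glue A (\<lambda>i x. f (j (prod_encode (n, i)) x)) x)" for f :: "'a => 'k"
 have JN: "J h z = h (fst (prod_decode m), r m z)" if "z \<in> N m" for h m z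
  unfolding J_def by (rule glue_eq[OF dN that])
 have J0: "J h z = 0" if "\<And>m. z \<notin> N m" for h z
  unfolding J_def by (rule glue_0[OF that])
 have RA: "R f (n, x) = f (j (prod_encode (n, i)) x)" if "x \<in> A i" for f n x i
  unfolding R_def using glue_eq[OF dA that] by simp
 have R0: "R f (n, x) = 0" if "\<And>i. x \<notin> A i" for f n x
  unfolding R_def using glue_0[OF that] by simp
 have bJ: "bounded_lin (c0_sum ?Z') ?Z J"
 proof (rule bounded_linI[where C = 1])
  fix h assume h: "h \<in> c0_sum ?Z'"
  have hn: "(\<lambda>x. h (n, x)) \<in> ?Z'" for n using h by (simp add: c0_sum_def)
  have "continuous_on K (J h)"
   unfolding J_def
  proof (rule continuous_on_glue[OF K(1) N(1) dN])
   fix m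
   have "continuous_on (A (snd (prod_decode m))) (\<lambda>x. h (fst (prod_decode m), x))"
    by (rule continuous_on_subset[OF _ AK]) (use hn in "simp add: cont_vanish_def")
   then show "continuous_on (N m) (\<lambda>z. h (fst (prod_decode m), r m z))"
    by (rule continuous_on_compose2) (use N(3)[of m] in "simp_all add: retract_emb_def")
  next
   fix d :: real assume d: "0 < d"
   let ?F = "{n. \<exists>x. d < norm (h (n, x))}"
   have "{m. \<exists>z\<in>N m. d < norm (h (fst (prod_decode m), r m z))} \<subseteq>
    prod_encode ` (SIGMA n : ?F. {i. \<exists>x\<in>A i. d < norm (h (n, x))})"
   proof
    fix m assume "m \<in> {m. \<exists>z\<in>N m. d < norm (h (fst (prod_decode m), r m z))}"
    then obtain z where z: "z \<in> N m" "d < norm (h (fst (prod_decode m), r m z))" by blast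
    obtain n i where p: "prod_decode m = (n, i)" by (cases "prod_decode m") (rule that)
    have "r m z \<in> A i" "d < norm (h (n, r m z))" using rA[OF z(1)] z(2) p by simp_all
    then have "(n, i) \<in> (SIGMA n : ?F. {i. \<exists>x\<in>A i. d < norm (h (n, x))})" by auto
    moreover have "m = prod_encode (n, i)" by (simp add: p[symmetric])
    ultimately show "m \<in> prod_encode ` (SIGMA n : ?F. {i. \<exists>x\<in>A i. d < norm (h (n, x))})"
     by (rule rev_image_eqI)
   qed
   moreover have "finite ?F" using h d by (simp add: c0_sum_def)
   ultimately show "finite {m. \<exists>z\<in>N m. d < norm (h (fst (prod_decode m), r m z))}"
    using finA[OF hn d] by (meson finite_SigmaI finite_imageI finite_subset)
  qed
  moreover have "J h z = 0" if "z \<notin> K" for z using that NK by (intro J0) blast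
  moreover have "J h z = 0" if "z \<in> CB K g" for z using that N(2) by (intro J0) blast
  ultimately show "J h \<in> ?Z" by (simp add: cont_vanish_def)
 next
  fix h b z assume h: "h \<in> c0_sum ?Z'" "\<And>x. norm (h x) \<le> b"
  have "0 \<le> b" using h(2) norm_ge_zero order_trans by blast
  then show "norm (J h z) \<le> 1 * b"
   unfolding J_def mult_1 by (rule norm_glue_le) (rule h(2), rule dN)
 qed (auto simp: J_def glue_def fun_eq_iff)
 have bR: "bounded_lin ?Z (c0_sum ?Z') R"
 proof (rule bounded_linI[where C = 1])
  fix f assume f: "f \<in> ?Z"
  have "(\<lambda>x. R f (n, x)) \<in> ?Z'" for n
  proof -
   have "continuous_on K' (\<lambda>x. R f (n, x))"
    unfolding R_def prod.case
   proof (rule continuous_on_glue[OF K'(1) Ac dA])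
    fix i
    have "continuous_on (N (prod_encode (n, i))) f"
     by (rule continuous_on_subset[OF _ NK]) (use f in "simp add: cont_vanish_def")
    moreover have "continuous_on (A i) (j (prod_encode (n, i)))" "j (prod_encode (n, i)) ` A i \<subseteq> N (prod_encode (n, i))"
     using N(3)[of "prod_encode (n, i)"] by (auto simp: retract_emb_def)
    ultimately show "continuous_on (A i) (\<lambda>x. f (j (prod_encode (n, i)) x))"
     by (rule continuous_on_compose2)
   next
    fix d :: real assume d: "0 < d"
    have "{i. \<exists>x\<in>A i. d < norm (f (j (prod_encode (n, i)) x))} \<subseteq>
      (\<lambda>i. prod_encode (n, i)) -` {m. \<exists>z\<in>N m. d < norm (f z)}"
     using jN by force
    moreover have "finite ((\<lambda>i. prod_encode (n, i)) -` {m. \<exists>z\<in>N m. d < norm (f z)})"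
     using finN[OF f d] by (intro finite_vimageI) (auto simp: inj_def)
    ultimately show "finite {i. \<exists>x\<in>A i. d < norm (f (j (prod_encode (n, i)) x))}"
     by (rule finite_subset)
   qed
   moreover have "R f (n, x) = 0" if "x \<notin> K' \<or> x \<in> ?E" for x
    using that UA by (intro R0) blast
   ultimately show ?thesis by (simp add: cont_vanish_def)
  qed
  moreover have "finite {n. \<exists>x. d < norm (R f (n, x))}" if d: "0 < d" for d
  proof (rule finite_subset)
   show "{n. \<exists>x. d < norm (R f (n, x))} \<subseteq> fst ` prod_decode ` {m. \<exists>z\<in>N m. d < norm (f z)}"
   proof
    fix n assume "n \<in> {n. \<exists>x. d < norm (R f (n, x))}"
    then obtain x where x: "d < norm (R f (n, x))" by blast
    then obtain i where i: "x \<in> A i" using R0[of x f n] d by force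
    then have "prod_encode (n, i) \<in> {m. \<exists>z\<in>N m. d < norm (f z)}"
     using x RA[OF i] jN[of x "prod_encode (n, i)"] by auto
    then have "(n, i) \<in> prod_decode ` {m. \<exists>z\<in>N m. d < norm (f z)}"
     by (rule rev_image_eqI) simp
    then show "n \<in> fst ` prod_decode ` {m. \<exists>z\<in>N m. d < norm (f z)}"
     by (rule rev_image_eqI) simp
   qed
  qed (use finN[OF f d] in simp)
  ultimately show "R f \<in> c0_sum ?Z'" by (simp add: c0_sum_def)
 next
  fix f b and y :: "nat \<times> 'b" assume h: "f \<in> ?Z" "\<And>x. norm (f x) \<le> b"
  have "0 \<le> b" using h(2) norm_ge_zero order_trans by blast
  then show "norm (R f y) \<le> 1 * b"
   unfolding R_def mult_1 by (cases y, simp only: prod.case) (rule norm_glue_le, assumption, rule h(2), rule dA)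
 qed (simp_all add: R_def glue_def fun_eq_iff)
 have "R (J h) = h" if h: "h \<in> c0_sum ?Z'" for h
 proof
  fix y :: "nat \<times> 'b"
  obtain n x where y: "y = (n, x)" by (cases y)
  show "R (J h) y = h y"
  proof (cases "\<exists>i. x \<in> A i")
   case True
   then obtain i where i: "x \<in> A i" by blast
   then have "j (prod_encode (n, i)) x \<in> N (prod_encode (n, i))" using jN(1)[of x "prod_encode (n, i)"] by simp
   then show ?thesis using y RA[OF i] JN jN(2)[of x "prod_encode (n, i)"] i by simp
  next
   case False
   then have "x \<notin> K' \<or> x \<in> ?E" using UA by blast
   moreover have "(\<lambda>x. h (n, x)) \<in> ?Z'" using h by (simp add: c0_sum_def)
   ultimately have "h (n, x) = 0" by (auto simp: cont_vanish_def)
   then show ?thesis using y R0[of x] False by simp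
  qed
 qed
 then show ?thesis unfolding complemented_def using bJ bR by blast
qed

lemma complemented_c0_sum_self:
 assumes "fun_subspace S"
 shows "S \<sqsubseteq>\<^sub>c c0_sum S"
proof -
 have z: "(\<lambda>_. 0) \<in> S" using assms by (simp add: fun_subspace_def)
 let ?J = "\<lambda>f (n, i). if n = (0::nat) then f i else 0"
 have "bounded_lin S (c0_sum S) ?J"
 proof (rule bounded_linI[where C = 1])
  fix f assume "f \<in> S"
  moreover have "finite {n. \<exists>i. e < norm (?J f (n, i))}" if "0 < e" for e
   by (rule finite_subset[of _ "{0}"]) (use that in "auto split: if_splits")
  moreover have "(\<lambda>i. ?J f (n, i)) \<in> S" for n using z \<open>f \<in> S\<close> by (cases "n = 0") auto
  ultimately show "?J f \<in> c0_sum S" by (simp add: c0_sum_def)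
 next
  fix f b y assume "\<And>x. norm (f x) \<le> b"
  moreover from this have "0 \<le> b" using norm_ge_zero order_trans by blast
  ultimately show "norm (?J f y) \<le> 1 * b" by (cases y) auto
 qed (auto simp: fun_eq_iff)
 moreover have "bounded_lin (c0_sum S) S (\<lambda>h i. h (0, i))"
  by (rule bounded_linI[where C = 1]) (auto simp: c0_sum_def)
 ultimately show ?thesis unfolding complemented_def by (intro exI conjI) auto
qed

text \<open>The decomposition method is applied with the c0-sum as the first space, since a c0-sum
  is isomorphic to its own c0-sum. Taking \<open>K'\<close> equal to \<open>K\<close> shows
  afterwards that the ideal itself has this property.\<close>

lemma rank_ideal_iso_c0_sum:
 fixes K :: "'a::metric_space set" and K' :: "'b::metric_space set"
 assumes K: "compact K" "countable K" "CB K g \<noteq> {}"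
  and K': "compact K'" "countable K'" "CB K' g \<noteq> {}"
 shows "c0_sum (rank_ideal K' g :: ('b => 'k::real_normed_field) set) \<simeq> rank_ideal K g"
proof (rule pelczynski_decomposition)
 show "c0_sum (rank_ideal K' g :: ('b => 'k) set) \<sqsubseteq>\<^sub>c rank_ideal K g"
  by (rule complemented_c0_sum_rank_ideal[OF K K'])
 have "(rank_ideal K g :: ('a => 'k) set) \<sqsubseteq>\<^sub>c c0_sum (rank_ideal K g)"
  by (intro complemented_c0_sum_self fun_subspace_cont_vanish)
 also note complemented_trans = complemented_trans
 note c = complemented_trans[OF calculation]
 have "(rank_ideal K g :: ('a => 'k) set) \<sqsubseteq>\<^sub>c rank_ideal K' g"
  by (rule c[OF complemented_c0_sum_rank_ideal[OF K' K]])
 then show "(rank_ideal K g :: ('a => 'k) set) \<sqsubseteq>\<^sub>c c0_sum (rank_ideal K' g)"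
  by (rule complemented_trans) (intro complemented_c0_sum_self fun_subspace_cont_vanish)
qed (intro fun_subspace_c0_sum fun_subspace_cont_vanish fun_iso_sym[OF c0_sum_c0_sum])+

lemma rank_ideal_iso:
 fixes K :: "'a::metric_space set" and K' :: "'b::metric_space set"
 assumes K: "compact K" "countable K" "CB K g \<noteq> {}"
  and K': "compact K'" "countable K'" "CB K' g \<noteq> {}"
 shows "(rank_ideal K g :: ('a => 'k::real_normed_field) set) \<simeq> rank_ideal K' g"
 using fun_iso_trans[OF fun_iso_sym[OF rank_ideal_iso_c0_sum[OF K K']] rank_ideal_iso_c0_sum[OF K' K']] .

lemma rank_ideal_dsum_self:
 fixes K :: "'a::metric_space set"
 assumes K: "compact K" "countable K" "CB K g \<noteq> {}"
 shows "(rank_ideal K g \<oplus>\<^sub>s rank_ideal K g :: ('a + 'a => 'k::real_normed_field) set) \<simeq> rank_ideal K g"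
proof -
 let ?Z = "rank_ideal K g :: ('a => 'k) set"
 have i: "c0_sum ?Z \<simeq> ?Z" by (rule rank_ideal_iso_c0_sum[OF K K])
 have "?Z \<oplus>\<^sub>s ?Z \<simeq> ?Z \<oplus>\<^sub>s c0_sum ?Z" by (intro dsum_cong fun_iso_refl fun_iso_sym[OF i])
 also have "\<dots> \<simeq> c0_sum ?Z" by (rule dsum_c0_sum)
 also note i
 finally show ?thesis .
qed

lemma complemented_rank_ideal:
 fixes K :: "'a::metric_space set" and G :: "'b::metric_space set"
 assumes K: "compact K" "countable K" "CB K g \<noteq> {}"
  and G: "compact G" "countable G" "CB G g = {}"
 shows "(cfun G :: ('b => 'k::real_normed_field) set) \<sqsubseteq>\<^sub>c rank_ideal K g"
proof -
 obtain b where "b \<in> CB K g" using K(3) by blast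
 then obtain N j r where N: "clopen_in K N" "N \<inter> CB K g = {}" "retract_emb G N j r"
  using embeds_near[where 'a = 'b and 'b = 'a, of g] K G open_UNIV UNIV_I unfolding embeds_near_def by metis
 let ?J = "\<lambda>f z. if z \<in> N then f (r z) else (0 :: 'k)" and ?R = "\<lambda>f x. if x \<in> G then f (j x) else (0 :: 'k)"
 have NK: "N \<subseteq> K" using N(1) by (simp add: clopen_in_def)
 have e: "j ` G \<subseteq> N" "r ` N \<subseteq> G" "continuous_on G j" "continuous_on N r" "\<And>x. x \<in> G ==> r (j x) = x"
  using N(3) by (auto simp: retract_emb_def)
 have "bounded_lin (cfun G) (rank_ideal K g) ?J"
 proof (rule bounded_linI[where C = 1])
  fix f :: "'b => 'k" assume f: "f \<in> cfun G"
  have "continuous_on N (\<lambda>z. f (r z))"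
   using f e by (intro continuous_on_compose2[of G f N r]) (auto simp: cont_vanish_def)
  then have "continuous_on K (?J f)"
   by (rule continuous_on_clopen_cases[OF N(1) _ continuous_on_const]) auto
  then show "?J f \<in> rank_ideal K g" using NK N(2) by (auto simp: cont_vanish_def)
 next
  fix f :: "'b => 'k" and b y assume "\<And>x. norm (f x) \<le> b"
  moreover from this have "0 \<le> b" using norm_ge_zero order_trans by blast
  ultimately show "norm (?J f y) \<le> 1 * b" by simp
 qed (auto simp: fun_eq_iff)
 moreover have "bounded_lin (rank_ideal K g) (cfun G) ?R"
 proof (rule bounded_linI[where C = 1])
  fix f :: "'a => 'k" assume f: "f \<in> rank_ideal K g"
  have "continuous_on G (\<lambda>x. f (j x))"
   using f e NK by (intro continuous_on_compose2[of K f G j]) (auto simp: cont_vanish_def)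
  then have "continuous_on G (?R f)" by (simp cong: continuous_on_cong)
  then show "?R f \<in> cfun G" by (auto simp: cont_vanish_def)
 next
  fix f :: "'a => 'k" and b y assume "\<And>x. norm (f x) \<le> b"
  moreover from this have "0 \<le> b" using norm_ge_zero order_trans by blast
  ultimately show "norm (?R f y) \<le> 1 * b" by simp
 qed (auto simp: fun_eq_iff)
 moreover have "?R (?J f) = f" if "f \<in> cfun G" for f
  using that e by (auto simp: fun_eq_iff cont_vanish_def)
 ultimately show ?thesis unfolding complemented_def by blast
qed

lemma complemented_dsum:
 assumes "S \<sqsubseteq>\<^sub>c S'" "T \<sqsubseteq>\<^sub>c T'"
 shows "S \<oplus>\<^sub>s T \<sqsubseteq>\<^sub>c S' \<oplus>\<^sub>s T'"
proof -
 obtain F F' where F: "bounded_lin S S' F" "bounded_lin S' S F'" "\<And>f. f \<in> S ==> F' (F f) = f"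
  using assms(1) unfolding complemented_def by blast
 obtain G G' where G: "bounded_lin T T' G" "bounded_lin T' T G'" "\<And>f. f \<in> T ==> G' (G f) = f"
  using assms(2) unfolding complemented_def by blast
 show ?thesis
  unfolding complemented_def
  by (intro exI conjI ballI, rule bounded_lin_dsum[OF F(1) G(1)], rule bounded_lin_dsum[OF F(2) G(2)])
   (auto simp: dsum_def F(3) G(3) fun_eq_iff split: sum.splits)
qed

lemma complemented_dsum_left:
 assumes "fun_subspace T"
 shows "S \<sqsubseteq>\<^sub>c S \<oplus>\<^sub>s T"
proof -
 have z: "(\<lambda>_. 0) \<in> T" using assms by (simp add: fun_subspace_def)
 have "bounded_lin S (S \<oplus>\<^sub>s T) (\<lambda>f. case_sum f (\<lambda>_. 0))"
 proof (rule bounded_linI[where C = 1])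
  fix f b y assume "\<And>x. norm (f x) \<le> b"
  moreover from this have "0 \<le> b" using norm_ge_zero order_trans by blast
  ultimately show "norm (case_sum f (\<lambda>_. 0) y) \<le> 1 * b" by (cases y) auto
 qed (auto simp: dsum_def z fun_eq_iff split: sum.splits)
 moreover have "bounded_lin (S \<oplus>\<^sub>s T) S (\<lambda>h i. h (Inl i))"
  by (rule bounded_linI[where C = 1]) (auto simp: dsum_def)
 ultimately show ?thesis unfolding complemented_def by (intro exI conjI) auto
qed

text \<open>C(G) is complemented in the ideal, and the ideal is isomorphic to its square, so adding
  C(G) leads to a complemented subspace of the ideal again.\<close>

lemma rank_ideal_absorbs:
 fixes K :: "'a::metric_space set" and G :: "'b::metric_space set"
 assumes K: "compact K" "countable K" "CB K g \<noteq> {}"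
  and G: "compact G" "countable G" "CB G g = {}"
 shows "(rank_ideal K g \<oplus>\<^sub>s cfun G :: ('a + 'b => 'k::real_normed_field) set) \<simeq> rank_ideal K g"
proof (rule fun_iso_sym, rule pelczynski_decomposition)
 let ?Z = "rank_ideal K g :: ('a => 'k) set" and ?C = "cfun G :: ('b => 'k) set"
 show "?Z \<sqsubseteq>\<^sub>c ?Z \<oplus>\<^sub>s ?C" by (intro complemented_dsum_left fun_subspace_cont_vanish)
 have "?Z \<oplus>\<^sub>s ?C \<sqsubseteq>\<^sub>c ?Z \<oplus>\<^sub>s ?Z"
  by (intro complemented_dsum fun_iso_imp_complemented fun_iso_refl complemented_rank_ideal[OF K G])
 then show "?Z \<oplus>\<^sub>s ?C \<sqsubseteq>\<^sub>c ?Z"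
  by (rule complemented_trans) (intro fun_iso_imp_complemented rank_ideal_dsum_self[OF K])
 show "?Z \<simeq> c0_sum ?Z" by (rule fun_iso_sym[OF rank_ideal_iso_c0_sum[OF K K]])
qed (intro fun_subspace_dsum fun_subspace_cont_vanish)+

text \<open>The retraction \<open>r\<close> onto \<open>E\<close> extends functions linearly:
  \<open>f\<close> is the sum of \<open>f \<circ> r\<close>, determined on \<open>E\<close>, and of
  a function that vanishes on \<open>E\<close>.\<close>

lemma cont_vanish_split:
 fixes K :: "'a::metric_space set"
 assumes "compact K" "countable K" "E \<subseteq> K" "compact E" "E \<noteq> {}"
 shows "(cfun K :: ('a => 'k::real_normed_field) set) \<simeq> cont_vanish K E \<oplus>\<^sub>s cfun E"
proof -
 obtain r where r: "continuous_on K r" "r ` K \<subseteq> E" "\<And>x. x \<in> E ==> r x = x"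
  by (rule clopen_retraction[OF assms], rule that)
 let ?e = "\<lambda>f x. if x \<in> K then f (r x) else (0 :: 'k)"
 let ?F = "\<lambda>f. case_sum (\<lambda>x. f x - ?e f x) (\<lambda>x. if x \<in> E then f x else (0 :: 'k))"
 let ?G = "\<lambda>h x. h (Inl x) + ?e (\<lambda>y. h (Inr y)) x"
 have ce: "continuous_on K (?e f)" if "continuous_on E f" for f
  using continuous_on_compose2[OF that r(1,2)] by (simp cong: continuous_on_cong)
 have "bounded_lin (cfun K) (cont_vanish K E \<oplus>\<^sub>s cfun E) ?F"
 proof (rule bounded_linI[where C = 2])
  fix f :: "'a => 'k" assume f: "f \<in> cfun K"
  have cE: "continuous_on E f" using f assms(3) by (auto simp: cont_vanish_def intro: continuous_on_subset)
  have "continuous_on K (\<lambda>x. f x - ?e f x)"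
   using f ce[OF cE] by (auto simp: cont_vanish_def intro: continuous_on_diff)
  moreover have "continuous_on E (\<lambda>x. if x \<in> E then f x else 0)"
   using cE by (simp cong: continuous_on_cong)
  ultimately show "?F f \<in> cont_vanish K E \<oplus>\<^sub>s cfun E"
   using f r(3) assms(3) by (auto simp: dsum_def cont_vanish_def)
 next
  fix f :: "'a => 'k" and b y assume f: "\<And>x. norm (f x) \<le> b"
  have "0 \<le> b" using f norm_ge_zero order_trans by blast
  moreover have "norm (f x - f z) \<le> 2 * b" for x z
   using norm_triangle_ineq4[of "f x" "f z"] f[of x] f[of z] by linarith
  ultimately show "norm (?F f y) \<le> 2 * b" using f by (cases y) (auto intro: order_trans[OF f])
 qed (auto simp: fun_eq_iff algebra_simps split: sum.splits)
 moreover have "bounded_lin (cont_vanish K E \<oplus>\<^sub>s cfun E) (cfun K) ?G"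
 proof (rule bounded_linI[where C = 2])
  fix h :: "'a + 'a => 'k" assume h: "h \<in> cont_vanish K E \<oplus>\<^sub>s cfun E"
  have "continuous_on K (?G h)"
   using h ce[of "\<lambda>y. h (Inr y)"] by (intro continuous_on_add) (auto simp: dsum_def cont_vanish_def)
  then show "?G h \<in> cfun K" using h by (auto simp: dsum_def cont_vanish_def)
 next
  fix h :: "'a + 'a => 'k" and b y assume h: "\<And>x. norm (h x) \<le> b"
  have "0 \<le> b" using h norm_ge_zero order_trans by blast
  moreover have "norm (h x + h z) \<le> 2 * b" for x z
   using norm_triangle_ineq[of "h x" "h z"] h[of x] h[of z] by linarith
  ultimately show "norm (?G h y) \<le> 2 * b" using h by (auto intro: order_trans[OF h])
 qed (auto simp: fun_eq_iff algebra_simps)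
 moreover have "?G (?F f) = f" if "f \<in> cfun K" for f
  using that r(2) by (auto simp: fun_eq_iff cont_vanish_def)
 moreover have "?F (?G h) = h" if "h \<in> cont_vanish K E \<oplus>\<^sub>s cfun E" for h
 proof -
  have h: "h (Inl x) = 0" if "x \<in> E \<or> x \<notin> K" for x
   using \<open>h \<in> _\<close> that by (auto simp: dsum_def cont_vanish_def)
  have h2: "h (Inr x) = 0" if "x \<notin> E" for x
   using \<open>h \<in> _\<close> that by (auto simp: dsum_def cont_vanish_def)
  show ?thesis
  proof
   fix s show "?F (?G h) s = h s"
    using h h2 r(2,3) assms(3) by (cases s) (auto simp: image_subset_iff)
  qed
 qed
 ultimately show ?thesis unfolding fun_iso_def by blast
qed

text \<open>Addition of ordinals does not commute; the next induction removes the first block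
  instead of the last.\<close>

lemma ord_nmult_Suc': "ord_nmult a (Suc n) = ord_add a (ord_nmult a n)"
proof (induction n)
 case (Suc n)
 have "ord_nmult a (Suc (Suc n)) = ord_add (ord_nmult a (Suc n)) a" by (rule ord_nmult_Suc)
 also have "\<dots> = ord_add a (ord_add (ord_nmult a n) a)" by (simp only: Suc ord_add_assoc)
 finally show ?case by (simp only: ord_nmult_Suc)
qed (simp add: ord_mult_succ)

text \<open>Splitting off the functions on \<open>CB K g\<close> leaves a space with one block less.
  It is either absorbed at once, or by induction isomorphic to the same ideal, which equals its own
  square.\<close>

lemma cont_vanish_iso_rank_ideal:
 fixes K :: "'a::metric_space set"
 assumes "compact K" "countable K" "CB K g \<noteq> {}" "CB K (ord_nmult g n) = {}"
 shows "(cfun K :: ('a => 'k::real_normed_field) set) \<simeq> rank_ideal K g"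
 using assms
proof (induction n arbitrary: K)
 case 0
 then show ?case using CB_subset by fastforce
next
 case (Suc n)
 note K = Suc.prems(1-3)
 let ?E = "CB K g"
 have E: "compact ?E" "countable ?E"
  using compact_CB[OF K(1)] countable_subset[OF CB_subset K(2)] by auto
 have cE: "CB ?E (ord_nmult g n) = {}"
  using Suc.prems(4) unfolding ord_nmult_Suc' CB_add .
 have s: "(cfun K :: ('a => 'k) set) \<simeq> rank_ideal K g \<oplus>\<^sub>s cfun ?E"
  by (rule cont_vanish_split[OF K(1,2) CB_subset E(1) K(3)])
 show ?case
 proof (cases "CB ?E g = {}")
  case True
  show ?thesis by (rule fun_iso_trans[OF s rank_ideal_absorbs[OF K E True]])
 next
  case False
  have "(cfun ?E :: ('a => 'k) set) \<simeq> rank_ideal ?E g"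
   by (rule Suc.IH[OF E False cE])
  also have "\<dots> \<simeq> rank_ideal K g" by (rule rank_ideal_iso[OF E False K])
  finally have "(rank_ideal K g \<oplus>\<^sub>s cfun ?E :: ('a + 'a => 'k) set) \<simeq> rank_ideal K g \<oplus>\<^sub>s rank_ideal K g"
   by (intro dsum_cong fun_iso_refl)
  also have "\<dots> \<simeq> rank_ideal K g" by (rule rank_ideal_dsum_self[OF K])
  finally show ?thesis by (rule fun_iso_trans[OF s])
 qed
qed

text \<open>By the theorem of Bessaga and Pelczynski, \<open>\<xi>\<close> is all that \<open>C(K)\<close> remembers of \<open>K\<close>: the space is
 isomorphic to \<open>C(\<omega>^\<omega>^\<xi>)\<close>.\<close>

definition rank_class :: "'a::topological_space set => countable_ordinal => bool" where
 "rank_class K \<xi> \<longleftrightarrow> CB K (omega_pow \<xi>) \<noteq> {} \<and>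
  (\<exists>n. CB K (ord_nmult (omega_pow \<xi>) n) = {})"

theorem cont_vanish_iso:
 fixes K :: "'a::metric_space set" and K' :: "'b::metric_space set"
 assumes K: "compact K" "countable K" "rank_class K \<xi>" and K': "compact K'" "countable K'" "rank_class K' \<xi>"
 shows "(cfun K :: ('a => 'k::real_normed_field) set) \<simeq> cfun K'"
proof -
 have k: "CB K (omega_pow \<xi>) \<noteq> {}" "CB K' (omega_pow \<xi>) \<noteq> {}"
  using K(3) K'(3) by (simp_all add: rank_class_def)
 obtain n n' where n: "CB K (ord_nmult (omega_pow \<xi>) n) = {}"
  "CB K' (ord_nmult (omega_pow \<xi>) n') = {}"
  using K(3) K'(3) by (auto simp: rank_class_def)
 have "(cfun K :: ('a => 'k) set) \<simeq> rank_ideal K (omega_pow \<xi>)"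
  by (rule cont_vanish_iso_rank_ideal[OF K(1,2) k(1) n(1)])
 also have "\<dots> \<simeq> rank_ideal K' (omega_pow \<xi>)" by (rule rank_ideal_iso[OF K(1,2) k(1) K'(1,2) k(2)])
 also have "\<dots> \<simeq> cfun K'"
  by (rule fun_iso_sym[OF cont_vanish_iso_rank_ideal[OF K'(1,2) k(2) n(2)]])
 finally show ?thesis .
qed

lemma ex_rank_class:
 fixes K :: "'a::metric_space set"
 assumes "compact K" "countable K" "infinite K"
 shows "\<exists>\<xi>. rank_class K \<xi>"
proof -
 have "K \<noteq> {}" using assms(3) by auto
 then obtain g where g: "CB K g \<noteq> {}" "CB K (ord_succ g) = {}"
  using CB_top[OF assms(1,2)] by metis
 \<comment> \<open>The last nonempty derivative is finite, so for infinite \<open>K\<close> it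
   cannot be \<open>K\<close> itself.\<close>
 have "g \<noteq> 0" using compact_CB_succ_empty[OF assms(1) g(2)] assms(3) by auto
 then obtain x n where x: "omega_pow x \<le> g" "g < ord_nmult (omega_pow x) n"
  by (rule omega_pow_bracket)
 then have "CB K (omega_pow x) \<noteq> {}" "CB K (ord_nmult (omega_pow x) n) = {}"
  using g CB_antimono[of "omega_pow x" g K]
   CB_antimono[of "ord_succ g" "ord_nmult (omega_pow x) n" K] by (auto simp: ord_succ_le_iff)
 then show ?thesis by (auto simp: rank_class_def)
qed

lemma rank_class_singleton:
 assumes "CB K (omega_pow \<xi>) = {t}"
 shows "rank_class K \<xi>"
proof -
 have "CB K (ord_nmult (omega_pow \<xi>) (Suc (Suc 0))) =
   CB (CB K (omega_pow \<xi>)) (omega_pow \<xi>)"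
  by (simp add: ord_mult_succ CB_add)
 also have "\<dots> = {}"
 proof -
  have "CB {t} (omega_pow \<xi>) \<subseteq> CB {t} (ord_succ 0)"
   using omega_pow_ge_one by (intro CB_antimono) (simp add: one_countable_ordinal_def)
  moreover have "\<not> t islimpt {t}" by (metis islimptE open_UNIV UNIV_I singletonD)
  then have "CB {t} (ord_succ 0) = {}" by (auto simp: CB_succ)
  ultimately show ?thesis using assms by auto
 qed
 finally show ?thesis unfolding rank_class_def using assms by blast
qed

subsection \<open>Normed spaces with a carrier and their completions\<close>

text \<open>The record has no zero vector. It appears as \<open>vscale X 0 x\<close>, which by
  \<open>zero_unique\<close> does not depend on \<open>x\<close>, and the laws about zero and
  negatives are phrased accordingly.\<close>

locale normed_nspace =
 fixes X :: "('k::real_normed_field, 'v) nspace"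
 assumes add_closed [simp]: "[|x \<in> vecs X; y \<in> vecs X|] ==> vadd X x y \<in> vecs X"
  and scale_closed [simp]: "x \<in> vecs X ==> vscale X c x \<in> vecs X"
  and add_commute: "[|x \<in> vecs X; y \<in> vecs X|] ==> vadd X x y = vadd X y x"
  and add_assoc: "[|x \<in> vecs X; y \<in> vecs X; z \<in> vecs X|] ==>
   vadd X (vadd X x y) z = vadd X x (vadd X y z)"
  and scale_add: "[|x \<in> vecs X; y \<in> vecs X|] ==>
   vscale X c (vadd X x y) = vadd X (vscale X c x) (vscale X c y)"
  and add_scale: "x \<in> vecs X ==> vscale X (c + d) x = vadd X (vscale X c x) (vscale X d x)"
  and scale_scale: "x \<in> vecs X ==> vscale X c (vscale X d x) = vscale X (c * d) x"
  and scale_one [simp]: "x \<in> vecs X ==> vscale X 1 x = x"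
  and add_zero [simp]: "[|x \<in> vecs X; y \<in> vecs X|] ==> vadd X x (vscale X 0 y) = x"
  and norm_triangle: "[|x \<in> vecs X; y \<in> vecs X|] ==> vnorm X (vadd X x y) \<le> vnorm X x + vnorm X y"
  and norm_scale: "x \<in> vecs X ==> vnorm X (vscale X c x) = norm c * vnorm X x"
  and norm_zeroD: "[|x \<in> vecs X; vnorm X x = 0|] ==> x = vscale X 0 x"
begin

abbreviation vdiff where "vdiff x y \<equiv> vadd X x (vscale X (-1) y)"

lemma zero_unique: "[|x \<in> vecs X; y \<in> vecs X|] ==> vscale X 0 x = vscale X 0 y"
 by (metis add_commute add_zero scale_closed)

lemma diff_self: "x \<in> vecs X ==> vdiff x x = vscale X 0 x"
 using add_scale[of x 1 "-1"] by simp

lemma norm_zero [simp]: "x \<in> vecs X ==> vnorm X (vscale X 0 x) = 0"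
 by (simp add: norm_scale)

lemma norm_nonneg [simp]: "x \<in> vecs X ==> 0 \<le> vnorm X x"
 using norm_triangle[of x "vscale X (-1) x"] by (simp add: diff_self norm_scale)

lemma add_add: "[|a \<in> vecs X; b \<in> vecs X; c \<in> vecs X; d \<in> vecs X|] ==>
  vadd X (vadd X a b) (vadd X c d) = vadd X (vadd X a c) (vadd X b d)"
 by (metis add_assoc add_closed add_commute)

lemma diff_add: "[|a \<in> vecs X; b \<in> vecs X; c \<in> vecs X; d \<in> vecs X|] ==>
  vdiff (vadd X a b) (vadd X c d) = vadd X (vdiff a c) (vdiff b d)"
 by (simp add: scale_add add_add)

lemma diff_diff: "[|x \<in> vecs X; y \<in> vecs X; z \<in> vecs X|] ==> vadd X (vdiff x y) (vdiff y z) = vdiff x z"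
proof -
 assume x: "x \<in> vecs X" "y \<in> vecs X" "z \<in> vecs X"
 have "vadd X (vdiff x y) (vdiff y z) = vadd X (vadd X x (vscale X (-1) z)) (vadd X (vscale X (-1) y) y)"
  using x by (metis add_add add_commute scale_closed)
 also have "vadd X (vscale X (-1) y) y = vscale X 0 y" using x by (metis add_commute diff_self scale_closed)
 finally show ?thesis using x by simp
qed

lemma diff_add_cancel: "[|x \<in> vecs X; y \<in> vecs X|] ==> vadd X (vdiff x y) y = x"
 by (metis add_assoc add_commute add_zero diff_self scale_closed)

lemma norm_diff_commute: "[|x \<in> vecs X; y \<in> vecs X|] ==> vnorm X (vdiff x y) = vnorm X (vdiff y x)"
proof -
 assume x: "x \<in> vecs X" "y \<in> vecs X"
 have "vdiff y x = vscale X (-1) (vdiff x y)"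
  using x by (simp add: scale_add scale_scale add_commute)
 then show ?thesis using x by (simp add: norm_scale)
qed

lemma vdist_eq: "[|x \<in> vecs X; y \<in> vecs X|] ==> vdist X x y = vnorm X (vdiff x y)"
 by (simp add: vdist_def)

sublocale M: Metric_space "vecs X" "vdist X"
proof
 show "0 \<le> vdist X x y" for x y by (simp add: vdist_def)
 show "vdist X x y = vdist X y x" for x y by (simp add: vdist_def norm_diff_commute)
 show "vdist X x y = 0 \<longleftrightarrow> x = y" if "x \<in> vecs X" "y \<in> vecs X" for x y
 proof
  assume "vdist X x y = 0"
  then have "vdiff x y = vscale X 0 (vdiff x y)" using that by (simp add: vdist_eq norm_zeroD)
  then have "vdiff x y = vscale X 0 y" using that by (metis zero_unique add_closed scale_closed)
  then show "x = y" using diff_add_cancel[OF that] that by (metis add_commute add_zero scale_closed)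
 qed (use that in "simp add: vdist_eq diff_self")
 show "vdist X x z \<le> vdist X x y + vdist X y z" if "x \<in> vecs X" "y \<in> vecs X" "z \<in> vecs X" for x y z
  using norm_triangle[of "vdiff x y" "vdiff y z"] that by (simp add: vdist_eq diff_diff)
qed

lemma norm_reverse_triangle: "[|x \<in> vecs X; y \<in> vecs X|] ==> \<bar>vnorm X x - vnorm X y\<bar> \<le> vdist X x y"
 using norm_triangle[of "vdiff x y" y] norm_triangle[of "vdiff y x" x] norm_diff_commute[of x y]
 by (simp add: vdist_eq diff_add_cancel)

lemma vdist_zero: "[|x \<in> vecs X; y \<in> vecs X|] ==> vdist X (vscale X 0 y) x = vnorm X x"
 by (metis M.commute vdist_eq scale_closed scale_scale mult_zero_right add_zero)

end

definition bounded_linear_map ::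
 "('k::real_normed_field, 'v) nspace => ('k, 'w) nspace => ('v => 'w) => bool" where
 "bounded_linear_map X Y T \<longleftrightarrow> linear_map X Y T \<and> (\<exists>C\<ge>0. \<forall>x\<in>vecs X. vnorm Y (T x) \<le> C * vnorm X x)"

lemma bounded_linear_mapD:
 assumes "bounded_linear_map X Y T"
 shows "x \<in> vecs X ==> T x \<in> vecs Y"
  and "x \<in> vecs X ==> y \<in> vecs X ==> T (vadd X x y) = vadd Y (T x) (T y)"
  and "x \<in> vecs X ==> T (vscale X c x) = vscale Y c (T x)"
 using assms unfolding bounded_linear_map_def linear_map_def by blast+

lemma bounded_linear_mapI:
 assumes "\<And>x. x \<in> vecs X ==> T x \<in> vecs Y"
  and "\<And>x y. x \<in> vecs X ==> y \<in> vecs X ==> T (vadd X x y) = vadd Y (T x) (T y)"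
  and "\<And>x c. x \<in> vecs X ==> T (vscale X c x) = vscale Y c (T x)"
  and "0 \<le> C" "\<And>x. x \<in> vecs X ==> vnorm Y (T x) \<le> C * vnorm X x"
 shows "bounded_linear_map X Y T"
 using assms unfolding bounded_linear_map_def linear_map_def by blast

lemma bounded_linear_map_bound:
 assumes "bounded_linear_map X Y T" "normed_nspace X"
 obtains C where "0 < C" "\<And>x. x \<in> vecs X ==> vnorm Y (T x) \<le> C * vnorm X x"
proof -
 interpret normed_nspace X by (rule assms(2))
 obtain C where C: "0 \<le> C" "\<And>x. x \<in> vecs X ==> vnorm Y (T x) \<le> C * vnorm X x"
  using assms(1) unfolding bounded_linear_map_def by blast
 have "vnorm Y (T x) \<le> (C + 1) * vnorm X x" if "x \<in> vecs X" for x
 proof -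
  have "C * vnorm X x \<le> (C + 1) * vnorm X x" using that by (simp add: algebra_simps)
  then show ?thesis using C(2)[OF that] by linarith
 qed
 then show thesis using that[of "C + 1"] C(1) by simp
qed

lemma linear_map_vdist:
 assumes "normed_nspace X" "normed_nspace Y" "linear_map X Y T" "x \<in> vecs X" "y \<in> vecs X"
 shows "vdist Y (T x) (T y) = vnorm Y (T (vadd X x (vscale X (-1) y)))"
 using assms unfolding linear_map_def
 by (simp add: normed_nspace.vdist_eq normed_nspace.scale_closed Pi_iff)

lemma bounded_linear_map_continuous:
 assumes X: "normed_nspace X" and Y: "normed_nspace Y" and T: "bounded_linear_map X Y T"
 shows "continuous_map (norm_topology X) (norm_topology Y) T"
proof -
 interpret X: normed_nspace X by (rule X)
 interpret Y: normed_nspace Y by (rule Y)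
 have lin: "linear_map X Y T" using T by (simp add: bounded_linear_map_def)
 obtain C where C: "0 < C" "\<And>x. x \<in> vecs X ==> vnorm Y (T x) \<le> C * vnorm X x"
  using bounded_linear_map_bound[OF T X] by blast
 have d: "vdist Y (T x) (T y) \<le> C * vdist X x y" if "x \<in> vecs X" "y \<in> vecs X" for x y
  using C(2)[of "X.vdiff x y"] that by (simp add: linear_map_vdist[OF X Y lin] X.vdist_eq)
 show ?thesis
  unfolding norm_topology_def X.M.metric_continuous_map[OF Y.M.Metric_space_axioms]
 proof (intro conjI ballI allI impI)
  show "T ` vecs X \<subseteq> vecs Y" using bounded_linear_mapD(1)[OF T] by blast
  fix a and e :: real assume a: "a \<in> vecs X" "0 < e"
  have "vdist Y (T a) (T x) < e" if "x \<in> vecs X" "vdist X a x < e / C" for x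
   using d[OF a(1) that(1)] that(2) C(1) by (smt (verit) less_divide_eq mult.commute)
  then show "\<exists>\<delta>>0. \<forall>x. x \<in> vecs X \<and> vdist X a x < \<delta> --> vdist Y (T a) (T x) < e"
   using a C(1) by (intro exI[of _ "e / C"]) simp
 qed
qed

lemma continuous_linear_map_bounded:
 assumes X: "normed_nspace X" and Y: "normed_nspace Y" and lin: "linear_map X Y T"
  and cont: "continuous_map (norm_topology X) (norm_topology Y) T"
 shows "bounded_linear_map X Y T"
proof (cases "vecs X = {}")
 case True
 then show ?thesis using lin unfolding bounded_linear_map_def by (auto intro: exI[of _ 0])
next
 case False
 interpret X: normed_nspace X by (rule X)
 interpret Y: normed_nspace Y by (rule Y)
 obtain w where w: "w \<in> vecs X" using False by blast
 let ?z = "vscale X 0 w"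
 have TX: "T x \<in> vecs Y" if "x \<in> vecs X" for x using lin that unfolding linear_map_def by blast
 have Tsc: "T (vscale X c x) = vscale Y c (T x)" if "x \<in> vecs X" for x c
  using lin that unfolding linear_map_def by blast
 obtain d where d: "d > 0" "\<And>x. x \<in> vecs X ==> vdist X ?z x < d ==> vdist Y (T ?z) (T x) < 1"
 proof -
  have "\<forall>e>0. \<exists>\<delta>>0. \<forall>x. x \<in> vecs X \<and> vdist X ?z x < \<delta> --> vdist Y (T ?z) (T x) < e"
   using cont w unfolding norm_topology_def X.M.metric_continuous_map[OF Y.M.Metric_space_axioms]
   by simp
  then show thesis using that zero_less_one by metis
 qed
 have b: "vnorm Y (T x) \<le> 1" if "x \<in> vecs X" "vnorm X x < d" for x
  using d(2)[of x] that w TX Tsc X.vdist_zero Y.vdist_zero by simp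
 have "vnorm Y (T x) \<le> (2 / d) * vnorm X x" if x: "x \<in> vecs X" for x
 proof (cases "vnorm X x = 0")
  case True
  then have "T x = vscale Y 0 (T x)" using X.norm_zeroD[OF x] Tsc[OF x] by metis
  then have "vnorm Y (T x) = 0" using TX[OF x] Y.norm_zero by metis
  then show ?thesis using True by simp
 next
  case False
  then have p: "0 < vnorm X x" using X.norm_nonneg[OF x] by simp
  \<comment> \<open>Scales \<open>x\<close> to norm \<open>d / 2\<close>, inside the ball on which
    \<open>T\<close> is bounded by 1.\<close>
  let ?c = "of_real (d / (2 * vnorm X x)) :: 'a"
  have nc: "norm ?c = d / (2 * vnorm X x)" by (subst norm_of_real) (use d(1) p in simp)
  have "vnorm X (vscale X ?c x) = d / 2" using x p nc by (simp add: X.norm_scale)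
  then have "vnorm Y (T (vscale X ?c x)) \<le> 1" using b x d(1) by simp
  then have "d / (2 * vnorm X x) * vnorm Y (T x) \<le> 1" using nc by (simp add: Tsc[OF x] Y.norm_scale TX[OF x])
  then show ?thesis using p d(1) by (simp add: field_simps)
 qed
 then show ?thesis using lin d(1) unfolding bounded_linear_map_def by (intro conjI exI[of _ "2 / d"]) auto
qed

lemma linearly_homeomorphicI:
 assumes "normed_nspace X" "normed_nspace Y" "bounded_linear_map X Y T" "bounded_linear_map Y X S"
  "\<And>x. x \<in> vecs X ==> S (T x) = x" "\<And>y. y \<in> vecs Y ==> T (S y) = y"
 shows "linearly_homeomorphic X Y"
proof -
 interpret X: normed_nspace X by (rule assms)
 interpret Y: normed_nspace Y by (rule assms)
 have "homeomorphic_maps (norm_topology X) (norm_topology Y) T S"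
  unfolding homeomorphic_maps_def
  using bounded_linear_map_continuous[OF assms(1-3)] bounded_linear_map_continuous[OF assms(2,1,4)] assms(5,6)
  by (auto simp: norm_topology_def)
 then show ?thesis
  using assms(3) homeomorphic_maps_imp_map unfolding linearly_homeomorphic_def bounded_linear_map_def by blast
qed

lemma linearly_homeomorphicE:
 assumes "linearly_homeomorphic X Y" "normed_nspace X" "normed_nspace Y"
 obtains T S where "bounded_linear_map X Y T" "bounded_linear_map Y X S"
  "\<And>x. x \<in> vecs X ==> S (T x) = x" "\<And>y. y \<in> vecs Y ==> T (S y) = y"
proof -
 interpret X: normed_nspace X by (rule assms)
 interpret Y: normed_nspace Y by (rule assms)
 obtain T where T: "linear_map X Y T" "homeomorphic_map (norm_topology X) (norm_topology Y) T"
  using assms(1) unfolding linearly_homeomorphic_def by blast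
 obtain S where "homeomorphic_maps (norm_topology X) (norm_topology Y) T S"
  using T(2) unfolding homeomorphic_map_maps by blast
 then have cT: "continuous_map (norm_topology X) (norm_topology Y) T"
  and cS: "continuous_map (norm_topology Y) (norm_topology X) S"
  and ST: "\<And>x. x \<in> vecs X ==> S (T x) = x" and TS: "\<And>y. y \<in> vecs Y ==> T (S y) = y"
  unfolding homeomorphic_maps_def by (auto simp: norm_topology_def)
 have SY: "S y \<in> vecs X" if "y \<in> vecs Y" for y
  using cS that unfolding continuous_map_def norm_topology_def by auto
 have Tl: "T (vadd X x x') = vadd Y (T x) (T x')" "T (vscale X c x) = vscale Y c (T x)"
  if "x \<in> vecs X" "x' \<in> vecs X" for x x' c
  using T(1) that unfolding linear_map_def by blast+
 have "linear_map Y X S"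
  unfolding linear_map_def
 proof (intro conjI ballI allI)
  show "S \<in> vecs Y \<rightarrow> vecs X" using SY by blast
  show "S (vadd Y y y') = vadd X (S y) (S y')" if "y \<in> vecs Y" "y' \<in> vecs Y" for y y'
   using Tl(1)[OF SY SY, OF that] ST[OF X.add_closed[OF SY SY, OF that]] TS that by simp
  show "S (vscale Y c y) = vscale X c (S y)" if "y \<in> vecs Y" for c y
   using Tl(2)[OF SY SY, OF that that, of c] ST[OF X.scale_closed[OF SY, OF that], of c] TS that by simp
 qed
 then show thesis
  by (intro that[of T S] continuous_linear_map_bounded assms(2,3) T(1) cT cS ST TS)
qed

lemma bounded_linear_map_compose:
 assumes "normed_nspace X" "normed_nspace Y" "bounded_linear_map X Y T" "bounded_linear_map Y Z S"
 shows "bounded_linear_map X Z (\<lambda>x. S (T x))"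
proof -
 obtain C where C: "0 < C" "\<And>x. x \<in> vecs X ==> vnorm Y (T x) \<le> C * vnorm X x"
  using bounded_linear_map_bound[OF assms(3,1)] by blast
 obtain D where D: "0 < D" "\<And>x. x \<in> vecs Y ==> vnorm Z (S x) \<le> D * vnorm Y x"
  using bounded_linear_map_bound[OF assms(4,2)] by blast
 show ?thesis
 proof (rule bounded_linear_mapI[where C = "D * C"])
  fix x assume x: "x \<in> vecs X"
  have "vnorm Z (S (T x)) \<le> D * vnorm Y (T x)" using D(2) bounded_linear_mapD(1)[OF assms(3) x] .
  also have "\<dots> \<le> D * (C * vnorm X x)" using C(2)[OF x] D(1) by simp
  finally show "vnorm Z (S (T x)) \<le> D * C * vnorm X x" by (simp add: mult.assoc)
 qed (use C D bounded_linear_mapD[OF assms(3)] bounded_linear_mapD[OF assms(4)] in simp_all)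
qed

lemma linearly_homeomorphic_trans:
 assumes "normed_nspace X" "normed_nspace Y" "normed_nspace Z"
  and "linearly_homeomorphic X Y" "linearly_homeomorphic Y Z"
 shows "linearly_homeomorphic X Z"
proof -
 obtain T S where T: "bounded_linear_map X Y T" "bounded_linear_map Y X S"
  "\<And>x. x \<in> vecs X ==> S (T x) = x" "\<And>y. y \<in> vecs Y ==> T (S y) = y"
  using linearly_homeomorphicE[OF assms(4,1,2)] by blast
 obtain T' S' where T': "bounded_linear_map Y Z T'" "bounded_linear_map Z Y S'"
  "\<And>x. x \<in> vecs Y ==> S' (T' x) = x" "\<And>y. y \<in> vecs Z ==> T' (S' y) = y"
  using linearly_homeomorphicE[OF assms(5,2,3)] by blast
 show ?thesis
  by (rule linearly_homeomorphicI[OF assms(1,3) bounded_linear_map_compose[OF assms(1,2) T(1) T'(1)]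
     bounded_linear_map_compose[OF assms(3,2) T'(2) T(2)]])
   (use T(3,4) T'(3,4) bounded_linear_mapD(1)[OF T(1)] bounded_linear_mapD(1)[OF T'(2)] in simp_all)
qed

lemma linearly_homeomorphic_sym:
 assumes "normed_nspace X" "normed_nspace Y" "linearly_homeomorphic X Y"
 shows "linearly_homeomorphic Y X"
 using linearly_homeomorphicE[OF assms(3,1,2)] linearly_homeomorphicI[OF assms(2,1)] by metis

section \<open>Completion by classes of Cauchy sequences\<close>

context normed_nspace
begin

lemma cauchy_seqs_iff:
 "s \<in> cauchy_seqs X \<longleftrightarrow> range s \<subseteq> vecs X \<and> (\<forall>e>0. \<exists>N. \<forall>n n'. N \<le> n --> N \<le> n' --> vdist X (s n) (s n') < e)"
 unfolding cauchy_seqs_def M.MCauchy_def by simp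

lemma cauchy_seqsD: "s \<in> cauchy_seqs X ==> s n \<in> vecs X"
 unfolding cauchy_seqs_iff by blast

lemma cauchy_const: "x \<in> vecs X ==> (\<lambda>_. x) \<in> cauchy_seqs X"
 unfolding cauchy_seqs_iff by auto

lemma vdist_add_le:
 "[|a \<in> vecs X; b \<in> vecs X; c \<in> vecs X; d \<in> vecs X|] ==>
  vdist X (vadd X a b) (vadd X c d) \<le> vdist X a c + vdist X b d"
 using norm_triangle[of "vdiff a c" "vdiff b d"] by (simp add: vdist_eq diff_add)

lemma cauchy_add:
 assumes "s \<in> cauchy_seqs X" "t \<in> cauchy_seqs X"
 shows "(\<lambda>n. vadd X (s n) (t n)) \<in> cauchy_seqs X"
 unfolding cauchy_seqs_iff
proof (intro conjI allI impI)
 show "range (\<lambda>n. vadd X (s n) (t n)) \<subseteq> vecs X" using cauchy_seqsD assms by auto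
 fix e :: real assume "0 < e"
 then obtain M N where "\<And>n n'. M \<le> n ==> M \<le> n' ==> vdist X (s n) (s n') < e / 2"
  "\<And>n n'. N \<le> n ==> N \<le> n' ==> vdist X (t n) (t n') < e / 2"
  using assms unfolding cauchy_seqs_iff by (meson half_gt_zero)
 then have "vdist X (vadd X (s n) (t n)) (vadd X (s n') (t n')) < e" if "max M N \<le> n" "max M N \<le> n'" for n n'
  using vdist_add_le[of "s n" "t n" "s n'" "t n'"] cauchy_seqsD assms that
  by (smt (verit) field_sum_of_halves max.bounded_iff)
 then show "\<exists>N. \<forall>n n'. N \<le> n --> N \<le> n' --> vdist X (vadd X (s n) (t n)) (vadd X (s n') (t n')) < e" by blast
qed

lemma cauchy_map:
 assumes "normed_nspace Y" "bounded_linear_map X Y T" "s \<in> cauchy_seqs X"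
 shows "(\<lambda>n. T (s n)) \<in> cauchy_seqs Y"
proof -
 interpret Y: normed_nspace Y by (rule assms)
 obtain C where C: "0 < C" "\<And>x. x \<in> vecs X ==> vnorm Y (T x) \<le> C * vnorm X x"
  using bounded_linear_map_bound[OF assms(2) normed_nspace_axioms] by blast
 have lin: "linear_map X Y T" using assms(2) by (simp add: bounded_linear_map_def)
 have d: "vdist Y (T x) (T y) \<le> C * vdist X x y" if "x \<in> vecs X" "y \<in> vecs X" for x y
  using C(2)[of "vdiff x y"] that by (simp add: linear_map_vdist[OF normed_nspace_axioms assms(1) lin] vdist_eq)
 show ?thesis
  unfolding Y.cauchy_seqs_iff
 proof (intro conjI allI impI)
  show "range (\<lambda>n. T (s n)) \<subseteq> vecs Y"
   using bounded_linear_mapD(1)[OF assms(2)] cauchy_seqsD[OF assms(3)] by auto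
  fix e :: real assume "0 < e"
  then obtain N where N: "\<And>n n'. N \<le> n ==> N \<le> n' ==> vdist X (s n) (s n') < e / C"
   using assms(3) C(1) unfolding cauchy_seqs_iff by (meson divide_pos_pos)
  have "vdist Y (T (s n)) (T (s n')) < e" if "N \<le> n" "N \<le> n'" for n n'
   using d[OF cauchy_seqsD[OF assms(3)] cauchy_seqsD[OF assms(3)], of n n'] N[OF that] C(1)
   by (smt (verit) less_divide_eq mult.commute)
  then show "\<exists>N. \<forall>n n'. N \<le> n --> N \<le> n' --> vdist Y (T (s n)) (T (s n')) < e" by blast
 qed
qed

lemma bounded_linear_map_scale: "bounded_linear_map X X (vscale X c)"
 by (rule bounded_linear_mapI[where C = "norm c"])
  (simp_all add: scale_add scale_scale norm_scale mult.commute)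

lemma cauchy_scale: "s \<in> cauchy_seqs X ==> (\<lambda>n. vscale X c (s n)) \<in> cauchy_seqs X"
 by (rule cauchy_map[OF normed_nspace_axioms bounded_linear_map_scale])

lemma equiv_cauchy_rel: "equiv (cauchy_seqs X) (cauchy_rel X)"
proof (rule equivI)
 show "cauchy_rel X \<subseteq> cauchy_seqs X \<times> cauchy_seqs X" by (auto simp: cauchy_rel_def)
 show "refl_on (cauchy_seqs X) (cauchy_rel X)"
  by (auto simp: refl_on_def cauchy_rel_def cauchy_seqsD)
 show "sym (cauchy_rel X)" by (auto simp: sym_def cauchy_rel_def M.commute)
 show "trans (cauchy_rel X)"
 proof (rule transI)
  fix s t u assume "(s, t) \<in> cauchy_rel X" "(t, u) \<in> cauchy_rel X"
  then have st: "s \<in> cauchy_seqs X" "t \<in> cauchy_seqs X" "u \<in> cauchy_seqs X"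
   "(\<lambda>n. vdist X (s n) (t n)) \<longlonglongrightarrow> 0" "(\<lambda>n. vdist X (t n) (u n)) \<longlonglongrightarrow> 0"
   by (auto simp: cauchy_rel_def)
  have "(\<lambda>n. vdist X (s n) (t n) + vdist X (t n) (u n)) \<longlonglongrightarrow> 0" using tendsto_add[OF st(4,5)] by simp
  then have "(\<lambda>n. vdist X (s n) (u n)) \<longlonglongrightarrow> 0"
   by (rule Lim_null_comparison[rotated]) (use M.triangle cauchy_seqsD st in "auto intro!: always_eventually")
  then show "(s, u) \<in> cauchy_rel X" using st by (simp add: cauchy_rel_def)
 qed
qed

definition compl_class where "compl_class s = cauchy_rel X `` {s}"

lemma vecs_completion: "vecs (completion X) = compl_class ` cauchy_seqs X"
 by (auto simp: completion_def quotient_def compl_class_def)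

lemma compl_class_eq_iff:
 "[|s \<in> cauchy_seqs X; t \<in> cauchy_seqs X|] ==>
  compl_class s = compl_class t \<longleftrightarrow> (\<lambda>n. vdist X (s n) (t n)) \<longlonglongrightarrow> 0"
 unfolding compl_class_def using eq_equiv_class_iff[OF equiv_cauchy_rel, of s t] by (simp add: cauchy_rel_def)

lemma mem_compl_class: "s \<in> cauchy_seqs X ==> t \<in> compl_class s \<longleftrightarrow> t \<in> cauchy_seqs X \<and> compl_class t = compl_class s"
 unfolding compl_class_def Image_singleton_iff equiv_class_eq_iff[OF equiv_cauchy_rel] by auto

lemma compl_classD:
 assumes "s' \<in> compl_class s" "s \<in> cauchy_seqs X"
 shows "s' \<in> cauchy_seqs X" "(\<lambda>n. vdist X (s' n) (s n)) \<longlonglongrightarrow> 0"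
proof -
 have s': "s' \<in> cauchy_seqs X" "compl_class s' = compl_class s"
  using mem_compl_class[OF assms(2)] assms(1) by simp_all
 then show "s' \<in> cauchy_seqs X" "(\<lambda>n. vdist X (s' n) (s n)) \<longlonglongrightarrow> 0"
  using compl_class_eq_iff[OF s'(1) assms(2)] by simp_all
qed

text \<open>The sum of classes was defined as a union over representatives. All representatives give
  the same class, so the union collapses.\<close>

lemma compl_add:
 assumes "s \<in> cauchy_seqs X" "t \<in> cauchy_seqs X"
 shows "vadd (completion X) (compl_class s) (compl_class t) = compl_class (\<lambda>n. vadd X (s n) (t n))"
proof -
 have "compl_class (\<lambda>n. vadd X (s' n) (t' n)) = compl_class (\<lambda>n. vadd X (s n) (t n))"
  if "s' \<in> compl_class s" "t' \<in> compl_class t" for s' t'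
 proof -
  note st = compl_classD(1)[OF that(1) assms(1)] compl_classD(1)[OF that(2) assms(2)]
   compl_classD(2)[OF that(1) assms(1)] compl_classD(2)[OF that(2) assms(2)]
  have "(\<lambda>n. vdist X (s' n) (s n) + vdist X (t' n) (t n)) \<longlonglongrightarrow> 0" using tendsto_add[OF st(3,4)] by simp
  then have "(\<lambda>n. vdist X (vadd X (s' n) (t' n)) (vadd X (s n) (t n))) \<longlonglongrightarrow> 0"
   by (rule Lim_null_comparison[rotated])
    (use vdist_add_le cauchy_seqsD st assms in "auto intro!: always_eventually")
  then show ?thesis using compl_class_eq_iff[OF cauchy_add[OF st(1,2)] cauchy_add[OF assms]] by simp
 qed
 moreover have "s \<in> compl_class s" "t \<in> compl_class t" using mem_compl_class assms by simp_all
 moreover have "vadd (completion X) (compl_class s) (compl_class t) =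
   (\<Union>s'\<in>compl_class s. \<Union>t'\<in>compl_class t. compl_class (\<lambda>n. vadd X (s' n) (t' n)))"
  by (simp add: completion_def compl_class_def)
 ultimately show ?thesis by blast
qed

lemma tendsto_vdist_map:
 assumes "normed_nspace Y" "bounded_linear_map X Y T" "s \<in> cauchy_seqs X" "t \<in> cauchy_seqs X"
  "(\<lambda>n. vdist X (s n) (t n)) \<longlonglongrightarrow> 0"
 shows "(\<lambda>n. vdist Y (T (s n)) (T (t n))) \<longlonglongrightarrow> 0"
proof -
 obtain C where C: "0 < C" "\<And>x. x \<in> vecs X ==> vnorm Y (T x) \<le> C * vnorm X x"
  using bounded_linear_map_bound[OF assms(2) normed_nspace_axioms] by blast
 have lin: "linear_map X Y T" using assms(2) by (simp add: bounded_linear_map_def)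
 have d: "vdist Y (T (s n)) (T (t n)) \<le> C * vdist X (s n) (t n)" for n
  using C(2)[of "vdiff (s n) (t n)"] cauchy_seqsD assms(3,4)
  by (simp add: linear_map_vdist[OF normed_nspace_axioms assms(1) lin] vdist_eq)
 have "(\<lambda>n. C * vdist X (s n) (t n)) \<longlonglongrightarrow> 0" using tendsto_mult_right_zero[OF assms(5)] .
 then show ?thesis
  by (rule Lim_null_comparison[rotated])
   (use d in "auto intro!: always_eventually simp: vdist_def
    normed_nspace.norm_nonneg[OF assms(1)] normed_nspace.add_closed[OF assms(1)] normed_nspace.scale_closed[OF assms(1)]")
qed

lemma compl_scale:
 assumes "s \<in> cauchy_seqs X"
 shows "vscale (completion X) c (compl_class s) = compl_class (\<lambda>n. vscale X c (s n))"
proof -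
 have "compl_class (\<lambda>n. vscale X c (s' n)) = compl_class (\<lambda>n. vscale X c (s n))" if "s' \<in> compl_class s" for s'
  using compl_class_eq_iff[OF cauchy_scale[OF compl_classD(1)[OF that assms]] cauchy_scale[OF assms]]
   tendsto_vdist_map[OF normed_nspace_axioms bounded_linear_map_scale compl_classD(1)[OF that assms] assms
    compl_classD(2)[OF that assms]] by simp
 moreover have "s \<in> compl_class s" using mem_compl_class assms by simp
 moreover have "vscale (completion X) c (compl_class s) =
   (\<Union>s'\<in>compl_class s. compl_class (\<lambda>n. vscale X c (s' n)))"
  by (simp add: completion_def compl_class_def)
 ultimately show ?thesis by blast
qed

lemma Cauchy_norm: "s \<in> cauchy_seqs X ==> Cauchy (\<lambda>n. vnorm X (s n))"
proof (rule metric_CauchyI)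
 fix e :: real assume s: "s \<in> cauchy_seqs X" and "0 < e"
 then obtain N where N: "\<And>n n'. N \<le> n ==> N \<le> n' ==> vdist X (s n) (s n') < e"
  unfolding cauchy_seqs_iff by meson
 have "dist (vnorm X (s m)) (vnorm X (s n)) < e" if "N \<le> m" "N \<le> n" for m n
  using norm_reverse_triangle[of "s m" "s n"] N[OF that] cauchy_seqsD[OF s] by (simp add: dist_real_def)
 then show "\<exists>M. \<forall>m\<ge>M. \<forall>n\<ge>M. dist (vnorm X (s m)) (vnorm X (s n)) < e" by blast
qed

lemma compl_norm:
 assumes "s \<in> cauchy_seqs X"
 shows "(\<lambda>n. vnorm X (s n)) \<longlonglongrightarrow> vnorm (completion X) (compl_class s)"
proof -
 have conv: "(\<lambda>n. vnorm X (s n)) \<longlonglongrightarrow> lim (\<lambda>n. vnorm X (s n))" if "s \<in> cauchy_seqs X" for s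
  using Cauchy_norm[OF that] Cauchy_convergent_iff convergent_LIMSEQ_iff by blast
 have l: "lim (\<lambda>n. vnorm X (s' n)) = lim (\<lambda>n. vnorm X (s n))" if "s' \<in> compl_class s" for s'
 proof -
  note st = compl_classD[OF that assms]
  have "(\<lambda>n. vnorm X (s' n) - vnorm X (s n)) \<longlonglongrightarrow> 0"
   by (rule Lim_null_comparison[OF _ st(2)])
    (use norm_reverse_triangle cauchy_seqsD st assms in "auto intro!: always_eventually")
  moreover have "(\<lambda>n. vnorm X (s' n) - vnorm X (s n)) \<longlonglongrightarrow> lim (\<lambda>n. vnorm X (s' n)) - lim (\<lambda>n. vnorm X (s n))"
   by (intro tendsto_diff conv st assms)
  ultimately show ?thesis using LIMSEQ_unique by fastforce
 qed
 have "compl_class s \<noteq> {}" using mem_compl_class assms by blast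
 moreover have "(\<lambda>s. lim (\<lambda>n. vnorm X (s n))) ` compl_class s = (\<lambda>_. lim (\<lambda>n. vnorm X (s n))) ` compl_class s"
  by (rule image_cong[OF refl l])
 ultimately have "(\<lambda>s. lim (\<lambda>n. vnorm X (s n))) ` compl_class s = {lim (\<lambda>n. vnorm X (s n))}"
  by (simp only: image_constant_conv if_False)
 then have "vnorm (completion X) (compl_class s) = lim (\<lambda>n. vnorm X (s n))"
  unfolding completion_def by simp
 then show ?thesis using conv[OF assms] by simp
qed

lemma compl_class_in: "s \<in> cauchy_seqs X ==> compl_class s \<in> vecs (completion X)"
 by (simp add: vecs_completion)

lemma normed_nspace_completion: "normed_nspace (completion X)"
proof
 let ?P = "completion X"
 show "vadd ?P A B \<in> vecs ?P" if "A \<in> vecs ?P" "B \<in> vecs ?P" for A B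
  using that unfolding vecs_completion by (auto simp: compl_add cauchy_add)
 show "vscale ?P c A \<in> vecs ?P" if "A \<in> vecs ?P" for A c
  using that unfolding vecs_completion by (auto simp: compl_scale cauchy_scale)
 show "vadd ?P A B = vadd ?P B A" if "A \<in> vecs ?P" "B \<in> vecs ?P" for A B
  using that unfolding vecs_completion by (auto simp: compl_add add_commute cauchy_seqsD)
 show "vadd ?P (vadd ?P A B) C = vadd ?P A (vadd ?P B C)" if "A \<in> vecs ?P" "B \<in> vecs ?P" "C \<in> vecs ?P" for A B C
  using that unfolding vecs_completion by (auto simp: compl_add cauchy_add add_assoc cauchy_seqsD)
 show "vscale ?P c (vadd ?P A B) = vadd ?P (vscale ?P c A) (vscale ?P c B)"
  if "A \<in> vecs ?P" "B \<in> vecs ?P" for A B c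
  using that unfolding vecs_completion
  by (auto simp: compl_add compl_scale cauchy_add cauchy_scale scale_add cauchy_seqsD)
 show "vscale ?P (c + d) A = vadd ?P (vscale ?P c A) (vscale ?P d A)" if "A \<in> vecs ?P" for A c d
  using that unfolding vecs_completion
  by (auto simp: compl_add compl_scale cauchy_add cauchy_scale add_scale cauchy_seqsD)
 show "vscale ?P c (vscale ?P d A) = vscale ?P (c * d) A" if "A \<in> vecs ?P" for A c d
  using that unfolding vecs_completion
  by (auto simp: compl_scale cauchy_scale scale_scale cauchy_seqsD)
 show "vscale ?P 1 A = A" if "A \<in> vecs ?P" for A
  using that unfolding vecs_completion by (auto simp: compl_scale cauchy_seqsD)
 show "vadd ?P A (vscale ?P 0 B) = A" if "A \<in> vecs ?P" "B \<in> vecs ?P" for A B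
  using that unfolding vecs_completion
  by (auto simp: compl_add compl_scale cauchy_scale cauchy_seqsD)
 show "vnorm ?P (vadd ?P A B) \<le> vnorm ?P A + vnorm ?P B" if AB: "A \<in> vecs ?P" "B \<in> vecs ?P" for A B
 proof -
  obtain s t where st: "s \<in> cauchy_seqs X" "t \<in> cauchy_seqs X" "A = compl_class s" "B = compl_class t"
   using AB unfolding vecs_completion by blast
  have "(\<lambda>n. vnorm X (vadd X (s n) (t n))) \<longlonglongrightarrow> vnorm ?P (vadd ?P A B)"
   using compl_norm[OF cauchy_add[OF st(1,2)]] st by (simp add: compl_add)
  moreover have "(\<lambda>n. vnorm X (s n) + vnorm X (t n)) \<longlonglongrightarrow> vnorm ?P A + vnorm ?P B"
   using st by (auto intro!: tendsto_add compl_norm)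
  ultimately show ?thesis
   by (rule LIMSEQ_le) (use norm_triangle cauchy_seqsD st in blast)
 qed
 show "vnorm ?P (vscale ?P c A) = norm c * vnorm ?P A" if A: "A \<in> vecs ?P" for A c
 proof -
  obtain s where s: "s \<in> cauchy_seqs X" "A = compl_class s" using A unfolding vecs_completion by blast
  have "(\<lambda>n. vnorm X (vscale X c (s n))) \<longlonglongrightarrow> vnorm ?P (vscale ?P c A)"
   using compl_norm[OF cauchy_scale[OF s(1)]] s by (simp add: compl_scale)
  moreover have "(\<lambda>n. vnorm X (vscale X c (s n))) \<longlonglongrightarrow> norm c * vnorm ?P A"
   using s by (auto simp: norm_scale cauchy_seqsD intro!: tendsto_mult compl_norm)
  ultimately show ?thesis by (rule LIMSEQ_unique)
 qed
 show "A = vscale ?P 0 A" if A: "A \<in> vecs ?P" "vnorm ?P A = 0" for A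
 proof -
  obtain s where s: "s \<in> cauchy_seqs X" "A = compl_class s" using A unfolding vecs_completion by blast
  have "(\<lambda>n. vdist X (vscale X 0 (s n)) (s n)) \<longlonglongrightarrow> 0"
   using compl_norm[OF s(1)] A s by (simp add: vdist_zero cauchy_seqsD)
  then have "compl_class (\<lambda>n. vscale X 0 (s n)) = compl_class s"
   using compl_class_eq_iff[OF cauchy_scale[OF s(1)] s(1)] by blast
  then show ?thesis using s by (simp add: compl_scale)
 qed
qed

definition compl_rep where "compl_rep A = (SOME s. s \<in> cauchy_seqs X \<and> compl_class s = A)"

lemma compl_rep: "A \<in> vecs (completion X) ==> compl_rep A \<in> cauchy_seqs X \<and> compl_class (compl_rep A) = A"
proof -
 assume "A \<in> vecs (completion X)"
 then have "\<exists>s. s \<in> cauchy_seqs X \<and> compl_class s = A" unfolding vecs_completion by blast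
 from someI_ex[OF this] show ?thesis unfolding compl_rep_def .
qed

lemma completion_dense:
 assumes "A \<in> vecs (completion X)" "0 < e"
 obtains x where "x \<in> vecs X" "vdist (completion X) A (compl_class (\<lambda>_. x)) < e"
proof -
 interpret P: normed_nspace "completion X" by (rule normed_nspace_completion)
 obtain s where s: "s \<in> cauchy_seqs X" "A = compl_class s" using assms unfolding vecs_completion by blast
 obtain N where N: "\<And>n n'. N \<le> n ==> N \<le> n' ==> vdist X (s n) (s n') < e / 2"
  using s(1) assms(2) unfolding cauchy_seqs_iff by (meson half_gt_zero)
 let ?x = "s N"
 have x: "?x \<in> vecs X" using s cauchy_seqsD by blast
 have "P.vdiff A (compl_class (\<lambda>_. ?x)) = compl_class (\<lambda>n. vdiff (s n) ?x)"
  using s x cauchy_const[OF x] cauchy_scale[OF cauchy_const[OF x]] by (simp add: compl_scale compl_add)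
 moreover have "(\<lambda>n. vdiff (s n) ?x) \<in> cauchy_seqs X"
  using cauchy_add[OF s(1) cauchy_scale[OF cauchy_const[OF x]]] .
 ultimately have "(\<lambda>n. vnorm X (vdiff (s n) ?x)) \<longlonglongrightarrow> vdist (completion X) A (compl_class (\<lambda>_. ?x))"
  using compl_norm x assms(1) compl_class_in[OF cauchy_const[OF x]] by (simp add: P.vdist_eq)
 moreover have "vnorm X (vdiff (s n) ?x) \<le> e / 2" if "N \<le> n" for n
  using N[OF that order_refl] x cauchy_seqsD[OF s(1)] by (simp add: vdist_eq less_imp_le)
 ultimately have "vdist (completion X) A (compl_class (\<lambda>_. ?x)) \<le> e / 2"
  by (meson LIMSEQ_le_const2)
 then show thesis using that[OF x] assms(2) by simp
qed

end

definition compl_map ::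
 "('k::real_normed_field, 'v) nspace => ('k, 'w) nspace => ('v => 'w) => (nat => 'v) set => (nat => 'w) set" where
 "compl_map X Y T A = normed_nspace.compl_class Y (\<lambda>n. T (normed_nspace.compl_rep X A n))"

lemma compl_map_class:
 assumes "normed_nspace X" "normed_nspace Y" "bounded_linear_map X Y T" "s \<in> cauchy_seqs X"
 shows "compl_map X Y T (normed_nspace.compl_class X s) = normed_nspace.compl_class Y (\<lambda>n. T (s n))"
proof -
 interpret X: normed_nspace X by (rule assms)
 interpret Y: normed_nspace Y by (rule assms)
 let ?r = "X.compl_rep (X.compl_class s)"
 have r: "?r \<in> cauchy_seqs X" "X.compl_class ?r = X.compl_class s"
  using X.compl_rep[OF X.compl_class_in[OF assms(4)]] by auto
 then have "(\<lambda>n. vdist Y (T (?r n)) (T (s n))) \<longlonglongrightarrow> 0"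
  using X.tendsto_vdist_map[OF assms(2,3)] X.compl_class_eq_iff assms(4) by blast
 then show ?thesis
  unfolding compl_map_def
  using Y.compl_class_eq_iff X.cauchy_map[OF assms(2,3)] r(1) assms(4) by blast
qed

lemma bounded_linear_map_compl_map:
 assumes "normed_nspace X" "normed_nspace Y" "bounded_linear_map X Y T"
 shows "bounded_linear_map (completion X) (completion Y) (compl_map X Y T)"
proof -
 interpret X: normed_nspace X by (rule assms)
 interpret Y: normed_nspace Y by (rule assms)
 note m = compl_map_class[OF assms] and c = X.cauchy_map[OF assms(2,3)]
 note D = bounded_linear_mapD[OF assms(3)]
 obtain C where C: "0 < C" "\<And>x. x \<in> vecs X ==> vnorm Y (T x) \<le> C * vnorm X x"
  using bounded_linear_map_bound[OF assms(3,1)] by blast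
 show ?thesis
 proof (rule bounded_linear_mapI[where C = C])
  fix A assume "A \<in> vecs (completion X)"
  then obtain s where s: "s \<in> cauchy_seqs X" "A = X.compl_class s" unfolding X.vecs_completion by blast
  show "compl_map X Y T A \<in> vecs (completion Y)" using s m c Y.compl_class_in by simp
  show "compl_map X Y T (vscale (completion X) k A) = vscale (completion Y) k (compl_map X Y T A)" for k
   using s m c D(3)[OF X.cauchy_seqsD[OF s(1)]] by (simp add: X.compl_scale Y.compl_scale X.cauchy_scale)
  have "(\<lambda>n. vnorm Y (T (s n))) \<longlonglongrightarrow> vnorm (completion Y) (compl_map X Y T A)"
   using Y.compl_norm[OF c[OF s(1)]] m s by simp
  moreover have "(\<lambda>n. C * vnorm X (s n)) \<longlonglongrightarrow> C * vnorm (completion X) A"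
   using s by (auto intro!: tendsto_mult X.compl_norm)
  ultimately show "vnorm (completion Y) (compl_map X Y T A) \<le> C * vnorm (completion X) A"
   by (rule LIMSEQ_le) (use C(2) X.cauchy_seqsD[OF s(1)] in blast)
  fix B assume "B \<in> vecs (completion X)"
  then obtain t where t: "t \<in> cauchy_seqs X" "B = X.compl_class t" unfolding X.vecs_completion by blast
  show "compl_map X Y T (vadd (completion X) A B) =
    vadd (completion Y) (compl_map X Y T A) (compl_map X Y T B)"
   using s t m c D(2)[OF X.cauchy_seqsD[OF s(1)] X.cauchy_seqsD[OF t(1)]]
   by (simp add: X.compl_add Y.compl_add X.cauchy_add)
 qed (use C in simp)
qed

lemma linearly_homeomorphic_completion:
 assumes "normed_nspace X" "normed_nspace Y" "bounded_linear_map X Y T" "bounded_linear_map Y X S"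
  "\<And>x. x \<in> vecs X ==> S (T x) = x" "\<And>y. y \<in> vecs Y ==> T (S y) = y"
 shows "linearly_homeomorphic (completion X) (completion Y)"
proof (rule linearly_homeomorphicI)
 interpret X: normed_nspace X by (rule assms)
 interpret Y: normed_nspace Y by (rule assms)
 show "normed_nspace (completion X)" "normed_nspace (completion Y)"
  by (rule X.normed_nspace_completion Y.normed_nspace_completion)+
 show "bounded_linear_map (completion X) (completion Y) (compl_map X Y T)"
  "bounded_linear_map (completion Y) (completion X) (compl_map Y X S)"
  using bounded_linear_map_compl_map assms by blast+
 show "compl_map Y X S (compl_map X Y T A) = A" if A: "A \<in> vecs (completion X)" for A
 proof -
  obtain s where s: "s \<in> cauchy_seqs X" "A = X.compl_class s" using A unfolding X.vecs_completion by blast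
  show ?thesis
   using s X.cauchy_map[OF assms(2,3) s(1)] X.cauchy_seqsD[OF s(1)]
   by (simp add: compl_map_class[OF assms(1-3)] compl_map_class[OF assms(2,1,4)] assms(5))
 qed
 show "compl_map X Y T (compl_map Y X S A) = A" if A: "A \<in> vecs (completion Y)" for A
 proof -
  obtain s where s: "s \<in> cauchy_seqs Y" "A = Y.compl_class s" using A unfolding Y.vecs_completion by blast
  show ?thesis
   using s Y.cauchy_map[OF assms(1,4) s(1)] Y.cauchy_seqsD[OF s(1)]
   by (simp add: compl_map_class[OF assms(1-3)] compl_map_class[OF assms(2,1,4)] assms(6))
 qed
qed

subsection \<open>The projective tensor product\<close>

lemma lookup_free_scale [simp]: "Poly_Mapping.lookup (free_scale c u) p = c * Poly_Mapping.lookup u p"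
 unfolding free_scale_def by (simp add: Poly_Mapping.map.rep_eq when_def)

lemma free_scale_add: "free_scale c (u + v) = free_scale c u + free_scale c v"
 by (rule poly_mapping_eqI) (simp add: lookup_add algebra_simps)

lemma free_scale_diff: "free_scale c (u - v) = free_scale c u - free_scale c v"
 by (rule poly_mapping_eqI) (simp add: lookup_minus algebra_simps)

lemma free_scale_zero [simp]: "free_scale 0 u = 0" "free_scale c 0 = 0"
 by (rule poly_mapping_eqI, simp)+

lemma free_scale_minus_one: "free_scale (- 1) u = - u"
 by (rule poly_mapping_eqI) simp

lemma keys_free_scale: "Poly_Mapping.keys (free_scale c u) \<subseteq> Poly_Mapping.keys u"
 by (auto simp: in_keys_iff)

text \<open>The linear extension of \<open>\<beta>\<close> from the generators to the free
  space.\<close>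

definition free_eval :: "('p => 'k) => ('p \<Rightarrow>\<^sub>0 'k::real_normed_field) => 'k" where
 "free_eval \<beta> u = (\<Sum>p\<in>Poly_Mapping.keys u. Poly_Mapping.lookup u p * \<beta> p)"

lemma free_eval_add: "free_eval \<beta> (u + v) = free_eval \<beta> u + free_eval \<beta> v"
 unfolding free_eval_def
 by (rule setsum_keys_plus_distrib[where f = "\<lambda>p c. c * \<beta> p"]) (simp_all add: distrib_right)

lemma free_eval_scale: "free_eval \<beta> (free_scale c u) = c * free_eval \<beta> u"
proof -
 have "free_eval \<beta> (free_scale c u) = (\<Sum>p\<in>Poly_Mapping.keys u. Poly_Mapping.lookup (free_scale c u) p * \<beta> p)"
  unfolding free_eval_def
  by (rule sum.mono_neutral_left) (auto simp: keys_free_scale in_keys_iff)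
 then show ?thesis by (simp add: free_eval_def sum_distrib_left mult.assoc)
qed

lemma free_eval_diff: "free_eval \<beta> (u - v) = free_eval \<beta> u - free_eval \<beta> v"
proof -
 have "u - v = u + free_scale (- 1) v" by (simp add: free_scale_minus_one)
 then show ?thesis by (simp only: free_eval_add free_eval_scale) simp
qed

lemma free_eval_gen [simp]: "free_eval \<beta> (free_gen x y) = \<beta> (x, y)"
 by (simp add: free_eval_def free_gen_def)

lemma free_eval_zero [simp]: "free_eval \<beta> 0 = 0"
 by (simp add: free_eval_def)

lemma free_scale_single: "free_scale c (Poly_Mapping.single p a) = Poly_Mapping.single p (c * a)"
 by (rule poly_mapping_eqI) (simp add: lookup_single when_def)

lemma sum_single_keys: "(\<Sum>p\<in>Poly_Mapping.keys u. Poly_Mapping.single p (Poly_Mapping.lookup u p)) = u"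
 by (rule poly_mapping_eqI) (auto simp: lookup_sum lookup_single when_def in_keys_iff)

definition list_tensor :: "('v \<times> 'w) list => ('v \<times> 'w \<Rightarrow>\<^sub>0 'k::real_normed_field)" where
 "list_tensor ps = (\<Sum>(x, y)\<leftarrow>ps. free_gen x y)"

lemma list_tensor_simps [simp]:
 "list_tensor [] = 0" "list_tensor (p # ps) = free_gen (fst p) (snd p) + list_tensor ps"
 "list_tensor (ps @ qs) = list_tensor ps + list_tensor qs"
 by (simp_all add: list_tensor_def case_prod_unfold)

lemma free_eval_list_tensor: "free_eval \<beta> (list_tensor ps) = (\<Sum>p\<leftarrow>ps. \<beta> p)"
 by (induction ps) (simp_all add: free_eval_add)

definition bilinear_form ::
 "('k::real_normed_field, 'v) nspace => ('k, 'w) nspace => real => ('v \<times> 'w => 'k) => bool" where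
 "bilinear_form X Y M \<beta> \<longleftrightarrow> 0 \<le> M \<and>
  (\<forall>x\<in>vecs X. \<forall>x'\<in>vecs X. \<forall>y\<in>vecs Y. \<beta> (vadd X x x', y) = \<beta> (x, y) + \<beta> (x', y)) \<and>
  (\<forall>x\<in>vecs X. \<forall>y\<in>vecs Y. \<forall>y'\<in>vecs Y. \<beta> (x, vadd Y y y') = \<beta> (x, y) + \<beta> (x, y')) \<and>
  (\<forall>x\<in>vecs X. \<forall>y\<in>vecs Y. \<forall>c. \<beta> (vscale X c x, y) = c * \<beta> (x, y) \<and> \<beta> (x, vscale Y c y) = c * \<beta> (x, y)) \<and>
  (\<forall>x\<in>vecs X. \<forall>y\<in>vecs Y. norm (\<beta> (x, y)) \<le> M * (vnorm X x * vnorm Y y))"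

lemma free_eval_bilinear_relations:
 assumes "bilinear_form X Y M \<beta>" "u \<in> bilinear_relations X Y"
 shows "free_eval \<beta> u = 0"
 using assms(2)
 by induction (use assms(1) in "simp_all add: free_eval_add free_eval_diff free_eval_scale bilinear_form_def")

text \<open>\<open>separates\<close> takes the place of the Hahn-Banach theorem: bounded forms
  recognise zero tensors. It turns the projective seminorm into a norm and lets tensors be compared
  by forms alone. For spaces of continuous functions it is elementary.\<close>

locale tensor_pair = X: normed_nspace X + Y: normed_nspace Y
 for X :: "('k::real_normed_field, 'v) nspace" and Y :: "('k, 'w) nspace" +
 assumes separates: "[|set ps \<subseteq> vecs X \<times> vecs Y; \<And>M \<beta>. bilinear_form X Y M \<beta> ==> (\<Sum>p\<leftarrow>ps. \<beta> p) = 0|] ==>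
  list_tensor ps \<in> bilinear_relations X Y"
begin

abbreviation "R \<equiv> bilinear_relations X Y"
abbreviation "F \<equiv> free_space X Y"
abbreviation "A \<equiv> algebraic_tensor X Y"
abbreviation "valid ps \<equiv> set ps \<subseteq> vecs X \<times> vecs Y"
abbreviation "cost ps \<equiv> \<Sum>(x, y)\<leftarrow>ps. vnorm X x * vnorm Y y"

lemma rel_diff: "u \<in> R ==> v \<in> R ==> u - v \<in> R"
 using bilinear_relations.add[of u X Y "free_scale (- 1) v"] bilinear_relations.scale[of v X Y "- 1"]
 by (simp add: free_scale_minus_one)

lemma free_space_add: "u \<in> F ==> v \<in> F ==> u + v \<in> F"
 unfolding free_space_def mem_Collect_eq by (rule order_trans[OF Poly_Mapping.keys_add]) simp

lemma free_space_scale: "u \<in> F ==> free_scale c u \<in> F"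
 unfolding free_space_def mem_Collect_eq by (rule order_trans[OF keys_free_scale])

lemma free_space_zero: "0 \<in> F"
 by (simp add: free_space_def)

lemma free_space_gen: "x \<in> vecs X ==> y \<in> vecs Y ==> free_gen x y \<in> F"
 by (simp add: free_space_def free_gen_def)

lemma free_space_list: "valid ps ==> list_tensor ps \<in> F"
 by (induction ps) (auto simp: free_space_zero intro!: free_space_add free_space_gen)

lemma equiv_tensor_rel: "equiv F (tensor_rel X Y)"
proof (rule equivI)
 show "tensor_rel X Y \<subseteq> F \<times> F" by (auto simp: tensor_rel_def)
 show "refl_on F (tensor_rel X Y)" by (auto simp: refl_on_def tensor_rel_def bilinear_relations.zero)
 show "sym (tensor_rel X Y)"
 proof (rule symI)
  fix u v assume "(u, v) \<in> tensor_rel X Y"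
  then show "(v, u) \<in> tensor_rel X Y"
   using rel_diff[OF bilinear_relations.zero, of "u - v"] by (simp add: tensor_rel_def)
 qed
 show "trans (tensor_rel X Y)"
 proof (rule transI)
  fix u v w assume uv: "(u, v) \<in> tensor_rel X Y" "(v, w) \<in> tensor_rel X Y"
  then have "(u - v) + (v - w) \<in> R" by (intro bilinear_relations.add) (simp_all add: tensor_rel_def)
  moreover have "(u - v) + (v - w) = u - w" by simp
  ultimately show "(u, w) \<in> tensor_rel X Y" using uv by (simp add: tensor_rel_def)
 qed
qed

text \<open>Coefficients are absorbed into the first factor, so that lists of pairs represent all
  tensors.\<close>

lemma ex_list_tensor:
 assumes "u \<in> F"
 obtains ps where "valid ps" "u - list_tensor ps \<in> R"
proof -
 have "\<exists>ps. valid ps \<and> (\<Sum>p\<in>B. Poly_Mapping.single p (c p)) - list_tensor ps \<in> R"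
  if "finite B" "B \<subseteq> vecs X \<times> vecs Y" for B and c :: "'v \<times> 'w => 'k"
  using that
 proof (induction B rule: finite_induct)
  case empty
  then show ?case by (intro exI[of _ "[]"]) (simp add: bilinear_relations.zero)
 next
  case (insert p B)
  obtain x y where p: "p = (x, y)" by (cases p)
  have xy: "x \<in> vecs X" "y \<in> vecs Y" using insert.prems p by auto
  obtain ps where ps: "valid ps" "(\<Sum>p\<in>B. Poly_Mapping.single p (c p)) - list_tensor ps \<in> R"
   using insert by auto
  have "Poly_Mapping.single p (c p) = free_scale (c p) (free_gen x y)"
   by (simp add: free_gen_def free_scale_single p)
  moreover have "0 - (free_gen (vscale X (c p) x) y - free_scale (c p) (free_gen x y)) \<in> R"
   by (intro rel_diff bilinear_relations.zero bilinear_relations.scale_left xy)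
  ultimately have "Poly_Mapping.single p (c p) - free_gen (vscale X (c p) x) y \<in> R" by simp
  from bilinear_relations.add[OF this ps(2)]
  have "(\<Sum>p\<in>insert p B. Poly_Mapping.single p (c p)) - list_tensor ((vscale X (c p) x, y) # ps) \<in> R"
   using insert.hyps by (simp add: algebra_simps)
  then show ?case using ps(1) xy by (intro exI[of _ "(vscale X (c p) x, y) # ps"]) auto
 qed
 from this[of "Poly_Mapping.keys u" "Poly_Mapping.lookup u"] show thesis
  using that assms by (auto simp: free_space_def sum_single_keys)
qed

definition scl where "scl c = map (\<lambda>(x, y). (vscale X c x, y))"

lemma scl_simps [simp]: "valid ps ==> valid (scl c ps)" "scl c (ps @ qs) = scl c ps @ scl c qs"
 by (auto simp: scl_def)

lemma cost_nonneg: "valid ps ==> 0 \<le> cost ps"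
 by (induction ps) auto

lemma cost_scl: "valid ps ==> cost (scl c ps) = norm c * cost ps"
 by (induction ps) (auto simp: scl_def X.norm_scale algebra_simps)

lemma sum_scl: "bilinear_form X Y M \<beta> ==> valid ps ==> (\<Sum>p\<leftarrow>scl c ps. \<beta> p) = c * (\<Sum>p\<leftarrow>ps. \<beta> p)"
 by (induction ps) (auto simp: scl_def bilinear_form_def distrib_left)

lemma scl_rel: "valid ps ==> free_scale c (list_tensor ps) - list_tensor (scl c ps) \<in> R"
proof (induction ps)
 case (Cons p ps)
 obtain x y where p: "p = (x, y)" by (cases p)
 have "0 - (free_gen (vscale X c x) y - free_scale c (free_gen x y)) \<in> R"
  using Cons.prems p by (intro rel_diff bilinear_relations.zero bilinear_relations.scale_left) auto
 moreover have "free_scale c (list_tensor ps) - list_tensor (scl c ps) \<in> R" using Cons by simp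
 ultimately have "(0 - (free_gen (vscale X c x) y - free_scale c (free_gen x y))) +
   (free_scale c (list_tensor ps) - list_tensor (scl c ps)) \<in> R" by (rule bilinear_relations.add)
 then show ?case by (simp add: p scl_def free_scale_add algebra_simps)
qed (simp add: bilinear_relations.zero scl_def)

definition cls where "cls ps = tensor_rel X Y `` {list_tensor ps}"

lemma cls_eq_rel: "valid ps ==> valid qs ==> cls ps = cls qs \<longleftrightarrow> list_tensor ps - list_tensor qs \<in> R"
 unfolding cls_def using eq_equiv_class_iff[OF equiv_tensor_rel free_space_list free_space_list, of ps qs]
 by (simp add: tensor_rel_def free_space_list)

text \<open>Forms annihilate the relations, which gives one direction; the other is
  \<open>separates\<close> for the list \<open>ps\<close> followed by the negative of
  \<open>qs\<close>.\<close>

lemma cls_eq_iff: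
 assumes "valid ps" "valid qs"
 shows "cls ps = cls qs \<longleftrightarrow> (\<forall>M \<beta>. bilinear_form X Y M \<beta> --> (\<Sum>p\<leftarrow>ps. \<beta> p) = (\<Sum>p\<leftarrow>qs. \<beta> p))"
proof (intro iffI allI impI)
 fix M \<beta> assume "cls ps = cls qs" and \<beta>: "bilinear_form X Y M \<beta>"
 then have "free_eval \<beta> (list_tensor ps - list_tensor qs) = 0"
  using free_eval_bilinear_relations[OF \<beta>] by (simp add: cls_eq_rel assms)
 then show "(\<Sum>p\<leftarrow>ps. \<beta> p) = (\<Sum>p\<leftarrow>qs. \<beta> p)" by (simp add: free_eval_diff free_eval_list_tensor)
next
 assume eq: "\<forall>M \<beta>. bilinear_form X Y M \<beta> --> (\<Sum>p\<leftarrow>ps. \<beta> p) = (\<Sum>p\<leftarrow>qs. \<beta> p)"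
 have "list_tensor (ps @ scl (- 1) qs) \<in> R"
  by (rule separates) (use eq assms in "auto simp: sum_scl")
 from bilinear_relations.add[OF this scl_rel[OF assms(2), of "- 1"]] show "cls ps = cls qs"
  by (simp add: cls_eq_rel assms free_scale_minus_one)
qed

lemma list_in_cls: "valid ps ==> valid qs ==> list_tensor qs \<in> cls ps \<longleftrightarrow> cls qs = cls ps"
 using cls_eq_rel[of ps qs] by (auto simp: cls_def tensor_rel_def free_space_list)

lemma rel_class_eq: "valid ps ==> u \<in> F ==> list_tensor ps - u \<in> R ==> tensor_rel X Y `` {u} = cls ps"
 unfolding cls_def by (rule equiv_class_eq[OF equiv_tensor_rel, symmetric]) (simp add: tensor_rel_def free_space_list)

lemma vecs_A: "vecs A = cls ` {ps. valid ps}"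
proof
 show "vecs A \<subseteq> cls ` {ps. valid ps}"
 proof
  fix B assume "B \<in> vecs A"
  then obtain u where u: "u \<in> F" "B = tensor_rel X Y `` {u}" by (auto simp: algebraic_tensor_def elim: quotientE)
  obtain ps where ps: "valid ps" "u - list_tensor ps \<in> R" by (rule ex_list_tensor[OF u(1)], rule that)
  then show "B \<in> cls ` {ps. valid ps}"
   using u rel_diff[OF bilinear_relations.zero ps(2)] rel_class_eq[OF ps(1) u(1)] by simp
 qed
qed (auto simp: algebraic_tensor_def cls_def free_space_list intro: quotientI)

lemma A_add: "valid ps ==> valid qs ==> vadd A (cls ps) (cls qs) = cls (ps @ qs)"
proof -
 assume v: "valid ps" "valid qs"
 have "tensor_rel X Y `` {u + v} = cls (ps @ qs)" if "u \<in> cls ps" "v \<in> cls qs" for u v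
 proof (rule rel_class_eq)
  have "(list_tensor ps - u) + (list_tensor qs - v) \<in> R"
   using that by (intro bilinear_relations.add) (simp_all add: cls_def tensor_rel_def)
  then show "list_tensor (ps @ qs) - (u + v) \<in> R" by (simp add: algebra_simps)
 qed (use v that free_space_add in "auto simp: cls_def tensor_rel_def")
 moreover have "list_tensor ps \<in> cls ps" "list_tensor qs \<in> cls qs" using v by (simp_all add: list_in_cls)
 moreover have "vadd A (cls ps) (cls qs) = (\<Union>u\<in>cls ps. \<Union>v\<in>cls qs. tensor_rel X Y `` {u + v})"
  by (simp add: algebraic_tensor_def)
 ultimately show ?thesis by blast
qed

lemma A_scale: "valid ps ==> vscale A c (cls ps) = cls (scl c ps)"
proof -
 assume v: "valid ps"
 have "tensor_rel X Y `` {free_scale c u} = cls (scl c ps)" if "u \<in> cls ps" for u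
 proof (rule rel_class_eq)
  have "free_scale c (list_tensor ps - u) - (free_scale c (list_tensor ps) - list_tensor (scl c ps)) \<in> R"
   using that by (intro rel_diff[OF bilinear_relations.scale scl_rel[OF v]]) (simp add: cls_def tensor_rel_def)
  then show "list_tensor (scl c ps) - free_scale c u \<in> R" by (simp add: free_scale_diff)
 qed (use v that free_space_scale in "auto simp: cls_def tensor_rel_def")
 moreover have "list_tensor ps \<in> cls ps" using v by (simp add: list_in_cls)
 moreover have "vscale A c (cls ps) = (\<Union>u\<in>cls ps. tensor_rel X Y `` {free_scale c u})"
  by (simp add: algebraic_tensor_def)
 ultimately show ?thesis by blast
qed

lemma vnorm_A: "valid ps ==> vnorm A (cls ps) = Inf {cost qs |qs. valid qs \<and> cls qs = cls ps}"
 unfolding algebraic_tensor_def using list_in_cls[of ps]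
 by (auto simp: list_tensor_def intro!: arg_cong[of _ _ Inf])

lemma vnorm_A_le: "valid ps ==> vnorm A (cls ps) \<le> cost ps"
 unfolding vnorm_A by (rule cInf_lower) (auto intro!: bdd_belowI[of _ 0] cost_nonneg)

lemma vnorm_A_greatest:
 "valid ps ==> (\<And>qs. valid qs ==> cls qs = cls ps ==> a \<le> cost qs) ==> a \<le> vnorm A (cls ps)"
 unfolding vnorm_A by (rule cInf_greatest) auto

lemma vnorm_A_approx:
 assumes "valid ps" "0 < e"
 obtains qs where "valid qs" "cls qs = cls ps" "cost qs < vnorm A (cls ps) + e"
 using vnorm_A_greatest[OF assms(1), of "vnorm A (cls ps) + e"] assms(2) that by force

lemma vnorm_A_bound:
 assumes v: "valid ps" and "0 \<le> C" and a: "\<And>qs. valid qs ==> cls qs = cls ps ==> a \<le> C * cost qs"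
 shows "a \<le> C * vnorm A (cls ps)"
proof (cases "C = 0")
 case True
 then show ?thesis using a[OF v refl] by simp
next
 case False
 then have "a / C \<le> vnorm A (cls ps)"
  using assms by (intro vnorm_A_greatest) (simp_all add: divide_le_eq mult.commute)
 then show ?thesis using False \<open>0 \<le> C\<close> by (simp add: divide_le_eq mult.commute)
qed

definition tensor_eval where "tensor_eval \<beta> B = (\<Sum>p\<leftarrow>(SOME ps. valid ps \<and> cls ps = B). \<beta> p)"

lemma tensor_eval_cls: "bilinear_form X Y M \<beta> ==> valid ps ==> tensor_eval \<beta> (cls ps) = (\<Sum>p\<leftarrow>ps. \<beta> p)"
 unfolding tensor_eval_def using someI[of "\<lambda>qs. valid qs \<and> cls qs = cls ps" ps] cls_eq_iff by blast

lemma norm_sum_list_le: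
 assumes "bilinear_form X Y M \<beta>" "valid ps"
 shows "norm (\<Sum>p\<leftarrow>ps. \<beta> p) \<le> M * cost ps"
 using assms(2)
proof (induction ps)
 case (Cons p ps)
 obtain x y where p: "p = (x, y)" by (cases p)
 have "norm (\<beta> (x, y)) \<le> M * (vnorm X x * vnorm Y y)"
  using assms(1) Cons.prems p unfolding bilinear_form_def by auto
 then show ?case
  using Cons p norm_triangle_ineq[of "\<beta> p" "\<Sum>p\<leftarrow>ps. \<beta> p"] by (simp add: distrib_left)
qed (use assms(1) in "simp add: bilinear_form_def")

lemma norm_sum_le_vnorm:
 assumes "bilinear_form X Y M \<beta>" "valid ps"
 shows "norm (\<Sum>p\<leftarrow>ps. \<beta> p) \<le> M * vnorm A (cls ps)"
proof (rule vnorm_A_bound[OF assms(2)])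
 show "0 \<le> M" using assms(1) by (simp add: bilinear_form_def)
 show "norm (\<Sum>p\<leftarrow>ps. \<beta> p) \<le> M * cost qs" if "valid qs" "cls qs = cls ps" for qs
  using norm_sum_list_le[OF assms(1) that(1)] cls_eq_iff[OF that(1) assms(2)] that(2) assms(1) by metis
qed

lemma vnorm_A_scale_le: "valid ps ==> vnorm A (cls (scl c ps)) \<le> norm c * vnorm A (cls ps)"
proof (rule vnorm_A_bound)
 fix qs assume "valid ps" "valid qs" "cls qs = cls ps"
 then show "vnorm A (cls (scl c ps)) \<le> norm c * cost qs"
  using vnorm_A_le[of "scl c qs"] A_scale[of ps c] A_scale[of qs c] by (simp add: cost_scl)
qed simp_all

sublocale A: normed_nspace A
proof
 note [simp] = A_add A_scale
 show "vadd A B C \<in> vecs A" if "B \<in> vecs A" "C \<in> vecs A" for B C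
  using that unfolding vecs_A by (elim imageE) simp
 show "vscale A c B \<in> vecs A" if "B \<in> vecs A" for B c using that unfolding vecs_A by (elim imageE) simp
 show "vadd A B C = vadd A C B" if "B \<in> vecs A" "C \<in> vecs A" for B C
  using that unfolding vecs_A by (elim imageE) (simp add: cls_eq_iff add.commute)
 show "vadd A (vadd A B C) D = vadd A B (vadd A C D)" if "B \<in> vecs A" "C \<in> vecs A" "D \<in> vecs A" for B C D
  using that unfolding vecs_A by (elim imageE) simp
 show "vscale A c (vadd A B C) = vadd A (vscale A c B) (vscale A c C)" if "B \<in> vecs A" "C \<in> vecs A" for B C c
  using that unfolding vecs_A by (elim imageE) simp
 show "vscale A (c + d) B = vadd A (vscale A c B) (vscale A d B)"
  "vscale A c (vscale A d B) = vscale A (c * d) B" "vscale A 1 B = B" if "B \<in> vecs A" for B c d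
  using that unfolding vecs_A by (elim imageE, simp add: cls_eq_iff sum_scl distrib_right)+
 show "vadd A B (vscale A 0 C) = B" if "B \<in> vecs A" "C \<in> vecs A" for B C
  using that unfolding vecs_A by (elim imageE) (simp_all add: cls_eq_iff sum_scl)
 show "vnorm A (vadd A B C) \<le> vnorm A B + vnorm A C" if BC: "B \<in> vecs A" "C \<in> vecs A" for B C
 proof -
  obtain ps qs where v: "valid ps" "B = cls ps" "valid qs" "C = cls qs" using BC unfolding vecs_A by auto
  have "vnorm A (vadd A B C) - vnorm A B \<le> cost qs'" if q: "valid qs'" "cls qs' = cls qs" for qs'
  proof -
   have "vnorm A (vadd A B C) - cost qs' \<le> cost ps'" if "valid ps'" "cls ps' = cls ps" for ps'
    using vnorm_A_le[of "ps' @ qs'"] A_add[OF that(1) q(1)] v q that by simp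
   then show ?thesis using vnorm_A_greatest[OF v(1), of "vnorm A (vadd A B C) - cost qs'"] v by simp
  qed
  then show ?thesis using vnorm_A_greatest[OF v(3), of "vnorm A (vadd A B C) - vnorm A B"] v by simp
 qed
 show "vnorm A (vscale A c B) = norm c * vnorm A B" if B: "B \<in> vecs A" for B c
 proof -
  obtain ps where v: "valid ps" "B = cls ps" using B unfolding vecs_A by auto
  have "norm c * vnorm A B \<le> vnorm A (vscale A c B)"
  proof (cases "c = 0")
   case True
   have "0 \<le> vnorm A (cls (scl c ps))" using v by (intro vnorm_A_greatest cost_nonneg) simp_all
   then show ?thesis using True v by simp
  next
   case False
   have "cls (scl (inverse c) (scl c ps)) = cls ps" using v False by (simp add: cls_eq_iff sum_scl)
   then have "vnorm A B \<le> norm (inverse c) * vnorm A (vscale A c B)"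
    using vnorm_A_scale_le[of "scl c ps" "inverse c"] v by simp
   from mult_left_mono[OF this norm_ge_zero[of c]] show ?thesis
    using False by (simp add: norm_inverse mult.assoc[symmetric])
  qed
  then show ?thesis using vnorm_A_scale_le[OF v(1), of c] v by simp
 qed
 \<comment> \<open>A tensor of norm 0 is annihilated by every bounded form, hence zero by
   separation.\<close>
 show "B = vscale A 0 B" if B: "B \<in> vecs A" "vnorm A B = 0" for B
 proof -
  obtain ps where v: "valid ps" "B = cls ps" using B unfolding vecs_A by auto
  have "(\<Sum>p\<leftarrow>ps. \<beta> p) = 0" if "bilinear_form X Y M \<beta>" for M \<beta>
   using norm_sum_le_vnorm[OF that v(1)] B(2) v(2) by simp
  then show ?thesis using v by (auto simp: cls_eq_iff sum_scl)
 qed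
qed

abbreviation "P \<equiv> X \<otimes>\<^sub>\<pi> Y"

lemma P_eq: "P = completion A"
 by (simp add: projective_tensor_def)

sublocale P: normed_nspace P
 unfolding P_eq by (rule A.normed_nspace_completion)

definition emb_tensor where "emb_tensor ps = A.compl_class (\<lambda>_. cls ps)"

lemma cls_in: "valid ps ==> cls ps \<in> vecs A"
 by (simp add: vecs_A)

lemma emb_tensor_in: "valid ps ==> emb_tensor ps \<in> vecs P"
 unfolding emb_tensor_def P_eq by (intro A.compl_class_in A.cauchy_const cls_in)

lemma emb_tensor_append:
 "valid ps ==> valid qs ==> emb_tensor (ps @ qs) = vadd P (emb_tensor ps) (emb_tensor qs)"
 unfolding emb_tensor_def P_eq using A.compl_add[OF A.cauchy_const[OF cls_in] A.cauchy_const[OF cls_in]]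
 by (simp add: A_add)

lemma emb_tensor_norm: "valid ps ==> vnorm P (emb_tensor ps) = vnorm A (cls ps)"
 using A.compl_norm[OF A.cauchy_const[OF cls_in, of ps]] by (simp add: emb_tensor_def P_eq LIMSEQ_const_iff)

definition elem_tensor where "elem_tensor x y = emb_tensor [(x, y)]"

lemma elem_tensor_in: "x \<in> vecs X ==> y \<in> vecs Y ==> elem_tensor x y \<in> vecs P"
 unfolding elem_tensor_def by (rule emb_tensor_in) simp

lemma elem_tensor_norm: "x \<in> vecs X ==> y \<in> vecs Y ==> vnorm P (elem_tensor x y) \<le> vnorm X x * vnorm Y y"
 using vnorm_A_le[of "[(x, y)]"] emb_tensor_norm[of "[(x, y)]"] by (simp add: elem_tensor_def)

lemma elem_tensor_add_left:
 assumes "x \<in> vecs X" "x' \<in> vecs X" "y \<in> vecs Y"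
 shows "elem_tensor (vadd X x x') y = vadd P (elem_tensor x y) (elem_tensor x' y)"
proof -
 have "cls [(vadd X x x', y)] = cls [(x, y), (x', y)]"
  using assms by (auto simp: cls_eq_iff bilinear_form_def)
 then show ?thesis
  using emb_tensor_append[of "[(x, y)]" "[(x', y)]"] assms by (simp add: elem_tensor_def emb_tensor_def)
qed

lemma elem_tensor_add_right:
 assumes "x \<in> vecs X" "y \<in> vecs Y" "y' \<in> vecs Y"
 shows "elem_tensor x (vadd Y y y') = vadd P (elem_tensor x y) (elem_tensor x y')"
proof -
 have "cls [(x, vadd Y y y')] = cls [(x, y), (x, y')]"
  using assms by (auto simp: cls_eq_iff bilinear_form_def)
 then show ?thesis
  using emb_tensor_append[of "[(x, y)]" "[(x, y')]"] assms by (simp add: elem_tensor_def emb_tensor_def)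
qed

lemma elem_tensor_scale:
 assumes "x \<in> vecs X" "y \<in> vecs Y"
 shows "elem_tensor (vscale X c x) y = vscale P c (elem_tensor x y)"
  and "elem_tensor x (vscale Y c y) = vscale P c (elem_tensor x y)"
proof -
 have "vscale P c (elem_tensor x y) = A.compl_class (\<lambda>_. cls [(vscale X c x, y)])"
  using A.compl_scale[OF A.cauchy_const[OF cls_in[of "[(x, y)]"]], of c] assms
  by (simp add: elem_tensor_def emb_tensor_def P_eq A_scale scl_def)
 moreover have "cls [(x, vscale Y c y)] = cls [(vscale X c x, y)]"
  using assms by (auto simp: cls_eq_iff bilinear_form_def)
 ultimately show "elem_tensor (vscale X c x) y = vscale P c (elem_tensor x y)"
  "elem_tensor x (vscale Y c y) = vscale P c (elem_tensor x y)"
  by (simp_all add: elem_tensor_def emb_tensor_def)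
qed

lemma emb_tensor_dense:
 assumes "z \<in> vecs P" "0 < e"
 obtains ps where "valid ps" "vdist P z (emb_tensor ps) < e"
proof -
 obtain a where a: "a \<in> vecs A" "vdist P z (A.compl_class (\<lambda>_. a)) < e"
  by (rule A.completion_dense[OF assms[unfolded P_eq]], rule that) (simp_all add: P_eq)
 then show thesis using that by (auto simp: vecs_A emb_tensor_def)
qed

definition functional :: "real => ((nat => ('v \<times> 'w \<Rightarrow>\<^sub>0 'k) set) set => 'k) => bool" where
 "functional C L \<longleftrightarrow> (\<forall>z\<in>vecs P. \<forall>w\<in>vecs P. L (vadd P z w) = L z + L w) \<and>
  (\<forall>z\<in>vecs P. \<forall>c. L (vscale P c z) = c * L z) \<and> (\<forall>z\<in>vecs P. norm (L z) \<le> C * vnorm P z)"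

lemma functional_emb:
 assumes "functional C L" "valid ps"
 shows "L (emb_tensor ps) = (\<Sum>(x, y)\<leftarrow>ps. L (elem_tensor x y))"
 using assms(2)
proof (induction ps)
 case Nil
 have "emb_tensor [] \<in> vecs P" by (rule emb_tensor_in) simp
 moreover have "vadd P (emb_tensor []) (emb_tensor []) = emb_tensor []" using emb_tensor_append[of "[]" "[]"] by simp
 ultimately have "L (emb_tensor []) = L (emb_tensor []) + L (emb_tensor [])"
  using assms(1) unfolding functional_def by metis
 then show ?case by simp
next
 case (Cons p ps)
 obtain x y where p: "p = (x, y)" by (cases p)
 have "emb_tensor (p # ps) = vadd P (elem_tensor x y) (emb_tensor ps)"
  using emb_tensor_append[of "[p]" ps] Cons.prems p by (simp add: elem_tensor_def)
 moreover have "elem_tensor x y \<in> vecs P" "emb_tensor ps \<in> vecs P"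
  using Cons.prems p by (auto intro: elem_tensor_in emb_tensor_in)
 ultimately have "L (emb_tensor (p # ps)) = L (elem_tensor x y) + L (emb_tensor ps)"
  using assms(1) unfolding functional_def by metis
 then show ?case using Cons p by simp
qed

lemma functional_diff:
 assumes "functional C L" "z \<in> vecs P" "w \<in> vecs P"
 shows "norm (L z - L w) \<le> C * vdist P z w"
proof -
 have "L (P.vdiff z w) = L z + (- 1) * L w"
  using assms P.scale_closed unfolding functional_def by metis
 moreover have "norm (L (P.vdiff z w)) \<le> C * vnorm P (P.vdiff z w)"
  using assms P.scale_closed P.add_closed unfolding functional_def by metis
 ultimately show ?thesis using assms by (simp add: P.vdist_eq)
qed

end

text \<open>The universal property of the projective tensor product. The form extends by continuity
  from algebraic tensors; completeness of the scalars makes its values along a Cauchy sequence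
  converge.\<close>

lemma tensor_pair_functional:
 fixes X :: "('k::{real_normed_field,banach}, 'v) nspace" and Y :: "('k, 'w) nspace"
 assumes "tensor_pair X Y" "bilinear_form X Y M \<beta>"
 shows "\<exists>L. tensor_pair.functional X Y M L \<and>
  (\<forall>x\<in>vecs X. \<forall>y\<in>vecs Y. L (tensor_pair.elem_tensor X Y x y) = \<beta> (x, y))"
proof -
 interpret tensor_pair X Y by (rule assms)
 let ?e = "tensor_eval \<beta>"
 define L where "L z = lim (\<lambda>n. ?e (A.compl_rep z n))" for z
 have M: "0 \<le> M" using assms(2) by (simp add: bilinear_form_def)
 have eadd: "?e (vadd A B C) = ?e B + ?e C" if "B \<in> vecs A" "C \<in> vecs A" for B C
  using that unfolding vecs_A
  by (auto simp: A_add tensor_eval_cls[OF assms(2)])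
 have esc: "?e (vscale A c B) = c * ?e B" if "B \<in> vecs A" for B c
  using that unfolding vecs_A
  by (auto simp: A_scale tensor_eval_cls[OF assms(2)] sum_scl[OF assms(2)])
 have eb: "norm (?e B) \<le> M * vnorm A B" if "B \<in> vecs A" for B
  using that norm_sum_le_vnorm[OF assms(2)] unfolding vecs_A by (auto simp: tensor_eval_cls[OF assms(2)])
 have ed: "norm (?e B - ?e C) \<le> M * vdist A B C" if "B \<in> vecs A" "C \<in> vecs A" for B C
  using eb[of "A.vdiff B C"] that by (simp add: eadd esc A.vdist_eq)
 have conv: "convergent (\<lambda>n. ?e (s n))" if s: "s \<in> cauchy_seqs A" for s
 proof -
  have "Cauchy (\<lambda>n. ?e (s n))"
  proof (rule metric_CauchyI)
   fix e :: real assume "0 < e"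
   then have "0 < e / (M + 1)" using M by simp
   then obtain N where N: "\<And>n n'. N \<le> n ==> N \<le> n' ==> vdist A (s n) (s n') < e / (M + 1)"
    using s unfolding A.cauchy_seqs_iff by meson
   have "dist (?e (s m)) (?e (s n)) < e" if "N \<le> m" "N \<le> n" for m n
   proof -
    have "dist (?e (s m)) (?e (s n)) \<le> M * vdist A (s m) (s n)"
     using ed A.cauchy_seqsD[OF s] by (simp add: dist_norm)
    also have "\<dots> \<le> (M + 1) * vdist A (s m) (s n)" by (simp add: distrib_right)
    also have "\<dots> < e" using N[OF that] M by (simp add: pos_less_divide_eq mult.commute)
    finally show ?thesis .
   qed
   then show "\<exists>N. \<forall>m\<ge>N. \<forall>n\<ge>N. dist (?e (s m)) (?e (s n)) < e" by blast
  qed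
  then show ?thesis by (rule Cauchy_convergent)
 qed
 have L: "(\<lambda>n. ?e (s n)) \<longlonglongrightarrow> L (A.compl_class s)" if s: "s \<in> cauchy_seqs A" for s
 proof -
  let ?r = "A.compl_rep (A.compl_class s)"
  have r: "?r \<in> cauchy_seqs A" "A.compl_class ?r = A.compl_class s"
   using A.compl_rep[OF A.compl_class_in[OF s]] by auto
  then have z: "(\<lambda>n. vdist A (s n) (?r n)) \<longlonglongrightarrow> 0" using A.compl_class_eq_iff[OF s r(1)] by simp
  have "(\<lambda>n. M * vdist A (s n) (?r n)) \<longlonglongrightarrow> 0" by (rule tendsto_mult_right_zero[OF z])
  then have "(\<lambda>n. ?e (s n) - ?e (?r n)) \<longlonglongrightarrow> 0"
   by (rule Lim_null_comparison[rotated])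
    (use ed A.cauchy_seqsD s r in "auto intro!: always_eventually")
  moreover have "(\<lambda>n. ?e (?r n)) \<longlonglongrightarrow> L (A.compl_class s)"
   using conv[OF r(1)] unfolding L_def convergent_LIMSEQ_iff .
  ultimately have "(\<lambda>n. (?e (s n) - ?e (?r n)) + ?e (?r n)) \<longlonglongrightarrow> 0 + L (A.compl_class s)"
   by (rule tendsto_add)
  then show ?thesis by simp
 qed
 have "functional M L"
  unfolding functional_def
 proof (intro conjI ballI allI)
  fix z assume "z \<in> vecs P"
  then obtain s where s: "s \<in> cauchy_seqs A" "z = A.compl_class s" unfolding P_eq A.vecs_completion by blast
  show "L (vscale P c z) = c * L z" for c
  proof (rule LIMSEQ_unique)
   show "(\<lambda>n. ?e (vscale A c (s n))) \<longlonglongrightarrow> L (vscale P c z)"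
    using L[OF A.cauchy_scale[OF s(1)]] s by (simp add: P_eq A.compl_scale)
   show "(\<lambda>n. ?e (vscale A c (s n))) \<longlonglongrightarrow> c * L z"
    using tendsto_mult_left[OF L[OF s(1)], of c] s by (simp add: esc A.cauchy_seqsD)
  qed
  have "(\<lambda>n. norm (?e (s n))) \<longlonglongrightarrow> norm (L z)" using s L by (auto intro: tendsto_norm)
  moreover have "(\<lambda>n. M * vnorm A (s n)) \<longlonglongrightarrow> M * vnorm P z"
   using s by (auto simp: P_eq intro!: tendsto_mult A.compl_norm)
  ultimately show "norm (L z) \<le> M * vnorm P z"
   by (rule LIMSEQ_le) (use eb A.cauchy_seqsD[OF s(1)] in blast)
  fix w assume "w \<in> vecs P"
  then obtain t where t: "t \<in> cauchy_seqs A" "w = A.compl_class t" unfolding P_eq A.vecs_completion by blast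
  show "L (vadd P z w) = L z + L w"
  proof (rule LIMSEQ_unique)
   show "(\<lambda>n. ?e (vadd A (s n) (t n))) \<longlonglongrightarrow> L (vadd P z w)"
    using L[OF A.cauchy_add[OF s(1) t(1)]] s t by (simp add: P_eq A.compl_add)
   show "(\<lambda>n. ?e (vadd A (s n) (t n))) \<longlonglongrightarrow> L z + L w"
    using tendsto_add[OF L[OF s(1)] L[OF t(1)]] s t by (simp add: eadd A.cauchy_seqsD)
  qed
 qed
 moreover have "L (elem_tensor x y) = \<beta> (x, y)" if "x \<in> vecs X" "y \<in> vecs Y" for x y
  using L[OF A.cauchy_const[OF cls_in[of "[(x, y)]"]]] that
  by (simp add: elem_tensor_def emb_tensor_def tensor_eval_cls[OF assms(2)] LIMSEQ_const_iff)
 ultimately show ?thesis by blast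
qed

text \<open>\<open>\<phi>\<close> acts on whole pairs, so that the same argument covers the product
  of two operators and the exchange of the factors.\<close>

lemma bounded_linear_map_tensor_push:
 assumes "tensor_pair X Y" "tensor_pair X' Y'"
  and im: "\<And>x y. x \<in> vecs X ==> y \<in> vecs Y ==> \<phi> (x, y) \<in> vecs X' \<times> vecs Y'"
  and form: "\<And>M \<beta>. bilinear_form X' Y' M \<beta> ==> bilinear_form X Y (M * C) (\<lambda>p. \<beta> (\<phi> p))"
  and bound: "0 \<le> C" "\<And>x y. x \<in> vecs X ==> y \<in> vecs Y ==>
   vnorm X' (fst (\<phi> (x, y))) * vnorm Y' (snd (\<phi> (x, y))) \<le> C * (vnorm X x * vnorm Y y)"
 shows "\<exists>T. bounded_linear_map (algebraic_tensor X Y) (algebraic_tensor X' Y') T \<and>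
  (\<forall>ps. set ps \<subseteq> vecs X \<times> vecs Y --> T (tensor_pair.cls X Y ps) = tensor_pair.cls X' Y' (map \<phi> ps))"
proof -
 interpret X: tensor_pair X Y by (rule assms)
 interpret Y: tensor_pair X' Y' by (rule assms)
 define T where "T B = Y.cls (map \<phi> (SOME ps. X.valid ps \<and> X.cls ps = B))" for B
 have v: "Y.valid (map \<phi> ps)" if "X.valid ps" for ps using that im by force
 have eq: "Y.cls (map \<phi> ps) = Y.cls (map \<phi> qs)" if "X.valid ps" "X.valid qs" "X.cls ps = X.cls qs" for ps qs
  unfolding Y.cls_eq_iff[OF v[OF that(1)] v[OF that(2)]] using that X.cls_eq_iff[OF that(1,2)] form
  by (fastforce simp: comp_def)
 have T: "T (X.cls ps) = Y.cls (map \<phi> ps)" if "X.valid ps" for ps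
  unfolding T_def using someI[of "\<lambda>qs. X.valid qs \<and> X.cls qs = X.cls ps" ps] eq that by blast
 have "bounded_linear_map X.A Y.A T"
 proof (rule bounded_linear_mapI[where C = C])
  fix B assume "B \<in> vecs X.A"
  then obtain ps where ps: "X.valid ps" "B = X.cls ps" by (auto simp: X.vecs_A)
  show "T B \<in> vecs Y.A" using ps T v Y.cls_in by simp
  show "T (vscale X.A c B) = vscale Y.A c (T B)" for c
  proof -
   have "(\<Sum>p\<leftarrow>X.scl c ps. \<beta> (\<phi> p)) = (\<Sum>p\<leftarrow>Y.scl c (map \<phi> ps). \<beta> p)" if "bilinear_form X' Y' M \<beta>" for M \<beta>
    using X.sum_scl[OF form[OF that] ps(1)] Y.sum_scl[OF that v[OF ps(1)]] by (simp add: comp_def)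
   then show ?thesis using ps T v by (simp add: X.A_scale Y.A_scale Y.cls_eq_iff comp_def)
  qed
  show "vnorm Y.A (T B) \<le> C * vnorm X.A B"
   unfolding ps(2)
  proof (rule X.vnorm_A_bound[OF ps(1) bound(1)])
   fix qs assume qs: "X.valid qs" "X.cls qs = X.cls ps"
   have "vnorm Y.A (T (X.cls ps)) \<le> Y.cost (map \<phi> qs)"
    using Y.vnorm_A_le[OF v[OF qs(1)]] T[OF qs(1)] qs(2) by simp
   also have "\<dots> \<le> C * X.cost qs"
    using qs(1)
   proof (induction qs)
    case (Cons p qs)
    then show ?case
     using bound(2)[of "fst p" "snd p"] by (auto simp: case_prod_unfold distrib_left intro!: add_mono)
   qed simp
   finally show "vnorm Y.A (T (X.cls ps)) \<le> C * X.cost qs" .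
  qed
  fix B' assume "B' \<in> vecs X.A"
  then obtain qs where "X.valid qs" "B' = X.cls qs" by (auto simp: X.vecs_A)
  then show "T (vadd X.A B B') = vadd Y.A (T B) (T B')" using ps T v by (simp add: X.A_add Y.A_add)
 qed (rule bound)
 then show ?thesis using T by blast
qed

lemma linearly_homeomorphic_tensor_push:
 assumes t: "tensor_pair X Y" "tensor_pair X' Y'"
  and "\<And>x y. x \<in> vecs X ==> y \<in> vecs Y ==> \<phi> (x, y) \<in> vecs X' \<times> vecs Y'"
  and "\<And>M \<beta>. bilinear_form X' Y' M \<beta> ==> bilinear_form X Y (M * C) (\<lambda>p. \<beta> (\<phi> p))"
  and "0 \<le> C" "\<And>x y. x \<in> vecs X ==> y \<in> vecs Y ==>
   vnorm X' (fst (\<phi> (x, y))) * vnorm Y' (snd (\<phi> (x, y))) \<le> C * (vnorm X x * vnorm Y y)"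
  and "\<And>x y. x \<in> vecs X' ==> y \<in> vecs Y' ==> \<psi> (x, y) \<in> vecs X \<times> vecs Y"
  and "\<And>M \<beta>. bilinear_form X Y M \<beta> ==> bilinear_form X' Y' (M * D) (\<lambda>p. \<beta> (\<psi> p))"
  and "0 \<le> D" "\<And>x y. x \<in> vecs X' ==> y \<in> vecs Y' ==>
   vnorm X (fst (\<psi> (x, y))) * vnorm Y (snd (\<psi> (x, y))) \<le> D * (vnorm X' x * vnorm Y' y)"
  and inv: "\<And>x y. x \<in> vecs X ==> y \<in> vecs Y ==> \<psi> (\<phi> (x, y)) = (x, y)"
   "\<And>x y. x \<in> vecs X' ==> y \<in> vecs Y' ==> \<phi> (\<psi> (x, y)) = (x, y)"
 shows "linearly_homeomorphic (X \<otimes>\<^sub>\<pi> Y) (X' \<otimes>\<^sub>\<pi> Y')"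
proof -
 interpret X: tensor_pair X Y by (rule t)
 interpret Y: tensor_pair X' Y' by (rule t)
 obtain T where T: "bounded_linear_map X.A Y.A T" "\<And>ps. X.valid ps ==> T (X.cls ps) = Y.cls (map \<phi> ps)"
  using bounded_linear_map_tensor_push[OF t assms(3-6)] by blast
 obtain S where S: "bounded_linear_map Y.A X.A S" "\<And>ps. Y.valid ps ==> S (Y.cls ps) = X.cls (map \<psi> ps)"
  using bounded_linear_map_tensor_push[OF t(2,1) assms(7-10)] by blast
 have v: "Y.valid (map \<phi> ps)" "map \<psi> (map \<phi> ps) = ps" if "X.valid ps" for ps
  using that assms(3) inv(1) by (induction ps) auto
 have w: "X.valid (map \<psi> ps)" "map \<phi> (map \<psi> ps) = ps" if "Y.valid ps" for ps
  using that assms(7) inv(2) by (induction ps) auto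
 show ?thesis
  unfolding projective_tensor_def
 proof (rule linearly_homeomorphic_completion[OF X.A.normed_nspace_axioms Y.A.normed_nspace_axioms T(1) S(1)])
  show "S (T B) = B" if "B \<in> vecs X.A" for B
   using that v by (auto simp: X.vecs_A T(2) S(2) simp del: map_map)
  show "T (S B) = B" if "B \<in> vecs Y.A" for B
   using that w by (auto simp: Y.vecs_A T(2) S(2) simp del: map_map)
 qed
qed

lemma bilinear_form_map:
 assumes X: "normed_nspace X" "normed_nspace X'" and Y: "normed_nspace Y" "normed_nspace Y'"
  and T: "bounded_linear_map X X' T" and S: "bounded_linear_map Y Y' S"
 obtains C where "0 \<le> C"
  "\<forall>x\<in>vecs X. \<forall>y\<in>vecs Y. vnorm X' (T x) * vnorm Y' (S y) \<le> C * (vnorm X x * vnorm Y y)"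
  "\<forall>M \<beta>. bilinear_form X' Y' M \<beta> --> bilinear_form X Y (M * C) (\<lambda>p. \<beta> (map_prod T S p))"
proof -
 note D = bounded_linear_mapD[OF T] bounded_linear_mapD[OF S]
 obtain c where c: "0 < c" "\<And>x. x \<in> vecs X ==> vnorm X' (T x) \<le> c * vnorm X x"
  by (rule bounded_linear_map_bound[OF T X(1)], rule that)
 obtain c' where c': "0 < c'" "\<And>y. y \<in> vecs Y ==> vnorm Y' (S y) \<le> c' * vnorm Y y"
  by (rule bounded_linear_map_bound[OF S Y(1)], rule that)
 have b: "vnorm X' (T x) * vnorm Y' (S y) \<le> c * c' * (vnorm X x * vnorm Y y)" if "x \<in> vecs X" "y \<in> vecs Y" for x y
 proof -
  have "vnorm X' (T x) * vnorm Y' (S y) \<le> (c * vnorm X x) * (c' * vnorm Y y)"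
   using that c c' D normed_nspace.norm_nonneg[OF X(1)] normed_nspace.norm_nonneg[OF Y(2)]
   by (intro mult_mono) auto
  then show ?thesis by (simp add: mult_ac)
 qed
 have "bilinear_form X Y (M * (c * c')) (\<lambda>p. \<beta> (map_prod T S p))" if \<beta>: "bilinear_form X' Y' M \<beta>" for M \<beta>
 proof -
  have M: "0 \<le> M" using \<beta> by (simp add: bilinear_form_def)
  have "norm (\<beta> (T x, S y)) \<le> M * (c * c') * (vnorm X x * vnorm Y y)" if xy: "x \<in> vecs X" "y \<in> vecs Y" for x y
  proof -
   have "norm (\<beta> (T x, S y)) \<le> M * (vnorm X' (T x) * vnorm Y' (S y))"
    using \<beta> D xy by (simp add: bilinear_form_def)
   also have "\<dots> \<le> M * (c * c' * (vnorm X x * vnorm Y y))" by (rule mult_left_mono[OF b[OF xy] M])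
   finally show ?thesis by (simp only: mult.assoc)
  qed
  then show ?thesis using \<beta> D M c(1) c'(1) by (simp add: bilinear_form_def)
 qed
 then show thesis using that[of "c * c'"] b c(1) c'(1) by simp
qed

theorem linearly_homeomorphic_tensor_cong:
 assumes t: "tensor_pair X Y" "tensor_pair X' Y'"
  and "linearly_homeomorphic X X'" "linearly_homeomorphic Y Y'"
 shows "linearly_homeomorphic (X \<otimes>\<^sub>\<pi> Y) (X' \<otimes>\<^sub>\<pi> Y')"
proof -
 note n = t[unfolded tensor_pair_def, THEN conjunct1] t[unfolded tensor_pair_def, THEN conjunct2, THEN conjunct1]
 obtain T S where T: "bounded_linear_map X X' T" "bounded_linear_map X' X S"
  "\<And>x. x \<in> vecs X ==> S (T x) = x" "\<And>y. y \<in> vecs X' ==> T (S y) = y"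
  by (rule linearly_homeomorphicE[OF assms(3) n(1,2)], rule that)
 obtain T' S' where T': "bounded_linear_map Y Y' T'" "bounded_linear_map Y' Y S'"
  "\<And>x. x \<in> vecs Y ==> S' (T' x) = x" "\<And>y. y \<in> vecs Y' ==> T' (S' y) = y"
  by (rule linearly_homeomorphicE[OF assms(4) n(3,4)], rule that)
 obtain C where C: "0 \<le> C"
  "\<forall>x\<in>vecs X. \<forall>y\<in>vecs Y. vnorm X' (T x) * vnorm Y' (T' y) \<le> C * (vnorm X x * vnorm Y y)"
  "\<forall>M \<beta>. bilinear_form X' Y' M \<beta> --> bilinear_form X Y (M * C) (\<lambda>p. \<beta> (map_prod T T' p))"
  by (rule bilinear_form_map[OF n T(1) T'(1)])
 obtain D where D: "0 \<le> D"
  "\<forall>x\<in>vecs X'. \<forall>y\<in>vecs Y'. vnorm X (S x) * vnorm Y (S' y) \<le> D * (vnorm X' x * vnorm Y' y)"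
  "\<forall>M \<beta>. bilinear_form X Y M \<beta> --> bilinear_form X' Y' (M * D) (\<lambda>p. \<beta> (map_prod S S' p))"
  by (rule bilinear_form_map[OF n(2,1) n(4,3) T(2) T'(2)])
 show ?thesis
  by (rule linearly_homeomorphic_tensor_push[OF t, of "map_prod T T'" C "map_prod S S'" D])
   (use C D T T' bounded_linear_mapD(1)[OF T(1)] bounded_linear_mapD(1)[OF T(2)]
    bounded_linear_mapD(1)[OF T'(1)] bounded_linear_mapD(1)[OF T'(2)] in "simp_all add: mem_Times_iff")
qed

theorem linearly_homeomorphic_tensor_swap:
 assumes t: "tensor_pair X Y" "tensor_pair Y X"
 shows "linearly_homeomorphic (X \<otimes>\<^sub>\<pi> Y) (Y \<otimes>\<^sub>\<pi> X)"
 by (rule linearly_homeomorphic_tensor_push[OF t, of prod.swap 1 prod.swap 1])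
  (auto simp: bilinear_form_def mult.commute)

subsection \<open>Tensor products of spaces of continuous functions\<close>

abbreviation CF :: "'a::topological_space set => ('k::real_normed_field, 'a => 'k) nspace" where
 "CF K \<equiv> continuous_functions K"

lemma vecs_CF: "vecs (CF K) = cfun K"
 by (simp add: continuous_functions_def cont_vanish_def)

lemma CF_ops [simp]:
 "vadd (CF K) = (\<lambda>f g x. f x + g x)" "vscale (CF K) = (\<lambda>c f x. c * f x)"
 by (simp_all add: continuous_functions_def)

lemma cont_vanish_ops [simp]:
 "f \<in> cont_vanish K E ==> g \<in> cont_vanish K E ==> (\<lambda>x. f x + g x) \<in> cont_vanish K E"
 "f \<in> cont_vanish K E ==> (\<lambda>x. c * f x) \<in> cont_vanish K E"
 "(\<lambda>x. 0) \<in> cont_vanish K E"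
 using fun_subspace_cont_vanish[of K E] unfolding fun_subspace_def by blast+

lemma cont_vanish_sum: "(\<And>i. i \<in> I ==> f i \<in> cont_vanish K E) ==> (\<lambda>x. \<Sum>i\<in>I. f i x) \<in> cont_vanish K E"
 by (induction I rule: infinite_finite_induct) simp_all

lemma CF_norm_ge:
 assumes "compact K" "f \<in> cfun K" "K \<noteq> {}"
 shows "norm (f x) \<le> vnorm (CF K) f"
proof -
 have "compact ((\<lambda>x. norm (f x)) ` K)"
  using assms by (intro compact_continuous_image continuous_on_norm) (auto simp: cont_vanish_def)
 then have bdd: "bdd_above ((\<lambda>x. norm (f x)) ` K)" by (intro bounded_imp_bdd_above compact_imp_bounded)
 have *: "norm (f x) \<le> vnorm (CF K) f" if "x \<in> K" for x
  unfolding continuous_functions_def using cSUP_upper[OF that bdd] by simp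
 obtain z where "z \<in> K" using assms(3) by blast
 then have "0 \<le> vnorm (CF K) f" using *[of z] norm_ge_zero order_trans by blast
 then show ?thesis using * assms(2) by (cases "x \<in> K") (auto simp: cont_vanish_def)
qed

lemma CF_norm_le: "K \<noteq> {} ==> (\<And>x. x \<in> K ==> norm (f x) \<le> b) ==> vnorm (CF K) f \<le> b"
 unfolding continuous_functions_def by (auto intro: cSUP_least)

lemma normed_nspace_CF:
 fixes K :: "'a::topological_space set"
 assumes K: "compact K" "K \<noteq> {}"
 shows "normed_nspace (CF K :: ('k::real_normed_field, 'a => 'k) nspace)"
proof
 let ?X = "CF K :: ('k, 'a => 'k) nspace"
 note ge = CF_norm_ge[OF K(1) _ K(2)]
 show "vnorm ?X (vadd ?X f g) \<le> vnorm ?X f + vnorm ?X g" if "f \<in> vecs ?X" "g \<in> vecs ?X" for f g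
  using that ge unfolding vecs_CF
  by (intro CF_norm_le K) (auto intro!: order_trans[OF norm_triangle_ineq] add_mono)
 have le: "vnorm ?X (vscale ?X c f) \<le> norm c * vnorm ?X f" if "f \<in> vecs ?X" for f c
  using that ge unfolding vecs_CF
  by (intro CF_norm_le K) (auto simp: norm_mult intro!: mult_left_mono)
 show "vnorm ?X (vscale ?X c f) = norm c * vnorm ?X f" if f: "f \<in> vecs ?X" for f c
 proof (rule antisym[OF le[OF f]])
  show "norm c * vnorm ?X f \<le> vnorm ?X (vscale ?X c f)"
  proof (cases "c = 0")
   case True
   obtain z where z: "z \<in> K" using K by blast
   have "norm (vscale ?X c f z) \<le> vnorm ?X (vscale ?X c f)"
    using f by (intro ge) (simp add: vecs_CF)
   then show ?thesis using True by simp
  next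
   case False
   have "vnorm ?X f = vnorm ?X (vscale ?X (inverse c) (vscale ?X c f))" using False by (simp add: mult.assoc[symmetric])
   also have "\<dots> \<le> norm (inverse c) * vnorm ?X (vscale ?X c f)" using f by (intro le) (simp add: vecs_CF)
   finally have "norm c * vnorm ?X f \<le> norm c * (norm (inverse c) * vnorm ?X (vscale ?X c f))"
    by (rule mult_left_mono) simp
   also have "\<dots> = norm (c * inverse c) * vnorm ?X (vscale ?X c f)" by (simp only: norm_mult mult.assoc)
   finally show ?thesis using False by simp
  qed
 qed
 show "f = vscale ?X 0 f" if "f \<in> vecs ?X" "vnorm ?X f = 0" for f
 proof
  fix x show "f x = vscale ?X 0 f x" using ge[of f x] that by (simp add: vecs_CF)
 qed
qed (auto simp: vecs_CF algebra_simps)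

text \<open>Elimination on the length of the list. If the first second factor \<open>g\<close> is
  nonzero at \<open>l0\<close>, multiples of it make the other second factors vanish at
  \<open>l0\<close>; the price is a multiple of \<open>g\<close> tensored with the combination
  \<open>comb\<close> of the other first factors. Evaluation at \<open>l0\<close> shows that
  \<open>f\<close> is this combination, so the first pair is absorbed and a shorter list
  remains.\<close>

lemma list_tensor_relations:
 assumes "set ps \<subseteq> vecs (CF K) \<times> vecs (CF L)" "\<And>k l. (\<Sum>(f, g)\<leftarrow>ps. f k * g l) = 0"
 shows "list_tensor ps \<in> bilinear_relations (CF K :: ('k::real_normed_field, _) nspace) (CF L)"
 using assms
proof (induction "length ps" arbitrary: ps)
 case 0
 then show ?case by (simp add: bilinear_relations.zero)
next
 case (Suc n)
 let ?R = "bilinear_relations (CF K :: ('k, _) nspace) (CF L)"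
 obtain f g qs where ps: "ps = (f, g) # qs" using Suc.hyps(2) by (metis Suc_length_conv surj_pair)
 have fg: "f \<in> vecs (CF K)" "g \<in> vecs (CF L)" and qs: "set qs \<subseteq> vecs (CF K) \<times> vecs (CF L)"
  using Suc.prems(1) ps by auto
 have zero: "free_gen (\<lambda>_. 0) h \<in> ?R" "free_gen f (\<lambda>_. 0) \<in> ?R" if "h \<in> vecs (CF L)" for h
  using bilinear_relations.scale_left[OF fg(1) that, of 0] bilinear_relations.scale_right[OF fg, of 0] by simp_all
 show ?case
 proof (cases "\<forall>l. g l = 0")
  case True
  then have "list_tensor qs \<in> ?R" using Suc ps qs by (intro Suc.hyps(1)) auto
  moreover have "g = (\<lambda>_. 0)" using True by auto
  ultimately show ?thesis using ps zero(2)[OF fg(2)] by (simp add: bilinear_relations.add)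
 next
  case False
  then obtain l0 where l0: "g l0 \<noteq> 0" by blast
  define c where "c p = - (snd p l0 / g l0)" for p :: "('a => 'k) \<times> ('b => 'k)"
  define upd where "upd p = (fst p, \<lambda>l. snd p l + c p * g l)" for p
  define comb where "comb qs = (\<lambda>k. \<Sum>p\<leftarrow>qs. c p * fst p k)" for qs
  have comb_in: "comb qs \<in> vecs (CF K)" if "set qs \<subseteq> vecs (CF K) \<times> vecs (CF L)" for qs
   using that by (induction qs) (auto simp: comb_def vecs_CF)
  have key: "free_gen (comb qs) g + list_tensor qs - list_tensor (map upd qs) \<in> ?R"
   if "set qs \<subseteq> vecs (CF K) \<times> vecs (CF L)" for qs
   using that
  proof (induction qs)
   case Nil
   then show ?case using zero(1)[OF fg(2)] by (simp add: comb_def)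
  next
   case (Cons p qs)
   obtain a b where p: "p = (a, b)" by (cases p)
   have ab: "a \<in> vecs (CF K)" "b \<in> vecs (CF L)" using Cons.prems p by auto
   have cq: "comb qs \<in> vecs (CF K)" using Cons.prems comb_in by auto
   have ca: "(\<lambda>k. c p * a k) \<in> vecs (CF K)" and cg: "(\<lambda>l. c p * g l) \<in> vecs (CF L)"
    using ab fg by (simp_all add: vecs_CF)
   have 1: "free_gen (comb (p # qs)) g - (free_gen (\<lambda>k. c p * a k) g + free_gen (comb qs) g) \<in> ?R"
    using bilinear_relations.add_left[OF ca cq fg(2)] by (simp add: comb_def p)
   have 2: "free_gen (\<lambda>k. c p * a k) g - free_scale (c p) (free_gen a g) \<in> ?R"
    using bilinear_relations.scale_left[OF ab(1) fg(2), of "c p"] by simp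
   have 3: "free_scale (- 1) (free_gen a (\<lambda>l. c p * g l) - free_scale (c p) (free_gen a g)) \<in> ?R"
    using bilinear_relations.scale[OF bilinear_relations.scale_right[OF ab(1) fg(2), of "c p"]] by simp
   have 4: "free_scale (- 1) (free_gen a (\<lambda>l. b l + c p * g l) - (free_gen a b + free_gen a (\<lambda>l. c p * g l))) \<in> ?R"
    using bilinear_relations.scale[OF bilinear_relations.add_right[OF ab cg]] by simp
   have 5: "free_gen (comb qs) g + list_tensor qs - list_tensor (map upd qs) \<in> ?R"
    using Cons by simp
   have "(free_gen (comb (p # qs)) g - (free_gen (\<lambda>k. c p * a k) g + free_gen (comb qs) g)) +
    ((free_gen (\<lambda>k. c p * a k) g - free_scale (c p) (free_gen a g)) +
    (free_scale (- 1) (free_gen a (\<lambda>l. c p * g l) - free_scale (c p) (free_gen a g)) +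
    (free_scale (- 1) (free_gen a (\<lambda>l. b l + c p * g l) - (free_gen a b + free_gen a (\<lambda>l. c p * g l))) +
    (free_gen (comb qs) g + list_tensor qs - list_tensor (map upd qs))))) \<in> ?R"
    by (intro bilinear_relations.add 1 2 3 4 5)
   moreover have "upd p = (a, \<lambda>l. b l + c p * g l)" by (simp add: upd_def p)
   moreover have "p = (a, b)" by (rule p)
   ultimately show ?case unfolding free_scale_minus_one by (simp add: algebra_simps)
  qed
  have f: "f = comb qs"
  proof
   fix k
   have "f k * g l0 + (\<Sum>(f, g)\<leftarrow>qs. f k * g l0) = 0" using Suc.prems(2)[of k l0] ps by simp
   moreover have "(\<Sum>(f, g)\<leftarrow>qs. f k * g l0) = - (comb qs k * g l0)"
    using l0 by (induction qs) (simp_all add: comb_def c_def case_prod_unfold algebra_simps)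
   ultimately have "f k * g l0 = comb qs k * g l0" by simp
   then show "f k = comb qs k" using l0 by simp
  qed
  have "list_tensor (map upd qs) \<in> ?R"
  proof (rule Suc.hyps(1))
   show "n = length (map upd qs)" using Suc.hyps(2) ps by simp
   show "set (map upd qs) \<subseteq> vecs (CF K) \<times> vecs (CF L)"
    using qs fg(2) by (auto simp: upd_def vecs_CF)
   fix k l
   have "(\<Sum>(f, g)\<leftarrow>map upd qs. f k * g l) = (\<Sum>(f, g)\<leftarrow>qs. f k * g l) + comb qs k * g l"
    by (induction qs) (simp_all add: comb_def upd_def case_prod_unfold algebra_simps)
   also have "\<dots> = 0" using Suc.prems(2)[of k l] ps f by (simp add: add.commute)
   finally show "(\<Sum>(f, g)\<leftarrow>map upd qs. f k * g l) = 0" .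
  qed
  from bilinear_relations.add[OF key[OF qs] this] show ?thesis using ps f by simp
 qed
qed

lemma bilinear_form_point:
 assumes "compact K" "K \<noteq> {}" "compact L" "L \<noteq> {}"
 shows "bilinear_form (CF K :: ('k::real_normed_field, _) nspace) (CF L) 1 (\<lambda>(f, g). f k * g l)"
 unfolding bilinear_form_def
 using assms by (auto simp: vecs_CF algebra_simps norm_mult intro!: mult_mono CF_norm_ge order_trans[OF norm_ge_zero])

text \<open>Evaluations at pairs of points are bounded forms, and they already separate
  tensors.\<close>

lemma tensor_pair_CF:
 fixes K :: "'a::topological_space set" and L :: "'b::topological_space set"
 assumes "compact K" "K \<noteq> {}" "compact L" "L \<noteq> {}"
 shows "tensor_pair (CF K :: ('k::real_normed_field, 'a => 'k) nspace) (CF L)"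
proof -
 interpret X: normed_nspace "CF K :: ('k, 'a => 'k) nspace" by (rule normed_nspace_CF[OF assms(1,2)])
 interpret Y: normed_nspace "CF L :: ('k, 'b => 'k) nspace" by (rule normed_nspace_CF[OF assms(3,4)])
 show ?thesis
 proof
  fix ps assume ps: "set ps \<subseteq> vecs (CF K) \<times> vecs (CF L)"
   and "\<And>M \<beta>. bilinear_form (CF K :: ('k, 'a => 'k) nspace) (CF L) M \<beta> ==> (\<Sum>p\<leftarrow>ps. \<beta> p) = 0"
  from this(2)[OF bilinear_form_point[OF assms]]
  show "list_tensor ps \<in> bilinear_relations (CF K) (CF L)"
   by (intro list_tensor_relations[OF ps]) (simp add: case_prod_unfold)
 qed
qed

lemma bounded_linear_map_CF:
 fixes A :: "'a::topological_space set" and B :: "'b::topological_space set"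
 assumes F: "bounded_lin (cfun A :: ('a => 'k::real_normed_field) set) (cfun B) F"
  and A: "compact A" "A \<noteq> {}" "B \<noteq> {}"
 shows "bounded_linear_map (CF A) (CF B) F"
proof -
 obtain C where C: "0 < C" "\<And>f b y. f \<in> cfun A ==> (\<And>x. norm (f x) \<le> b) ==> norm (F f y) \<le> C * b"
  using bounded_lin_bound[OF F] by blast
 show ?thesis
 proof (rule bounded_linear_mapI[where C = C])
  fix f assume "f \<in> vecs (CF A :: ('k, 'a => 'k) nspace)"
  then show "vnorm (CF B) (F f) \<le> C * vnorm (CF A) f"
   using CF_norm_ge[OF A(1) _ A(2), of f] by (intro CF_norm_le A C(2)) (simp_all add: vecs_CF)
 qed (use C(1) bounded_linD[OF F] in "simp_all add: vecs_CF")
qed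

lemma linearly_homeomorphic_CF:
 fixes K :: "'a::topological_space set" and K' :: "'b::topological_space set"
 assumes K: "compact K" "K \<noteq> {}" and K': "compact K'" "K' \<noteq> {}"
  and iso: "(cfun K :: ('a => 'k::real_normed_field) set) \<simeq> cfun K'"
 shows "linearly_homeomorphic (CF K :: ('k, 'a => 'k) nspace) (CF K')"
proof -
 obtain F G where F: "bounded_lin (cfun K :: ('a => 'k) set) (cfun K') F"
  "bounded_lin (cfun K' :: ('b => 'k) set) (cfun K) G"
  "\<And>f. f \<in> cfun K ==> G (F f) = f" "\<And>g. g \<in> cfun K' ==> F (G g) = g"
  using iso unfolding fun_iso_def by blast
 show ?thesis
  by (rule linearly_homeomorphicI[OF normed_nspace_CF[OF K] normed_nspace_CF[OF K'] bounded_linear_map_CF[OF F(1) K K'(2)] bounded_linear_map_CF[OF F(2) K' K(2)]])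
   (use F in "simp_all add: vecs_CF")
qed

lemma cont_vanish_homeomorphism:
 assumes "homeomorphism K K' f k"
 shows "(cfun K :: ('a::topological_space => 'k::real_normed_field) set) \<simeq> cont_vanish (K' :: 'b::topological_space set) {}"
proof -
 let ?F = "\<lambda>g y. if y \<in> K' then g (k y) else (0 :: 'k)" and ?G = "\<lambda>g x. if x \<in> K then g (f x) else (0 :: 'k)"
 have h: "continuous_on K f" "f ` K = K'" "continuous_on K' k" "k ` K' = K" "\<And>x. x \<in> K ==> k (f x) = x"
  "\<And>y. y \<in> K' ==> f (k y) = y"
  using assms by (auto simp: homeomorphism_def)
 have "bounded_lin (cfun K) (cfun K') ?F"
 proof (rule bounded_linI[where C = 1])
  fix g :: "'a => 'k" assume "g \<in> cfun K"
  then have "continuous_on K' (\<lambda>y. g (k y))"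
   using h by (intro continuous_on_compose2[of K g K' k]) (auto simp: cont_vanish_def)
  then show "?F g \<in> cfun K'" by (simp add: cont_vanish_def cong: continuous_on_cong)
 next
  fix g :: "'a => 'k" and b y assume "\<And>x. norm (g x) \<le> b"
  moreover from this have "0 \<le> b" using norm_ge_zero order_trans by blast
  ultimately show "norm (?F g y) \<le> 1 * b" by simp
 qed (auto simp: fun_eq_iff)
 moreover have "bounded_lin (cfun K') (cfun K) ?G"
 proof (rule bounded_linI[where C = 1])
  fix g :: "'b => 'k" assume "g \<in> cfun K'"
  then have "continuous_on K (\<lambda>y. g (f y))"
   using h by (intro continuous_on_compose2[of K' g K f]) (auto simp: cont_vanish_def)
  then show "?G g \<in> cfun K" by (simp add: cont_vanish_def cong: continuous_on_cong)
 next
  fix g :: "'b => 'k" and b x assume "\<And>y. norm (g y) \<le> b"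
  moreover from this have "0 \<le> b" using norm_ge_zero order_trans by blast
  ultimately show "norm (?G g x) \<le> 1 * b" by simp
 qed (auto simp: fun_eq_iff)
 moreover have "?G (?F g) = g" if "g \<in> cfun K" for g
  using that h by (auto simp: fun_eq_iff cont_vanish_def)
 moreover have "?F (?G g) = g" if "g \<in> cfun K'" for g
  using that h by (auto simp: fun_eq_iff cont_vanish_def)
 ultimately show ?thesis unfolding fun_iso_def by blast
qed

subsection \<open>Random signs\<close>

text \<open>A subset \<open>B\<close> of the index set encodes the choice of signs that is \<open>1\<close> on \<open>B\<close> and \<open>-1\<close> elsewhere.\<close>

definition sgn_of :: "'i set => 'i => real" where
 "sgn_of B i = (if i \<in> B then 1 else - 1)"

lemma sgn_of_square [simp]: "sgn_of B i * sgn_of B i = 1"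
 by (simp add: sgn_of_def)

lemma abs_sgn_of [simp]: "\<bar>sgn_of B i\<bar> = 1"
 by (simp add: sgn_of_def)

lemma sum_Pow_insert:
 assumes "finite I" "a \<notin> I"
 shows "(\<Sum>B\<in>Pow (insert a I). f B) = (\<Sum>B\<in>Pow I. f B + f (insert a B))"
proof -
 have "inj_on (insert a) (Pow I)" using assms(2) by (auto simp: inj_on_def)
 moreover have "Pow I \<inter> insert a ` Pow I = {}" using assms(2) by auto
 ultimately show ?thesis
  using assms(1) by (simp add: Pow_insert sum.union_disjoint sum.reindex sum.distrib)
qed

lemma sign_sum_insert:
 fixes t :: "'i => 'v::real_vector"
 assumes "finite I" "a \<notin> I" "B \<subseteq> I"
 shows "(\<Sum>i\<in>insert a I. sgn_of B i *\<^sub>R t i) = (\<Sum>i\<in>I. sgn_of B i *\<^sub>R t i) - t a"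
  and "(\<Sum>i\<in>insert a I. sgn_of (insert a B) i *\<^sub>R t i) = (\<Sum>i\<in>I. sgn_of B i *\<^sub>R t i) + t a"
proof -
 have "(\<Sum>i\<in>I. sgn_of (insert a B) i *\<^sub>R t i) = (\<Sum>i\<in>I. sgn_of B i *\<^sub>R t i)"
  using assms(2) by (intro sum.cong) (auto simp: sgn_of_def)
 moreover have "a \<notin> B" using assms by auto
 ultimately show "(\<Sum>i\<in>insert a I. sgn_of B i *\<^sub>R t i) = (\<Sum>i\<in>I. sgn_of B i *\<^sub>R t i) - t a"
  "(\<Sum>i\<in>insert a I. sgn_of (insert a B) i *\<^sub>R t i) = (\<Sum>i\<in>I. sgn_of B i *\<^sub>R t i) + t a"
  using assms(1,2) by (simp_all add: sgn_of_def)
qed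

text \<open>The parallelogram law, applied to the two signs of each new index.\<close>

lemma sign_sum_second_moment:
 fixes t :: "'i => 'v::real_inner"
 assumes "finite I"
 shows "(\<Sum>B\<in>Pow I. (norm (\<Sum>i\<in>I. sgn_of B i *\<^sub>R t i))\<^sup>2) = 2 ^ card I * (\<Sum>i\<in>I. (norm (t i))\<^sup>2)"
 using assms
proof (induction I rule: finite_induct)
 case (insert a I)
 have "(norm (x - t a))\<^sup>2 + (norm (x + t a))\<^sup>2 = 2 * (norm x)\<^sup>2 + 2 * (norm (t a))\<^sup>2" for x
  by (simp add: power2_norm_eq_inner inner_diff_left inner_diff_right inner_add_left inner_add_right inner_commute)
 then have "(\<Sum>B\<in>Pow (insert a I). (norm (\<Sum>i\<in>insert a I. sgn_of B i *\<^sub>R t i))\<^sup>2) =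
   (\<Sum>B\<in>Pow I. 2 * (norm (\<Sum>i\<in>I. sgn_of B i *\<^sub>R t i))\<^sup>2 + 2 * (norm (t a))\<^sup>2)"
  unfolding sum_Pow_insert[OF insert.hyps]
  by (intro sum.cong) (simp_all add: sign_sum_insert[OF insert.hyps])
 also have "\<dots> = 2 * (\<Sum>B\<in>Pow I. (norm (\<Sum>i\<in>I. sgn_of B i *\<^sub>R t i))\<^sup>2) + 2 ^ card I * (2 * (norm (t a))\<^sup>2)"
  using insert.hyps by (simp add: sum.distrib sum_distrib_left card_Pow)
 finally show ?case using insert by (simp add: algebra_simps)
qed simp

text \<open>The constant 3 is dictated by the induction: the new index produces the mixed term 12 Q
  n, which must fit into twice the constant times (Q + n)^2.\<close>

lemma sign_sum_fourth_moment:
 fixes t :: "'i => 'v::real_inner"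
 assumes "finite I"
 shows "(\<Sum>B\<in>Pow I. (norm (\<Sum>i\<in>I. sgn_of B i *\<^sub>R t i)) ^ 4) \<le> 3 * 2 ^ card I * (\<Sum>i\<in>I. (norm (t i))\<^sup>2)\<^sup>2"
 using assms
proof (induction I rule: finite_induct)
 case (insert a I)
 let ?Q = "\<Sum>i\<in>I. (norm (t i))\<^sup>2" and ?S = "\<lambda>B. norm (\<Sum>i\<in>I. sgn_of B i *\<^sub>R t i)" and ?n = "(norm (t a))\<^sup>2"
 \<comment> \<open>Odd powers of the inner product cancel between the two signs, and its square is
   estimated by Cauchy-Schwarz.\<close>
 have *: "(norm (x - t a)) ^ 4 + (norm (x + t a)) ^ 4 \<le> 2 * (norm x) ^ 4 + 12 * ((norm x)\<^sup>2 * ?n) + 2 * ?n\<^sup>2" for x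
 proof -
  have p4: "(norm y) ^ 4 = ((norm y)\<^sup>2)\<^sup>2" for y :: 'v by (simp add: power2_eq_square power4_eq_xxxx)
  have "(norm (x - t a))\<^sup>2 = (norm x)\<^sup>2 + ?n - 2 * (x \<bullet> t a)" "(norm (x + t a))\<^sup>2 = (norm x)\<^sup>2 + ?n + 2 * (x \<bullet> t a)"
   by (simp_all add: power2_norm_eq_inner inner_diff_left inner_diff_right inner_add_left inner_add_right inner_commute)
  moreover have "(x \<bullet> t a)\<^sup>2 \<le> (norm x)\<^sup>2 * ?n"
   using Cauchy_Schwarz_ineq[of x "t a"] by (simp add: power2_norm_eq_inner)
  moreover have "(N + n - 2 * c)\<^sup>2 + (N + n + 2 * c)\<^sup>2 = 2 * N\<^sup>2 + 4 * (N * n) + 2 * n\<^sup>2 + 8 * c\<^sup>2" for N n c :: real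
   by (simp add: power2_eq_square algebra_simps)
  ultimately show ?thesis unfolding p4 by simp
 qed
 have "(\<Sum>B\<in>Pow (insert a I). (norm (\<Sum>i\<in>insert a I. sgn_of B i *\<^sub>R t i)) ^ 4) \<le>
   (\<Sum>B\<in>Pow I. 2 * ?S B ^ 4 + 12 * ((?S B)\<^sup>2 * ?n) + 2 * ?n\<^sup>2)"
  unfolding sum_Pow_insert[OF insert.hyps]
 proof (rule sum_mono)
  fix B assume "B \<in> Pow I"
  then show "norm (\<Sum>i\<in>insert a I. sgn_of B i *\<^sub>R t i) ^ 4 + norm (\<Sum>i\<in>insert a I. sgn_of (insert a B) i *\<^sub>R t i) ^ 4
    \<le> 2 * ?S B ^ 4 + 12 * ((?S B)\<^sup>2 * ?n) + 2 * ?n\<^sup>2"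
   using *[of "\<Sum>i\<in>I. sgn_of B i *\<^sub>R t i"] by (simp only: sign_sum_insert[OF insert.hyps] Pow_iff)
 qed
 also have "\<dots> = 2 * (\<Sum>B\<in>Pow I. ?S B ^ 4) + 12 * ((\<Sum>B\<in>Pow I. (?S B)\<^sup>2) * ?n) + 2 ^ card I * (2 * ?n\<^sup>2)"
  using insert.hyps by (simp add: sum.distrib sum_distrib_left sum_distrib_right card_Pow)
 also have "\<dots> \<le> 2 * (3 * 2 ^ card I * ?Q\<^sup>2) + 12 * ((2 ^ card I * ?Q) * ?n) + 2 ^ card I * (2 * ?n\<^sup>2)"
  using insert.IH sign_sum_second_moment[OF insert.hyps(1), of t] by simp
 also have "\<dots> \<le> 3 * 2 ^ card (insert a I) * (?Q + ?n)\<^sup>2"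
  using insert.hyps by (simp add: power2_eq_square algebra_simps)
 finally show ?case using insert.hyps by (simp add: add.commute)
qed simp

text \<open>A first moment is bounded below by the second and fourth moments: a pointwise inequality
  between \<open>u\<close>, \<open>u^2\<close> and \<open>u^4\<close> is averaged over all
  signs.\<close>

lemma khinchine_lower:
 fixes t :: "'i => 'v::real_inner"
 assumes "finite I"
 shows "2 ^ card I * L2_set (\<lambda>i. norm (t i)) I \<le> 2 * (\<Sum>B\<in>Pow I. norm (\<Sum>i\<in>I. sgn_of B i *\<^sub>R t i))"
proof (cases "(\<Sum>i\<in>I. (norm (t i))\<^sup>2) = 0")
 case True
 then show ?thesis by (simp add: L2_set_def sum_nonneg)
next
 case False
 define Q where "Q = (\<Sum>i\<in>I. (norm (t i))\<^sup>2)"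
 have Q: "0 < Q" using False unfolding Q_def by (simp add: sum_nonneg order.strict_iff_order)
 \<comment> \<open>With this scale the fourth-moment term uses up exactly half of the second-moment
   term.\<close>
 define l where "l = sqrt (2 * Q)"
 have l: "0 < l" "l\<^sup>2 = 2 * Q" using Q by (simp_all add: l_def)
 let ?S = "\<lambda>B. norm (\<Sum>i\<in>I. sgn_of B i *\<^sub>R t i)"
 \<comment> \<open>For \<open>x = u / l\<close> this is
   \<open>x * (x - 1)^2 * (x + 2) \<ge> 0\<close>, an equality at \<open>u = l\<close>.\<close>
 have amgm: "3 * u\<^sup>2 \<le> 2 * l * u + u ^ 4 / l\<^sup>2" if "0 \<le> u" for u
 proof -
  define x where "x = u / l"
  have x: "0 \<le> x" "u = x * l" using that l by (simp_all add: x_def)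
  have "0 \<le> x * ((x - 1)\<^sup>2 * (x + 2))" using x(1) by (intro mult_nonneg_nonneg) auto
  then have "3 * x\<^sup>2 \<le> 2 * x + x ^ 4" by (simp add: power2_eq_square power4_eq_xxxx algebra_simps)
  then have "l\<^sup>2 * (3 * x\<^sup>2) \<le> l\<^sup>2 * (2 * x + x ^ 4)" by (intro mult_left_mono) auto
  moreover have "u ^ 4 / l\<^sup>2 = l\<^sup>2 * x ^ 4" using l(1) by (simp add: x(2) power2_eq_square power4_eq_xxxx)
  ultimately show ?thesis by (simp add: x(2) power2_eq_square algebra_simps)
 qed
 have "3 * (2 ^ card I * Q) = (\<Sum>B\<in>Pow I. 3 * (?S B)\<^sup>2)"
  using sign_sum_second_moment[OF assms, of t] by (simp add: Q_def sum_distrib_left[symmetric])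
 also have "\<dots> \<le> (\<Sum>B\<in>Pow I. 2 * l * ?S B + ?S B ^ 4 / l\<^sup>2)" by (intro sum_mono amgm) simp
 also have "\<dots> = 2 * l * (\<Sum>B\<in>Pow I. ?S B) + (\<Sum>B\<in>Pow I. ?S B ^ 4) / l\<^sup>2"
  by (simp add: sum.distrib sum_distrib_left sum_divide_distrib)
 also have "(\<Sum>B\<in>Pow I. ?S B ^ 4) / l\<^sup>2 \<le> (3 * 2 ^ card I * Q\<^sup>2) / (2 * Q)"
  using sign_sum_fourth_moment[OF assms, of t] Q l by (simp add: Q_def divide_right_mono)
 also have "(3 * 2 ^ card I * Q\<^sup>2) / (2 * Q) = 3 / 2 * (2 ^ card I * Q)" using Q by (simp add: power2_eq_square)
 finally have main: "3 / 2 * (2 ^ card I * Q) \<le> 2 * l * (\<Sum>B\<in>Pow I. ?S B)" by simp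
 \<comment> \<open>The rational bound makes the final constant come out as 2.\<close>
 have "sqrt 2 \<le> 3 / 2" by (rule real_le_lsqrt) (simp_all add: power2_eq_square)
 then have l32: "l \<le> 3 / 2 * sqrt Q" unfolding l_def real_sqrt_mult using Q by (intro mult_right_mono) auto
 have s0: "0 \<le> (\<Sum>B\<in>Pow I. ?S B)" by (simp add: sum_nonneg)
 have "sqrt Q * sqrt Q = Q" using Q by simp
 then have e: "sqrt Q * (2 ^ card I * sqrt Q) = 2 ^ card I * Q" by (metis mult.left_commute)
 have "3 / 2 * (2 ^ card I * Q) \<le> 2 * (3 / 2 * sqrt Q) * (\<Sum>B\<in>Pow I. ?S B)"
  using main mult_right_mono[OF mult_left_mono[OF l32, of 2] s0] by linarith
 then have "sqrt Q * (2 ^ card I * sqrt Q) \<le> sqrt Q * (2 * (\<Sum>B\<in>Pow I. ?S B))"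
  unfolding e by (simp add: mult.commute mult.left_commute)
 then have "2 ^ card I * sqrt Q \<le> 2 * (\<Sum>B\<in>Pow I. ?S B)"
  by (rule mult_left_le_imp_le) (use Q in simp)
 then show ?thesis by (simp add: L2_set_def Q_def)
qed

lemma khinchine_upper:
 fixes t :: "'i => 'v::real_inner"
 assumes "finite I"
 shows "(\<Sum>B\<in>Pow I. norm (\<Sum>i\<in>I. sgn_of B i *\<^sub>R t i)) \<le> 2 ^ card I * L2_set (\<lambda>i. norm (t i)) I"
proof -
 have "(\<Sum>B\<in>Pow I. norm (\<Sum>i\<in>I. sgn_of B i *\<^sub>R t i))\<^sup>2 \<le>
   (\<Sum>B\<in>Pow I. (norm (\<Sum>i\<in>I. sgn_of B i *\<^sub>R t i))\<^sup>2) * card (Pow I)"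
  by (rule sum_squared_le_sum_of_squares)
 also have "\<dots> = (2 ^ card I * L2_set (\<lambda>i. norm (t i)) I)\<^sup>2"
  using assms by (simp add: sign_sum_second_moment card_Pow L2_set_def power_mult_distrib sum_nonneg)
   (simp add: power2_eq_square)
 finally show ?thesis by (rule power2_le_imp_le) simp
qed

lemma L2_set_sum_le: "L2_set (\<lambda>i. \<Sum>B\<in>X. f B i) I \<le> (\<Sum>B\<in>X. L2_set (f B) I)"
proof (induction X rule: infinite_finite_induct)
 case (insert B X)
 then show ?case using L2_set_triangle_ineq[of "f B" "\<lambda>i. \<Sum>B\<in>X. f B i" I] by simp
qed (simp_all add: L2_set_def)

abbreviation sign_sum :: "'i set => 'j set => 'i set => 'j set => ('i => 'j => 'v::real_vector) => 'v" where
 "sign_sum I J B D t \<equiv> \<Sum>i\<in>I. \<Sum>j\<in>J. (sgn_of B i * sgn_of D j) *\<^sub>R t i j"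

text \<open>Khinchine's inequality is used once for each index. Between the two uses, Minkowski's
  inequality in the form \<open>L2_set_sum_le\<close> takes the sum over signs out of the
  \<open>L2_set\<close>.\<close>

lemma sign_chaos_lower:
 fixes t :: "'i => 'j => 'v::real_inner"
 assumes I: "finite I" and J: "finite J"
 shows "2 ^ (card I + card J) * L2_set (\<lambda>i. L2_set (\<lambda>j. norm (t i j)) J) I \<le>
  4 * (\<Sum>D\<in>Pow J. \<Sum>B\<in>Pow I. norm (sign_sum I J B D t))"
proof -
 let ?x = "\<lambda>D i. \<Sum>j\<in>J. sgn_of D j *\<^sub>R t i j"
 have eq: "(\<Sum>i\<in>I. \<Sum>j\<in>J. (sgn_of B i * sgn_of D j) *\<^sub>R t i j) = (\<Sum>i\<in>I. sgn_of B i *\<^sub>R ?x D i)" for B D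
  by (simp add: scaleR_sum_right)
 have "2 ^ card J * L2_set (\<lambda>i. L2_set (\<lambda>j. norm (t i j)) J) I = L2_set (\<lambda>i. 2 ^ card J * L2_set (\<lambda>j. norm (t i j)) J) I"
  by (simp add: L2_set_right_distrib)
 also have "\<dots> \<le> L2_set (\<lambda>i. 2 * (\<Sum>D\<in>Pow J. norm (?x D i))) I"
  by (intro L2_set_mono khinchine_lower J) simp
 also have "\<dots> = 2 * L2_set (\<lambda>i. \<Sum>D\<in>Pow J. norm (?x D i)) I"
  by (simp add: L2_set_right_distrib)
 also have "\<dots> \<le> 2 * (\<Sum>D\<in>Pow J. L2_set (\<lambda>i. norm (?x D i)) I)"
  by (intro mult_left_mono L2_set_sum_le) simp
 finally have 1: "2 ^ card J * L2_set (\<lambda>i. L2_set (\<lambda>j. norm (t i j)) J) I \<le> 2 * (\<Sum>D\<in>Pow J. L2_set (\<lambda>i. norm (?x D i)) I)" .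
 have "2 ^ (card I + card J) * L2_set (\<lambda>i. L2_set (\<lambda>j. norm (t i j)) J) I \<le>
   2 ^ card I * (2 * (\<Sum>D\<in>Pow J. L2_set (\<lambda>i. norm (?x D i)) I))"
  unfolding power_add mult.assoc by (intro mult_left_mono 1) simp
 also have "\<dots> = 2 * (\<Sum>D\<in>Pow J. 2 ^ card I * L2_set (\<lambda>i. norm (?x D i)) I)"
  by (simp add: sum_distrib_left mult_ac)
 also have "\<dots> \<le> 2 * (\<Sum>D\<in>Pow J. 2 * (\<Sum>B\<in>Pow I. norm (\<Sum>i\<in>I. sgn_of B i *\<^sub>R ?x D i)))"
  by (intro mult_left_mono sum_mono khinchine_lower I) simp
 finally show ?thesis unfolding eq by (simp add: sum_distrib_left[symmetric])
qed

lemma sign_chaos_upper: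
 fixes t :: "'i => 'j => 'v::real_inner"
 assumes I: "finite I" and J: "finite J"
 shows "(\<Sum>D\<in>Pow J. \<Sum>B\<in>Pow I. norm (sign_sum I J B D t)) \<le>
  2 ^ (card I + card J) * L2_set (\<lambda>i. L2_set (\<lambda>j. norm (t i j)) J) I"
proof -
 let ?x = "\<lambda>D i. \<Sum>j\<in>J. sgn_of D j *\<^sub>R t i j"
 have eq: "(\<Sum>i\<in>I. \<Sum>j\<in>J. (sgn_of B i * sgn_of D j) *\<^sub>R t i j) = (\<Sum>i\<in>I. sgn_of B i *\<^sub>R ?x D i)" for B D
  by (simp add: scaleR_sum_right)
 have "(\<Sum>D\<in>Pow J. \<Sum>B\<in>Pow I. norm (\<Sum>i\<in>I. sgn_of B i *\<^sub>R ?x D i)) \<le> (\<Sum>D\<in>Pow J. 2 ^ card I * L2_set (\<lambda>i. norm (?x D i)) I)"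
  by (intro sum_mono khinchine_upper I)
 also have "\<dots> = 2 ^ card I * (\<Sum>D\<in>Pow J. L2_set (\<lambda>i. norm (?x D i)) I)" by (simp add: sum_distrib_left)
 also have "(\<Sum>D\<in>Pow J. L2_set (\<lambda>i. norm (?x D i)) I) \<le> 2 ^ card J * L2_set (\<lambda>i. L2_set (\<lambda>j. norm (t i j)) J) I"
 proof (rule power2_le_imp_le)
  have "(\<Sum>D\<in>Pow J. L2_set (\<lambda>i. norm (?x D i)) I)\<^sup>2 \<le> (\<Sum>D\<in>Pow J. (L2_set (\<lambda>i. norm (?x D i)) I)\<^sup>2) * card (Pow J)"
   by (rule sum_squared_le_sum_of_squares)
  also have "(\<Sum>D\<in>Pow J. (L2_set (\<lambda>i. norm (?x D i)) I)\<^sup>2) = (\<Sum>i\<in>I. \<Sum>D\<in>Pow J. (norm (?x D i))\<^sup>2)"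
   by (simp add: L2_set_def sum_nonneg) (rule sum.swap)
  also have "\<dots> = 2 ^ card J * (L2_set (\<lambda>i. L2_set (\<lambda>j. norm (t i j)) J) I)\<^sup>2"
   by (simp add: sign_sum_second_moment[OF J] L2_set_def sum_nonneg sum_distrib_left)
  finally show "(\<Sum>D\<in>Pow J. L2_set (\<lambda>i. norm (?x D i)) I)\<^sup>2 \<le> (2 ^ card J * L2_set (\<lambda>i. L2_set (\<lambda>j. norm (t i j)) J) I)\<^sup>2"
   using J by (simp add: card_Pow power_mult_distrib power2_eq_square mult_ac)
 qed simp
 finally show ?thesis unfolding eq by (simp add: power_add mult.assoc)
qed

text \<open>Both sides are comparable to the Hilbert--Schmidt norm of \<open>t\<close>, which does not see the signs \<open>a\<close>.\<close>

lemma sign_chaos_compare: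
 fixes t :: "'i => 'j => 'v::real_inner" and a :: "'i => 'j => real"
 assumes "finite I" "finite J" "\<And>i j. \<bar>a i j\<bar> = 1"
 shows "(\<Sum>D\<in>Pow J. \<Sum>B\<in>Pow I. norm (sign_sum I J B D t)) \<le>
  4 * (\<Sum>D\<in>Pow J. \<Sum>B\<in>Pow I. norm (sign_sum I J B D (\<lambda>i j. a i j *\<^sub>R t i j)))"
proof -
 note sign_chaos_upper[OF assms(1,2), of t]
 also have "2 ^ (card I + card J) * L2_set (\<lambda>i. L2_set (\<lambda>j. norm (t i j)) J) I =
   2 ^ (card I + card J) * L2_set (\<lambda>i. L2_set (\<lambda>j. norm (a i j *\<^sub>R t i j)) J) I"
  using assms(3) by simp
 also note sign_chaos_lower[OF assms(1,2), of "\<lambda>i j. a i j *\<^sub>R t i j"]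
 finally show ?thesis .
qed

subsection \<open>Walsh matrices\<close>

text \<open>The characters of the group of subsets under symmetric difference: indexed by the
  subsets of a set of size r, they form an orthogonal sign matrix of order 2^r.\<close>

definition walsh :: "nat set => nat set => real" where
 "walsh i j = (- 1) ^ card (i \<inter> j)"

lemma abs_walsh [simp]: "\<bar>walsh i j\<bar> = 1"
 by (simp add: walsh_def power_abs)

lemma walsh_orthogonal:
 assumes "finite R"
 shows "(\<Sum>j\<in>Pow R. walsh i j * walsh i' j) = (if i \<inter> R = i' \<inter> R then 2 ^ card R else 0)"
 using assms
proof (induction R rule: finite_induct)
 case (insert e R)
 have ins: "walsh i (insert e j) = (if e \<in> i then - 1 else 1) * walsh i j" if "j \<in> Pow R" for i j
 proof -
  have "finite (i \<inter> j)" "e \<notin> i \<inter> j" using that insert.hyps finite_subset by auto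
  then show ?thesis by (auto simp: walsh_def Int_insert_right)
 qed
 have "(\<Sum>j\<in>Pow (insert e R). walsh i j * walsh i' j) =
   (\<Sum>j\<in>Pow R. (1 + (if e \<in> i then - 1 else 1) * (if e \<in> i' then - 1 else 1)) * (walsh i j * walsh i' j))"
  unfolding sum_Pow_insert[OF insert.hyps]
  by (intro sum.cong) (simp_all add: ins algebra_simps)
 also have "\<dots> = (1 + (if e \<in> i then - 1 else 1) * (if e \<in> i' then - 1 else 1)) * (if i \<inter> R = i' \<inter> R then 2 ^ card R else 0)"
  by (simp only: sum_distrib_left[symmetric] insert.IH)
 also have "\<dots> = (if i \<inter> insert e R = i' \<inter> insert e R then 2 ^ card (insert e R) else 0)"
  using insert.hyps by (auto simp: Int_insert_right)
 finally show ?case .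
qed (simp add: walsh_def)

text \<open>With N = 2^r rows the trivial bound is N^2. Orthogonality bounds the square sum of the
  vector \<open>w\<close> by N^2, and Cauchy-Schwarz over the N columns gives N^(3/2); this gain
  decides the proof.\<close>

lemma walsh_bilinear_bound:
 fixes u v :: "nat set => 'k::{real_normed_field,real_inner}"
 assumes R: "finite R" and u: "\<And>i. norm (u i) \<le> 1" and v: "\<And>j. norm (v j) \<le> 1"
 shows "norm (\<Sum>i\<in>Pow R. \<Sum>j\<in>Pow R. walsh i j *\<^sub>R (u i * v j)) \<le> 2 ^ card R * sqrt (2 ^ card R)"
proof -
 let ?N = "2 ^ card R :: real"
 define w where "w j = (\<Sum>i\<in>Pow R. walsh i j *\<^sub>R u i)" for j
 have cN: "real (card (Pow R)) = ?N" using R by (simp add: card_Pow)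
 have "(\<Sum>j\<in>Pow R. (norm (w j))\<^sup>2) = (\<Sum>j\<in>Pow R. \<Sum>i\<in>Pow R. \<Sum>i'\<in>Pow R. (walsh i j * walsh i' j) * (u i' \<bullet> u i))"
  by (simp add: power2_norm_eq_inner w_def inner_sum_left inner_sum_right sum_distrib_left mult_ac)
 also have "\<dots> = (\<Sum>i\<in>Pow R. \<Sum>j\<in>Pow R. \<Sum>i'\<in>Pow R. (walsh i j * walsh i' j) * (u i' \<bullet> u i))" by (rule sum.swap)
 also have "\<dots> = (\<Sum>i\<in>Pow R. \<Sum>i'\<in>Pow R. \<Sum>j\<in>Pow R. (walsh i j * walsh i' j) * (u i' \<bullet> u i))"
  by (intro sum.cong refl sum.swap)
 also have "\<dots> = (\<Sum>i\<in>Pow R. \<Sum>i'\<in>Pow R. (if i = i' then ?N else 0) * (u i' \<bullet> u i))"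
  by (intro sum.cong refl) (simp add: sum_distrib_right[symmetric] walsh_orthogonal[OF R] Int_absorb2)
 also have "\<dots> = (\<Sum>i\<in>Pow R. ?N * (norm (u i))\<^sup>2)"
  using R by (intro sum.cong refl) (simp add: power2_norm_eq_inner sum.delta if_distrib[of "\<lambda>x. x * _"] cong: if_cong)
 also have "\<dots> \<le> (\<Sum>i\<in>Pow R. ?N * 1)"
  using u by (intro sum_mono mult_left_mono) (auto simp: power_le_one)
 finally have w2: "(\<Sum>j\<in>Pow R. (norm (w j))\<^sup>2) \<le> ?N * ?N" using cN by simp
 have "(\<Sum>i\<in>Pow R. \<Sum>j\<in>Pow R. walsh i j *\<^sub>R (u i * v j)) = (\<Sum>j\<in>Pow R. w j * v j)"
  by (subst sum.swap) (simp add: w_def sum_distrib_right)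
 also have "norm \<dots> \<le> (\<Sum>j\<in>Pow R. norm (w j))"
 proof (rule sum_norm_le)
  show "norm (w j * v j) \<le> norm (w j)" for j
   using v[of j] mult_left_mono[OF v[of j], of "norm (w j)"] by (simp add: norm_mult)
 qed
 also have "\<dots> \<le> sqrt ((\<Sum>j\<in>Pow R. (norm (w j))\<^sup>2) * card (Pow R))"
  by (intro real_le_rsqrt sum_squared_le_sum_of_squares)
 also have "\<dots> \<le> sqrt ((?N * ?N) * ?N)"
  unfolding cN using w2 by (intro real_sqrt_le_mono mult_right_mono) auto
 also have "\<dots> = ?N * sqrt ?N" by (simp add: real_sqrt_mult)
 finally show ?thesis .
qed

subsection \<open>Functionals on spaces of continuous functions\<close>

definition bounded_functional ::
 "'a::topological_space set => real => (('a => 'k::real_normed_field) => 'k) => bool" where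
 "bounded_functional K M m \<longleftrightarrow> 0 \<le> M \<and>
  (\<forall>f\<in>cfun K. \<forall>g\<in>cfun K. m (\<lambda>x. f x + g x) = m f + m g) \<and>
  (\<forall>f\<in>cfun K. \<forall>c. m (\<lambda>x. c * f x) = c * m f) \<and>
  (\<forall>f\<in>cfun K. \<forall>b. (\<forall>x. norm (f x) \<le> b) --> norm (m f) \<le> M * b)"

lemma bounded_functionalD:
 assumes "bounded_functional K M m"
 shows "0 \<le> M" "f \<in> cfun K ==> g \<in> cfun K ==> m (\<lambda>x. f x + g x) = m f + m g"
  "f \<in> cfun K ==> m (\<lambda>x. c * f x) = c * m f"
  "f \<in> cfun K ==> (\<And>x. norm (f x) \<le> b) ==> norm (m f) \<le> M * b"
 using assms unfolding bounded_functional_def by blast+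

lemma bounded_functional_diff:
 assumes "bounded_functional K M m" "f \<in> cfun K" "g \<in> cfun K"
 shows "(\<lambda>x. f x - g x) \<in> cfun K" "m (\<lambda>x. f x - g x) = m f - m g"
proof -
 have "m (\<lambda>x. f x + (- 1) * g x) = m f + m (\<lambda>x. (- 1) * g x)"
  by (rule bounded_functionalD(2)[OF assms(1,2)]) (rule cont_vanish_ops(2)[OF assms(3)])
 then have "m (\<lambda>x. f x + (- 1) * g x) = m f + (- 1) * m g"
  by (simp only: bounded_functionalD(3)[OF assms(1,3)])
 then show "m (\<lambda>x. f x - g x) = m f - m g" by simp
 show "(\<lambda>x. f x - g x) \<in> cfun K"
  by (rule fun_subspace_diff[OF fun_subspace_cont_vanish assms(2,3)])
qed

lemma bounded_functional_zero: "bounded_functional K M m ==> m (\<lambda>_. 0) = 0"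
 using bounded_functionalD(3)[of K M m "\<lambda>_. 0" 0] by simp

lemma bounded_functional_sum:
 assumes m: "bounded_functional K M m" and "\<And>i. i \<in> I ==> f i \<in> cfun K"
 shows "m (\<lambda>x. \<Sum>i\<in>I. c i * f i x) = (\<Sum>i\<in>I. c i * m (f i))"
 using assms(2)
proof (induction I rule: infinite_finite_induct)
 case (insert a I)
 have "(\<lambda>x. \<Sum>i\<in>I. c i * f i x) \<in> cfun K" using insert.prems by (intro cont_vanish_sum) simp
 then show ?case
  using insert bounded_functionalD(2)[OF m, of "\<lambda>x. c a * f a x"] bounded_functionalD(3)[OF m, of "f a"] by simp
qed (simp_all add: bounded_functional_zero[OF m])

definition unit_ball :: "'a::topological_space set => ('a => 'k::real_normed_field) set" where
 "unit_ball K = {g \<in> cfun K. \<forall>x. norm (g x) \<le> 1}"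

lemma unit_ballD: "f \<in> unit_ball K ==> f \<in> cfun K \<and> norm (f x) \<le> 1"
 by (simp add: unit_ball_def)

definition restrict0 :: "'a set => ('a => 'k::zero) => 'a => 'k" where
 "restrict0 A f x = (if x \<in> A then f x else 0)"

abbreviation ind :: "'a set => 'a => 'k::real_normed_field" where
 "ind A \<equiv> restrict0 A (\<lambda>_. 1)"

lemma restrict0_in:
 fixes K :: "'a::t2_space set"
 assumes "clopen_in K A" "continuous_on K f"
 shows "restrict0 A f \<in> cfun K"
proof -
 have "A \<subseteq> K" using assms by (simp add: clopen_in_def)
 have "continuous_on A f" by (rule continuous_on_subset[OF assms(2) \<open>A \<subseteq> K\<close>])
 then have "continuous_on K (restrict0 A f)"
  by (rule continuous_on_clopen_cases[OF assms(1) _ continuous_on_const]) (auto simp: restrict0_def)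
 then show ?thesis using \<open>A \<subseteq> K\<close> by (auto simp: cont_vanish_def restrict0_def)
qed

lemma restrict0_in': "clopen_in K A ==> f \<in> cfun K ==> restrict0 A f \<in> cont_vanish (K :: 'a::t2_space set) {}"
 by (rule restrict0_in) (simp_all add: cont_vanish_def)

lemma ind_in: "clopen_in K A ==> ind A \<in> cont_vanish (K :: 'a::t2_space set) {}"
 by (rule restrict0_in) simp_all

lemma clopen_in_INT:
 fixes K :: "'a::t2_space set"
 assumes "finite I" "compact K" "\<And>i. i \<in> I ==> clopen_in K (B i)"
 shows "clopen_in K {y \<in> K. \<forall>i\<in>I. y \<in> B i}"
 using assms(1,3)
proof (induction I rule: finite_induct)
 case (insert a I)
 have "{y \<in> K. \<forall>i\<in>insert a I. y \<in> B i} = {y \<in> K. \<forall>i\<in>I. y \<in> B i} \<inter> B a"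
  by auto
 then show ?case using insert clopen_in_Int by (metis (no_types, lifting) insert_iff)
qed (simp add: clopen_in_self assms(2))

text \<open>Finitely many clopen sets with small oscillation cover \<open>K\<close>; the partition
  consists of the atoms they generate, some of which may be empty.\<close>

lemma ex_clopen_partition:
 fixes K :: "'a::metric_space set" and F :: "('a => 'k::real_normed_field) set"
 assumes K: "compact K" "countable K" and F: "finite F" "F \<subseteq> cfun K" and "0 < e"
 obtains I :: "'a set set" and s z where "finite I" "\<forall>y\<in>K. s y \<in> I" "\<forall>S\<in>I. clopen_in K {y \<in> K. s y = S}"
  "\<forall>f\<in>F. \<forall>y\<in>K. norm (f y - f (z (s y))) \<le> e"
proof -
 have "\<exists>U. clopen_in K U \<and> x \<in> U \<and> (\<forall>y\<in>U. \<forall>f\<in>F. norm (f y - f x) \<le> e)" if x: "x \<in> K" for x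
 proof -
  have "\<exists>d>0. \<forall>f\<in>F. \<forall>y\<in>K. dist y x < d --> norm (f y - f x) \<le> e"
   using F
  proof (induction F rule: finite_induct)
   case empty
   then show ?case by (intro exI[of _ 1]) simp
  next
   case (insert g F)
   then obtain d where d: "d > 0" "\<forall>f\<in>F. \<forall>y\<in>K. dist y x < d --> norm (f y - f x) \<le> e" by auto
   have "continuous_on K g" using insert.prems by (auto simp: cont_vanish_def)
   then obtain d' where "d' > 0" "\<forall>y\<in>K. dist y x < d' --> dist (g y) (g x) < e"
    using x \<open>0 < e\<close> unfolding continuous_on_iff by blast
   then show ?case using d by (intro exI[of _ "min d d'"]) (auto simp: dist_norm less_imp_le)
  qed
  then obtain d where d: "d > 0" "\<forall>f\<in>F. \<forall>y\<in>K. dist y x < d --> norm (f y - f x) \<le> e" by blast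
  obtain U where "clopen_in K U" "x \<in> U" "U \<subseteq> ball x d"
   by (rule clopen_nbhd[OF K x open_ball, of x d]) (use d(1) that in auto)
  moreover have "norm (f y - f x) \<le> e" if y: "y \<in> U" and "f \<in> F" for y f
  proof -
   have "y \<in> K" "dist y x < d" using y \<open>clopen_in K U\<close> \<open>U \<subseteq> ball x d\<close> by (auto simp: clopen_in_def dist_commute)
   then show ?thesis using d(2) that(2) by blast
  qed
  ultimately show ?thesis by blast
 qed
 then obtain U where U: "\<And>x. x \<in> K ==> clopen_in K (U x)" "\<And>x. x \<in> K ==> x \<in> U x"
  "\<And>x y f. x \<in> K ==> y \<in> U x ==> f \<in> F ==> norm (f y - f x) \<le> e" by metis
 have oU: "open (- (K - U x))" if "x \<in> K" for x by (rule clopen_in_open(1)[OF U(1)[OF that]])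
 have cov: "K \<subseteq> (\<Union>x\<in>K. - (K - U x))" using U(2) by auto
 obtain C where C: "C \<subseteq> K" "finite C" "K \<subseteq> (\<Union>x\<in>C. - (K - U x))"
  by (rule compactE_image[OF K(1) oU cov], assumption, rule that)
 \<comment> \<open>An atom is labelled by the set of those centres whose neighbourhoods contain it;
   \<open>z\<close> picks one of them as the place where functions are sampled.\<close>
 define s where "s y = {x \<in> C. y \<in> U x}" for y
 define z where "z S = (SOME x. x \<in> S)" for S :: "'a set"
 have z: "z (s y) \<in> s y" if y: "y \<in> K" for y
 proof -
  obtain x where "x \<in> C" "y \<in> - (K - U x)" by (rule UN_E[OF subsetD[OF C(3) y]])
  then have "s y \<noteq> {}" using y by (auto simp: s_def)
  then show ?thesis unfolding z_def by (simp add: some_in_eq)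
 qed
 have "clopen_in K {y \<in> K. s y = S}" if "S \<in> Pow C" for S
 proof -
  have "{y \<in> K. s y = S} = {y \<in> K. \<forall>x\<in>C. y \<in> (if x \<in> S then U x else K - U x)}"
   using that by (auto simp: s_def split: if_splits)
  moreover have "clopen_in K (if x \<in> S then U x else K - U x)" if "x \<in> C" for x
   using U(1) C(1) that clopen_in_Diff_self by (auto simp: subset_iff)
  ultimately show ?thesis using clopen_in_INT[OF C(2) K(1)] by simp
 qed
 moreover have "norm (f y - f (z (s y))) \<le> e" if "f \<in> F" "y \<in> K" for f y
  using z[OF that(2)] C(1) U(3)[of "z (s y)" y f] that by (auto simp: s_def)
 moreover have "s y \<in> Pow C" for y by (auto simp: s_def)
 ultimately show thesis using that[of "Pow C" s z] C(2) by blast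
qed

lemma ex_phase: "\<exists>c :: 'k::real_normed_field. norm c = 1 \<and> c * w = of_real (norm w)"
proof (cases "w = 0")
 case False
 then show ?thesis by (intro exI[of _ "of_real (norm w) / w"]) (simp add: norm_divide)
qed (intro exI[of _ 1], simp)

text \<open>Finitely many functionals on \<open>C(K)\<close> look like vectors in a finite-dimensional \<open>L\<^sub>1\<close> space.\<close>

lemma functional_model:
 fixes K :: "'a::metric_space set" and m :: "'i => ('a => 'k::real_normed_field) => 'k"
 assumes K: "compact K" "countable K" and m: "\<forall>i\<in>R. bounded_functional K M (m i)" "0 \<le> M"
  and F: "finite F" "F \<subseteq> unit_ball K" and e: "0 < e"
 obtains J :: "'a set set" and t :: "'a set => 'i => 'k" where "finite J"
  "\<forall>c N. (\<forall>f\<in>unit_ball K. norm (\<Sum>i\<in>R. c i *\<^sub>R m i f) \<le> N) --> (\<Sum>S\<in>J. norm (\<Sum>i\<in>R. c i *\<^sub>R t S i)) \<le> N"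
  "\<forall>c. \<forall>f\<in>F. (\<forall>i\<in>R. \<bar>c i\<bar> \<le> 1) -->
   norm (\<Sum>i\<in>R. c i *\<^sub>R m i f) \<le> (\<Sum>S\<in>J. norm (\<Sum>i\<in>R. c i *\<^sub>R t S i)) + e"
proof -
 \<comment> \<open>Replacing a function by a step function costs at most \<open>M * d\<close> for
   each of the \<open>card R\<close> functionals; the added 1 avoids division by 0.\<close>
 define d where "d = e / (real (card R) * M + 1)"
 have pos: "0 < real (card R) * M + 1" using m(2) by (simp add: add_nonneg_pos)
 then have d: "0 < d" using e by (simp add: d_def)
 have F': "F \<subseteq> cfun K" using F(2) by (auto simp: unit_ball_def)
 obtain J :: "'a set set" and s z where J: "finite J" "\<forall>y\<in>K. s y \<in> J" "\<forall>S\<in>J. clopen_in K {y \<in> K. s y = S}"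
  and z: "\<forall>f\<in>F. \<forall>y\<in>K. norm (f y - f (z (s y))) \<le> d"
  by (rule ex_clopen_partition[OF K F(1) F' d], rule that)
 let ?C = "\<lambda>S. ind {y \<in> K. s y = S} :: 'a => 'k"
 \<comment> \<open>The mass that \<open>m i\<close> gives to the piece \<open>S\<close>; the sum of
   absolute values over the pieces is the L1 norm of the model.\<close>
 define t where "t S i = m i (?C S)" for S i
 have C: "?C S \<in> cfun K" if "S \<in> J" for S using J(3) that by (intro ind_in) blast
 have step: "(\<lambda>y. \<Sum>S\<in>J. a S * ?C S y) \<in> cfun K" for a
  by (intro cont_vanish_sum cont_vanish_ops(2) C)
 have stepv: "(\<Sum>S\<in>J. a S * ?C S y) = (if y \<in> K then a (s y) else 0)" for a y
 proof (cases "y \<in> K")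
  case True
  then have "(\<Sum>S\<in>J. a S * ?C S y) = (\<Sum>S\<in>J. if S = s y then a S else 0)"
   by (intro sum.cong) (auto simp: restrict0_def)
  then show ?thesis using True J(1,2) by simp
 qed (simp add: restrict0_def)
 have sm: "(\<Sum>i\<in>R. c i *\<^sub>R m i (\<lambda>y. \<Sum>S\<in>J. a S * ?C S y)) = (\<Sum>S\<in>J. a S * (\<Sum>i\<in>R. c i *\<^sub>R t S i))" for a c
 proof -
  have "(\<Sum>i\<in>R. c i *\<^sub>R m i (\<lambda>y. \<Sum>S\<in>J. a S * ?C S y)) = (\<Sum>i\<in>R. \<Sum>S\<in>J. a S * (c i *\<^sub>R t S i))"
   by (intro sum.cong refl) (simp add: bounded_functional_sum[OF bspec[OF m(1)] C] scaleR_sum_right t_def)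
  then show ?thesis by (subst (asm) sum.swap) (simp only: sum_distrib_left)
 qed
 have v: "(\<Sum>S\<in>J. norm (\<Sum>i\<in>R. c i *\<^sub>R t S i)) \<le> N"
  if N: "\<forall>f\<in>unit_ball K. norm (\<Sum>i\<in>R. c i *\<^sub>R m i f) \<le> N" for c N
 proof -
  \<comment> \<open>The phases \<open>a\<close> align all pieces. The step function with these
    values lies in the unit ball and attains the L1 norm.\<close>
  have "\<forall>S. \<exists>a :: 'k. norm a = 1 \<and> a * (\<Sum>i\<in>R. c i *\<^sub>R t S i) = of_real (norm (\<Sum>i\<in>R. c i *\<^sub>R t S i))"
   by (intro allI ex_phase)
  from choice[OF this] obtain a where a: "\<forall>S. norm (a S) = 1 \<and> a S * (\<Sum>i\<in>R. c i *\<^sub>R t S i) = of_real (norm (\<Sum>i\<in>R. c i *\<^sub>R t S i))" ..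
  have "(\<lambda>y. \<Sum>S\<in>J. a S * ?C S y) \<in> unit_ball K"
   using step[of a] a by (simp add: unit_ball_def stepv)
  from bspec[OF N this] have "norm (of_real (\<Sum>S\<in>J. norm (\<Sum>i\<in>R. c i *\<^sub>R t S i)) :: 'k) \<le> N" unfolding sm using a by simp
  then show ?thesis unfolding norm_of_real by simp
 qed
 have w: "norm (\<Sum>i\<in>R. c i *\<^sub>R m i f) \<le> (\<Sum>S\<in>J. norm (\<Sum>i\<in>R. c i *\<^sub>R t S i)) + e"
  if f: "f \<in> F" and c: "\<forall>i\<in>R. \<bar>c i\<bar> \<le> 1" for c f
 proof -
  have fu: "f \<in> cfun K" "\<And>x. norm (f x) \<le> 1" using f F(2) unit_ballD by blast+
  let ?g = "\<lambda>y. \<Sum>S\<in>J. f (z S) * ?C S y"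
  have "norm (m i f - m i ?g) \<le> M * d" if i: "i \<in> R" for i
   unfolding bounded_functional_diff(2)[OF bspec[OF m(1) i] fu(1) step, symmetric]
  proof (rule bounded_functionalD(4)[OF bspec[OF m(1) i] bounded_functional_diff(1)[OF bspec[OF m(1) i] fu(1) step]])
   show "norm (f y - ?g y) \<le> d" for y
    using z f fu(1) d unfolding stepv by (cases "y \<in> K") (auto simp: cont_vanish_def)
  qed
  then have "norm (c i *\<^sub>R (m i f - m i ?g)) \<le> 1 * (M * d)" if "i \<in> R" for i
   unfolding norm_scaleR using c that by (intro mult_mono) auto
  then have "norm (\<Sum>i\<in>R. c i *\<^sub>R (m i f - m i ?g)) \<le> (\<Sum>i\<in>R. 1 * (M * d))" by (rule sum_norm_le)
  also have "\<dots> \<le> e" using e pos by (simp add: d_def divide_le_eq algebra_simps)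
  finally have 1: "norm ((\<Sum>i\<in>R. c i *\<^sub>R m i f) - (\<Sum>S\<in>J. f (z S) * (\<Sum>i\<in>R. c i *\<^sub>R t S i))) \<le> e"
   by (simp only: scaleR_right_diff_distrib sum_subtractf sm)
  have "norm (\<Sum>S\<in>J. f (z S) * (\<Sum>i\<in>R. c i *\<^sub>R t S i)) \<le> (\<Sum>S\<in>J. norm (\<Sum>i\<in>R. c i *\<^sub>R t S i))"
   by (rule sum_norm_le) (simp add: norm_mult mult_left_le_one_le fu(2))
  then show ?thesis using 1 norm_triangle_sub[of "\<Sum>i\<in>R. c i *\<^sub>R m i f"] by (smt (verit))
 qed
 show thesis by (rule that[OF J(1), of t]) (blast intro: v w)+
qed

text \<open>Cotype 2 of the dual of C(K), read off from L1: on each coordinate of the model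
  Cauchy-Schwarz passes from the sum over \<open>q\<close> to an l2 norm, Khinchine passes from
  there to an average over signs, and the average is bounded by \<open>N\<close> because every
  single choice of signs is.\<close>

lemma functional_cotype:
 fixes K :: "'a::metric_space set" and m :: "nat => ('a => 'k::{real_normed_field,real_inner}) => 'k"
 assumes K: "compact K" "countable K" and m: "\<And>q. q < p ==> bounded_functional K M (m q)" "0 \<le> M"
  and f: "\<And>q. q < p ==> f q \<in> unit_ball K" "\<And>q. q < p ==> d \<le> norm (m q (f q))"
  and N: "\<And>B h. h \<in> unit_ball K ==> norm (\<Sum>q<p. sgn_of B q *\<^sub>R m q h) \<le> N"
 shows "sqrt (real p) * d \<le> 2 * N"
proof (cases "p = 0")
 case True
 then show ?thesis using N[of "\<lambda>_. 0"] by (simp add: unit_ball_def)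
next
 case False
 have "real p * d \<le> 2 * sqrt (real p) * N + e" if "0 < e" for e
 proof -
  have e: "0 < e / real p" using that False by simp
  have F: "finite (f ` {..<p})" "f ` {..<p} \<subseteq> unit_ball K" using f(1) by auto
  have m': "\<forall>q\<in>{..<p}. bounded_functional K M (m q)" using m(1) by simp
  obtain J :: "'a set set" and t :: "'a set => nat => 'k" where J: "finite J"
   "\<forall>c N. (\<forall>f\<in>unit_ball K. norm (\<Sum>q<p. c q *\<^sub>R m q f) \<le> N) --> (\<Sum>S\<in>J. norm (\<Sum>q<p. c q *\<^sub>R t S q)) \<le> N"
   "\<forall>c. \<forall>h\<in>f ` {..<p}. (\<forall>q\<in>{..<p}. \<bar>c q\<bar> \<le> 1) -->
    norm (\<Sum>q<p. c q *\<^sub>R m q h) \<le> (\<Sum>S\<in>J. norm (\<Sum>q<p. c q *\<^sub>R t S q)) + e / real p"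
   by (rule functional_model[OF K m' m(2) F e], rule that)
  have "d \<le> (\<Sum>S\<in>J. norm (t S q)) + e / real p" if q: "q < p" for q
  proof -
   \<comment> \<open>Coefficients concentrated at \<open>q\<close> extract the single functional
     \<open>m q\<close> from the model.\<close>
   have one: "(\<Sum>i<p. (if i = q then 1 else 0 :: real) *\<^sub>R x i) = x q" for x :: "nat => 'k"
   proof -
    have "(\<Sum>i<p. (if i = q then 1 else 0 :: real) *\<^sub>R x i) = (\<Sum>i<p. if i = q then x i else 0)" by (intro sum.cong) auto
    then show ?thesis using q by simp
   qed
   show ?thesis using spec[OF J(3), of "\<lambda>i. if i = q then 1 else 0"] f(2)[OF q] q unfolding one by force
  qed
  then have "(\<Sum>q<p. d) \<le> (\<Sum>q<p. (\<Sum>S\<in>J. norm (t S q)) + e / real p)" by (intro sum_mono) simp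
  then have 1: "real p * d \<le> (\<Sum>S\<in>J. \<Sum>q<p. norm (t S q)) + e"
   using False by (subst sum.swap) (simp add: sum.distrib)
  have "(\<Sum>q<p. norm (t S q)) \<le> sqrt (real p) * L2_set (\<lambda>q. norm (t S q)) {..<p}" for S
  proof -
   have "(\<Sum>q<p. norm (t S q)) \<le> sqrt ((\<Sum>q<p. (norm (t S q))\<^sup>2) * real (card {..<p}))"
    by (intro real_le_rsqrt sum_squared_le_sum_of_squares)
   then show ?thesis by (simp add: L2_set_def real_sqrt_mult mult.commute)
  qed
  then have "2 ^ p * (\<Sum>S\<in>J. \<Sum>q<p. norm (t S q)) \<le> 2 ^ p * (\<Sum>S\<in>J. sqrt (real p) * L2_set (\<lambda>q. norm (t S q)) {..<p})"
   by (intro mult_left_mono sum_mono) auto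
  also have "\<dots> = sqrt (real p) * (\<Sum>S\<in>J. 2 ^ card {..<p} * L2_set (\<lambda>q. norm (t S q)) {..<p})"
   by (simp add: sum_distrib_left mult_ac)
  also have "\<dots> \<le> sqrt (real p) * (\<Sum>S\<in>J. 2 * (\<Sum>B\<in>Pow {..<p}. norm (\<Sum>q<p. sgn_of B q *\<^sub>R t S q)))"
   by (intro mult_left_mono sum_mono khinchine_lower) auto
  also have "\<dots> = sqrt (real p) * (2 * (\<Sum>B\<in>Pow {..<p}. \<Sum>S\<in>J. norm (\<Sum>q<p. sgn_of B q *\<^sub>R t S q)))"
   by (subst sum.swap) (simp add: sum_distrib_left)
  also have "\<dots> \<le> sqrt (real p) * (2 * (\<Sum>B\<in>Pow {..<p}. N))"
   using J(2) N by (intro mult_left_mono sum_mono) auto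
  also have "\<dots> = 2 ^ p * (2 * sqrt (real p) * N)" by (simp add: card_Pow)
  finally have "(\<Sum>S\<in>J. \<Sum>q<p. norm (t S q)) \<le> 2 * sqrt (real p) * N" by simp
  then show ?thesis using 1 by linarith
 qed
 then have "real p * d \<le> 2 * sqrt (real p) * N" by (rule field_le_epsilon)
 moreover have "real p * d = sqrt (real p) * (sqrt (real p) * d)" by (simp add: mult.assoc[symmetric])
 ultimately have "sqrt (real p) * (sqrt (real p) * d) \<le> sqrt (real p) * (2 * N)" by (simp only: mult_ac)
 then show ?thesis by (rule mult_left_le_imp_le) (use False in simp)
qed

text \<open>The functions \<open>f B D\<close> may depend on the signs, whereas \<open>N\<close>
  bounds single functions with the matrix \<open>a\<close> inserted. In the L1 model the best
  function for given signs yields the L1 norm, so \<open>sign_chaos_compare\<close> can be applied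
  to each coordinate and removes \<open>a\<close> at the price of the factor 4.\<close>

lemma functional_chaos:
 fixes K :: "'a::metric_space set" and m :: "'i => 'i => ('a => 'k::{real_normed_field,real_inner}) => 'k"
 assumes K: "compact K" "countable K" and R: "finite R"
  and m: "\<And>i j. i \<in> R ==> j \<in> R ==> bounded_functional K M (m i j)" "0 \<le> M"
  and f: "\<And>B D. f B D \<in> unit_ball K" and a: "\<And>i j. \<bar>a i j\<bar> = (1::real)"
  and N: "\<And>B D h. h \<in> unit_ball K ==> norm (sign_sum R R B D (\<lambda>i j. a i j *\<^sub>R m i j h)) \<le> N"
 shows "(\<Sum>D\<in>Pow R. \<Sum>B\<in>Pow R. norm (sign_sum R R B D (\<lambda>i j. m i j (f B D)))) \<le> 4 * (2 ^ card R * 2 ^ card R * N)"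
proof (rule field_le_epsilon)
 fix e :: real assume "0 < e"
 let ?P = "2 ^ card R * 2 ^ card R :: real"
 have e: "0 < e / ?P" using \<open>0 < e\<close> by simp
 let ?F = "(\<lambda>(B, D). f B D) ` (Pow R \<times> Pow R)"
 have F: "finite ?F" "?F \<subseteq> unit_ball K" using f R by auto
 have m': "\<forall>p\<in>R \<times> R. bounded_functional K M (case p of (i, j) => m i j)" using m(1) by auto
 obtain J :: "'a set set" and t :: "'a set => 'i \<times> 'i => 'k" where J: "finite J"
  "\<forall>c N. (\<forall>f\<in>unit_ball K. norm (\<Sum>p\<in>R \<times> R. c p *\<^sub>R (case p of (i, j) => m i j) f) \<le> N) -->
   (\<Sum>S\<in>J. norm (\<Sum>p\<in>R \<times> R. c p *\<^sub>R t S p)) \<le> N"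
  "\<forall>c. \<forall>h\<in>?F. (\<forall>p\<in>R \<times> R. \<bar>c p\<bar> \<le> 1) -->
   norm (\<Sum>p\<in>R \<times> R. c p *\<^sub>R (case p of (i, j) => m i j) h) \<le> (\<Sum>S\<in>J. norm (\<Sum>p\<in>R \<times> R. c p *\<^sub>R t S p)) + e / ?P"
  by (rule functional_model[OF K m' m(2) F e], rule that)
 let ?s = "\<lambda>B D (i, j). sgn_of B i * sgn_of D j" and ?t = "\<lambda>S i j. t S (i, j)"
 have conv: "sign_sum R R B D x = (\<Sum>p\<in>R \<times> R. ?s B D p *\<^sub>R (case p of (i, j) => x i j))" for B D and x :: "'i => 'i => 'k"
  by (simp add: sum.cartesian_product case_prod_unfold)
 have 1: "norm (sign_sum R R B D (\<lambda>i j. m i j (f B D))) \<le> (\<Sum>S\<in>J. norm (sign_sum R R B D (?t S))) + e / ?P"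
  if "B \<in> Pow R" "D \<in> Pow R" for B D
 proof -
  have "f B D \<in> ?F" using that by force
  from bspec[OF spec[OF J(3), of "?s B D"] this] show ?thesis unfolding conv by (auto simp: case_prod_unfold abs_mult)
 qed
 have 2: "(\<Sum>S\<in>J. norm (sign_sum R R B D (\<lambda>i j. a i j *\<^sub>R ?t S i j))) \<le> N" for B D
 proof -
  have "(\<Sum>S\<in>J. norm (\<Sum>p\<in>R \<times> R. (?s B D p * case_prod a p) *\<^sub>R t S p)) \<le> N"
  proof (rule mp[OF spec[OF spec[OF J(2)]]], rule ballI)
   show "norm (\<Sum>p\<in>R \<times> R. (?s B D p * case_prod a p) *\<^sub>R (case p of (i, j) => m i j) h) \<le> N"
    if "h \<in> unit_ball K" for h
    using N[OF that, of B D] unfolding conv by (simp add: case_prod_unfold)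
  qed
  then show ?thesis unfolding conv by (simp add: case_prod_unfold)
 qed
 have "(\<Sum>D\<in>Pow R. \<Sum>B\<in>Pow R. norm (sign_sum R R B D (\<lambda>i j. m i j (f B D)))) \<le>
   (\<Sum>D\<in>Pow R. \<Sum>B\<in>Pow R. (\<Sum>S\<in>J. norm (sign_sum R R B D (?t S))) + e / ?P)"
  by (intro sum_mono 1)
 also have "\<dots> = (\<Sum>S\<in>J. \<Sum>D\<in>Pow R. \<Sum>B\<in>Pow R. norm (sign_sum R R B D (?t S))) + e"
  using R by (simp add: sum.distrib card_Pow sum.swap[of _ J])
 also have "\<dots> \<le> (\<Sum>S\<in>J. 4 * (\<Sum>D\<in>Pow R. \<Sum>B\<in>Pow R. norm (sign_sum R R B D (\<lambda>i j. a i j *\<^sub>R ?t S i j)))) + e"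
  by (intro add_right_mono sum_mono sign_chaos_compare R a)
 also have "\<dots> = 4 * (\<Sum>D\<in>Pow R. \<Sum>B\<in>Pow R. \<Sum>S\<in>J. norm (sign_sum R R B D (\<lambda>i j. a i j *\<^sub>R ?t S i j))) + e"
  by (simp only: sum_distrib_left[symmetric]) (simp only: sum.swap[of _ J])
 also have "\<dots> \<le> 4 * (\<Sum>D\<in>Pow R. \<Sum>B\<in>Pow R. N) + e"
  by (intro add_right_mono mult_left_mono sum_mono 2) simp
 also have "\<dots> = 4 * (?P * N) + e" using R by (simp add: card_Pow)
 finally show "(\<Sum>D\<in>Pow R. \<Sum>B\<in>Pow R. norm (sign_sum R R B D (\<lambda>i j. m i j (f B D)))) \<le> 4 * (?P * N) + e" .
qed

subsection \<open>Escaping chains\<close>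

lemma unit_ball_restrict:
 fixes K :: "'a::t2_space set"
 shows "clopen_in K A ==> g \<in> unit_ball K ==> restrict0 A g \<in> unit_ball K"
 unfolding unit_ball_def using restrict0_in'[of K A g] by (simp add: restrict0_def)

lemma restrict0_split: "(\<lambda>x. restrict0 A g x + restrict0 (K - A) g x) = g" if "g \<in> cont_vanish K E"
 using that by (intro ext) (auto simp: restrict0_def cont_vanish_def)

lemma cont_vanish_clopen:
 fixes K :: "'a::t2_space set" and g :: "'a => 'k::real_normed_field"
 assumes A: "clopen_in K A"
 shows "g \<in> cfun A ==> g \<in> cfun K"
  and "g \<in> cfun K ==> restrict0 A g \<in> cfun A"
proof -
 have AK: "A \<subseteq> K" using A by (simp add: clopen_in_def)
 show "g \<in> cfun K" if g: "g \<in> cfun A"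
 proof -
  have "continuous_on K (restrict0 A g)"
   by (rule continuous_on_clopen_cases[OF A _ continuous_on_const[of _ 0]])
    (use g in "auto simp: restrict0_def cont_vanish_def")
  moreover have "restrict0 A g = g" using g by (intro ext) (auto simp: restrict0_def cont_vanish_def)
  ultimately show ?thesis using g AK by (auto simp: cont_vanish_def)
 qed
 show "restrict0 A g \<in> cfun A" if g: "g \<in> cfun K"
 proof -
  have "continuous_on A g" using g AK by (auto simp: cont_vanish_def intro: continuous_on_subset)
  then have "continuous_on A (restrict0 A g)" by (rule continuous_on_eq) (simp add: restrict0_def)
  then show ?thesis by (simp add: cont_vanish_def restrict0_def)
 qed
qed

lemma ex_clopen_small:
 fixes K :: "'a::metric_space set" and g :: "'a => 'k::real_normed_field"
 assumes K: "compact K" "countable K" and a: "a \<in> K" "norm (g a) < e" and g: "g \<in> cfun K"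
 obtains A where "clopen_in K A" "a \<in> A" "\<forall>x\<in>A. norm (g x) < e"
proof -
 have "continuous_on K g" using g by (simp add: cont_vanish_def)
 then obtain d where d: "0 < d" "\<forall>x\<in>K. dist x a < d --> dist (g x) (g a) < e - norm (g a)"
  using a unfolding continuous_on_iff by (metis diff_gt_0_iff_gt)
 obtain A where A: "clopen_in K A" "a \<in> A" "A \<subseteq> ball a d"
  by (rule clopen_nbhd[OF K a(1) open_ball, of a d]) (use d(1) that in auto)
 have "norm (g x) < e" if "x \<in> A" for x
 proof -
  have "x \<in> K" "dist x a < d" using A that by (auto simp: clopen_in_def dist_commute)
  then have "norm (g x - g a) < e - norm (g a)" using d(2) by (simp add: dist_norm)
  then show ?thesis using norm_triangle_sub[of "g x" "g a"] by linarith
 qed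
 then show thesis using that A by blast
qed

text \<open>A basic neighbourhood in the topology of pointwise convergence of forms;
  \<open>W\<close> lists the finitely many tests.\<close>

definition near :: "('e \<times> 'f) set => real => ('e => 'f => 'k::real_normed_field) => ('e => 'f => 'k) => bool" where
 "near W r y y' \<longleftrightarrow> (\<forall>(e, g)\<in>W. norm (y' e g - y e g) < r)"

lemma nearD: "near W r y y' ==> (e, g) \<in> W ==> norm (y' e g - y e g) < r"
 by (auto simp: near_def)

lemma near_refl: "0 < r ==> near W r y y"
 by (auto simp: near_def)

lemma near_mono: "near W r y y' ==> W' \<subseteq> W ==> r \<le> s ==> near W' s y y'"
 unfolding near_def by fastforce

lemma near_trans:
 assumes "near W r y y'" "near W s y' y''"
 shows "near W (r + s) y y''"
 unfolding near_def
proof safe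
 fix e g assume "(e, g) \<in> W"
 then have "norm (y' e g - y e g) < r" "norm (y'' e g - y' e g) < s" using assms by (blast dest: nearD)+
 then show "norm (y'' e g - y e g) < r + s"
  using norm_triangle_ineq[of "y'' e g - y' e g" "y' e g - y e g"] by simp
qed

text \<open>Such neighbourhoods are open: finitely many strict inequalities leave a common
  margin.\<close>

lemma near_slack:
 assumes "finite W" "near W r y y'"
 shows "\<exists>s>0. \<forall>y''. near W s y' y'' --> near W r y y''"
proof -
 have "\<exists>s>0. near W (r - s) y y'"
  using assms
 proof (induction W rule: finite_induct)
  case empty
  then show ?case by (auto simp: near_def intro: exI[of _ 1])
 next
  case (insert p W)
  then obtain s where s: "0 < s" "near W (r - s) y y'" by (auto simp: near_def)
  obtain e g where p: "p = (e, g)" by (cases p)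
  define a where "a = norm (y' e g - y e g)"
  have ar: "a < r" using insert.prems p by (simp add: near_def a_def)
  define t where "t = min s ((r - a) / 2)"
  have t: "t \<le> s" "t \<le> (r - a) / 2" unfolding t_def by (rule min.cobounded1, rule min.cobounded2)
  have t0: "0 < t" using s(1) ar unfolding t_def by simp
  have "near W (r - t) y y'" by (rule near_mono[OF s(2) subset_refl]) (use t(1) in linarith)
  moreover have "a < r - t" using t(2) ar by argo
  ultimately show ?case using t0 p by (intro exI[of _ t]) (simp add: near_def a_def)
 qed
 then obtain s where s: "0 < s" "near W (r - s) y y'" by blast
 then show ?thesis using near_trans[OF s(2), of s] by (intro exI[of _ s]) simp
qed

text \<open>\<open>y\<close> is a weak limit of elements of \<open>S\<close> that do not become small along a weak null net.\<close>

definition escaping ::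
 "'a::topological_space set => 'e set => real => ('e => ('a => 'k::real_normed_field) => 'k) set =>
 ('e => ('a => 'k) => 'k) => bool"
where
 "escaping K E d S y \<longleftrightarrow> (\<forall>W r \<Phi>. finite W \<and> W \<subseteq> E \<times> cfun K \<and> 0 < r \<and>
  finite \<Phi> \<and> (\<forall>\<phi>\<in>\<Phi>. \<exists>N. bounded_functional K N \<phi>) -->
   (\<exists>y'\<in>S. near W r y y' \<and> (\<exists>e\<in>E. \<exists>g\<in>unit_ball K. (\<forall>\<phi>\<in>\<Phi>. norm (\<phi> g) < r) \<and> d \<le> norm (y' e g))))"

lemma escapingE:
 assumes "escaping K E d S y" "finite W" "W \<subseteq> E \<times> cfun K" "0 < r" "finite \<Phi>" "\<forall>\<phi>\<in>\<Phi>. \<exists>N. bounded_functional K N \<phi>"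
 obtains y' e g where "y' \<in> S" "near W r y y'" "e \<in> E" "g \<in> unit_ball K" "\<forall>\<phi>\<in>\<Phi>. norm (\<phi> g) < r" "d \<le> norm (y' e g)"
proof -
 have "\<exists>y'\<in>S. near W r y y' \<and> (\<exists>e\<in>E. \<exists>g\<in>unit_ball K. (\<forall>\<phi>\<in>\<Phi>. norm (\<phi> g) < r) \<and> d \<le> norm (y' e g))"
  using spec[OF spec[OF spec[OF assms(1)[unfolded escaping_def], of W], of r], of \<Phi>] assms(2-) by simp
 then show thesis by (elim bexE conjE) (rule that)
qed

lemma escaping_near:
 assumes "escaping K E d S y" "finite W" "W \<subseteq> E \<times> cfun K" "0 < r"
 shows "\<exists>y'\<in>S. near W r y y'"
 by (rule escapingE[OF assms finite.emptyI]) auto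

lemma bounded_functional_point: "bounded_functional K 1 (\<lambda>g. g x)"
 by (simp add: bounded_functional_def)

text \<open>The families tested have all signed sums bounded by 1, not disjoint supports. This
  condition survives an isomorphism of C(K), up to the constant, whereas disjointness does
  not.\<close>

definition cotype_bound ::
 "'a::topological_space set => 'e set => real => ('e => ('a => 'k::real_normed_field) => 'k) => bool"
where
 "cotype_bound K E C y \<longleftrightarrow> (\<forall>p d e g.
  (\<forall>q<p. e q \<in> E \<and> g q \<in> cfun K \<and> d \<le> norm (y (e q) (g q))) \<and>
  (\<forall>B x. norm (\<Sum>q<p. sgn_of B q *\<^sub>R g q x) \<le> 1) --> sqrt (real p) * d \<le> C)"

lemma cotype_boundD:
 assumes "cotype_bound K E C y"
  and "\<And>q. q < p ==> e q \<in> E" "\<And>q. q < p ==> g q \<in> cfun K" "\<And>q. q < p ==> d \<le> norm (y (e q) (g q))"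
  and "\<And>B x. norm (\<Sum>q<p. sgn_of B q *\<^sub>R g q x) \<le> 1"
 shows "sqrt (real p) * d \<le> C"
 using assms unfolding cotype_bound_def by blast

definition admissible ::
 "'a::topological_space set => 'e set => real => real => ('e => ('a => 'k::real_normed_field) => 'k) => bool"
where
 "admissible K E M C y \<longleftrightarrow> (\<forall>e\<in>E. bounded_functional K M (y e)) \<and> cotype_bound K E C y"

text \<open>Modelled on Szlenk derivatives: \<open>S h\<close> plays the part of an
  \<open>h\<close>-th derived set. Demanding escape from every earlier stage treats successors and
  limits alike.\<close>

definition escape_chain where
 "escape_chain K E M C d l S \<longleftrightarrow> 0 < d \<and> (\<forall>g\<le>l. S g \<noteq> {} \<and> (\<forall>y\<in>S g. admissible K E M C y)) \<and>
  (\<forall>h\<le>l. \<forall>g<h. \<forall>y\<in>S h. escaping K E d (S g) y)" for l :: countable_ordinal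

lemma escape_chainD:
 assumes "escape_chain K E M C d l S"
 shows "0 < d" "g \<le> l ==> S g \<noteq> {}" "g \<le> l ==> y \<in> S g ==> admissible K E M C y"
  "h \<le> l ==> g < h ==> y \<in> S h ==> escaping K E d (S g) y"
 using assms unfolding escape_chain_def by blast+

lemma escape_chain_mono: "escape_chain K E M C d l S ==> k \<le> l ==> escape_chain K E M C d k S"
 unfolding escape_chain_def by (meson order_trans)

section \<open>Transport of chains along isomorphisms\<close>

lemma bounded_functional_compose:
 fixes K :: "'a::topological_space set" and K' :: "'b::topological_space set"
  and T :: "('b => 'k::real_normed_field) => 'a => 'k"
 assumes T: "bounded_lin (cfun K') (cfun K) T"
  and c: "0 \<le> c" "\<And>f b x. f \<in> cfun K' ==> (\<And>x. norm (f x) \<le> b) ==> norm (T f x) \<le> c * b"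
  and m: "bounded_functional K M m"
 shows "bounded_functional K' (M * c) (\<lambda>g. m (T g))"
 unfolding bounded_functional_def
proof (intro conjI ballI allI impI)
 show "0 \<le> M * c" using c(1) bounded_functionalD(1)[OF m] by simp
 fix f :: "'b => 'k" assume f: "f \<in> cfun K'"
 note Tf = bounded_linD(1)[OF T]
 show "m (T (\<lambda>x. f x + g x)) = m (T f) + m (T g)" if g: "g \<in> cfun K'" for g
  by (simp only: bounded_linD(2)[OF T f g] bounded_functionalD(2)[OF m Tf[OF f] Tf[OF g]])
 show "m (T (\<lambda>x. a * f x)) = a * m (T f)" for a
  by (simp only: bounded_linD(3)[OF T f] bounded_functionalD(3)[OF m Tf[OF f]])
 show "norm (m (T f)) \<le> M * c * b" if "\<forall>x. norm (f x) \<le> b" for b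
  using bounded_functionalD(4)[OF m Tf[OF f] c(2)[OF f]] that by (simp only: mult.assoc)
qed

lemma bounded_lin_sum:
 fixes K :: "'a::topological_space set" and K' :: "'b::topological_space set"
  and T :: "('b => 'k::real_normed_field) => 'a => 'k"
 assumes T: "bounded_lin (cfun K') (cfun K) T" and g: "\<And>i. i \<in> I ==> g i \<in> cfun K'"
 shows "T (\<lambda>x. \<Sum>i\<in>I. a i * g i x) = (\<lambda>y. \<Sum>i\<in>I. a i * T (g i) y)"
 using g
proof (induction I rule: infinite_finite_induct)
 case (insert i I)
 have "(\<lambda>x. \<Sum>i\<in>I. a i * g i x) \<in> cfun K'" using insert.prems by (intro cont_vanish_sum) simp
 then show ?case
  using insert bounded_linD(2)[OF T, of "\<lambda>x. a i * g i x"] bounded_linD(3)[OF T, of "g i"] by simp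
qed (use bounded_linD(3)[OF T, of "\<lambda>_. 0" 0] in simp_all)

lemma admissible_compose:
 fixes K :: "'a::topological_space set" and K' :: "'b::topological_space set"
  and T :: "('b => 'k::real_normed_field) => 'a => 'k"
 assumes T: "bounded_lin (cfun K') (cfun K) T"
  and c: "0 < c" "\<And>f b x. f \<in> cfun K' ==> (\<And>x. norm (f x) \<le> b) ==> norm (T f x) \<le> c * b"
  and y: "admissible K E M C y"
 shows "admissible K' E (M * c) (C * c) (\<lambda>e g. y e (T g))"
 unfolding admissible_def
proof (intro conjI ballI)
 have b: "bounded_functional K M (y e)" if "e \<in> E" for e using y that by (simp add: admissible_def)
 show "bounded_functional K' (M * c) (\<lambda>g. y e (T g))" if "e \<in> E" for e
  by (rule bounded_functional_compose[OF T less_imp_le[OF c(1)] c(2) b[OF that]])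
 show "cotype_bound K' E (C * c) (\<lambda>e g. y e (T g))"
  unfolding cotype_bound_def
 proof (intro allI impI, elim conjE)
  fix p d e and g :: "nat => 'b => 'k"
  assume g: "\<forall>q<p. e q \<in> E \<and> g q \<in> cfun K' \<and> d \<le> norm (y (e q) (T (g q)))"
   and 1: "\<forall>B x. norm (\<Sum>q<p. sgn_of B q *\<^sub>R g q x) \<le> 1"
  have co: "cotype_bound K E C y" using y by (simp add: admissible_def)
  \<comment> \<open>Division by the bound \<open>c\<close> of \<open>T\<close> brings the signed
    sums of the transported functions back to at most 1.\<close>
  let ?c = "of_real (1 / c) :: 'k" and ?h = "\<lambda>q x. of_real (1 / c) * T (g q) x"
  have Tg: "T (g q) \<in> cfun K" if "q < p" for q using bounded_linD(1)[OF T] g that by blast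
  have "sqrt (real p) * (d / c) \<le> C"
  proof (rule cotype_boundD[OF co])
   fix q assume q: "q < p"
   show "e q \<in> E" using g q by blast
   show "?h q \<in> cfun K" by (rule cont_vanish_ops(2)[OF Tg[OF q]])
   have "y (e q) (?h q) = ?c * y (e q) (T (g q))"
    by (rule bounded_functionalD(3)[OF b Tg[OF q]]) (use g q in blast)
   moreover have "d \<le> norm (y (e q) (T (g q)))" using g q by blast
   ultimately show "d / c \<le> norm (y (e q) (?h q))" using c(1) by (simp add: norm_mult norm_divide divide_right_mono)
  next
   fix B x
   let ?s = "\<lambda>x. \<Sum>q<p. of_real (sgn_of B q) * g q x"
   have "norm (T ?s x) \<le> c * 1"
   proof (rule c(2))
    show "?s \<in> cfun K'" using g by (intro cont_vanish_sum cont_vanish_ops(2)) simp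
    show "norm (?s x) \<le> 1" for x using 1 by (simp add: scaleR_conv_of_real)
   qed
   moreover have "T ?s = (\<lambda>x. \<Sum>q<p. of_real (sgn_of B q) * T (g q) x)"
    by (rule bounded_lin_sum[OF T]) (use g in simp)
   moreover have "(\<Sum>q<p. sgn_of B q *\<^sub>R ?h q x) = ?c * (\<Sum>q<p. of_real (sgn_of B q) * T (g q) x)"
    by (simp add: sum_distrib_left scaleR_conv_of_real mult_ac)
   ultimately show "norm (\<Sum>q<p. sgn_of B q *\<^sub>R ?h q x) \<le> 1"
    using c(1) by (simp add: norm_mult norm_divide divide_le_eq)
  qed
  then show "sqrt (real p) * d \<le> C * c" using c(1) by (simp add: divide_le_eq)
 qed
qed

lemma escaping_compose:
 fixes K :: "'a::topological_space set" and K' :: "'b::topological_space set"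
  and T :: "('b => 'k::real_normed_field) => 'a => 'k" and E :: "'e set"
 assumes T: "bounded_lin (cfun K') (cfun K) T"
  and U: "bounded_lin (cfun K) (cfun K') U" and TU: "\<And>f. f \<in> cfun K ==> T (U f) = f"
  and c: "0 < c" "\<And>f b x. f \<in> cfun K ==> (\<And>x. norm (f x) \<le> b) ==> norm (U f x) \<le> c * b"
  and S: "\<And>y. y \<in> S ==> admissible K E M C y" and y: "escaping K E d S y"
 shows "escaping K' E (d / c) ((\<lambda>y e g. y e (T g)) ` S) (\<lambda>e g. y e (T g))"
 unfolding escaping_def
proof (intro allI impI, elim conjE)
 fix W :: "('e \<times> ('b => 'k)) set" and r :: real and \<Phi> :: "(('b => 'k) => 'k) set"
 assume W: "finite W" "W \<subseteq> E \<times> cfun K'" and r: "0 < r"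
  and \<Phi>: "finite \<Phi>" "\<forall>\<phi>\<in>\<Phi>. \<exists>N. bounded_functional K' N \<phi>"
 let ?W = "(\<lambda>(e, g). (e, T g)) ` W" and ?\<Phi> = "(\<lambda>\<phi> g. \<phi> (U g)) ` \<Phi>" and ?r = "min r (r * c)"
 have W': "finite ?W" "?W \<subseteq> E \<times> cfun K" using W bounded_linD(1)[OF T] by auto
 have r': "0 < ?r" using r c(1) by simp
 have \<Phi>': "finite ?\<Phi>" "\<forall>\<phi>\<in>?\<Phi>. \<exists>N. bounded_functional K N \<phi>"
  using \<Phi> bounded_functional_compose[OF U less_imp_le[OF c(1)] c(2)] by blast+
 obtain y' e g where y': "y' \<in> S" "near ?W ?r y y'" and e: "e \<in> E" and g: "g \<in> unit_ball K"
  "\<forall>\<phi>\<in>?\<Phi>. norm (\<phi> g) < ?r" "d \<le> norm (y' e g)"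
  by (rule escapingE[OF y W' r' \<Phi>'])
 have gK: "g \<in> cfun K" "\<And>x. norm (g x) \<le> 1" using g(1) by (simp_all add: unit_ball_def)
 note Ug = bounded_linD(1)[OF U gK(1)]
 let ?a = "of_real (1 / c) :: 'k"
 let ?k = "\<lambda>x. ?a * U g x"
 have "norm (?k x) \<le> 1" for x
  using c(2)[OF gK, of x] c(1) by (simp add: norm_mult norm_divide divide_le_eq)
 then have k: "?k \<in> unit_ball K'" using cont_vanish_ops(2)[OF Ug] unfolding unit_ball_def by blast
 have "bounded_functional K M (y' e)" using S[OF y'(1)] e by (simp add: admissible_def)
 from bounded_functionalD(3)[OF this gK(1), of ?a] have "y' e (T ?k) = ?a * y' e g"
  by (simp only: bounded_linD(3)[OF T Ug] TU[OF gK(1)])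
 then have "d / c \<le> norm (y' e (T ?k))" using g(3) c(1) by (simp add: norm_mult norm_divide divide_right_mono)
 moreover have "norm (\<phi> ?k) < r" if f: "\<phi> \<in> \<Phi>" for \<phi>
 proof -
  obtain N where "bounded_functional K' N \<phi>" using bspec[OF \<Phi>(2) f] ..
  from bounded_functionalD(3)[OF this Ug, of ?a] have "norm (\<phi> ?k) = norm (\<phi> (U g)) / c"
   using c(1) by (simp add: norm_mult norm_divide)
  moreover have "norm (\<phi> (U g)) < r * c" using g(2) f by simp
  ultimately show ?thesis using c(1) by (simp add: divide_less_eq)
 qed
 moreover have "near W r (\<lambda>e g. y e (T g)) (\<lambda>e g. y' e (T g))" using y'(2) by (auto simp: near_def)
 ultimately show "\<exists>y'\<in>(\<lambda>y e g. y e (T g)) ` S. near W r (\<lambda>e g. y e (T g)) y' \<and>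
   (\<exists>e\<in>E. \<exists>g\<in>unit_ball K'. (\<forall>\<phi>\<in>\<Phi>. norm (\<phi> g) < r) \<and> d / c \<le> norm (y' e g))"
  using k by (intro bexI[OF _ imageI[OF y'(1)]] bexI[OF _ e] bexI[of _ ?k] conjI) blast+
qed

text \<open>Composition of all forms with an isomorphism changes constants only, so the length of
  chains is an isomorphism invariant of C(K).\<close>

lemma escape_chain_transfer:
 fixes K :: "'a::topological_space set" and K' :: "'b::topological_space set"
  and S :: "countable_ordinal => ('e => ('a => 'k::real_normed_field) => 'k) set"
 assumes iso: "(cfun K' :: ('b => 'k) set) \<simeq> cfun K" and S: "escape_chain K E M C d l S"
 obtains M' C' d' and S' :: "countable_ordinal => ('e => ('b => 'k) => 'k) set" where "escape_chain K' E M' C' d' l S'"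
proof -
 obtain T U where T: "bounded_lin (cfun K') (cfun K) (T :: ('b => 'k) => 'a => 'k)"
  and U: "bounded_lin (cfun K) (cfun K') U" and TU: "\<forall>f\<in>cfun K. T (U f) = f"
  using iso unfolding fun_iso_def by blast
 obtain c where c: "0 < c" "\<And>f b y. f \<in> cfun K' ==> (\<And>x. norm (f x) \<le> b) ==> norm (T f y) \<le> c * b"
  using bounded_lin_bound[OF T] by blast
 obtain c' where c': "0 < c'" "\<And>f b y. f \<in> cfun K ==> (\<And>x. norm (f x) \<le> b) ==> norm (U f y) \<le> c' * b"
  using bounded_lin_bound[OF U] by blast
 have "escape_chain K' E (M * c) (C * c) (d / c') l (\<lambda>g. (\<lambda>y e g. y e (T g)) ` S g)"
  unfolding escape_chain_def
 proof (intro conjI allI impI ballI)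
  show "0 < d / c'" using escape_chainD(1)[OF S] c'(1) by simp
  show "(\<lambda>y e g. y e (T g)) ` S g \<noteq> {}" if "g \<le> l" for g using escape_chainD(2)[OF S that] by simp
  show "admissible K' E (M * c) (C * c) y" if gl: "g \<le> l" and y: "y \<in> (\<lambda>y e g. y e (T g)) ` S g" for g y
  proof -
   obtain z where z: "z \<in> S g" "y = (\<lambda>e g. z e (T g))" using y by auto
   have "admissible K E M C z" by (rule escape_chainD(3)[OF S gl z(1)])
   then show ?thesis unfolding z(2) using admissible_compose[OF T c, of E M C z] by simp
  qed
  show "escaping K' E (d / c') ((\<lambda>y e g. y e (T g)) ` S g) y"
   if hl: "h \<le> l" and gh: "g < h" and y: "y \<in> (\<lambda>y e g. y e (T g)) ` S h" for g h y
  proof -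
   obtain z where z: "z \<in> S h" "y = (\<lambda>e g. z e (T g))" using y by auto
   have gl: "g \<le> l" using hl gh by simp
   have esc: "escaping K E d (S g) z" by (rule escape_chainD(4)[OF S hl gh z(1)])
   have adm: "\<And>y. y \<in> S g ==> admissible K E M C y" by (rule escape_chainD(3)[OF S gl])
   show ?thesis unfolding z(2)
    by (rule escaping_compose[OF T U bspec[OF TU] c' adm esc])
  qed
 qed
 then show thesis by (rule that)
qed

section \<open>Bumps produced by long chains\<close>

lemma bounded_functional_restrict:
 fixes K :: "'a::t2_space set"
 assumes A: "clopen_in K A" and m: "bounded_functional A N \<phi>"
 shows "bounded_functional K N (\<lambda>g. \<phi> (restrict0 A g))"
 unfolding bounded_functional_def
proof (intro conjI ballI allI impI)
 fix f g :: "'a => 'b" assume f: "f \<in> cfun K"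
 note r = cont_vanish_clopen(2)[OF A]
 have "restrict0 A (\<lambda>x. f x + g x) = (\<lambda>x. restrict0 A f x + restrict0 A g x)"
  "restrict0 A (\<lambda>x. c * f x) = (\<lambda>x. c * restrict0 A f x)" for c
  by (simp_all add: fun_eq_iff restrict0_def)
 then show "g \<in> cfun K ==> \<phi> (restrict0 A (\<lambda>x. f x + g x)) = \<phi> (restrict0 A f) + \<phi> (restrict0 A g)"
  "\<phi> (restrict0 A (\<lambda>x. c * f x)) = c * \<phi> (restrict0 A f)" for c
  using bounded_functionalD(2)[OF m r[OF f] r] bounded_functionalD(3)[OF m r[OF f]] by simp_all
 show "norm (\<phi> (restrict0 A f)) \<le> N * b" if "\<forall>x. norm (f x) \<le> b" for b
  by (rule bounded_functionalD(4)[OF m r[OF f]])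
   (use that in "auto simp: restrict0_def intro: order_trans[OF norm_ge_zero]")
qed (rule bounded_functionalD(1)[OF m])

text \<open>A dichotomy. If no form of stage \<open>k\<close> near \<open>y\<close> is large on
  functions carried by \<open>V\<close> and small at \<open>t\<close>, then all escaping between the
  stages \<open>k\<close> and \<open>k + b\<close> takes place on \<open>K - V\<close>, and
  restriction gives a chain of length \<open>b\<close> there, which the induction hypothesis
  forbids.\<close>

lemma escape_chain_step:
 fixes K :: "'a::metric_space set" and S :: "countable_ordinal => ('e => ('a => 'k::real_normed_field) => 'k) set"
 assumes K: "compact K" "countable K" and t: "t \<in> K" and clop: "clopen_in K V" "t \<in> V"
  and S: "escape_chain K E M C d l S" and l: "ord_add k b \<le> l"
  and IH: "\<And>M C d S. \<not> escape_chain (K - V) E M C d b (S :: countable_ordinal => ('e => ('a => 'k) => 'k) set)"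
  and y: "y \<in> S (ord_add k b)" and W: "finite W" "W \<subseteq> E \<times> cfun K" and r: "0 < r" and s0: "0 < s0"
 obtains y' e g where "y' \<in> S k" "near W r y y'" "e \<in> E" "g \<in> unit_ball K" "\<forall>x. x \<notin> V --> g x = 0"
  "norm (g t) < s0" "d / 4 \<le> norm (y' e g)"
proof (rule ccontr)
 assume "\<not> thesis"
 with that have no: "\<not> (\<exists>y'\<in>S k. near W r y y' \<and> (\<exists>e\<in>E. \<exists>g\<in>unit_ball K. (\<forall>x. x \<notin> V --> g x = 0) \<and> norm (g t) < s0 \<and> d / 4 \<le> norm (y' e g)))"
  by blast
 have d: "0 < d" by (rule escape_chainD(1)[OF S])
 have kl: "ord_add k g \<le> l" if "g \<le> b" for g using that l by (meson ord_add_le_cancel order_trans)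
 have kl0: "k \<le> l" using ord_le_add l order_trans by blast
 let ?A = "K - V"
 have A: "clopen_in K ?A" by (rule clopen_in_Diff_self[OF clop(1)])
 have AK: "?A \<subseteq> K" by blast
 have WW: "W' \<subseteq> E \<times> cfun K" if "W' \<subseteq> E \<times> cfun ?A" for W' :: "('e \<times> ('a => 'k)) set"
  using that cont_vanish_clopen(1)[OF A] by fast
 define S' where "S' g = {y' \<in> S (ord_add k g). near W r y y'}" for g
 \<comment> \<open>If a form of a higher stage had such a large value, an approximating form of
   stage \<open>k\<close> would keep at least half of it, which was excluded.\<close>
 have small: "norm (y' e g) < d / 2"
  if y': "y' \<in> S' c" and c: "c \<le> b" and e: "e \<in> E" and g: "g \<in> unit_ball K" "\<forall>x. x \<notin> V --> g x = 0" "norm (g t) < s0"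
  for y' c e g
 proof (rule ccontr)
  assume "\<not> ?thesis"
  then have big: "d / 2 \<le> norm (y' e g)" by simp
  have nr: "near W r y y'" and mem: "y' \<in> S (ord_add k c)" using y' by (simp_all add: S'_def)
  have "\<exists>y''\<in>S k. near W r y y'' \<and> d / 4 \<le> norm (y'' e g)"
  proof (cases "c = 0")
   case True
   then show ?thesis using nr mem big d by (intro bexI[of _ y']) auto
  next
   case False
   obtain s where s: "0 < s" "\<forall>y''. near W s y' y'' --> near W r y y''" using near_slack[OF W(1) nr] by blast
   have esc: "escaping K E d (S k) y'" by (rule escape_chainD(4)[OF S kl[OF c] ord_less_add[OF False] mem])
   let ?W = "insert (e, g) W"
   have W': "finite ?W" "?W \<subseteq> E \<times> cfun K" using W e g(1) by (auto simp: unit_ball_def)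
   have "0 < min s (d / 4)" using s(1) d by simp
   from escaping_near[OF esc W' this]
   obtain y'' where y'': "y'' \<in> S k" "near ?W (min s (d / 4)) y' y''" by blast
   have "near W s y' y''" by (rule near_mono[OF y''(2)]) auto
   then have "near W r y y''" using s(2) by blast
   moreover have "norm (y'' e g - y' e g) < d / 4" using nearD[OF y''(2), of e g] by simp
   then have "d / 4 \<le> norm (y'' e g)" using big norm_triangle_ineq2[of "y' e g" "y'' e g"] by (simp add: norm_minus_commute)
   ultimately show ?thesis using y''(1) by blast
  qed
  then show False using no e g by blast
 qed
 have "escape_chain ?A E M C (d / 2) b S'"
  unfolding escape_chain_def
 proof (intro conjI allI impI ballI)
  show "0 < d / 2" using d by simp
  show "S' g \<noteq> {}" if g: "g \<le> b" for g
  proof (cases "g = b")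
   case True
   then show ?thesis using y near_refl[OF r] by (auto simp: S'_def)
  next
   case False
   then have "escaping K E d (S (ord_add k g)) y"
    using g by (intro escape_chainD(4)[OF S l _ y]) simp
   from escaping_near[OF this W r] show ?thesis by (auto simp: S'_def)
  qed
  show "admissible ?A E M C y'" if g: "g \<le> b" and y': "y' \<in> S' g" for g y'
  proof -
   have adm: "admissible K E M C y'" using escape_chainD(3)[OF S kl[OF g]] y' by (simp add: S'_def)
   have "bounded_functional ?A M (y' e)" if "e \<in> E" for e
   proof -
    have bf: "bounded_functional K M (y' e)" using adm that by (simp add: admissible_def)
    show ?thesis
     unfolding bounded_functional_def
     by (intro conjI ballI allI impI bounded_functionalD[OF bf] cont_vanish_clopen(1)[OF A]) auto
   qed
   moreover have "cotype_bound ?A E C y'"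
    unfolding cotype_bound_def
   proof (intro allI impI, elim conjE)
    fix p c e and g :: "nat => 'a => 'k"
    assume 1: "\<forall>q<p. e q \<in> E \<and> g q \<in> cfun ?A \<and> c \<le> norm (y' (e q) (g q))"
     and 2: "\<forall>B x. norm (\<Sum>q<p. sgn_of B q *\<^sub>R g q x) \<le> 1"
    have co: "cotype_bound K E C y'" using adm by (simp add: admissible_def)
    show "sqrt (real p) * c \<le> C"
     by (rule cotype_boundD[OF co, of p e g]) (use 1 2 cont_vanish_clopen(1)[OF A] in auto)
   qed
   ultimately show ?thesis by (simp add: admissible_def)
  qed
  show "escaping ?A E (d / 2) (S' g) y1" if h: "h \<le> b" and gh: "g < h" and y1: "y1 \<in> S' h" for g h y1
   unfolding escaping_def
  proof (intro allI impI, elim conjE)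
   fix W' :: "('e \<times> ('a => 'k)) set" and r' :: real and \<Phi> :: "(('a => 'k) => 'k) set"
   assume W': "finite W'" "W' \<subseteq> E \<times> cfun ?A" and r': "0 < r'"
    and \<Phi>: "finite \<Phi>" "\<forall>\<phi>\<in>\<Phi>. \<exists>N. bounded_functional ?A N \<phi>"
   have gb: "g \<le> b" using h gh by simp
   have nr: "near W r y y1" and mem: "y1 \<in> S (ord_add k h)" using y1 by (simp_all add: S'_def)
   obtain s where s: "0 < s" "\<forall>y''. near W s y1 y'' --> near W r y y''" using near_slack[OF W(1) nr] by blast
   have esc: "escaping K E d (S (ord_add k g)) y1"
    by (rule escape_chainD(4)[OF S kl[OF h] ord_add_less_mono[OF gh] mem])
   have W'': "finite (W \<union> W')" "W \<union> W' \<subseteq> E \<times> cfun K" using W W' WW[OF W'(2)] by auto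
   \<comment> \<open>Evaluation at \<open>t\<close> is added to the tests, so that the escaping
     function is small at \<open>t\<close> and \<open>small\<close> applies to its part on
     \<open>V\<close>.\<close>
   let ?\<Phi> = "insert (\<lambda>g. g t) ((\<lambda>\<phi> g. \<phi> (restrict0 ?A g)) ` \<Phi>)" and ?r = "min s (min r' s0)"
   have \<Phi>': "finite ?\<Phi>" "\<forall>\<phi>\<in>?\<Phi>. \<exists>N. bounded_functional K N \<phi>"
    using \<Phi> bounded_functional_point bounded_functional_restrict[OF A] by blast+
   have "0 < ?r" using s(1) r' s0 by simp
   from escapingE[OF esc W'' this \<Phi>'] obtain y2 e f where y2: "y2 \<in> S (ord_add k g)" "near (W \<union> W') ?r y1 y2"
    and e: "e \<in> E" and f: "f \<in> unit_ball K" "\<forall>\<phi>\<in>?\<Phi>. norm (\<phi> f) < ?r" "d \<le> norm (y2 e f)" by metis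
   have "near W s y1 y2" by (rule near_mono[OF y2(2)]) auto
   then have "near W r y y2" using s(2) by blast
   then have y2S: "y2 \<in> S' g" using y2(1) by (simp add: S'_def)
   have fK: "f \<in> cfun K" using f(1) by (simp add: unit_ball_def)
   let ?o = "restrict0 V f" and ?a = "restrict0 ?A f"
   have oK: "?o \<in> unit_ball K" by (rule unit_ball_restrict[OF clop(1) f(1)])
   have aK: "?a \<in> cfun ?A" by (rule cont_vanish_clopen(2)[OF A fK])
   \<comment> \<open>The part on \<open>V\<close> contributes less than half, so at least
     \<open>d / 2\<close> of the escaping value is left on \<open>K - V\<close>.\<close>
   have "norm (y2 e ?o) < d / 2"
    by (rule small[OF y2S gb e oK]) (use f(2) clop(2) in "simp_all add: restrict0_def")
   moreover have "y2 e f = y2 e ?o + y2 e ?a"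
   proof -
    have bf: "bounded_functional K M (y2 e)"
     using escape_chainD(3)[OF S kl[OF gb] y2(1)] e by (simp add: admissible_def)
    show ?thesis
     using bounded_functionalD(2)[OF bf restrict0_in'[OF clop(1) fK] restrict0_in'[OF A fK]] restrict0_split[OF fK] by simp
   qed
   then have "norm (y2 e f) \<le> norm (y2 e ?o) + norm (y2 e ?a)" by (simp only: norm_triangle_ineq)
   ultimately have big: "d / 2 \<le> norm (y2 e ?a)" using f(3) by linarith
   have "?a \<in> unit_ball ?A" using aK f(1) by (simp add: unit_ball_def restrict0_def)
   moreover have "\<forall>\<phi>\<in>\<Phi>. norm (\<phi> ?a) < r'" using f(2) by simp
   moreover have "near W' r' y1 y2" by (rule near_mono[OF y2(2)]) auto
   ultimately show "\<exists>y'\<in>S' g. near W' r' y1 y' \<and> (\<exists>e\<in>E. \<exists>g\<in>unit_ball ?A. (\<forall>\<phi>\<in>\<Phi>. norm (\<phi> g) < r') \<and> d / 2 \<le> norm (y' e g))"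
    using y2S e big by (intro bexI[OF _ y2S] bexI[OF _ e] bexI[of _ ?a] conjI)
  qed
 qed
 then show False using IH by blast
qed

text \<open>Each block of length \<open>b\<close> yields one bump in \<open>V\<close> that is small
  at \<open>t\<close>. After it is cut off near \<open>t\<close>, the remaining bumps are sought in
  a clopen neighbourhood of \<open>t\<close> where it vanishes, and hence have disjoint supports.
  Approximation preserves the values obtained so far.\<close>

lemma escape_chain_bumps:
 fixes K :: "'a::metric_space set" and S :: "countable_ordinal => ('e => ('a => 'k::real_normed_field) => 'k) set"
 assumes K: "compact K" "countable K" and t: "t \<in> K"
  and S: "escape_chain K E M C d l S"
  and IH: "\<forall>V. clopen_in K V \<and> t \<in> V --> (\<forall>M C d S. \<not> escape_chain (K - V) E M C d b (S :: countable_ordinal => ('e => ('a => 'k) => 'k) set))"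
  and l: "ord_nmult b p \<le> l" and y: "y \<in> S (ord_nmult b p)" and V: "clopen_in K V" "t \<in> V"
  and W: "finite W" "W \<subseteq> E \<times> cfun K" and r: "0 < r"
 shows "\<exists>y' e g. y' \<in> S 0 \<and> near W r y y' \<and> (\<forall>q<p. e q \<in> E \<and> g q \<in> unit_ball K \<and> d / 8 \<le> norm (y' (e q) (g q))) \<and>
  (\<forall>x. (\<forall>q<p. g q x \<noteq> 0 --> x \<in> V)) \<and> (\<forall>x. \<forall>q<p. \<forall>q'<p. g q x \<noteq> 0 \<and> g q' x \<noteq> 0 --> q = q')"
 using l y V W r
proof (induction p arbitrary: y V W r)
 case 0
 then show ?case using near_refl by (intro exI[of _ y]) simp
next
 case (Suc p)
 have d: "0 < d" by (rule escape_chainD(1)[OF S])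
 note Suc.prems(1,2)[unfolded ord_nmult_Suc]
 have pl: "ord_nmult b p \<le> l" using \<open>ord_add (ord_nmult b p) b \<le> l\<close> ord_le_add order_trans by blast
 have r2: "0 < r / 2" using Suc.prems(7) by simp
 have IH': "\<not> escape_chain (K - V) E M C d b S" for M C d and S :: "countable_ordinal => ('e => ('a => 'k) => 'k) set"
  using IH Suc.prems(3,4) by simp
 \<comment> \<open>Cutting off near \<open>t\<close> must cost at most \<open>d / 16\<close>. The
   absolute value is a precaution: nonnegativity of \<open>M\<close> is derived only below.\<close>
 let ?s = "d / (16 * (\<bar>M\<bar> + 1))"
 have s: "0 < ?s" using d by (intro divide_pos_pos mult_pos_pos) linarith+
 obtain y1 e0 g0 where y1: "y1 \<in> S (ord_nmult b p)" "near W (r / 2) y y1" and e0: "e0 \<in> E"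
  and g0: "g0 \<in> unit_ball K" "\<forall>x. x \<notin> V --> g0 x = 0" "norm (g0 t) < ?s" "d / 4 \<le> norm (y1 e0 g0)"
  by (rule escape_chain_step[OF K t Suc.prems(3,4) S \<open>ord_add (ord_nmult b p) b \<le> l\<close> IH'
   \<open>y \<in> S (ord_add (ord_nmult b p) b)\<close> Suc.prems(5,6) r2 s])
 have bf: "bounded_functional K M (y1 e0)"
  using escape_chainD(3)[OF S pl y1(1)] e0 by (simp add: admissible_def)
 have M: "0 \<le> M" by (rule bounded_functionalD(1)[OF bf])
 have gK: "g0 \<in> cfun K" using g0(1) by (simp add: unit_ball_def)
 obtain B0 where B0: "clopen_in K B0" "t \<in> B0" "\<forall>x\<in>B0. norm (g0 x) < ?s"
  by (rule ex_clopen_small[OF K t g0(3) gK])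
 let ?B = "V \<inter> B0"
 have B: "clopen_in K ?B" "t \<in> ?B" using clopen_in_Int[OF Suc.prems(3) B0(1)] Suc.prems(4) B0(2) by auto
 let ?g = "restrict0 (K - ?B) g0" and ?h = "restrict0 ?B g0"
 have hg: "?h \<in> cfun K" "?g \<in> cfun K"
  by (rule restrict0_in'[OF B(1) gK], rule restrict0_in'[OF clopen_in_Diff_self[OF B(1)] gK])
 have gu: "?g \<in> unit_ball K" by (rule unit_ball_restrict[OF clopen_in_Diff_self[OF B(1)] g0(1)])
 have "norm (?h x) \<le> ?s" for x using B0(3) s by (cases "x \<in> ?B") (simp_all add: restrict0_def less_imp_le)
 then have "norm (y1 e0 ?h) \<le> M * ?s" by (rule bounded_functionalD(4)[OF bf hg(1)])
 also have "\<dots> \<le> d / 16" using d M by (simp add: divide_le_eq field_simps)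
 finally have 1: "norm (y1 e0 ?h) \<le> d / 16" .
 have "y1 e0 g0 = y1 e0 ?h + y1 e0 ?g" using bounded_functionalD(2)[OF bf hg] restrict0_split[OF gK] by simp
 then have "norm (y1 e0 g0) \<le> norm (y1 e0 ?h) + norm (y1 e0 ?g)" by (simp only: norm_triangle_ineq)
 \<comment> \<open>\<open>d / 4\<close> less \<open>d / 16\<close> for cutting off; another
   \<open>d / 16\<close> is spent on the approximation by a form of stage 0, and
   \<open>d / 8\<close> is left.\<close>
 then have 2: "3 * d / 16 \<le> norm (y1 e0 ?g)" using 1 g0(4) by linarith
 let ?W = "insert (e0, ?g) W" and ?r = "min (r / 2) (d / 16)"
 have W': "finite ?W" "?W \<subseteq> E \<times> cfun K" using Suc.prems(5,6) e0 hg(2) by auto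
 have r': "0 < ?r" using r2 d by simp
 obtain y' e g where y': "y' \<in> S 0" "near ?W ?r y1 y'"
  and eg: "\<forall>q<p. e q \<in> E \<and> g q \<in> unit_ball K \<and> d / 8 \<le> norm (y' (e q) (g q))"
  and sp: "\<forall>x. \<forall>q<p. g q x \<noteq> 0 --> x \<in> ?B" and dj: "\<forall>x. \<forall>q<p. \<forall>q'<p. g q x \<noteq> 0 \<and> g q' x \<noteq> 0 --> q = q'"
  using Suc.IH[OF pl y1(1) B W' r'] by (elim exE conjE)
 have "near W (r / 2) y1 y'" by (rule near_mono[OF y'(2)]) auto
 then have near: "near W r y y'" using near_trans[OF y1(2)] by fastforce
 have "norm (y' e0 ?g - y1 e0 ?g) < d / 16" using nearD[OF y'(2), of e0 ?g] by simp
 then have 3: "d / 8 \<le> norm (y' e0 ?g)"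
  using 2 norm_triangle_ineq2[of "y1 e0 ?g" "y' e0 ?g"] by (simp add: norm_minus_commute)
 let ?e = "e(p := e0)" and ?f = "g(p := ?g)"
 have g0': "?g x \<noteq> 0 ==> x \<in> V \<and> x \<notin> ?B" for x using g0(2) by (auto simp: restrict0_def split: if_splits)
 have "\<forall>q<Suc p. ?e q \<in> E \<and> ?f q \<in> unit_ball K \<and> d / 8 \<le> norm (y' (?e q) (?f q))"
  using eg e0 gu 3 by (simp add: less_Suc_eq)
 moreover have "\<forall>x. \<forall>q<Suc p. ?f q x \<noteq> 0 --> x \<in> V"
  using sp g0' by (simp add: less_Suc_eq)
 moreover have "q = q'" if "q < Suc p" "q' < Suc p" "?f q x \<noteq> 0" "?f q' x \<noteq> 0" for x q q'
 proof (cases "q = p")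
  case True
  then have "x \<notin> ?B" using that(3) g0' by simp
  then show ?thesis using that(2,4) sp True by (auto simp: less_Suc_eq split: if_splits)
 next
  case False
  then have q: "q < p" "g q x \<noteq> 0" using that by simp_all
  then have "x \<in> ?B" using sp by blast
  then have "q' \<noteq> p" using that(4) g0'[of x] by auto
  then have "q' < p" "g q' x \<noteq> 0" using that by simp_all
  then show ?thesis using dj q by blast
 qed
 then have "\<forall>x. \<forall>q<Suc p. \<forall>q'<Suc p. ?f q x \<noteq> 0 \<and> ?f q' x \<noteq> 0 --> q = q'" by blast
 ultimately show ?case using y'(1) near by (intro exI[of _ y'] exI[of _ ?e] exI[of _ ?f] conjI)
qed

text \<open>The length contains \<open>p\<close> blocks \<open>omega_pow z\<close> for every
  \<open>p\<close>, hence there are \<open>p\<close> disjoint bumps. Their signed sums are bounded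
  by 1, so the cotype bound gives \<open>sqrt (real p) * (d / 8) \<le> C\<close> for all
  \<open>p\<close>.\<close>

lemma no_escape_chain_singleton:
 fixes K :: "'a::metric_space set" and S :: "countable_ordinal => ('e => ('a => 'k::real_normed_field) => 'k) set"
 assumes K: "compact K" "countable K" and t: "t \<in> K"
  and IH: "\<forall>V. clopen_in K V \<and> t \<in> V --> (\<forall>M C d S. \<not> escape_chain (K - V) E M C d (omega_pow z) (S :: countable_ordinal => ('e => ('a => 'k) => 'k) set))"
 shows "\<not> escape_chain K E M C d (omega_pow (ord_succ z)) S"
proof
 assume S: "escape_chain K E M C d (omega_pow (ord_succ z)) S"
 have d: "0 < d" by (rule escape_chainD(1)[OF S])
 have "sqrt (real p) * (d / 8) \<le> C" for p
 proof -
  have pl: "ord_nmult (omega_pow z) p \<le> omega_pow (ord_succ z)" by (rule ord_nmult_le_omega_pow_succ)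
  then obtain y where y: "y \<in> S (ord_nmult (omega_pow z) p)" using escape_chainD(2)[OF S] by blast
  obtain y' e g where y': "y' \<in> S 0" and eg: "\<forall>q<p. e q \<in> E \<and> g q \<in> unit_ball K \<and> d / 8 \<le> norm (y' (e q) (g q))"
   and dj: "\<forall>x. \<forall>q<p. \<forall>q'<p. g q x \<noteq> 0 \<and> g q' x \<noteq> 0 --> q = q'"
   using escape_chain_bumps[OF K t S IH pl y clopen_in_self[OF K(1)] t finite.emptyI empty_subsetI zero_less_one]
   by (elim exE conjE)
  have "cotype_bound K E C y'" using escape_chainD(3)[OF S _ y'] by (simp add: admissible_def less_imp_le)
  then show ?thesis
  proof (rule cotype_boundD)
   fix q assume "q < p"
   then show "e q \<in> E" "g q \<in> cfun K" "d / 8 \<le> norm (y' (e q) (g q))"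
    using eg by (simp_all add: unit_ball_def)
  next
   fix B x
   show "norm (\<Sum>q<p. sgn_of B q *\<^sub>R g q x) \<le> 1"
   proof (cases "\<exists>q<p. g q x \<noteq> 0")
    case True
    then obtain q where q: "q < p" "g q x \<noteq> 0" by blast
    have "(\<Sum>q<p. sgn_of B q *\<^sub>R g q x) = (\<Sum>i\<in>{q}. sgn_of B i *\<^sub>R g i x)"
     by (rule sum.mono_neutral_right) (use q dj in auto)
    then have "norm (\<Sum>q<p. sgn_of B q *\<^sub>R g q x) = norm (g q x)" by (simp add: sgn_of_def)
    then show ?thesis using eg q(1) by (simp add: unit_ball_def)
   qed simp
  qed
 qed
 then have le: "sqrt (real p) \<le> 8 * C / d" for p using d by (simp add: field_simps)
 obtain p where p: "(8 * C / d)\<^sup>2 < real p" using reals_Archimedean2 by blast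
 have "8 * C / d < sqrt (real p)"
  by (rule order_le_less_trans[OF abs_ge_self]) (use real_sqrt_less_mono[OF p] in "simp only: real_sqrt_abs")
 then show False using le[of p] by linarith
qed

text \<open>The length of escaping chains determines the class of \<open>K\<close>: a chain of length \<open>\<omega>^(z+1)\<close> yields
 arbitrarily many disjoint bumps, which the cotype condition forbids, unless it already escapes on a
 clopen subset of smaller class.\<close>

theorem no_escape_chain:
 fixes K :: "'a::metric_space set" and S :: "countable_ordinal => ('e => ('a => 'k::real_normed_field) => 'k) set"
 assumes "compact K" "countable K" "rank_class K z"
 shows "\<not> escape_chain K E M C d (omega_pow (ord_succ z)) S"
 using assms
proof (induction z arbitrary: K M C d S rule: less_induct)
 case (less z)
 let ?G = "CB K (omega_pow z)"
 have G: "compact ?G" "countable ?G" "?G \<noteq> {}"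
  using compact_CB[OF less.prems(1)] countable_subset[OF CB_subset less.prems(2)]
   less.prems(3) by (auto simp: rank_class_def)
 obtain t where t: "t \<in> ?G" "\<not> t islimpt ?G" using compact_countable_isolated[OF G] by blast
 have tK: "t \<in> K" using t(1) CB_subset by blast
 obtain U where U: "open U" "t \<in> U" "?G \<inter> U \<subseteq> {t}" using t(2) unfolding islimpt_def by auto
 obtain A where A: "clopen_in K A" "t \<in> A" "A \<subseteq> U"
  by (rule clopen_nbhd[OF less.prems(1,2) tK U(1,2)])
 have AK: "compact A" "countable A" using A(1) countable_subset[OF _ less.prems(2)] by (auto simp: clopen_in_def)
 \<comment> \<open>\<open>t\<close> is isolated in the last relevant derivative, so a small clopen
   neighbourhood has \<open>t\<close> as its only point of that rank.\<close>
 have cbA: "CB A (omega_pow z) = {t}"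
  unfolding CB_clopen[OF A(1)] using U(3) A(2,3) t(1) by auto
 have no: "\<not> escape_chain (A - V) E M C d (omega_pow z) S"
  if cl: "clopen_in A V" "t \<in> V" for V M C d and S :: "countable_ordinal => ('e => ('a => 'k) => 'k) set"
 proof
  assume S: "escape_chain (A - V) E M C d (omega_pow z) S"
  have B: "compact (A - V)" "countable (A - V)" using cl(1) AK(2) by (auto simp: clopen_in_def)
  have empty: "CB (A - V) (omega_pow z) = {}"
   using CB_clopen[OF clopen_in_Diff_self[OF cl(1)], of "omega_pow z"] cbA cl(2) by auto
  show False
  proof (cases "finite (A - V)")
   case True
   obtain y where y: "y \<in> S (omega_pow z)" using escape_chainD(2)[OF S order_refl] by blast
   have esc: "escaping (A - V) E d (S 0) y" by (rule escape_chainD(4)[OF S order_refl omega_pow_pos y])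
   \<comment> \<open>On a finite set all evaluations together are a finite family of tests, so
     weakly small functions are small in norm and nothing can escape.\<close>
   let ?\<Phi> = "(\<lambda>x g. g x) ` (A - V) :: (('a => 'k) => 'k) set" and ?r = "d / (\<bar>M\<bar> + 1)"
   have \<Phi>: "finite ?\<Phi>" "\<forall>\<phi>\<in>?\<Phi>. \<exists>N. bounded_functional (A - V) N \<phi>"
    using True bounded_functional_point by blast+
   have d: "0 < d" by (rule escape_chainD(1)[OF S])
   then have r: "0 < ?r" by (intro divide_pos_pos) linarith+
   obtain y' e g where y': "y' \<in> S 0" "e \<in> E" "g \<in> unit_ball (A - V)" "\<forall>\<phi>\<in>?\<Phi>. norm (\<phi> g) < ?r" "d \<le> norm (y' e g)"
    by (rule escapingE[OF esc finite.emptyI empty_subsetI r \<Phi>])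
   have m: "bounded_functional (A - V) M (y' e)"
    using escape_chainD(3)[OF S _ y'(1)] y'(2) by (simp add: admissible_def less_imp_le)
   have "norm (y' e g) \<le> M * ?r"
   proof (rule bounded_functionalD(4)[OF m])
    show "norm (g x) \<le> ?r" for x
     using y'(3,4) r by (cases "x \<in> A - V") (auto simp: unit_ball_def cont_vanish_def less_imp_le)
   qed (use y'(3) in "simp add: unit_ball_def")
   also have "\<dots> < d" using bounded_functionalD(1)[OF m] d by (simp add: divide_less_eq)
   finally show False using y'(5) by simp
  next
   case False
   obtain v where v: "rank_class (A - V) v" using ex_rank_class[OF B False] by blast
   \<comment> \<open>Off a neighbourhood of \<open>t\<close> the class is smaller than
     \<open>z\<close>, so the induction hypothesis forbids even chains of length
     \<open>omega_pow z\<close>.\<close>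
   have "\<not> omega_pow z \<le> omega_pow v"
    using v empty CB_antimono[of "omega_pow z" "omega_pow v" "A - V"] by (auto simp: rank_class_def)
   then have "v < z" by simp
   then have "omega_pow (ord_succ v) \<le> omega_pow z" by (simp add: ord_succ_le_iff)
   then show False using less.IH[OF \<open>v < z\<close> B v] escape_chain_mono[OF S] by blast
  qed
 qed
 have no': "\<forall>V. clopen_in A V \<and> t \<in> V --> (\<forall>M C d S. \<not> escape_chain (A - V) E M C d (omega_pow z) (S :: countable_ordinal => ('e => ('a => 'k) => 'k) set))"
  by (intro allI impI no) simp_all
 show ?case
 proof
  assume S: "escape_chain K E M C d (omega_pow (ord_succ z)) S"
  \<comment> \<open>\<open>A\<close> has the same class as \<open>K\<close>, so a chain on
    \<open>K\<close> moves to the set with a single top point.\<close>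
  have iso: "(cfun A :: ('a => 'k) set) \<simeq> cfun K"
   by (rule cont_vanish_iso[OF AK rank_class_singleton[OF cbA] less.prems])
  show False
   by (rule escape_chain_transfer[OF iso S])
    (use no_escape_chain_singleton[OF AK A(2) no'] in blast)
 qed
qed

subsection \<open>Isomorphisms of tensor products\<close>

context tensor_pair
begin

text \<open>One list serves all functionals at once, with an error proportional to their bound;
  applied to evaluations it gives approximation uniform in the points.\<close>

lemma functional_approx_cost:
 assumes z: "z \<in> vecs P" and e: "0 < e"
 obtains ps where "valid ps" "cost ps \<le> vnorm P z + e"
  "\<forall>C L. functional C L --> norm (L z - (\<Sum>(x, y)\<leftarrow>ps. L (elem_tensor x y))) \<le> \<bar>C\<bar> * e"
proof -
 have e2: "0 < e / 2" using e by simp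
 obtain qs where qs: "valid qs" "vdist P z (emb_tensor qs) < e / 2"
  by (rule emb_tensor_dense[OF z e2], rule that)
 obtain ps where ps: "valid ps" "cls ps = cls qs"
  "cost ps < vnorm A (cls qs) + e / 2"
  by (rule vnorm_A_approx[OF qs(1) e2], rule that)
 have eq: "emb_tensor qs = emb_tensor ps"
  using ps(2) by (simp add: emb_tensor_def)
 have "vnorm P (emb_tensor qs) \<le> vnorm P z + e / 2"
  using P.norm_reverse_triangle[OF z emb_tensor_in[OF qs(1)]] qs(2) by linarith
 then have cost: "cost ps \<le> vnorm P z + e"
  using ps(3) emb_tensor_norm[OF qs(1)] by simp
 have "norm (L z - (\<Sum>(x, y)\<leftarrow>ps. L (elem_tensor x y))) \<le> \<bar>C\<bar> * e" if L: "functional C L" for C L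
 proof -
  have "norm (L z - L (emb_tensor ps)) \<le> C * vdist P z (emb_tensor ps)"
   by (rule functional_diff[OF L z emb_tensor_in[OF ps(1)]])
  also have "\<dots> \<le> \<bar>C\<bar> * e" using qs(2) e unfolding eq by (intro mult_mono) auto
  finally show ?thesis by (simp add: functional_emb[OF L ps(1)])
 qed
 then show thesis using that[OF ps(1) cost] by blast
qed

lemma functionalD:
 assumes "functional C L"
 shows "z \<in> vecs P ==> w \<in> vecs P ==> L (vadd P z w) = L z + L w" "z \<in> vecs P ==> L (vscale P c z) = c * L z"
  "z \<in> vecs P ==> norm (L z) \<le> C * vnorm P z"
 using assms unfolding functional_def by blast+

end

lemma unit_ball_norm:
 assumes "f \<in> unit_ball K" "K \<noteq> {}"
 shows "f \<in> vecs (CF K)" "vnorm (CF K) f \<le> 1"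
 using assms by (auto simp: unit_ball_def vecs_CF intro: CF_norm_le)

lemma ex_unit_function:
 fixes K :: "'a::topological_space set" and f :: "'a => 'k::real_normed_field"
 assumes K: "compact K" "K \<noteq> {}" and f: "f \<in> cfun K"
 shows "\<exists>u\<in>unit_ball K. f = (\<lambda>x. of_real (vnorm (CF K) f) * u x)"
proof (cases "vnorm (CF K) f = 0")
 case True
 then have "f = (\<lambda>_. 0)" using CF_norm_ge[OF K(1) f K(2)] by (intro ext) simp
 then show ?thesis by (intro bexI[of _ "\<lambda>_. 0"]) (simp_all add: unit_ball_def)
next
 case False
 let ?b = "vnorm (CF K) f"
 have b: "0 < ?b" using False CF_norm_ge[OF K(1) f K(2)] norm_ge_zero by (metis order_less_le order_trans)
 let ?u = "\<lambda>x. of_real (1 / ?b) * f x"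
 have "?u \<in> cfun K" by (rule cont_vanish_ops(2)[OF f])
 moreover have "norm (?u x) \<le> 1" for x
  using CF_norm_ge[OF K(1) f K(2), of x] b by (simp add: norm_mult norm_divide)
 moreover have "f = (\<lambda>x. of_real ?b * ?u x)" using False by (intro ext) simp
 ultimately show ?thesis unfolding unit_ball_def by (intro bexI[of _ ?u] CollectI conjI allI)
qed

lemma unit_function_approx:
 fixes K :: "'a::topological_space set" and L :: "'b::topological_space set"
 assumes K: "compact K" "K \<noteq> {}" and L: "compact L" "L \<noteq> {}"
  and w: "w \<in> vecs ((CF K :: ('k::real_normed_field, 'a => 'k) nspace) \<otimes>\<^sub>\<pi> CF L)" and e: "0 < e"
 obtains n :: nat and c x y where "\<forall>r<n. x r \<in> unit_ball K \<and> y r \<in> unit_ball L"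
  "(\<Sum>r<n. norm (c r)) \<le> vnorm (CF K \<otimes>\<^sub>\<pi> CF L) w + e"
  "\<forall>C F. tensor_pair.functional (CF K) (CF L) C F -->
   norm (F w - (\<Sum>r<n. c r * F (tensor_pair.elem_tensor (CF K) (CF L) (x r) (y r)))) \<le> \<bar>C\<bar> * e"
proof -
 let ?X = "CF K :: ('k, 'a => 'k) nspace" and ?Y = "CF L :: ('k, 'b => 'k) nspace"
 interpret tensor_pair ?X ?Y by (rule tensor_pair_CF[OF K L])
 obtain ps where ps: "set ps \<subseteq> vecs ?X \<times> vecs ?Y" "(\<Sum>(x, y)\<leftarrow>ps. vnorm ?X x * vnorm ?Y y) \<le> vnorm P w + e"
  "\<forall>C F. functional C F --> norm (F w - (\<Sum>(x, y)\<leftarrow>ps. F (elem_tensor x y))) \<le> \<bar>C\<bar> * e"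
  by (rule functional_approx_cost[OF w e], rule that)
 let ?c = "\<lambda>r. of_real (vnorm ?X (fst (ps ! r)) * vnorm ?Y (snd (ps ! r))) :: 'k"
 have "\<forall>r\<in>{..<length ps}. \<exists>u. fst u \<in> unit_ball K \<and> snd u \<in> unit_ball L \<and>
   (\<forall>C F. functional C F --> F (elem_tensor (fst (ps ! r)) (snd (ps ! r))) = ?c r * F (elem_tensor (fst u) (snd u)))"
 proof
  fix r assume "r \<in> {..<length ps}"
  then have "ps ! r \<in> vecs ?X \<times> vecs ?Y" by (intro subsetD[OF ps(1)] nth_mem) simp
  then have fg: "fst (ps ! r) \<in> cfun K" "snd (ps ! r) \<in> cfun L"
   by (simp_all add: vecs_CF mem_Times_iff)
  let ?f = "fst (ps ! r)" and ?g = "snd (ps ! r)"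
  obtain u where u: "u \<in> unit_ball K" "?f = (\<lambda>x. of_real (vnorm ?X ?f) * u x)" using ex_unit_function[OF K fg(1)] by blast
  obtain v where v: "v \<in> unit_ball L" "?g = (\<lambda>x. of_real (vnorm ?Y ?g) * v x)" using ex_unit_function[OF L fg(2)] by blast
  have uv: "u \<in> vecs ?X" "v \<in> vecs ?Y" using u(1) v(1) by (simp_all add: vecs_CF unit_ball_def)
  have g: "?g \<in> vecs ?Y" using fg(2) by (simp add: vecs_CF)
  have 1: "elem_tensor ?f ?g = vscale P (of_real (vnorm ?X ?f)) (elem_tensor u ?g)"
   using elem_tensor_scale(1)[OF uv(1) g, of "of_real (vnorm ?X ?f)"] u(2) by simp
  have 2: "elem_tensor u ?g = vscale P (of_real (vnorm ?Y ?g)) (elem_tensor u v)"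
   using elem_tensor_scale(2)[OF uv, of "of_real (vnorm ?Y ?g)"] v(2) by simp
  have "F (elem_tensor ?f ?g) = ?c r * F (elem_tensor u v)" if F: "functional C F" for C F
  proof -
   have "F (elem_tensor ?f ?g) = of_real (vnorm ?X ?f) * F (elem_tensor u ?g)"
    unfolding 1 by (rule functionalD(2)[OF F elem_tensor_in[OF uv(1) g]])
   also have "F (elem_tensor u ?g) = of_real (vnorm ?Y ?g) * F (elem_tensor u v)"
    unfolding 2 by (rule functionalD(2)[OF F elem_tensor_in[OF uv]])
   finally show ?thesis by simp
  qed
  then show "\<exists>u. fst u \<in> unit_ball K \<and> snd u \<in> unit_ball L \<and>
   (\<forall>C F. functional C F --> F (elem_tensor ?f ?g) = ?c r * F (elem_tensor (fst u) (snd u)))"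
   using u(1) v(1) by (intro exI[of _ "(u, v)"]) simp
 qed
 from bchoice[OF this] obtain u where u: "\<forall>r\<in>{..<length ps}. fst (u r) \<in> unit_ball K \<and> snd (u r) \<in> unit_ball L \<and>
   (\<forall>C F. functional C F --> F (elem_tensor (fst (ps ! r)) (snd (ps ! r))) = ?c r * F (elem_tensor (fst (u r)) (snd (u r))))" ..
 have sl: "(\<Sum>(x, y)\<leftarrow>ps. h x y) = (\<Sum>r<length ps. h (fst (ps ! r)) (snd (ps ! r)))" for h :: "('a => 'k) => ('b => 'k) => 'z::comm_monoid_add"
  by (simp add: sum_list_sum_nth case_prod_unfold atLeast0LessThan)
 show thesis
 proof (rule that)
  show "\<forall>r<length ps. fst (u r) \<in> unit_ball K \<and> snd (u r) \<in> unit_ball L" using u by simp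
  have "norm (?c r) = vnorm ?X (fst (ps ! r)) * vnorm ?Y (snd (ps ! r))" if "r < length ps" for r
  proof -
   have "ps ! r \<in> vecs ?X \<times> vecs ?Y" using that ps(1) nth_mem by blast
   then show ?thesis by (simp add: mem_Times_iff norm_mult)
  qed
  then show "(\<Sum>r<length ps. norm (?c r)) \<le> vnorm P w + e"
   using ps(2) unfolding sl by simp
  show "\<forall>C F. functional C F -->
   norm (F w - (\<Sum>r<length ps. ?c r * F (elem_tensor (fst (u r)) (snd (u r))))) \<le> \<bar>C\<bar> * e"
  proof (intro allI impI)
   fix C F assume F: "functional C F"
   have "F (elem_tensor (fst (ps ! r)) (snd (ps ! r))) = ?c r * F (elem_tensor (fst (u r)) (snd (u r)))"
    if "r \<in> {..<length ps}" for r
    using bspec[OF u that] F by (elim conjE allE impE)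
   then have eq: "(\<Sum>(x, y)\<leftarrow>ps. F (elem_tensor x y)) = (\<Sum>r<length ps. ?c r * F (elem_tensor (fst (u r)) (snd (u r))))"
    unfolding sl by (rule sum.cong[OF refl])
   have "norm (F w - (\<Sum>(x, y)\<leftarrow>ps. F (elem_tensor x y))) \<le> \<bar>C\<bar> * e" using ps(3) F by simp
   then show "norm (F w - (\<Sum>r<length ps. ?c r * F (elem_tensor (fst (u r)) (snd (u r))))) \<le> \<bar>C\<bar> * e"
    by (simp only: eq)
  qed
 qed
qed

text \<open>What is kept of an isomorphism \<open>\<Phi>\<close> from \<open>C(K) \<otimes> C(L)\<close> to \<open>C(K') \<otimes> C(L')\<close> is the family of forms
 \<open>v k l f g\<close>, the value at \<open>(k, l)\<close> of the preimage of \<open>f \<otimes> g\<close>.\<close>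

locale tensor_isomorphism =
 fixes K :: "'a::metric_space set" and L :: "'b::metric_space set"
  and K' :: "'c::metric_space set" and L' :: "'d::metric_space set"
  and M :: real and v :: "'a => 'b => ('c => 'k::{real_normed_field,euclidean_space}) => ('d => 'k) => 'k"
 assumes K: "compact K" "countable K" "K \<noteq> {}" and L: "compact L" "countable L" "L \<noteq> {}"
  and K': "compact K'" "countable K'" "K' \<noteq> {}" and L': "compact L'" "countable L'" "L' \<noteq> {}"
  and bilinear: "k \<in> K ==> l \<in> L ==> bilinear_form (CF K') (CF L') M (\<lambda>(f, g). v k l f g)"
  and repr: "f \<in> unit_ball K' ==> g \<in> unit_ball L' ==> 0 < e ==>
   \<exists>(n::nat) c x z. (\<forall>r<n. x r \<in> unit_ball K \<and> z r \<in> unit_ball L) \<and> (\<Sum>r<n. norm (c r)) \<le> M \<and>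
    (\<forall>k\<in>K. \<forall>l\<in>L. norm (v k l f g - (\<Sum>r<n. c r * (x r k * z r l))) \<le> e)"
  and coord: "x \<in> unit_ball K ==> z \<in> unit_ball L ==> 0 < e ==>
   \<exists>(n::nat) c f g. (\<forall>r<n. f r \<in> unit_ball K' \<and> g r \<in> unit_ball L') \<and> (\<Sum>r<n. norm (c r)) \<le> M \<and>
    (\<forall>k\<in>K. \<forall>l\<in>L. norm (x k * z l - (\<Sum>r<n. c r * v k l (f r) (g r))) \<le> e)"

lemma tensor_isomorphism_exists:
 fixes K :: "'a::metric_space set" and L :: "'b::metric_space set"
  and K' :: "'c::metric_space set" and L' :: "'d::metric_space set"
 assumes K: "compact K" "countable K" "K \<noteq> {}" and L: "compact L" "countable L" "L \<noteq> {}"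
  and K': "compact K'" "countable K'" "K' \<noteq> {}" and L': "compact L'" "countable L'" "L' \<noteq> {}"
  and iso: "linearly_homeomorphic ((CF K :: ('k::{real_normed_field,euclidean_space}, 'a => 'k) nspace) \<otimes>\<^sub>\<pi> CF L)
   ((CF K' :: ('k::{real_normed_field,euclidean_space}, 'c => 'k) nspace) \<otimes>\<^sub>\<pi> CF L')"
 obtains M and v :: "'a => 'b => ('c => 'k::{real_normed_field,euclidean_space}) => ('d => 'k) => 'k" where "tensor_isomorphism K L K' L' M v"
proof -
 let ?X = "CF K :: ('k, 'a => 'k) nspace" and ?Y = "CF L :: ('k, 'b => 'k) nspace"
 let ?X' = "CF K' :: ('k, 'c => 'k) nspace" and ?Y' = "CF L' :: ('k, 'd => 'k) nspace"
 interpret T: tensor_pair ?X ?Y by (rule tensor_pair_CF[OF K(1,3) L(1,3)])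
 interpret T': tensor_pair ?X' ?Y' by (rule tensor_pair_CF[OF K'(1,3) L'(1,3)])
 obtain \<Phi> \<Psi> where \<Phi>: "bounded_linear_map T.P T'.P \<Phi>" and \<Psi>: "bounded_linear_map T'.P T.P \<Psi>"
  and inv: "\<And>w. w \<in> vecs T.P ==> \<Psi> (\<Phi> w) = w"
  by (rule linearly_homeomorphicE[OF iso T.P.normed_nspace_axioms T'.P.normed_nspace_axioms], rule that)
 obtain c where c: "0 < c" "\<And>w. w \<in> vecs T.P ==> vnorm T'.P (\<Phi> w) \<le> c * vnorm T.P w"
  by (rule bounded_linear_map_bound[OF \<Phi> T.P.normed_nspace_axioms], rule that)
 obtain d where d: "0 < d" "\<And>w. w \<in> vecs T'.P ==> vnorm T.P (\<Psi> w) \<le> d * vnorm T'.P w"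
  by (rule bounded_linear_map_bound[OF \<Psi> T'.P.normed_nspace_axioms], rule that)
 have "\<forall>p. \<exists>F. T.functional 1 F \<and> (\<forall>x\<in>vecs ?X. \<forall>y\<in>vecs ?Y. F (T.elem_tensor x y) = x (fst p) * y (snd p))" for p :: "'a \<times> 'b"
  using tensor_pair_functional[OF T.tensor_pair_axioms bilinear_form_point[OF K(1,3) L(1,3)]] by simp
 from choice[OF this] obtain E where E: "T.functional 1 (E p)"
  "x \<in> vecs ?X ==> y \<in> vecs ?Y ==> E p (T.elem_tensor x y) = x (fst p) * y (snd p)" for p x y by blast
 define v where "v k l f g = E (k, l) (\<Psi> (T'.elem_tensor f g))" for k l f g
 have F: "T'.functional d (\<lambda>w. E p (\<Psi> w))" for p
  unfolding T'.functional_def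
 proof (intro conjI ballI allI)
  fix z assume z: "z \<in> vecs T'.P"
  note Pz = bounded_linear_mapD(1)[OF \<Psi>]
  show "E p (\<Psi> (vadd T'.P z w)) = E p (\<Psi> z) + E p (\<Psi> w)" if "w \<in> vecs T'.P" for w
   using T.functionalD(1)[OF E(1) Pz Pz] bounded_linear_mapD(2)[OF \<Psi>] z that by simp
  show "E p (\<Psi> (vscale T'.P a z)) = a * E p (\<Psi> z)" for a
   using T.functionalD(2)[OF E(1) Pz] bounded_linear_mapD(3)[OF \<Psi>] z by simp
  show "norm (E p (\<Psi> z)) \<le> d * vnorm T'.P z"
   using T.functionalD(3)[OF E(1) Pz[OF z], of p] d(2)[OF z] by simp
 qed
 note unit = unit_ball_norm
 show thesis
 proof (rule that, unfold_locales)
  fix k l assume "k \<in> K" "l \<in> L"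
  \<comment> \<open>One constant serves all three conditions: the forms are bounded by
    \<open>d\<close>, while preimages and images of elementary tensors need coefficients of total
    size at most \<open>d + 1\<close> and \<open>c + 1\<close>.\<close>
  show "bilinear_form ?X' ?Y' (c + d + 1) (\<lambda>(f, g). v k l f g)"
   unfolding bilinear_form_def
  proof (intro conjI ballI allI)
   show "0 \<le> c + d + 1" using c d by simp
   fix f g assume f: "f \<in> vecs ?X'" and g: "g \<in> vecs ?Y'"
   note el = T'.elem_tensor_in
   show "(case (vadd ?X' f f', g) of (f, g) => v k l f g) = (case (f, g) of (f, g) => v k l f g) + (case (f', g) of (f, g) => v k l f g)" if "f' \<in> vecs ?X'" for f'
    using T'.functionalD(1)[OF F el[OF f g] el[OF that g]] T'.elem_tensor_add_left[OF f that g] by (simp add: v_def)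
   show "(case (f, vadd ?Y' g g') of (f, g) => v k l f g) = (case (f, g) of (f, g) => v k l f g) + (case (f, g') of (f, g) => v k l f g)" if "g' \<in> vecs ?Y'" for g'
    using T'.functionalD(1)[OF F el[OF f g] el[OF f that]] T'.elem_tensor_add_right[OF f g that] by (simp add: v_def)
   show "(case (vscale ?X' a f, g) of (f, g) => v k l f g) = a * (case (f, g) of (f, g) => v k l f g)" for a
    using T'.functionalD(2)[OF F el[OF f g]] T'.elem_tensor_scale(1)[OF f g, of a] by (simp add: v_def)
   show "(case (f, vscale ?Y' a g) of (f, g) => v k l f g) = a * (case (f, g) of (f, g) => v k l f g)" for a
    using T'.functionalD(2)[OF F el[OF f g]] T'.elem_tensor_scale(2)[OF f g, of a] by (simp add: v_def)
   have "norm (v k l f g) \<le> d * vnorm T'.P (T'.elem_tensor f g)"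
    unfolding v_def by (rule T'.functionalD(3)[OF F el[OF f g]])
   also have "\<dots> \<le> (c + d + 1) * (vnorm ?X' f * vnorm ?Y' g)"
    using T'.elem_tensor_norm[OF f g] T'.P.norm_nonneg[OF el[OF f g]] c(1) d(1) by (intro mult_mono) auto
   finally show "norm (case (f, g) of (f, g) => v k l f g) \<le> (c + d + 1) * (vnorm ?X' f * vnorm ?Y' g)" by simp
  qed
 next
  fix f :: "'c => 'k" and g :: "'d => 'k" and e :: real assume f: "f \<in> unit_ball K'" and g: "g \<in> unit_ball L'" and e: "0 < e"
  note fv = unit[OF f K'(3)] and gv = unit[OF g L'(3)]
  \<comment> \<open>The minimum with 1 limits the excess in the total size of the coefficients,
    however large \<open>e\<close> is.\<close>
  let ?w = "\<Psi> (T'.elem_tensor f g)" and ?e = "min e 1"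
  have w: "?w \<in> vecs T.P" by (rule bounded_linear_mapD(1)[OF \<Psi> T'.elem_tensor_in[OF fv(1) gv(1)]])
  have "vnorm T'.P (T'.elem_tensor f g) \<le> 1"
   by (rule order_trans[OF T'.elem_tensor_norm[OF fv(1) gv(1)] mult_le_one[OF fv(2) T'.Y.norm_nonneg[OF gv(1)] gv(2)]])
  from order_trans[OF d(2)[OF T'.elem_tensor_in[OF fv(1) gv(1)]] mult_left_mono[OF this less_imp_le[OF d(1)]]]
  have wd: "vnorm T.P ?w \<le> d * 1" .
  have e': "0 < ?e" using e by simp
  obtain n :: nat and a x y where n: "\<forall>r<n. x r \<in> unit_ball K \<and> y r \<in> unit_ball L"
   "(\<Sum>r<n. norm (a r)) \<le> vnorm T.P ?w + ?e"
   "\<forall>C F. T.functional C F --> norm (F ?w - (\<Sum>r<n. a r * F (T.elem_tensor (x r) (y r)))) \<le> \<bar>C\<bar> * ?e"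
   by (rule unit_function_approx[OF K(1,3) L(1,3) w e'], rule that)
  have "norm (v k l f g - (\<Sum>r<n. a r * (x r k * y r l))) \<le> e" for k l
  proof -
   have "(\<Sum>r<n. a r * E (k, l) (T.elem_tensor (x r) (y r))) = (\<Sum>r<n. a r * (x r k * y r l))"
    using n(1) by (intro sum.cong refl) (simp add: E(2) vecs_CF unit_ball_def)
   moreover have "norm (E (k, l) ?w - (\<Sum>r<n. a r * E (k, l) (T.elem_tensor (x r) (y r)))) \<le> \<bar>1\<bar> * ?e"
    using n(3) E(1) by blast
   ultimately show ?thesis unfolding v_def by simp
  qed
  then show "\<exists>(n::nat) a x z. (\<forall>r<n. x r \<in> unit_ball K \<and> z r \<in> unit_ball L) \<and> (\<Sum>r<n. norm (a r)) \<le> c + d + 1 \<and>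
    (\<forall>k\<in>K. \<forall>l\<in>L. norm (v k l f g - (\<Sum>r<n. a r * (x r k * z r l))) \<le> e)"
   using n(1,2) wd c(1) by (intro exI[of _ n] exI[of _ a] exI[of _ x] exI[of _ y]) auto
 next
  fix x :: "'a => 'k" and z :: "'b => 'k" and e :: real assume x: "x \<in> unit_ball K" and z: "z \<in> unit_ball L" and e: "0 < e"
  note xv = unit[OF x K(3)] and zv = unit[OF z L(3)]
  \<comment> \<open>The functionals used are evaluations after \<open>\<Psi>\<close>, with bound
    \<open>d\<close>, hence the division by \<open>d\<close>.\<close>
  let ?w = "\<Phi> (T.elem_tensor x z)" and ?e = "min (e / d) 1"
  note el = T.elem_tensor_in[OF xv(1) zv(1)]
  have w: "?w \<in> vecs T'.P" by (rule bounded_linear_mapD(1)[OF \<Phi> el])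
  have "vnorm T.P (T.elem_tensor x z) \<le> 1"
   by (rule order_trans[OF T.elem_tensor_norm[OF xv(1) zv(1)] mult_le_one[OF xv(2) T.Y.norm_nonneg[OF zv(1)] zv(2)]])
  from order_trans[OF c(2)[OF el] mult_left_mono[OF this less_imp_le[OF c(1)]]]
  have wc: "vnorm T'.P ?w \<le> c * 1" .
  have e': "0 < ?e" using e d(1) by simp
  obtain n :: nat and a f g where n: "\<forall>r<n. f r \<in> unit_ball K' \<and> g r \<in> unit_ball L'"
   "(\<Sum>r<n. norm (a r)) \<le> vnorm T'.P ?w + ?e"
   "\<forall>C F. T'.functional C F --> norm (F ?w - (\<Sum>r<n. a r * F (T'.elem_tensor (f r) (g r)))) \<le> \<bar>C\<bar> * ?e"
   by (rule unit_function_approx[OF K'(1,3) L'(1,3) w e'], rule that)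
  have "norm (x k * z l - (\<Sum>r<n. a r * v k l (f r) (g r))) \<le> e" for k l
  proof -
   have "E (k, l) (\<Psi> ?w) = x k * z l" using inv[OF el] E(2)[OF xv(1) zv(1), of "(k, l)"] by simp
   moreover have "norm (E (k, l) (\<Psi> ?w) - (\<Sum>r<n. a r * E (k, l) (\<Psi> (T'.elem_tensor (f r) (g r))))) \<le> \<bar>d\<bar> * ?e"
    using spec[OF spec[OF n(3), of d], of "\<lambda>w. E (k, l) (\<Psi> w)"] F[of "(k, l)"] by simp
   ultimately have "norm (x k * z l - (\<Sum>r<n. a r * v k l (f r) (g r))) \<le> \<bar>d\<bar> * ?e" unfolding v_def by simp
   also have "\<dots> \<le> d * (e / d)" using d(1) e by (intro mult_mono) auto
   finally show ?thesis using d(1) by simp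
  qed
  then show "\<exists>(n::nat) a f g. (\<forall>r<n. f r \<in> unit_ball K' \<and> g r \<in> unit_ball L') \<and> (\<Sum>r<n. norm (a r)) \<le> c + d + 1 \<and>
    (\<forall>k\<in>K. \<forall>l\<in>L. norm (x k * z l - (\<Sum>r<n. a r * v k l (f r) (g r))) \<le> e)"
   using n(1,2) wc d(1) by (intro exI[of _ n] exI[of _ a] exI[of _ f] exI[of _ g]) auto
 qed (fact K L K' L')+
qed

section \<open>Forms with one variable fixed\<close>

lemma bilinear_form_functional:
 fixes K :: "'a::metric_space set" and L :: "'b::metric_space set" and v :: "('a => 'k::real_normed_field) => ('b => 'k) => 'k"
 assumes v: "bilinear_form (CF K) (CF L) M (\<lambda>(f, g). v f g)" and K: "compact K" "K \<noteq> {}" and L: "compact L" "L \<noteq> {}"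
  and g: "g \<in> cfun L" and b: "vnorm (CF L) g \<le> b"
 shows "bounded_functional K (M * b) (\<lambda>f. v f g)"
 unfolding bounded_functional_def
proof (intro conjI ballI allI impI)
 interpret X: normed_nspace "CF K :: ('k, 'a => 'k) nspace" by (rule normed_nspace_CF[OF K])
 interpret Y: normed_nspace "CF L :: ('k, 'b => 'k) nspace" by (rule normed_nspace_CF[OF L])
 have M: "0 \<le> M" using v by (simp add: bilinear_form_def)
 have gv: "g \<in> vecs (CF L)" using g by (simp add: vecs_CF)
 show "0 \<le> M * b" using M order_trans[OF Y.norm_nonneg[OF gv] b] by simp
 fix f :: "'a => 'k" assume f: "f \<in> cfun K"
 show "norm (v f g) \<le> M * b * c" if "\<forall>x. norm (f x) \<le> c" for c
 proof -
  have "vnorm (CF K) f \<le> c" using that by (intro CF_norm_le K(2)) simp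
  then have "vnorm (CF K) f * vnorm (CF L) g \<le> c * b"
   using b X.norm_nonneg[of f] f Y.norm_nonneg[OF gv] by (intro mult_mono') (auto simp: vecs_CF)
  from mult_left_mono[OF this M] show ?thesis
   using v f g by (fastforce simp: bilinear_form_def vecs_CF mult_ac)
 qed
qed (use v g in "simp_all add: bilinear_form_def vecs_CF")

lemma bilinear_form_unit:
 fixes K :: "'a::metric_space set" and L :: "'b::metric_space set" and v :: "('a => 'k::real_normed_field) => ('b => 'k) => 'k"
 assumes v: "bilinear_form (CF K) (CF L) M (\<lambda>(f, g). v f g)" and K: "compact K" "K \<noteq> {}" and L: "compact L" "L \<noteq> {}"
 shows "g \<in> unit_ball L ==> bounded_functional K M (\<lambda>f. v f g)"
  and "f \<in> unit_ball K ==> bounded_functional L M (v f)"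
proof -
 have "bilinear_form (CF L) (CF K) M (\<lambda>(g, f). v f g)" using v by (simp add: bilinear_form_def mult.commute)
 from bilinear_form_functional[OF this L K, of f 1] bilinear_form_functional[OF v K L, of g 1]
 show "g \<in> unit_ball L ==> bounded_functional K M (\<lambda>f. v f g)"
  "f \<in> unit_ball K ==> bounded_functional L M (v f)"
  using unit_ball_norm[of g L] unit_ball_norm[of f K] K(2) L(2) by (simp_all add: vecs_CF)
qed

text \<open>The values belong to the functionals \<open>\<lambda>f. v f (g q)\<close> on C(K). Their
  signed sums are \<open>v h\<close> applied to signed sums of the \<open>g q\<close>, hence bounded
  by \<open>M\<close>, and cotype of the dual of C(K) applies.\<close>

lemma bilinear_form_admissible:
 fixes K :: "'a::metric_space set" and L :: "'b::metric_space set"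
  and v :: "('a => 'k::{real_normed_field,real_inner}) => ('b => 'k) => 'k"
 assumes v: "bilinear_form (CF K) (CF L) M (\<lambda>(f, g). v f g)" and K: "compact K" "countable K" "K \<noteq> {}" and L: "compact L" "L \<noteq> {}"
 shows "admissible L (unit_ball K) M (2 * M) v"
 unfolding admissible_def
proof (intro conjI ballI)
 show "bounded_functional L M (v e)" if "e \<in> unit_ball K" for e
  by (rule bilinear_form_unit(2)[OF v K(1,3) L that])
 have M: "0 \<le> M" using v by (simp add: bilinear_form_def)
 show "cotype_bound L (unit_ball K) (2 * M) v"
  unfolding cotype_bound_def
 proof (intro allI impI, elim conjE)
  fix p d e and g :: "nat => 'b => 'k"
  assume eg: "\<forall>q<p. e q \<in> unit_ball K \<and> g q \<in> cfun L \<and> d \<le> norm (v (e q) (g q))"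
   and 1: "\<forall>B x. norm (\<Sum>q<p. sgn_of B q *\<^sub>R g q x) \<le> 1"
  \<comment> \<open>A crude common bound; it does not enter the conclusion of
    \<open>functional_cotype\<close>.\<close>
  define b where "b = (\<Sum>q<p. \<bar>vnorm (CF L) (g q)\<bar>)"
  have bf: "bounded_functional K (M * b) (\<lambda>f. v f (g q))" if q: "q < p" for q
  proof (rule bilinear_form_functional[OF v K(1,3) L])
   show "g q \<in> cfun L" using eg q by blast
   have "\<bar>vnorm (CF L) (g q)\<bar> \<le> b" unfolding b_def by (rule member_le_sum) (use q in auto)
   then show "vnorm (CF L) (g q) \<le> b" by linarith
  qed
  show "sqrt (real p) * d \<le> 2 * M"
  proof (rule functional_cotype[OF K(1,2) bf])
   have "0 \<le> b" by (simp add: b_def sum_nonneg)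
   then show "0 \<le> M * b" using M by simp
   show "e q \<in> unit_ball K" "d \<le> norm (v (e q) (g q))" if "q < p" for q
    using eg that by simp_all
   fix B and h :: "'a => 'k" assume hu: "h \<in> unit_ball K"
   note bh = bilinear_form_unit(2)[OF v K(1,3) L hu]
   let ?s = "\<lambda>x. \<Sum>q<p. of_real (sgn_of B q) * g q x"
   have "v h ?s = (\<Sum>q<p. of_real (sgn_of B q) * v h (g q))"
    by (rule bounded_functional_sum[OF bh]) (use eg in simp)
   moreover have "norm (v h ?s) \<le> M * 1"
   proof (rule bounded_functionalD(4)[OF bh])
    show "?s \<in> cfun L" using eg by (intro cont_vanish_sum cont_vanish_ops(2)) simp
    show "norm (?s x) \<le> 1" for x using 1 by (simp add: scaleR_conv_of_real)
   qed
   ultimately show "norm (\<Sum>q<p. sgn_of B q *\<^sub>R v h (g q)) \<le> M" by (simp add: scaleR_conv_of_real)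
  qed
 qed
qed

text \<open>Each image is totally bounded. Elements are coded by the nearby centres chosen for all
  functionals; there are finitely many codes, and equal codes mean small distances.\<close>

lemma finite_net:
 fixes \<Phi> :: "('f => 'k::heine_borel) set"
 assumes \<Phi>: "finite \<Phi>" "\<forall>\<phi>\<in>\<Phi>. bounded (\<phi> ` U)" and r: "0 < r"
 obtains G where "finite G" "G \<subseteq> U" "\<forall>f\<in>U. \<exists>f'\<in>G. \<forall>\<phi>\<in>\<Phi>. dist (\<phi> f) (\<phi> f') < r"
proof -
 have "\<exists>C. finite C \<and> \<phi> ` U \<subseteq> (\<Union>s\<in>C. ball s (r / 2))" if "\<phi> \<in> \<Phi>" for \<phi>
 proof -
  have "compact (closure (\<phi> ` U))" using \<Phi>(2) that by (simp add: compact_closure)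
  then have "\<exists>C. finite C \<and> closure (\<phi> ` U) \<subseteq> (\<Union>s\<in>C. ball s (r / 2))"
   unfolding compact_eq_totally_bounded using r half_gt_zero by blast
  then show ?thesis using closure_subset by (meson order_trans)
 qed
 then obtain C where C: "\<And>\<phi>. \<phi> \<in> \<Phi> ==> finite (C \<phi>)" "\<And>\<phi>. \<phi> \<in> \<Phi> ==> \<phi> ` U \<subseteq> (\<Union>s\<in>C \<phi>. ball s (r / 2))" by metis
 have "\<exists>s. s \<in> C \<phi> \<and> dist s (\<phi> f) < r / 2" if "\<phi> \<in> \<Phi>" "f \<in> U" for \<phi> f
  using C(2)[OF that(1)] that(2) unfolding mem_ball[symmetric] by blast
 then obtain s where s: "\<And>\<phi> f. \<phi> \<in> \<Phi> ==> f \<in> U ==> s \<phi> f \<in> C \<phi> \<and> dist (s \<phi> f) (\<phi> f) < r / 2" by metis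
 let ?c = "\<lambda>f. restrict (\<lambda>\<phi>. s \<phi> f) \<Phi>"
 have "?c ` U \<subseteq> PiE \<Phi> C" using s by auto
 then have fin: "finite (?c ` U)" by (rule finite_subset) (intro finite_PiE \<Phi>(1) C(1))
 show thesis
 proof (rule that[of "inv_into U ?c ` ?c ` U"])
  show "\<forall>f\<in>U. \<exists>f'\<in>inv_into U ?c ` ?c ` U. \<forall>\<phi>\<in>\<Phi>. dist (\<phi> f) (\<phi> f') < r"
  proof (intro ballI bexI)
   fix f \<phi> assume f: "f \<in> U" and \<phi>: "\<phi> \<in> \<Phi>"
   let ?f = "inv_into U ?c (?c f)"
   have f': "?f \<in> U" "?c ?f = ?c f" by (rule inv_into_into[OF imageI[OF f]], rule f_inv_into_f[OF imageI[OF f]])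
   have "s \<phi> ?f = s \<phi> f" using fun_cong[OF f'(2), of \<phi>] by (simp only: restrict_apply'[OF \<phi>])
   then show "dist (\<phi> f) (\<phi> ?f) < r" using s[OF \<phi> f] s[OF \<phi> f'(1)] by (metis dist_triangle_half_r)
  qed blast
 qed (rule finite_imageI[OF fin], rule image_subsetI, rule inv_into_into)
qed

lemma near_radius:
 fixes Q :: "'p::metric_space set"
 assumes "finite W" and q: "q \<in> Q" and r: "0 < r"
  and cont: "\<And>e g. (e, g) \<in> W ==> continuous_on Q (\<lambda>p. Y p e g)"
 shows "\<exists>s>0. \<forall>p\<in>Q. dist p q < s --> near W r (Y q) (Y p)"
 using assms(1) cont
proof (induction W rule: finite_induct)
 case empty
 then show ?case by (intro exI[of _ 1]) (simp add: near_def)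
next
 case (insert w W)
 obtain e g where w: "w = (e, g)" by (cases w)
 obtain s where s: "0 < s" "\<forall>p\<in>Q. dist p q < s --> near W r (Y q) (Y p)" using insert by auto
 have "continuous_on Q (\<lambda>p. Y p e g)" using insert.prems w by blast
 then obtain t where t: "0 < t" "\<forall>p\<in>Q. dist p q < t --> dist (Y p e g) (Y q e g) < r"
  using q r unfolding continuous_on_iff by blast
 have "near (insert w W) r (Y q) (Y p)" if "p \<in> Q" "dist p q < min s t" for p
  using s(2) t(2) that by (simp add: near_def w dist_norm)
 then show ?case using s(1) t(1) by (intro exI[of _ "min s t"]) simp
qed

text \<open>Where the forms cease to escape, finitely many functions represent the whole unit ball up to a small
 error.\<close>

lemma bilinear_family_stuck:
 fixes K :: "'a::metric_space set" and L :: "'b::metric_space set" and Q :: "'p::metric_space set"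
  and Y :: "'p => ('a => 'k::{real_normed_field,euclidean_space}) => ('b => 'k) => 'k"
 assumes K: "compact K" "countable K" "K \<noteq> {}" and L: "compact L" "countable L" "L \<noteq> {}" "rank_class L z"
  and Y: "\<And>p. p \<in> Q ==> bilinear_form (CF K) (CF L) M (\<lambda>(f, g). Y p f g)"
  and cont: "\<And>f g. f \<in> unit_ball K ==> g \<in> cfun L ==> continuous_on Q (\<lambda>p. Y p f g)"
  and R: "\<And>h. h \<le> omega_pow (ord_succ z) ==> R h \<noteq> {} \<and> R h \<subseteq> Q" and d: "0 < d"
 obtains g h q s G where "g < h" "h \<le> omega_pow (ord_succ z)" "q \<in> R h" "0 < s" "finite G" "G \<subseteq> unit_ball L"
  "\<forall>f\<in>unit_ball L. \<exists>f'\<in>G. \<forall>p\<in>R g. dist p q < s --> (\<forall>e\<in>unit_ball K. norm (Y p e f - Y p e f') \<le> 2 * d)"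
proof -
 let ?l = "omega_pow (ord_succ z)" and ?E = "unit_ball K :: ('a => 'k) set" and ?U = "unit_ball L :: ('b => 'k) set"
 have "\<not> escape_chain L ?E M (2 * M) d ?l (\<lambda>g. Y ` R g)" by (rule no_escape_chain[OF L(1,2,4)])
 moreover have "Y ` R g \<noteq> {} \<and> (\<forall>y\<in>Y ` R g. admissible L ?E M (2 * M) y)" if "g \<le> ?l" for g
  using R[OF that] bilinear_form_admissible[OF Y K L(1,3)] by auto
 ultimately have "\<not> (\<forall>h\<le>?l. \<forall>g<h. \<forall>y\<in>Y ` R h. escaping L ?E d (Y ` R g) y)"
  using d unfolding escape_chain_def by blast
 then obtain g h q where gh: "h \<le> ?l" "g < h" "q \<in> R h" "\<not> escaping L ?E d (Y ` R g) (Y q)" by auto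
 obtain W r and \<Phi> :: "(('b => 'k) => 'k) set" where W: "finite W" "W \<subseteq> ?E \<times> cfun L" and r: "0 < r"
  and \<Phi>: "finite \<Phi>" "\<forall>\<phi>\<in>\<Phi>. \<exists>N. bounded_functional L N \<phi>"
  and no: "\<not> (\<exists>y'\<in>Y ` R g. near W r (Y q) y' \<and> (\<exists>e\<in>?E. \<exists>f\<in>?U. (\<forall>\<phi>\<in>\<Phi>. norm (\<phi> f) < r) \<and> d \<le> norm (y' e f)))"
  using gh(4) unfolding escaping_def not_all not_imp by (elim exE conjE)
 have q: "q \<in> Q" using R[OF gh(1)] gh(3) by blast
 have "\<exists>s>0. \<forall>p\<in>Q. dist p q < s --> near W r (Y q) (Y p)"
  by (rule near_radius[OF W(1) q r]) (use W(2) in "auto intro: cont")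
 then obtain s where s: "0 < s" "\<forall>p\<in>Q. dist p q < s --> near W r (Y q) (Y p)" by blast
 have "bounded (\<phi> ` ?U)" if \<phi>: "\<phi> \<in> \<Phi>" for \<phi>
 proof -
  obtain N where N: "bounded_functional L N \<phi>" using bspec[OF \<Phi>(2) \<phi>] ..
  show ?thesis
   by (rule boundedI[where B = "N * 1"]) (use bounded_functionalD(4)[OF N, where b = 1] in "auto simp: unit_ball_def")
 qed
 then have b: "\<forall>\<phi>\<in>\<Phi>. bounded (\<phi> ` ?U)" by blast
 obtain G where G: "finite G" "G \<subseteq> ?U" "\<forall>f\<in>?U. \<exists>f'\<in>G. \<forall>\<phi>\<in>\<Phi>. dist (\<phi> f) (\<phi> f') < r"
  by (rule finite_net[OF \<Phi>(1) b r])
 have "norm (Y p e f - Y p e f') \<le> 2 * d"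
  if p: "p \<in> R g" "dist p q < s" and e: "e \<in> ?E" and f: "f \<in> ?U" "f' \<in> ?U" "\<forall>\<phi>\<in>\<Phi>. dist (\<phi> f) (\<phi> f') < r" for p e f f'
 proof -
  have pQ: "p \<in> Q" using p(1) R[OF order_trans[OF less_imp_le[OF gh(2)] gh(1)]] by blast
  \<comment> \<open>Half the difference lies in the unit ball and is small for all tests in
    \<open>\<Phi>\<close>. As escape fails at \<open>q\<close>, no form near it reaches
    \<open>d\<close> on this function, which bounds the difference by \<open>2 * d\<close>.\<close>
  let ?h = "\<lambda>x. of_real (1 / 2) * (f x - f' x)"
  have fK: "f \<in> cfun L" "f' \<in> cfun L" using f by (simp_all add: unit_ball_def)
  have half: "m ?h = of_real (1 / 2) * (m f - m f')" if m: "bounded_functional L N m" for N m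
   by (simp only: bounded_functionalD(3)[OF m bounded_functional_diff(1)[OF m fK]] bounded_functional_diff(2)[OF m fK])
  note Ye = bilinear_form_unit(2)[OF Y[OF pQ] K(1,3) L(1,3) e]
  have "norm (?h x) \<le> 1" for x
   using norm_triangle_ineq4[of "f x" "f' x"] unit_ballD[OF f(1), of x] unit_ballD[OF f(2), of x]
   by (simp add: norm_mult norm_divide)
  moreover have "?h \<in> cfun L" by (rule cont_vanish_ops(2)[OF bounded_functional_diff(1)[OF Ye fK]])
  ultimately have h: "?h \<in> ?U" unfolding unit_ball_def by blast
  have "norm (\<phi> ?h) < r" if \<phi>: "\<phi> \<in> \<Phi>" for \<phi>
  proof -
   obtain N where "bounded_functional L N \<phi>" using bspec[OF \<Phi>(2) \<phi>] ..
   from half[OF this] have "norm (\<phi> ?h) = norm (\<phi> f - \<phi> f') / 2" by (simp only: norm_mult norm_of_real)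
   moreover have "norm (\<phi> f - \<phi> f') < r" using f(3) \<phi> by (simp add: dist_norm)
   ultimately show ?thesis using r by linarith
  qed
  moreover have "near W r (Y q) (Y p)" using s(2) p(2) pQ by blast
  ultimately have "\<not> d \<le> norm (Y p e ?h)" using no imageI[OF p(1), of Y] e h by blast
  moreover have "norm (Y p e ?h) = norm (Y p e f - Y p e f') / 2" unfolding half[OF Ye] by (simp only: norm_mult norm_of_real)
  ultimately show ?thesis by linarith
 qed
 then have "\<forall>f\<in>?U. \<exists>f'\<in>G. \<forall>p\<in>R g. dist p q < s --> (\<forall>e\<in>?E. norm (Y p e f - Y p e f') \<le> 2 * d)"
  using G(2,3) by (meson subsetD)
 then show thesis by (rule that[OF gh(2,1,3) s(1) G(1,2)])
qed

text \<open>Bumps that span a copy of a finite-dimensional sup-normed space: any coefficients of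
  norm at most 1 give an element of the unit ball with these values at the points
  \<open>k i\<close>. Each new point receives a clopen set that is cut out of the earlier
  bumps.\<close>

lemma ex_partial_unity:
 fixes K :: "'a::metric_space set"
 assumes K: "compact K" "countable K" and I: "finite I" "inj_on k I" "k ` I \<subseteq> K"
 shows "\<exists>b :: 'i => 'a => 'k::real_normed_field. (\<forall>i\<in>I. b i \<in> unit_ball K \<and> (\<forall>j\<in>I. b i (k j) = (if i = j then 1 else 0))) \<and>
  (\<forall>x. (\<Sum>i\<in>I. norm (b i x)) \<le> 1)"
 using I
proof (induction I rule: finite_induct)
 case (insert a I)
 then obtain b :: "'i => 'a => 'k" where b: "\<forall>i\<in>I. b i \<in> unit_ball K \<and> (\<forall>j\<in>I. b i (k j) = (if i = j then 1 else 0))"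
  "\<forall>x. (\<Sum>i\<in>I. norm (b i x)) \<le> 1" by auto
 have ka: "k a \<in> K" "k a \<notin> k ` I" using insert.prems insert.hyps(2) by auto
 have "open (- (k ` I))" using finite_imp_closed[OF finite_imageI[OF insert.hyps(1)]] by blast
 then obtain A where A: "clopen_in K A" "k a \<in> A" "A \<subseteq> - (k ` I)"
  using ka clopen_nbhd[OF K ka(1), of "- (k ` I)"] by blast
 define c where "c i = (if i = a then ind A else restrict0 (K - A) (b i))" for i
 have ca: "ind A \<in> (unit_ball K :: ('a => 'k) set)"
  using ind_in[OF A(1)] by (simp add: unit_ball_def restrict0_def)
 have "c i \<in> unit_ball K" if "i \<in> insert a I" for i
  using that b(1) ca unit_ball_restrict[OF clopen_in_Diff_self[OF A(1)]] by (auto simp: c_def)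
 moreover have "c i (k j) = (if i = j then 1 else 0)" if i: "i \<in> insert a I" and j: "j \<in> insert a I" for i j
 proof (cases "j = a")
  case True
  then show ?thesis using A(2) by (simp add: c_def restrict0_def)
 next
  case False
  then have "j \<in> I" using j by simp
  then have kj: "k j \<in> K - A" using A(3) insert.prems(2) by auto
  show ?thesis
  proof (cases "i = a")
   case True
   then show ?thesis using kj False by (simp add: c_def restrict0_def)
  next
   case False
   then show ?thesis using kj b(1) \<open>j \<in> I\<close> i by (simp add: c_def restrict0_def)
  qed
 qed
 moreover have "(\<Sum>i\<in>insert a I. norm (c i x)) \<le> 1" for x
 proof -
  have "(\<Sum>i\<in>insert a I. norm (c i x)) = norm (ind A x :: 'k) + (\<Sum>i\<in>I. norm (restrict0 (K - A) (b i) x))"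
   using insert.hyps by (simp add: c_def) (intro sum.cong, auto)
  also have "\<dots> \<le> 1"
  proof (cases "x \<in> A")
   case False
   have "(\<Sum>i\<in>I. norm (restrict0 (K - A) (b i) x)) \<le> (\<Sum>i\<in>I. norm (b i x))"
    by (intro sum_mono) (simp add: restrict0_def)
   then show ?thesis using b(2)[rule_format, of x] False by (simp add: restrict0_def)
  qed (simp add: restrict0_def)
  finally show ?thesis .
 qed
 ultimately show ?case by (intro exI[of _ c]) blast
qed simp

section \<open>Continuity of the forms in the pair of points\<close>

context tensor_isomorphism
begin

lemma M_nonneg: "0 \<le> M"
proof -
 obtain k l where "k \<in> K" "l \<in> L" using K(3) L(3) by blast
 then show ?thesis using bilinear by (simp add: bilinear_form_def)
qed

text \<open>By \<open>repr\<close>, the preimage of an elementary tensor is a uniform limit of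
  finite sums of products of continuous functions.\<close>

lemma continuous_unit:
 assumes f: "f \<in> unit_ball K'" and g: "g \<in> unit_ball L'"
 shows "continuous_on (K \<times> L) (\<lambda>p. v (fst p) (snd p) f g)"
proof -
 have "\<forall>i::nat. \<exists>\<phi>. continuous_on (K \<times> L) \<phi> \<and> (\<forall>p\<in>K \<times> L. norm (v (fst p) (snd p) f g - \<phi> p) \<le> 1 / Suc i)"
 proof
  fix i :: nat
  have i: "0 < 1 / real (Suc i)" by simp
  obtain n :: nat and c x z where n: "\<forall>r<n. x r \<in> unit_ball K \<and> z r \<in> unit_ball L"
   "\<forall>k\<in>K. \<forall>l\<in>L. norm (v k l f g - (\<Sum>r<n. c r * (x r k * z r l))) \<le> 1 / Suc i"
   using repr[OF f g i] by (elim exE conjE)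
  have "continuous_on (K \<times> L) (\<lambda>p. \<Sum>r<n. c r * (x r (fst p) * z r (snd p)))"
  proof (intro continuous_on_sum continuous_on_mult continuous_on_const)
   fix r assume "r \<in> {..<n}"
   then have xz: "continuous_on K (x r)" "continuous_on L (z r)" using n(1) by (simp_all add: unit_ball_def cont_vanish_def)
   show "continuous_on (K \<times> L) (\<lambda>p. x r (fst p))"
    by (rule continuous_on_compose2[OF xz(1) continuous_on_fst[OF continuous_on_id]]) auto
   show "continuous_on (K \<times> L) (\<lambda>p. z r (snd p))"
    by (rule continuous_on_compose2[OF xz(2) continuous_on_snd[OF continuous_on_id]]) auto
  qed
  then show "\<exists>\<phi>. continuous_on (K \<times> L) \<phi> \<and> (\<forall>p\<in>K \<times> L. norm (v (fst p) (snd p) f g - \<phi> p) \<le> 1 / Suc i)"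
   using n(2) by (intro exI[of _ "\<lambda>p. \<Sum>r<n. c r * (x r (fst p) * z r (snd p))"]) auto
 qed
 from choice[OF this] obtain \<phi> where \<phi>: "\<And>i. continuous_on (K \<times> L) (\<phi> i)"
  "\<And>i p. p \<in> K \<times> L ==> norm (v (fst p) (snd p) f g - \<phi> i p) \<le> 1 / Suc i" by blast
 have "uniform_limit (K \<times> L) \<phi> (\<lambda>p. v (fst p) (snd p) f g) sequentially"
 proof (rule uniform_limitI)
  fix e :: real assume "0 < e"
  then obtain N where N: "inverse (real (Suc N)) < e" using reals_Archimedean by blast
  have "dist (\<phi> i p) (v (fst p) (snd p) f g) < e" if "i \<ge> N" "p \<in> K \<times> L" for i p
  proof -
   have "dist (\<phi> i p) (v (fst p) (snd p) f g) \<le> 1 / Suc i"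
    using \<phi>(2)[OF that(2), of i] by (simp add: dist_norm norm_minus_commute)
   also have "\<dots> \<le> inverse (real (Suc N))" using that(1) by (simp add: field_simps)
   finally show ?thesis using N by simp
  qed
  then show "\<forall>\<^sub>F i in sequentially. \<forall>p\<in>K \<times> L. dist (\<phi> i p) (v (fst p) (snd p) f g) < e"
   unfolding eventually_sequentially by blast
 qed
 then show ?thesis by (rule uniform_limit_theorem[rotated]) (simp_all add: \<phi>(1))
qed

lemma continuous_forms:
 assumes f: "f \<in> cfun K'" and g: "g \<in> cfun L'"
 shows "continuous_on (K \<times> L) (\<lambda>p. v (fst p) (snd p) f g)"
proof -
 obtain u where u: "u \<in> unit_ball K'" "f = (\<lambda>x. of_real (vnorm (CF K') f) * u x)"
  using ex_unit_function[OF K'(1,3) f] by blast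
 obtain w where w: "w \<in> unit_ball L'" "g = (\<lambda>x. of_real (vnorm (CF L') g) * w x)"
  using ex_unit_function[OF L'(1,3) g] by blast
 let ?a = "of_real (vnorm (CF K') f) :: 'k" and ?b = "of_real (vnorm (CF L') g) :: 'k"
 have "v k l f g = ?a * (?b * v k l u w)" if "k \<in> K" "l \<in> L" for k l
 proof -
  note bi = bilinear[OF that]
  have uw: "u \<in> cfun K'" "w \<in> cfun L'" using u(1) w(1) by (simp_all add: unit_ball_def)
  have "v k l (\<lambda>x. ?a * u x) g = ?a * v k l u g" using bi uw g by (simp add: bilinear_form_def vecs_CF)
  moreover have "v k l u (\<lambda>x. ?b * w x) = ?b * v k l u w" using bi uw by (simp add: bilinear_form_def vecs_CF)
  ultimately show ?thesis using u(2) w(2) by simp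
 qed
 then have "continuous_on (K \<times> L) (\<lambda>p. v (fst p) (snd p) f g) \<longleftrightarrow> continuous_on (K \<times> L) (\<lambda>p. ?a * (?b * v (fst p) (snd p) u w))"
  by (intro continuous_on_cong) auto
 then show ?thesis by (simp add: continuous_on_mult continuous_unit[OF u(1) w(1)])
qed

end

lemma infinite_ex_inj:
 assumes "infinite A" "finite I"
 shows "\<exists>k. inj_on k I \<and> k ` I \<subseteq> A"
proof -
 obtain A0 where A0: "finite A0" "card A0 = card I" "A0 \<subseteq> A" using infinite_arbitrarily_large[OF assms(1)] by metis
 then obtain h where "bij_betw h I A0" using finite_same_card_bij[OF assms(2) A0(1)] by metis
 then show ?thesis using A0(3) by (auto simp: bij_betw_def)
qed

lemma partial_unity_sum:
 fixes K :: "'a::metric_space set" and b :: "'i => 'a => 'k::real_normed_field"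
 assumes I: "finite I" and b: "\<forall>i\<in>I. b i \<in> unit_ball K \<and> (\<forall>j\<in>I. b i (k j) = (if i = j then 1 else 0))" "\<forall>x. (\<Sum>i\<in>I. norm (b i x)) \<le> 1"
  and c: "\<And>i. norm (c i) \<le> 1"
 shows "(\<lambda>x. \<Sum>i\<in>I. c i * b i x) \<in> unit_ball K" "j \<in> I ==> (\<Sum>i\<in>I. c i * b i (k j)) = c j"
proof -
 have "norm (\<Sum>i\<in>I. c i * b i x) \<le> 1" for x
 proof -
  have "norm (\<Sum>i\<in>I. c i * b i x) \<le> (\<Sum>i\<in>I. norm (b i x))"
   by (rule sum_norm_le) (simp add: norm_mult mult_left_le_one_le c)
  then show ?thesis using b(2) order_trans by blast
 qed
 moreover have "(\<lambda>x. \<Sum>i\<in>I. c i * b i x) \<in> cfun K"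
  using b(1) by (intro cont_vanish_sum cont_vanish_ops(2)) (simp add: unit_ball_def)
 ultimately show "(\<lambda>x. \<Sum>i\<in>I. c i * b i x) \<in> unit_ball K" by (simp add: unit_ball_def)
 assume j: "j \<in> I"
 then have "(\<Sum>i\<in>I. c i * b i (k j)) = (\<Sum>i\<in>I. if i = j then c i else 0)" using b(1) by (intro sum.cong) auto
 then show "(\<Sum>i\<in>I. c i * b i (k j)) = c j" using I j by simp
qed

section \<open>The smaller exponent: infinite rectangles and signs\<close>

context tensor_isomorphism
begin

text \<open>The stages are products of derivatives, not derivatives of the product, so that the
  points of an earlier stage near the stuck point \<open>q\<close> form a rectangle. Both sides are
  infinite because each coordinate of \<open>q\<close> is a limit point of the earlier
  derivative.\<close>

lemma small_rectangle:
 assumes z: "rank_class L' z" and ne: "CB K (omega_pow (ord_succ z)) \<noteq> {}"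
  "CB L (omega_pow (ord_succ z)) \<noteq> {}" and d: "0 < d"
 obtains A B G where "infinite A" "A \<subseteq> K" "infinite B" "B \<subseteq> L" "finite G" "G \<subseteq> unit_ball L'"
  "\<forall>f\<in>unit_ball L'. \<exists>f'\<in>G. \<forall>k\<in>A. \<forall>l\<in>B. \<forall>e\<in>unit_ball K'. norm (v k l e f - v k l e f') \<le> 2 * d"
proof -
 let ?R = "\<lambda>h. CB K h \<times> CB L h"
 have R: "?R h \<noteq> {} \<and> ?R h \<subseteq> K \<times> L" if "h \<le> omega_pow (ord_succ z)" for h
  using ne CB_antimono[OF that, of K] CB_antimono[OF that, of L]
   CB_subset[of K h] CB_subset[of L h] by auto
 have bil: "bilinear_form (CF K') (CF L') M (\<lambda>(f, g). v (fst p) (snd p) f g)" if "p \<in> K \<times> L" for p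
  using bilinear that by (auto simp: mem_Times_iff)
 have cont: "continuous_on (K \<times> L) (\<lambda>p. v (fst p) (snd p) f g)" if "f \<in> unit_ball K'" "g \<in> cfun L'" for f g
  using that by (intro continuous_forms) (simp_all add: unit_ball_def)
 obtain g h q s G where gh: "g < h" "h \<le> omega_pow (ord_succ z)" "q \<in> ?R h" "0 < s" and G: "finite G" "G \<subseteq> unit_ball L'"
  and small: "\<forall>f\<in>unit_ball L'. \<exists>f'\<in>G. \<forall>p\<in>?R g. dist p q < s -->
   (\<forall>e\<in>unit_ball K'. norm (v (fst p) (snd p) e f - v (fst p) (snd p) e f') \<le> 2 * d)"
  by (rule bilinear_family_stuck[where Q = "K \<times> L" and Y = "\<lambda>p. v (fst p) (snd p)" and R = ?R, OF K' L' z bil cont R d])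
 have lp: "fst q islimpt CB K g" "snd q islimpt CB L g"
  using gh(1,3) by (auto simp: CB_iff[of _ _ h])
 let ?A = "CB K g \<inter> ball (fst q) (s / 2)" and ?B = "CB L g \<inter> ball (snd q) (s / 2)"
 have inf: "infinite ?A" "infinite ?B" using lp gh(4) unfolding islimpt_eq_infinite_ball by auto
 have "(k, l) \<in> ?R g \<and> dist (k, l) q < s" if "k \<in> ?A" "l \<in> ?B" for k l
 proof -
  have "dist k (fst q) < s / 2" "dist l (snd q) < s / 2" using that by (simp_all add: dist_commute)
  moreover have "dist (k, l) q \<le> dist k (fst q) + dist l (snd q)"
   unfolding dist_prod_def fst_conv snd_conv by (rule sqrt_sum_squares_le_sum) simp_all
  ultimately show ?thesis using that by simp
 qed
 then have "\<forall>f\<in>unit_ball L'. \<exists>f'\<in>G. \<forall>k\<in>?A. \<forall>l\<in>?B. \<forall>e\<in>unit_ball K'. norm (v k l e f - v k l e f') \<le> 2 * d"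
  using small by (metis fst_conv snd_conv)
 then show thesis
  by (rule that[OF inf(1) _ inf(2) _ G, rotated 2]) (rule le_infI1[OF CB_subset])+
qed

text \<open>The product of two sign functions lies in the unit balls' tensor product, so
  \<open>coord\<close> represents it by forms; replacing second arguments by members of the net is
  harmless at the stated tolerance. Testing the representation against the same signs gives a number
  of the order of the square of \<open>card I\<close>, and some single term must account for
  it.\<close>

lemma sign_test:
 fixes k :: "'i => 'a" and l :: "'i => 'b"
 assumes I: "finite I" "I \<noteq> {}" and k: "inj_on k I" "k ` I \<subseteq> K" and l: "inj_on l I" "l ` I \<subseteq> L" and G: "finite G"
  and net: "\<forall>g\<in>unit_ball L'. \<exists>s\<in>G. \<forall>i\<in>I. \<forall>j\<in>I. \<forall>f\<in>unit_ball K'.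
   norm (v (k i) (l j) f g - v (k i) (l j) f s) \<le> 1 / (4 * (M + 1))"
 shows "\<exists>f\<in>unit_ball K'. real (card I) * real (card I) \<le>
  2 * (M + 1) * (\<Sum>s\<in>G. norm (sign_sum I I B D (\<lambda>i j. v (k i) (l j) f s)))"
proof (rule ccontr)
 assume no: "\<not> ?thesis"
 let ?S = "\<lambda>f s. sign_sum I I B D (\<lambda>i j. v (k i) (l j) f s)"
 let ?N = "real (card I) * real (card I)" and ?d = "1 / (4 * (M + 1))"
 have M: "0 < M + 1" using M_nonneg by simp
 have T: "norm (?S f s) < ?N / (2 * (M + 1))" if "f \<in> unit_ball K'" "s \<in> G" for f s
 proof -
  have "norm (?S f s) \<le> (\<Sum>s\<in>G. norm (?S f s))" by (rule member_le_sum) (use that G in auto)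
  moreover have "(\<Sum>s\<in>G. norm (?S f s)) < ?N / (2 * (M + 1))"
   using no that(1) M by (auto simp: not_le field_simps)
  ultimately show ?thesis by linarith
 qed
 have N: "0 < ?N" using I by (simp add: card_gt_0_iff)
 let ?s = "\<lambda>i j. of_real (sgn_of B i * sgn_of D j) :: 'k"
 obtain p :: "'i => 'a => 'k" where p: "\<forall>i\<in>I. p i \<in> unit_ball K \<and> (\<forall>j\<in>I. p i (k j) = (if i = j then 1 else 0))" "\<forall>x. (\<Sum>i\<in>I. norm (p i x)) \<le> 1"
  using ex_partial_unity[OF K(1,2) I(1) k] by blast
 obtain q :: "'i => 'b => 'k" where q: "\<forall>i\<in>I. q i \<in> unit_ball L \<and> (\<forall>j\<in>I. q i (l j) = (if i = j then 1 else 0))" "\<forall>x. (\<Sum>i\<in>I. norm (q i x)) \<le> 1"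
  using ex_partial_unity[OF L(1,2) I(1) l] by blast
 let ?x = "\<lambda>x. \<Sum>i\<in>I. of_real (sgn_of B i) * p i x" and ?z = "\<lambda>x. \<Sum>i\<in>I. of_real (sgn_of D i) * q i x"
 have x: "?x \<in> unit_ball K" and xk: "\<And>j. j \<in> I ==> ?x (k j) = of_real (sgn_of B j)"
  by (rule partial_unity_sum[OF I(1) p], simp)+
 have z: "?z \<in> unit_ball L" and zl: "\<And>j. j \<in> I ==> ?z (l j) = of_real (sgn_of D j)"
  by (rule partial_unity_sum[OF I(1) q], simp)+
 have quarter: "(0::real) < 1 / 4" by simp
 obtain n :: nat and c f g where fg: "\<forall>r<n. f r \<in> unit_ball K' \<and> g r \<in> unit_ball L'" and c: "(\<Sum>r<n. norm (c r)) \<le> M"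
  and co: "\<forall>k\<in>K. \<forall>l\<in>L. norm (?x k * ?z l - (\<Sum>r<n. c r * v k l (f r) (g r))) \<le> 1 / 4"
  using coord[OF x z quarter] by (elim exE conjE)
 have "\<forall>r\<in>{..<n}. \<exists>s. s \<in> G \<and> (\<forall>i\<in>I. \<forall>j\<in>I. \<forall>f\<in>unit_ball K'. norm (v (k i) (l j) f (g r) - v (k i) (l j) f s) \<le> ?d)"
  using net fg by blast
 from bchoice[OF this] obtain h where h: "\<forall>r\<in>{..<n}. h r \<in> G \<and>
  (\<forall>i\<in>I. \<forall>j\<in>I. \<forall>f\<in>unit_ball K'. norm (v (k i) (l j) f (g r) - v (k i) (l j) f (h r)) \<le> ?d)" ..
 let ?P = "\<lambda>i j. \<Sum>r<n. c r * v (k i) (l j) (f r) (h r)"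
 \<comment> \<open>One quarter is the error of the representation; the other comes from the net, as
   coefficients of total size at most \<open>M\<close> meet the tolerance \<open>?d\<close>.\<close>
 have 1: "norm (1 - ?s i j * ?P i j) \<le> 1 / 2" if i: "i \<in> I" and j: "j \<in> I" for i j
 proof -
  have kl: "k i \<in> K" "l j \<in> L" using i j k l by auto
  have "norm (v (k i) (l j) (f r) (g r) - v (k i) (l j) (f r) (h r)) \<le> ?d" if "r < n" for r
   using h fg i j that by simp
  then have "norm (\<Sum>r<n. c r * (v (k i) (l j) (f r) (g r) - v (k i) (l j) (f r) (h r))) \<le> (\<Sum>r<n. norm (c r) * ?d)"
   by (intro sum_norm_le) (simp only: norm_mult lessThan_iff mult_left_mono norm_ge_zero)
  also have "\<dots> \<le> M * ?d" unfolding sum_distrib_right[symmetric] using c M by (intro mult_right_mono) auto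
  also have "\<dots> \<le> 1 / 4" using M by (simp add: divide_le_eq)
  finally have "norm ((\<Sum>r<n. c r * v (k i) (l j) (f r) (g r)) - ?P i j) \<le> 1 / 4"
   by (simp only: right_diff_distrib sum_subtractf)
  moreover have "norm (?s i j - (\<Sum>r<n. c r * v (k i) (l j) (f r) (g r))) \<le> 1 / 4"
   using co[rule_format, OF kl] by (simp only: xk[OF i] zl[OF j] of_real_mult)
  ultimately have "norm (?s i j - ?P i j) \<le> 1 / 2"
   using norm_triangle_ineq[of "?s i j - (\<Sum>r<n. c r * v (k i) (l j) (f r) (g r))"
    "(\<Sum>r<n. c r * v (k i) (l j) (f r) (g r)) - ?P i j"] by simp
  moreover have "1 - ?s i j * ?P i j = ?s i j * (?s i j - ?P i j)"
  proof -
   have "?s i j * ?s i j = 1" by (simp add: sgn_of_def)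
   then show ?thesis by (simp add: right_diff_distrib)
  qed
  moreover have "norm (?s i j) = 1" by (simp only: norm_of_real abs_mult abs_sgn_of mult_1)
  ultimately show ?thesis by (simp only: norm_mult[of "?s i j"] mult_1)
 qed
 have "norm (\<Sum>i\<in>I. \<Sum>j\<in>I. 1 - ?s i j * ?P i j) \<le> (\<Sum>i\<in>I. \<Sum>j\<in>I. 1 / 2)"
  by (intro sum_norm_le 1)
 then have "norm (of_real ?N - (\<Sum>i\<in>I. \<Sum>j\<in>I. ?s i j * ?P i j)) \<le> ?N / 2"
  by (simp add: sum_subtractf)
 moreover have "norm (of_real ?N :: 'k) = ?N" by (simp only: norm_of_real) simp
 ultimately have 2: "?N / 2 \<le> norm (\<Sum>i\<in>I. \<Sum>j\<in>I. ?s i j * ?P i j)"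
  using norm_triangle_ineq2[of "of_real ?N :: 'k" "\<Sum>i\<in>I. \<Sum>j\<in>I. ?s i j * ?P i j"] by linarith
 \<comment> \<open>Exchanging the sums leaves one sign sum for each term of the representation. If
   all were below \<open>?N / (2 * (M + 1))\<close>, the total would stay below
   \<open>?N / 2\<close>.\<close>
 have "(\<Sum>i\<in>I. \<Sum>j\<in>I. ?s i j * ?P i j) = (\<Sum>i\<in>I. \<Sum>j\<in>I. \<Sum>r<n. c r * (?s i j * v (k i) (l j) (f r) (h r)))"
  by (simp add: sum_distrib_left mult_ac)
 also have "\<dots> = (\<Sum>r<n. c r * ?S (f r) (h r))"
  by (simp only: sum.swap[of _ "{..<n}" I] sum_distrib_left scaleR_conv_of_real)
 also have "norm \<dots> \<le> (\<Sum>r<n. norm (c r) * (?N / (2 * (M + 1))))"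
 proof (rule sum_norm_le)
  fix r assume "r \<in> {..<n}"
  then have "norm (?S (f r) (h r)) \<le> ?N / (2 * (M + 1))" using T fg h by (simp add: less_imp_le)
  then show "norm (c r * ?S (f r) (h r)) \<le> norm (c r) * (?N / (2 * (M + 1)))"
   by (simp only: norm_mult mult_left_mono norm_ge_zero)
 qed
 also have "\<dots> \<le> M * (?N / (2 * (M + 1)))" unfolding sum_distrib_right[symmetric] using c M N by (intro mult_right_mono) auto
 also have "\<dots> < ?N / 2" using M N by (simp add: field_simps)
 finally show False using 2 by linarith
qed

text \<open>Let n = 2^r. By \<open>sign_test\<close>, every choice of product signs has a function
  on \<open>K'\<close> whose sign sums over \<open>G\<close> have total size of order n^2. By
  \<open>functional_chaos\<close> with the Walsh matrix, each member of \<open>G\<close> contributes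
  on average at most 4 (M n^(3/2) + 1). Since \<open>G\<close> and \<open>M\<close> are fixed before
  r, this bounds sqrt n by a constant.\<close>

theorem no_small_rectangle:
 assumes A: "infinite A" "A \<subseteq> K" and B: "infinite B" "B \<subseteq> L" and G: "finite G" "G \<subseteq> unit_ball L'"
  and net: "\<forall>g\<in>unit_ball L'. \<exists>s\<in>G. \<forall>k\<in>A. \<forall>l\<in>B. \<forall>f\<in>unit_ball K'. norm (v k l f g - v k l f s) \<le> 1 / (4 * (M + 1))"
 shows False
proof -
 have M: "0 \<le> M" by (rule M_nonneg)
 have main: "sqrt (2 ^ r) \<le> 8 * (M + 1) * real (card G) * (M + 1)" for r :: nat
 proof -
  let ?R = "{..<r}" and ?n = "2 ^ r :: real"
  \<comment> \<open>Rows and columns are indexed by subsets to match the Walsh matrix. The first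
    term of \<open>?N\<close> is the bound for forms of total size \<open>M\<close>, the 1 is the
    approximation error.\<close>
  let ?I = "Pow ?R" and ?N = "M * (2 ^ r * sqrt (2 ^ r)) + 1"
  have I: "finite ?I" "?I \<noteq> {}" and cI: "real (card ?I) = ?n" by (auto simp: card_Pow)
  obtain k where k: "inj_on k ?I" "k ` ?I \<subseteq> A" using infinite_ex_inj[OF A(1) I(1)] by blast
  obtain l where l: "inj_on l ?I" "l ` ?I \<subseteq> B" using infinite_ex_inj[OF B(1) I(1)] by blast
  have kl: "k i \<in> K" "l j \<in> L" if "i \<in> ?I" "j \<in> ?I" for i j using that k(2) l(2) A(2) B(2) by blast+
  have net': "\<forall>g\<in>unit_ball L'. \<exists>s\<in>G. \<forall>i\<in>?I. \<forall>j\<in>?I. \<forall>f\<in>unit_ball K'.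
    norm (v (k i) (l j) f g - v (k i) (l j) f s) \<le> 1 / (4 * (M + 1))"
   using net k(2) l(2) by (metis image_subset_iff)
  have kI: "k ` ?I \<subseteq> K" "l ` ?I \<subseteq> L" by (rule order_trans[OF k(2) A(2)], rule order_trans[OF l(2) B(2)])
  let ?W = "\<lambda>C D f x. sign_sum ?I ?I C D (\<lambda>i j. v (k i) (l j) f x)"
  have "\<forall>P. \<exists>f. f \<in> unit_ball K' \<and> ?n * ?n \<le> 2 * (M + 1) * (\<Sum>x\<in>G. norm (?W (fst P) (snd P) f x))"
   using sign_test[OF I k(1) kI(1) l(1) kI(2) G(1) net'] unfolding cI by blast
  from choice[OF this] obtain \<phi> where \<phi>: "\<And>P. \<phi> P \<in> unit_ball K'"
   "\<And>P. ?n * ?n \<le> 2 * (M + 1) * (\<Sum>x\<in>G. norm (?W (fst P) (snd P) (\<phi> P) x))" by blast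
  have chaos: "(\<Sum>D\<in>Pow ?I. \<Sum>C\<in>Pow ?I. norm (?W C D (\<phi> (C, D)) x)) \<le> 4 * (2 ^ card ?I * 2 ^ card ?I * ?N)" if x: "x \<in> G" for x
  proof (rule functional_chaos[OF K'(1,2) I(1), where a = walsh and M = M])
   show "bounded_functional K' M (\<lambda>h. v (k i) (l j) h x)" if "i \<in> ?I" "j \<in> ?I" for i j
    by (rule bilinear_form_unit(1)[OF bilinear[OF kl[OF that]] K'(1,3) L'(1,3) subsetD[OF G(2) x]])
   show "0 \<le> M" by (rule M)
   show "\<phi> (C, D) \<in> unit_ball K'" for C D by (rule \<phi>(1))
   show "\<bar>walsh i j\<bar> = 1" for i j by simp
   fix C D and h :: "'c => 'k" assume h: "h \<in> unit_ball K'"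
   \<comment> \<open>With this tolerance the errors at all \<open>?n * ?n\<close> pairs add up to at
     most 1.\<close>
   have pos: "0 < 1 / (?n * ?n)" by simp
   obtain n :: nat and c y z where yz: "\<forall>r<n. y r \<in> unit_ball K \<and> z r \<in> unit_ball L" and c: "(\<Sum>r<n. norm (c r)) \<le> M"
    and re: "\<forall>k\<in>K. \<forall>l\<in>L. norm (v k l h x - (\<Sum>r<n. c r * (y r k * z r l))) \<le> 1 / (?n * ?n)"
    using repr[OF h subsetD[OF G(2) x] pos] by (elim exE conjE)
   let ?s = "\<lambda>(i::nat set) (j::nat set). sgn_of C i * sgn_of D j" and ?q = "\<lambda>i j. \<Sum>r<n. c r * (y r (k i) * z r (l j))"
   have "norm (?s i j *\<^sub>R (walsh i j *\<^sub>R (v (k i) (l j) h x - ?q i j))) \<le> 1 / (?n * ?n)" if "i \<in> ?I" "j \<in> ?I" for i j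
    using re kl[OF that] by (simp add: abs_mult)
   then have "norm (\<Sum>i\<in>?I. \<Sum>j\<in>?I. ?s i j *\<^sub>R (walsh i j *\<^sub>R (v (k i) (l j) h x - ?q i j))) \<le> (\<Sum>i\<in>?I. \<Sum>j\<in>?I. 1 / (?n * ?n))"
    by (intro sum_norm_le) blast
   also have "\<dots> = 1" using cI by simp
   finally have 1: "norm ((\<Sum>i\<in>?I. \<Sum>j\<in>?I. ?s i j *\<^sub>R (walsh i j *\<^sub>R v (k i) (l j) h x)) -
     (\<Sum>i\<in>?I. \<Sum>j\<in>?I. ?s i j *\<^sub>R (walsh i j *\<^sub>R ?q i j))) \<le> 1"
    by (simp only: scaleR_right_diff_distrib sum_subtractf)
   have "(\<Sum>i\<in>?I. \<Sum>j\<in>?I. ?s i j *\<^sub>R (walsh i j *\<^sub>R ?q i j)) =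
     (\<Sum>i\<in>?I. \<Sum>j\<in>?I. \<Sum>r<n. c r * (walsh i j *\<^sub>R ((sgn_of C i *\<^sub>R y r (k i)) * (sgn_of D j *\<^sub>R z r (l j)))))"
    by (simp add: sum_distrib_left scaleR_conv_of_real mult_ac)
   also have "\<dots> = (\<Sum>r<n. c r * (\<Sum>i\<in>?I. \<Sum>j\<in>?I. walsh i j *\<^sub>R ((sgn_of C i *\<^sub>R y r (k i)) * (sgn_of D j *\<^sub>R z r (l j)))))"
    by (simp only: sum.swap[of _ "{..<n}" ?I] sum_distrib_left)
   also have "norm \<dots> \<le> (\<Sum>r<n. norm (c r) * (?n * sqrt ?n))"
   proof (rule sum_norm_le)
    fix t assume t: "t \<in> {..<n}"
    have "norm (\<Sum>i\<in>?I. \<Sum>j\<in>?I. walsh i j *\<^sub>R ((sgn_of C i *\<^sub>R y t (k i)) * (sgn_of D j *\<^sub>R z t (l j)))) \<le> 2 ^ card ?R * sqrt (2 ^ card ?R)"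
     by (rule walsh_bilinear_bound) (use yz t in "simp_all add: unit_ball_def")
    then have le: "norm (\<Sum>i\<in>?I. \<Sum>j\<in>?I. walsh i j *\<^sub>R ((sgn_of C i *\<^sub>R y t (k i)) * (sgn_of D j *\<^sub>R z t (l j)))) \<le> ?n * sqrt ?n" by simp
    show "norm (c t * (\<Sum>i\<in>?I. \<Sum>j\<in>?I. walsh i j *\<^sub>R ((sgn_of C i *\<^sub>R y t (k i)) * (sgn_of D j *\<^sub>R z t (l j))))) \<le> norm (c t) * (?n * sqrt ?n)"
     unfolding norm_mult[of "c t"] by (rule mult_left_mono[OF le norm_ge_zero])
   qed
   also have "\<dots> \<le> M * (?n * sqrt ?n)" unfolding sum_distrib_right[symmetric] using c by (intro mult_right_mono) auto
   finally show "norm (\<Sum>i\<in>?I. \<Sum>j\<in>?I. (sgn_of C i * sgn_of D j) *\<^sub>R (walsh i j *\<^sub>R v (k i) (l j) h x)) \<le> ?N"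
    using 1 norm_triangle_sub[of "\<Sum>i\<in>?I. \<Sum>j\<in>?I. ?s i j *\<^sub>R (walsh i j *\<^sub>R v (k i) (l j) h x)"
     "\<Sum>i\<in>?I. \<Sum>j\<in>?I. ?s i j *\<^sub>R (walsh i j *\<^sub>R ?q i j)"] by linarith
  qed
  let ?c = "2 ^ card ?I * 2 ^ card ?I :: real"
  have c0: "0 < ?c" by simp
  have "?c * (?n * ?n) = (\<Sum>D\<in>Pow ?I. \<Sum>C\<in>Pow ?I. ?n * ?n)" by (simp add: card_Pow)
  also have "\<dots> \<le> (\<Sum>D\<in>Pow ?I. \<Sum>C\<in>Pow ?I. 2 * (M + 1) * (\<Sum>x\<in>G. norm (?W C D (\<phi> (C, D)) x)))"
  proof (intro sum_mono)
   show "?n * ?n \<le> 2 * (M + 1) * (\<Sum>x\<in>G. norm (?W C D (\<phi> (C, D)) x))" for C D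
    using \<phi>(2)[of "(C, D)"] by (simp only: fst_conv snd_conv)
  qed
  also have "\<dots> = 2 * (M + 1) * (\<Sum>x\<in>G. \<Sum>D\<in>Pow ?I. \<Sum>C\<in>Pow ?I. norm (?W C D (\<phi> (C, D)) x))"
   by (simp only: sum.swap[of _ G] sum_distrib_left)
  also have "\<dots> \<le> 2 * (M + 1) * (\<Sum>x\<in>G. 4 * (?c * ?N))"
   using M by (intro mult_left_mono sum_mono chaos) auto
  also have "\<dots> = ?c * (8 * (M + 1) * real (card G) * ?N)" by (simp add: algebra_simps)
  finally have 2: "?n * ?n \<le> 8 * (M + 1) * real (card G) * ?N" using c0 by (simp only: mult_le_cancel_left_pos)
  have "1 \<le> ?n * sqrt ?n" using mult_mono[of 1 ?n 1 "sqrt ?n"] by simp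
  then have "?N \<le> (M + 1) * (?n * sqrt ?n)" by (simp add: distrib_right)
  then have "8 * (M + 1) * real (card G) * ?N \<le> 8 * (M + 1) * real (card G) * ((M + 1) * (?n * sqrt ?n))"
   using M by (intro mult_left_mono) auto
  with 2 have "?n * ?n \<le> 8 * (M + 1) * real (card G) * ((M + 1) * (?n * sqrt ?n))" by linarith
  moreover have "?n * ?n = sqrt ?n * (?n * sqrt ?n)" by simp
  ultimately have "sqrt ?n * (?n * sqrt ?n) \<le> (8 * (M + 1) * real (card G) * (M + 1)) * (?n * sqrt ?n)" by (simp only: mult.assoc)
  then show ?thesis by (rule mult_right_le_imp_le) simp
 qed
 obtain r where r: "(8 * (M + 1) * real (card G) * (M + 1))\<^sup>2 < 2 ^ r"
  using real_arch_pow[of 2] by auto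
 have "8 * (M + 1) * real (card G) * (M + 1) < sqrt (2 ^ r)"
  by (rule order_le_less_trans[OF abs_ge_self]) (use real_sqrt_less_mono[OF r] in "simp only: real_sqrt_abs")
 then show False using main[of r] by linarith
qed

end

section \<open>The larger exponent: disjoint unions and separation of points\<close>

definition disjoint_union :: "'c::metric_space set => 'c set => ('c \<times> real) set" where
 "disjoint_union K L = K \<times> {0} \<union> L \<times> {1}"

lemma disjoint_union_clopen:
 assumes "compact K" "compact L"
 shows "compact (disjoint_union K L)" "clopen_in (disjoint_union K L) (K \<times> {0})" "clopen_in (disjoint_union K L) (L \<times> {1})"
proof -
 have c: "compact (K \<times> {0 :: real})" "compact (L \<times> {1 :: real})" using assms by (simp_all add: compact_Times)
 then show "compact (disjoint_union K L)" unfolding disjoint_union_def by (rule compact_Un)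
 have "disjoint_union K L - K \<times> {0} = L \<times> {1}" "disjoint_union K L - L \<times> {1} = K \<times> {0}"
  by (auto simp: disjoint_union_def)
 then show "clopen_in (disjoint_union K L) (K \<times> {0})" "clopen_in (disjoint_union K L) (L \<times> {1})"
  using c by (auto simp: clopen_in_def disjoint_union_def)
qed

lemma CB_slice:
 fixes K :: "'c::metric_space set"
 shows "CB (K \<times> {s :: real}) g = (\<lambda>x. (x, s)) ` CB K g"
 by (rule homeomorphism_CB[where k = fst])
  (auto simp: homeomorphism_def intro!: continuous_intros)

text \<open>Derivatives are formed on each slice separately, and a sufficiently high multiple of the
  larger unit empties both.\<close>

lemma rank_class_disjoint_union:
 fixes K L :: "'c::metric_space set"
 assumes K: "compact K" "rank_class K x" and L: "compact L" "rank_class L z" and le: "z \<le> x"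
 shows "rank_class (disjoint_union K L) x"
proof -
 let ?D = "disjoint_union K L"
 note cl = disjoint_union_clopen[OF K(1) L(1)]
 have cb: "CB ?D g = (\<lambda>x. (x, 0)) ` CB K g \<union> (\<lambda>x. (x, 1)) ` CB L g" for g
 proof -
  have "CB ?D g = CB ?D g \<inter> (K \<times> {0}) \<union> CB ?D g \<inter> (L \<times> {1})"
   using CB_subset[of ?D g] by (auto simp: disjoint_union_def)
  then show ?thesis
   unfolding CB_clopen[OF cl(2), symmetric] CB_clopen[OF cl(3), symmetric] CB_slice .
 qed
 obtain n where n: "CB K (ord_nmult (omega_pow x) n) = {}" using K(2) by (auto simp: rank_class_def)
 obtain m where m: "CB L (ord_nmult (omega_pow z) m) = {}" using L(2) by (auto simp: rank_class_def)
 have mono: "ord_nmult (omega_pow x) a \<le> ord_nmult (omega_pow x) b" if "a \<le> b" for a b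
 proof (cases "a = b")
  case False
  then have "ord_of_nat a < ord_of_nat b" using that by (simp add: ord_of_nat_less)
  then show ?thesis by (rule less_imp_le[OF ord_mult_less_mono[OF omega_pow_neq_zero]])
 qed simp
 have "ord_nmult (omega_pow z) m \<le> ord_nmult (omega_pow x) (Suc m)"
 proof (cases "z = x")
  case False
  then have "ord_nmult (omega_pow z) m \<le> omega_pow x"
   using le ord_nmult_le_omega_pow_succ[of z m] omega_pow_le_iff[of "ord_succ z" x] by (auto simp: ord_succ_le_iff intro: order_trans)
  also have "omega_pow x \<le> ord_nmult (omega_pow x) (Suc m)"
   using mono[of "Suc 0" "Suc m"] unfolding ord_nmult_1 by (meson Suc_le_mono le0)
  finally show ?thesis .
 next
  case True
  have "m \<le> Suc m" by simp
  from mono[OF this] show ?thesis unfolding True .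
 qed
 also have "\<dots> \<le> ord_nmult (omega_pow x) (Suc m + n)" by (rule mono) simp
 finally have "ord_nmult (omega_pow z) m \<le> ord_nmult (omega_pow x) (Suc m + n)" .
 from CB_antimono[OF this, of L] have "CB L (ord_nmult (omega_pow x) (Suc m + n)) = {}"
  unfolding m by (simp only: subset_empty)
 moreover have "ord_nmult (omega_pow x) n \<le> ord_nmult (omega_pow x) (Suc m + n)" by (rule mono) simp
 from CB_antimono[OF this, of K] have "CB K (ord_nmult (omega_pow x) (Suc m + n)) = {}"
  unfolding n by (simp only: subset_empty)
 ultimately have "CB ?D (ord_nmult (omega_pow x) (Suc m + n)) = {}" by (simp only: cb image_empty Un_empty)
 moreover have "CB ?D (omega_pow x) \<noteq> {}" using K(2) by (simp add: rank_class_def cb)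
 ultimately show ?thesis unfolding rank_class_def by blast
qed

definition slice_extend :: "real => ('c => 'k::zero) => 'c \<times> real => 'k" where
 "slice_extend s f p = (if snd p = s then f (fst p) else 0)"

lemma slice_functions:
 fixes D :: "('c::metric_space \<times> real) set" and f :: "'c => 'k::real_normed_field"
 assumes D: "clopen_in D (A \<times> {s})" and A: "\<And>x. (x, s) \<in> D \<longleftrightarrow> x \<in> A"
 shows "f \<in> cfun A ==> slice_extend s f \<in> cfun D"
  and "F \<in> cfun D ==> (\<lambda>x. F (x, s) :: 'k) \<in> cfun A"
proof -
 show "slice_extend s f \<in> cfun D" if f: "f \<in> cfun A"
 proof -
  have "continuous_on A f" using f by (simp add: cont_vanish_def)
  then have "continuous_on (A \<times> {s}) (\<lambda>p. f (fst p))"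
   by (rule continuous_on_compose2[OF _ continuous_on_fst[OF continuous_on_id]]) auto
  then have "continuous_on D (slice_extend s f)"
  proof (rule continuous_on_clopen_cases[OF D _ continuous_on_const[of _ 0]])
   show "slice_extend s f p = f (fst p)" if "p \<in> A \<times> {s}" for p
    using that by (cases p) (simp add: slice_extend_def)
   show "slice_extend s f p = 0" if p: "p \<in> D - A \<times> {s}" for p
   proof (cases "snd p = s")
    case True
    have "(fst p, snd p) \<in> D" "(fst p, snd p) \<notin> A \<times> {s}" using p by simp_all
    then have "fst p \<in> A" "fst p \<notin> A" unfolding True A by simp_all
    then show ?thesis by blast
   qed (simp add: slice_extend_def)
  qed
  moreover have "slice_extend s f p = 0" if "p \<notin> D" for p
  proof (cases "snd p = s")
   case True
   then have "fst p \<notin> A" using that A[of "fst p"] by (cases p) simp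
   then show ?thesis using f by (simp add: cont_vanish_def slice_extend_def)
  qed (simp add: slice_extend_def)
  ultimately show ?thesis by (simp add: cont_vanish_def)
 qed
 show "(\<lambda>x. F (x, s)) \<in> cfun A" if F: "F \<in> cfun D"
 proof -
  have "continuous_on D F" using F by (simp add: cont_vanish_def)
  then have "continuous_on A (\<lambda>x. F (x, s))"
   by (rule continuous_on_compose2) (use A in "auto intro!: continuous_intros")
  then show ?thesis using F A by (auto simp: cont_vanish_def)
 qed
qed

lemma slice_extend_eval [simp]: "slice_extend s f (x, s) = f x" "s \<noteq> t ==> slice_extend s f (x, t) = 0"
 by (simp_all add: slice_extend_def)

lemma slice_norm:
 fixes D :: "('c::metric_space \<times> real) set" and F :: "'c \<times> real => 'k::real_normed_field"
 assumes D: "compact D" "D \<noteq> {}" and A: "A \<noteq> {}" and F: "F \<in> cfun D"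
 shows "vnorm (CF A) (\<lambda>x. F (x, s)) \<le> vnorm (CF D) F"
 by (rule CF_norm_le[OF A CF_norm_ge[OF D(1) F D(2)]])

context tensor_isomorphism
begin

text \<open>The indicator of a clopen set containing \<open>k\<close> but not \<open>k'\<close> is
  represented up to 1/4 by forms with coefficients of total size at most \<open>M\<close>. If the
  forms at the two points were \<open>d\<close>-close, the values 1 and 0 would differ by at most
  1/4 + 1/4 + M d, which is below 1.\<close>

lemma coordinates_separated:
 assumes k: "k \<in> K" "k' \<in> K" "k \<noteq> k'" and l: "l \<in> L" and d: "0 < d" "M * d < 1 / 2"
  and close: "\<And>f g. f \<in> unit_ball K' ==> g \<in> unit_ball L' ==> norm (v k l f g - v k' l f g) \<le> d"
 shows False
proof -
 have "open (- {k'})" by (rule open_Compl[OF closed_singleton])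
 then obtain A where A: "clopen_in K A" "k \<in> A" "A \<subseteq> - {k'}" using clopen_nbhd[OF K(1,2) k(1), of "- {k'}"] k(3) by blast
 have x: "ind A \<in> (unit_ball K :: ('a => 'k) set)" and z: "ind L \<in> (unit_ball L :: ('b => 'k) set)"
  using ind_in[OF A(1)] ind_in[OF clopen_in_self[OF L(1)]] by (simp_all add: unit_ball_def restrict0_def)
 have quarter: "(0::real) < 1 / 4" by simp
 obtain n :: nat and c f g where fg: "\<forall>r<n. f r \<in> unit_ball K' \<and> g r \<in> unit_ball L'" and c: "(\<Sum>r<n. norm (c r)) \<le> M"
  and co: "\<forall>k\<in>K. \<forall>l\<in>L. norm (ind A k * ind L l - (\<Sum>r<n. c r * v k l (f r) (g r))) \<le> 1 / 4"
  using coord[OF x z quarter] by (elim exE conjE)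
 let ?s = "\<lambda>k. \<Sum>r<n. c r * v k l (f r) (g r)"
 have "norm (1 - ?s k) \<le> 1 / 4" "norm (0 - ?s k') \<le> 1 / 4"
  using co[rule_format, OF k(1) l] co[rule_format, OF k(2) l] A(2,3) l by (auto simp: restrict0_def)
 moreover have "norm (?s k - ?s k') \<le> (\<Sum>r<n. norm (c r) * d)"
  unfolding sum_subtractf[symmetric] right_diff_distrib[symmetric]
  using fg close by (intro sum_norm_le) (simp add: norm_mult mult_left_mono)
 moreover have "(\<Sum>r<n. norm (c r) * d) \<le> M * d" unfolding sum_distrib_right[symmetric] using c d(1) by (intro mult_right_mono) auto
 moreover have "norm (1 :: 'k) \<le> norm (1 - ?s k) + norm (?s k - ?s k') + norm (?s k')"
  using norm_triangle_ineq[of "1 - ?s k" "?s k - ?s k'"] norm_triangle_ineq[of "1 - ?s k'" "?s k'"] by simp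
 ultimately show False using d(2) by simp
qed

end

text \<open>The symmetrised forms on the disjoint union of \<open>K'\<close> and \<open>L'\<close> treat both factors at once.\<close>

lemma no_smaller_class:
 fixes K' L' :: "'c::metric_space set" and K :: "'a::metric_space set" and L :: "'b::metric_space set"
  and v :: "'a => 'b => ('c => 'k::{real_normed_field,euclidean_space}) => ('c => 'k) => 'k"
 assumes T: "tensor_isomorphism K L K' L' M v" and x: "rank_class K' x" and z: "rank_class L' z" "z \<le> x"
  and ne: "CB K (omega_pow (ord_succ x)) \<noteq> {}"
 shows False
proof -
 interpret tensor_isomorphism K L K' L' M v by (rule T)
 obtain l where l: "l \<in> L" using L(3) by blast
 let ?D = "disjoint_union K' L'"
 note cl = disjoint_union_clopen[OF K'(1) L'(1)]
 have sl: "(x, 0) \<in> ?D \<longleftrightarrow> x \<in> K'" "(x, 1) \<in> ?D \<longleftrightarrow> x \<in> L'" for x by (auto simp: disjoint_union_def)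
 have D: "compact ?D" "countable ?D" "?D \<noteq> {}" "rank_class ?D x"
  using cl(1) K' L' rank_class_disjoint_union[OF K'(1) x L'(1) z] by (auto simp: disjoint_union_def)
 note J0 = slice_functions(2)[OF cl(2) sl(1)] and J1 = slice_functions(2)[OF cl(3) sl(2)]
 note X0 = slice_functions(1)[OF cl(2) sl(1)] and X1 = slice_functions(1)[OF cl(3) sl(2)]
 \<comment> \<open>\<open>Y\<close> is symmetric, so a net for its second argument yields nets for
   both factors; a function carried by one slice picks out one of the two summands.\<close>
 define Y :: "'a => ('c \<times> real => 'k) => ('c \<times> real => 'k) => 'k" where "Y k F G = v k l (\<lambda>x. F (x, 0)) (\<lambda>x. G (x, 1)) + v k l (\<lambda>x. G (x, 0)) (\<lambda>x. F (x, 1))" for k F G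
 have Y: "bilinear_form (CF ?D) (CF ?D) (2 * M) (\<lambda>(F, G). Y k F G)" if k: "k \<in> K" for k
  unfolding bilinear_form_def
 proof (intro conjI ballI allI)
  note bi = bilinear[OF k l, unfolded bilinear_form_def vecs_CF CF_ops split_conv]
  show "0 \<le> 2 * M" using M_nonneg by simp
  fix F G :: "'c \<times> real => 'k" assume FG: "F \<in> vecs (CF ?D)" "G \<in> vecs (CF ?D)"
  note F = FG(1)[unfolded vecs_CF] and G = FG(2)[unfolded vecs_CF]
  show "(case (vadd (CF ?D) F F', G) of (F, G) => Y k F G) = (case (F, G) of (F, G) => Y k F G) + (case (F', G) of (F, G) => Y k F G)"
   if "F' \<in> vecs (CF ?D)" for F'
   using bi J0[OF F] J1[OF F] J0[OF G] J1[OF G] J0[OF that[unfolded vecs_CF]] J1[OF that[unfolded vecs_CF]] by (simp add: Y_def)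
  show "(case (F, vadd (CF ?D) G G') of (F, G) => Y k F G) = (case (F, G) of (F, G) => Y k F G) + (case (F, G') of (F, G) => Y k F G)"
   if "G' \<in> vecs (CF ?D)" for G'
   using bi J0[OF F] J1[OF F] J0[OF G] J1[OF G] J0[OF that[unfolded vecs_CF]] J1[OF that[unfolded vecs_CF]] by (simp add: Y_def)
  show "(case (vscale (CF ?D) c F, G) of (F, G) => Y k F G) = c * (case (F, G) of (F, G) => Y k F G)"
   "(case (F, vscale (CF ?D) c G) of (F, G) => Y k F G) = c * (case (F, G) of (F, G) => Y k F G)" for c
   using bi J0[OF F] J1[OF F] J0[OF G] J1[OF G] by (simp_all add: Y_def distrib_left)
  interpret D: normed_nspace "CF ?D :: ('k, 'c \<times> real => 'k) nspace" by (rule normed_nspace_CF[OF D(1,3)])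
  interpret L: normed_nspace "CF L' :: ('k, 'c => 'k) nspace" by (rule normed_nspace_CF[OF L'(1,3)])
  have bd: "norm (v k l (\<lambda>x. F (x, 0)) (\<lambda>x. G (x, 1))) \<le> M * (vnorm (CF ?D) F * vnorm (CF ?D) G)"
   if F: "F \<in> cfun ?D" and G: "G \<in> cfun ?D" for F G :: "'c \<times> real => 'k"
  proof -
   have Gv: "(\<lambda>x. G (x, 1)) \<in> vecs (CF L')" and Fv: "F \<in> vecs (CF ?D)" using J1[OF G] F by (simp_all only: vecs_CF)
   have "norm (v k l (\<lambda>x. F (x, 0)) (\<lambda>x. G (x, 1))) \<le> M * (vnorm (CF K') (\<lambda>x. F (x, 0)) * vnorm (CF L') (\<lambda>x. G (x, 1)))"
    using bi J0[OF F] J1[OF G] by simp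
   also have "\<dots> \<le> M * (vnorm (CF ?D) F * vnorm (CF ?D) G)"
    by (rule mult_left_mono[OF mult_mono[OF slice_norm[OF D(1,3) K'(3) F] slice_norm[OF D(1,3) L'(3) G]
     D.norm_nonneg[OF Fv] L.norm_nonneg[OF Gv]] M_nonneg])
   finally show ?thesis .
  qed
  have "norm (Y k F G) \<le> M * (vnorm (CF ?D) F * vnorm (CF ?D) G) + M * (vnorm (CF ?D) G * vnorm (CF ?D) F)"
   unfolding Y_def by (rule norm_triangle_le[OF add_mono[OF bd[OF F G] bd[OF G F]]])
  then show "norm (case (F, G) of (F, G) => Y k F G) \<le> 2 * M * (vnorm (CF ?D) F * vnorm (CF ?D) G)"
   by (simp add: mult_ac)
 qed
 have vcont: "continuous_on K (\<lambda>k. v k l f g)" if "f \<in> cfun K'" "g \<in> cfun L'" for f g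
 proof -
  have "continuous_on K (\<lambda>k. (k, l))" by (intro continuous_intros)
  from continuous_on_compose2[OF continuous_forms[OF that] this] show ?thesis using l by (simp add: image_subset_iff)
 qed
 have Ycont: "continuous_on K (\<lambda>k. Y k F G)" if "F \<in> unit_ball ?D" "G \<in> cfun ?D" for F G
  unfolding Y_def using that by (intro continuous_on_add vcont J0 J1) (simp_all add: unit_ball_def)
 have R: "CB K h \<noteq> {} \<and> CB K h \<subseteq> K" if "h \<le> omega_pow (ord_succ x)" for h
  using ne CB_antimono[OF that, of K] CB_subset[of K h] by auto
 \<comment> \<open>Two forms will differ by at most \<open>9 * ?d\<close>: at each of the two points
   \<open>4 * ?d\<close> for passing to the net in both variables, and \<open>?d\<close> for moving
   between the points on the net. \<open>coordinates_separated\<close> asks for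
   \<open>M * (9 * ?d) < 1 / 2\<close>.\<close>
 let ?d = "1 / (18 * (M + 1))"
 have d: "0 < ?d" using M_nonneg by simp
 obtain g h k s G where gh: "g < h" "h \<le> omega_pow (ord_succ x)" "k \<in> CB K h" "0 < s"
  and G: "finite G" "G \<subseteq> unit_ball ?D"
  and net: "\<forall>f\<in>unit_ball ?D. \<exists>f'\<in>G. \<forall>p\<in>CB K g. dist p k < s -->
   (\<forall>e\<in>unit_ball ?D. norm (Y p e f - Y p e f') \<le> 2 * ?d)"
  by (rule bilinear_family_stuck[where Q = K and Y = Y and R = "CB K", OF D(1-3) D Y Ycont R d])
 have kK: "k \<in> K" and lp: "k islimpt CB K g" and kg: "k \<in> CB K g"
  using gh(1,3) CB_antimono[OF less_imp_le[OF gh(1)], of K] by (auto simp: CB_iff[of _ _ h])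
 have uX: "slice_extend 0 f \<in> unit_ball ?D" if "f \<in> unit_ball K'" for f :: "'c => 'k"
  using that X0[of f] by (simp add: unit_ball_def slice_extend_def)
 have uX1: "slice_extend 1 f \<in> unit_ball ?D" if "f \<in> unit_ball L'" for f :: "'c => 'k"
  using that X1[of f] by (simp add: unit_ball_def slice_extend_def)
 let ?f = "\<lambda>s x. s (x, 0) :: 'k" and ?g = "\<lambda>s x. s (x, 1) :: 'k"
 have J: "?f s \<in> unit_ball K'" "?g s \<in> unit_ball L'" if "s \<in> G" for s
  using G(2) that J0[of s] J1[of s] by (auto simp: unit_ball_def)
 have Y0: "Y p (slice_extend 0 f) F = v p l f (?g F)" "Y p (slice_extend 1 g) F = v p l (?f F) g"
  if "p \<in> K" "F \<in> unit_ball ?D" "f \<in> unit_ball K'" "g \<in> unit_ball L'" for p f g F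
 proof -
  note b = bilinear_form_unit[OF bilinear[OF that(1) l] K'(1,3) L'(1,3)]
  have "?f F \<in> unit_ball K'" "?g F \<in> unit_ball L'" using that(2) J0[of F] J1[of F] by (auto simp: unit_ball_def)
  then show "Y p (slice_extend 0 f) F = v p l f (?g F)" "Y p (slice_extend 1 g) F = v p l (?f F) g"
   using bounded_functional_zero[OF b(1)] bounded_functional_zero[OF b(2)] by (simp_all add: Y_def)
 qed
 let ?W = "?f ` G \<times> ?g ` G"
 \<comment> \<open>Only finitely many pairs of net functions remain to be compared, and on these the
   forms depend continuously on the point.\<close>
 have "\<exists>t>0. \<forall>p\<in>K. dist p k < t --> near ?W ?d (v k l) (v p l)"
 proof (rule near_radius[OF _ kK d])
  show "finite ?W" using G(1) by simp
  show "continuous_on K (\<lambda>p. v p l e f)" if "(e, f) \<in> ?W" for e f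
   using that J by (intro vcont) (auto simp: unit_ball_def)
 qed
 then obtain t where t: "0 < t" "\<forall>p\<in>K. dist p k < t --> near ?W ?d (v k l) (v p l)" by blast
 have "0 < min s t" using t(1) gh(4) by simp
 then obtain p where p: "p \<in> CB K g" "p \<noteq> k" "dist p k < min s t"
  using lp unfolding islimpt_approachable by blast
 have pK: "p \<in> K" using p(1) CB_subset by blast
 have near: "near ?W ?d (v k l) (v p l)" using t(2) pK p(3) by simp
 have close: "norm (v p l f g' - v k l f g') \<le> 9 * ?d" if f: "f \<in> unit_ball K'" and g': "g' \<in> unit_ball L'" for f g'
 proof -
  obtain a where a: "a \<in> G" "\<forall>p\<in>CB K g. dist p k < s -->
   (\<forall>e\<in>unit_ball ?D. norm (Y p e (slice_extend 0 f) - Y p e a) \<le> 2 * ?d)" using net uX[OF f] by blast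
  obtain b where b: "b \<in> G" "\<forall>p\<in>CB K g. dist p k < s -->
   (\<forall>e\<in>unit_ball ?D. norm (Y p e (slice_extend 1 g') - Y p e b) \<le> 2 * ?d)" using net uX1[OF g'] by blast
  have ab: "a \<in> unit_ball ?D" "b \<in> unit_ball ?D" using G(2) a(1) b(1) by blast+
  \<comment> \<open>First the second variable is moved to the net, then the first; the other
    variable serves as the test function from the opposite slice.\<close>
  have "norm (v q l f g' - v q l (?f a) (?g b)) \<le> 4 * ?d" if q: "q \<in> CB K g" "dist q k < s" for q
  proof -
   have qK: "q \<in> K" using q(1) CB_subset by blast
   have "norm (v q l f g' - v q l f (?g b)) \<le> 2 * ?d"
    using bspec[OF mp[OF bspec[OF b(2) q(1)] q(2)] uX[OF f]]
    unfolding Y0(1)[OF qK uX1[OF g'] f g'] Y0(1)[OF qK ab(2) f g'] by simp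
   moreover have "norm (v q l f (?g b) - v q l (?f a) (?g b)) \<le> 2 * ?d"
    using bspec[OF mp[OF bspec[OF a(2) q(1)] q(2)] uX1[OF J(2)[OF b(1)]]]
    unfolding Y0(2)[OF qK uX[OF f] f J(2)[OF b(1)]] Y0(2)[OF qK ab(1) f J(2)[OF b(1)]] by simp
   ultimately show ?thesis
    using norm_triangle_ineq[of "v q l f g' - v q l f (?g b)" "v q l f (?g b) - v q l (?f a) (?g b)"] by simp
  qed
  from this[OF p(1)] this[OF kg]
  have 1: "norm (v p l f g' - v p l (?f a) (?g b)) \<le> 4 * ?d" "norm (v k l f g' - v k l (?f a) (?g b)) \<le> 4 * ?d"
   using p(3) gh(4) by simp_all
  have 2: "norm (v p l (?f a) (?g b) - v k l (?f a) (?g b)) < ?d" by (rule nearD[OF near]) (use a(1) b(1) in blast)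
  have "norm (v p l f g' - v k l f g') \<le> norm (v p l f g' - v p l (?f a) (?g b)) +
    norm (v p l (?f a) (?g b) - v k l (?f a) (?g b)) + norm (v k l f g' - v k l (?f a) (?g b))"
   using norm_triangle_ineq4[of "v p l f g' - v k l (?f a) (?g b)" "v k l f g' - v k l (?f a) (?g b)"]
    norm_triangle_ineq[of "v p l f g' - v p l (?f a) (?g b)" "v p l (?f a) (?g b) - v k l (?f a) (?g b)"] by simp
  then show ?thesis using 1 2 by linarith
 qed
 show False
 proof (rule coordinates_separated[OF pK kK p(2) l _ _ close])
  show "0 < 9 * ?d" using d by simp
  show "M * (9 * ?d) < 1 / 2" using M_nonneg by (simp add: divide_less_eq)
 qed
qed

subsection \<open>The classification\<close>

lemma rank_class_nonempty: "rank_class K x ==> K \<noteq> {}"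
 using CB_subset by (fastforce simp: rank_class_def)

lemma linearly_homeomorphic_class:
 fixes K :: "'a::metric_space set" and K' :: "'b::metric_space set"
 assumes K: "compact K" "countable K" "rank_class K x" and K': "compact K'" "countable K'" "rank_class K' x"
 shows "linearly_homeomorphic (CF K :: ('k::real_normed_field, 'a => 'k) nspace) (CF K')"
 by (rule linearly_homeomorphic_CF[OF K(1) rank_class_nonempty[OF K(3)] K'(1) rank_class_nonempty[OF K'(3)] cont_vanish_iso[OF K K']])

text \<open>\<open>no_smaller_class\<close> settles the larger exponent. For the smaller one,
  \<open>z' < z\<close> makes the derivatives of both factors long enough compared with the class of
  \<open>L'\<close> to produce an infinite rectangle, which \<open>no_small_rectangle\<close>
  excludes.\<close>

lemma class_order:
 fixes K :: "'a::metric_space set" and L :: "'b::metric_space set" and K' L' :: "'c::metric_space set"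
 assumes K: "compact K" "countable K" "rank_class K x" and L: "compact L" "countable L" "rank_class L z"
  and K': "compact K'" "countable K'" "rank_class K' x'" and L': "compact L'" "countable L'" "rank_class L' z'"
  and le: "z \<le> x" "z' \<le> x'"
  and iso: "linearly_homeomorphic ((CF K :: ('k::{real_normed_field,euclidean_space}, 'a => 'k) nspace) \<otimes>\<^sub>\<pi> CF L)
   ((CF K' :: ('k::{real_normed_field,euclidean_space}, 'c => 'k) nspace) \<otimes>\<^sub>\<pi> CF L')"
 shows "x \<le> x'" "z \<le> z'"
proof -
 obtain M and v :: "'a => 'b => ('c => 'k) => ('c => 'k) => 'k" where T: "tensor_isomorphism K L K' L' M v"
  by (rule tensor_isomorphism_exists[OF K(1,2) rank_class_nonempty[OF K(3)] L(1,2) rank_class_nonempty[OF L(3)]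
   K'(1,2) rank_class_nonempty[OF K'(3)] L'(1,2) rank_class_nonempty[OF L'(3)] iso], rule that)
 have ne: "CB K (omega_pow (ord_succ y)) \<noteq> {}" if "y < x" for y
  using CB_antimono[of "omega_pow (ord_succ y)" "omega_pow x" K] K(3) that
  by (auto simp: rank_class_def ord_succ_le_iff)
 have ne': "CB L (omega_pow (ord_succ y)) \<noteq> {}" if "y < z" for y
  using CB_antimono[of "omega_pow (ord_succ y)" "omega_pow z" L] L(3) that
  by (auto simp: rank_class_def ord_succ_le_iff)
 show "x \<le> x'"
 proof (rule ccontr)
  assume "\<not> x \<le> x'"
  then have "x' < x" by simp
  from no_smaller_class[OF T K'(3) L'(3) le(2) ne[OF this]] show False .
 qed
 show "z \<le> z'"
 proof (rule ccontr)
  assume "\<not> z \<le> z'"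
  \<comment> \<open>The order within the pair enters here: it makes the derivatives of
    \<open>K\<close> at least as long as those of \<open>L\<close>.\<close>
  then have z: "z' < z" "z' < x" using le(1) by simp_all
  note r = L'(3)
  interpret tensor_isomorphism K L K' L' M v by (rule T)
  have d: "0 < 1 / (8 * (M + 1))" using M_nonneg by simp
  \<comment> \<open>\<open>small_rectangle\<close> doubles its parameter, and
    \<open>no_small_rectangle\<close> asks for the tolerance
    \<open>1 / (4 * (M + 1))\<close>.\<close>
  have "2 * (1 / (8 * (M + 1))) = 1 / (4 * (M + 1))" using M_nonneg by (simp add: divide_simps)
  from small_rectangle[OF r ne[OF z(2)] ne'[OF z(1)] d, unfolded this] show False
   by (rule, rule no_small_rectangle)
 qed
qed

lemma ex_model:
 obtains K :: "(nat => real) set" where "compact K" "countable K" "rank_class K x"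
  "linearly_homeomorphic (C_omega x :: ('k::real_normed_field, _) nspace) (CF K)"
proof -
 let ?J = "{0..omega_pow (omega_pow x)}"
 obtain K :: "(nat => real) set" and f k t where h: "homeomorphism ?J K f k" and K: "compact K" "countable K"
  and t: "CB K (omega_pow x) = {t}" by (rule ex_metric_model, rule that)
 have r: "rank_class K x" by (rule rank_class_singleton[OF t])
 have "?J \<noteq> {}" by simp
 then have "linearly_homeomorphic (CF ?J :: ('k, _) nspace) (CF K)"
  by (rule linearly_homeomorphic_CF[OF compact_ord_interval _ K(1) rank_class_nonempty[OF r] cont_vanish_homeomorphism[OF h]])
 then show thesis using that[OF K r] by (simp add: C_omega_def omega_pow_def)
qed

lemma tensor_pair_C_omega: "tensor_pair (C_omega x :: ('k::real_normed_field, _) nspace) (C_omega z)"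
 unfolding C_omega_def omega_pow_def[symmetric] by (rule tensor_pair_CF) (simp_all add: compact_ord_interval)

lemma normed_nspace_tensor: "tensor_pair X Y ==> normed_nspace (X \<otimes>\<^sub>\<pi> Y)"
proof -
 assume "tensor_pair X Y"
 then interpret tensor_pair X Y .
 show ?thesis by (rule P.normed_nspace_axioms)
qed

lemma CF_C_omega:
 fixes K :: "'a::metric_space set"
 assumes K: "compact K" "countable K" "rank_class K x"
 shows "linearly_homeomorphic (CF K :: ('k::real_normed_field, 'a => 'k) nspace) (C_omega x)"
proof -
 obtain K' :: "(nat => real) set" where K': "compact K'" "countable K'" "rank_class K' x"
  "linearly_homeomorphic (C_omega x :: ('k, _) nspace) (CF K')" by (rule ex_model, rule that)
 have n: "normed_nspace (CF K :: ('k, 'a => 'k) nspace)" "normed_nspace (CF K' :: ('k, _) nspace)"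
  by (rule normed_nspace_CF[OF K(1) rank_class_nonempty[OF K(3)]], rule normed_nspace_CF[OF K'(1) rank_class_nonempty[OF K'(3)]])
 have n': "normed_nspace (C_omega x :: ('k, _) nspace)"
  unfolding C_omega_def omega_pow_def[symmetric] by (rule normed_nspace_CF) (simp_all add: compact_ord_interval)
 show ?thesis
  by (rule linearly_homeomorphic_trans[OF n n' linearly_homeomorphic_class[OF K K'(1-3)] linearly_homeomorphic_sym[OF n' n(2) K'(4)]])
qed

lemma CF_C_omega_tensor:
 fixes K :: "'a::metric_space set" and L :: "'b::metric_space set"
 assumes K: "compact K" "countable K" "rank_class K x" and L: "compact L" "countable L" "rank_class L z"
 shows "linearly_homeomorphic ((CF K :: ('k::real_normed_field, 'a => 'k) nspace) \<otimes>\<^sub>\<pi> CF L) (C_omega x \<otimes>\<^sub>\<pi> C_omega z)"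
 by (rule linearly_homeomorphic_tensor_cong[OF tensor_pair_CF[OF K(1) rank_class_nonempty[OF K(3)] L(1) rank_class_nonempty[OF L(3)]]
  tensor_pair_C_omega CF_C_omega[OF K] CF_C_omega[OF L]])

text \<open>\<open>class_order\<close> concerns metric spaces, so both sides are first moved to
  metric models of the same classes.\<close>

lemma C_omega_tensor_inject:
 assumes le: "z \<le> x" "z' \<le> x'"
  and iso: "linearly_homeomorphic ((C_omega x :: ('k::{real_normed_field,euclidean_space}, _) nspace) \<otimes>\<^sub>\<pi> C_omega z)
   ((C_omega x' :: ('k::{real_normed_field,euclidean_space}, _) nspace) \<otimes>\<^sub>\<pi> C_omega z')"
 shows "x \<le> x' \<and> z \<le> z'"
proof -
 note n = normed_nspace_tensor[OF tensor_pair_C_omega]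
 obtain K :: "(nat => real) set" where K: "compact K" "countable K" "rank_class K x" by (rule ex_model, rule that)
 obtain L :: "(nat => real) set" where L: "compact L" "countable L" "rank_class L z" by (rule ex_model, rule that)
 obtain K' :: "(nat => real) set" where K': "compact K'" "countable K'" "rank_class K' x'" by (rule ex_model, rule that)
 obtain L' :: "(nat => real) set" where L': "compact L'" "countable L'" "rank_class L' z'" by (rule ex_model, rule that)
 let ?T = "(CF K :: ('k, (nat => real) => 'k) nspace) \<otimes>\<^sub>\<pi> CF L" and ?T' = "(CF K' :: ('k, (nat => real) => 'k) nspace) \<otimes>\<^sub>\<pi> CF L'"
 have nT: "normed_nspace ?T" "normed_nspace ?T'"
  using K L K' L' by (intro normed_nspace_tensor tensor_pair_CF; simp add: rank_class_nonempty)+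
 have "linearly_homeomorphic ?T (C_omega x' \<otimes>\<^sub>\<pi> C_omega z')"
  by (rule linearly_homeomorphic_trans[OF nT(1) n n CF_C_omega_tensor[OF K L] iso])
 then have "linearly_homeomorphic ?T ?T'"
  by (rule linearly_homeomorphic_trans[OF nT(1) n nT(2) _ linearly_homeomorphic_sym[OF nT(2) n CF_C_omega_tensor[OF K' L']]])
 from class_order[OF K L K' L' le this] show ?thesis by blast
qed

theorem tensor_classification:
 fixes K :: "'a::metric_space set" and L :: "'b::metric_space set"
 assumes K: "compact K" "countable K" "infinite K" and L: "compact L" "countable L" "infinite L"
 shows "\<exists>!(\<xi>, \<zeta>). \<zeta> \<le> \<xi> \<and> linearly_homeomorphic
  ((CF K :: ('k::{real_normed_field,euclidean_space}, 'a => 'k) nspace) \<otimes>\<^sub>\<pi> CF L) (C_omega \<xi> \<otimes>\<^sub>\<pi> C_omega \<zeta>)"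
proof -
 let ?T = "(CF K :: ('k, 'a => 'k) nspace) \<otimes>\<^sub>\<pi> CF L"
 note tC = tensor_pair_C_omega[where ?'k = 'k]
 note n = normed_nspace_tensor[OF tC]
 obtain x where x: "rank_class K x" using ex_rank_class[OF K] by blast
 obtain z where z: "rank_class L z" using ex_rank_class[OF L] by blast
 have nT: "normed_nspace ?T"
  by (rule normed_nspace_tensor[OF tensor_pair_CF[OF K(1) rank_class_nonempty[OF x] L(1) rank_class_nonempty[OF z]]])
 have iso: "linearly_homeomorphic ?T (C_omega x \<otimes>\<^sub>\<pi> C_omega z)" by (rule CF_C_omega_tensor[OF K(1,2) x L(1,2) z])
 \<comment> \<open>The classes of \<open>K\<close> and \<open>L\<close> come in no particular order;
   exchanging the factors arranges \<open>\<zeta> \<le> \<xi>\<close>.\<close>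
 have "linearly_homeomorphic ?T (C_omega z \<otimes>\<^sub>\<pi> C_omega x)"
  by (rule linearly_homeomorphic_trans[OF nT n n iso linearly_homeomorphic_tensor_swap[OF tC tC]])
 then have ex: "\<exists>p. case p of (\<xi>, \<zeta>) => \<zeta> \<le> \<xi> \<and> linearly_homeomorphic ?T (C_omega \<xi> \<otimes>\<^sub>\<pi> C_omega \<zeta>)"
 proof (cases "z \<le> x")
  case True
  then show ?thesis using iso by (intro exI[of _ "(x, z)"]) simp
 next
  case False
  then show ?thesis using \<open>linearly_homeomorphic ?T (C_omega z \<otimes>\<^sub>\<pi> C_omega x)\<close> by (intro exI[of _ "(z, x)"]) simp
 qed
 \<comment> \<open>The inequality is proved in one direction only; exchanging the two pairs gives
   equality.\<close>
 have le: "x1 \<le> x2 \<and> z1 \<le> z2"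
  if "z1 \<le> x1" "linearly_homeomorphic ?T (C_omega x1 \<otimes>\<^sub>\<pi> C_omega z1)" "z2 \<le> x2" "linearly_homeomorphic ?T (C_omega x2 \<otimes>\<^sub>\<pi> C_omega z2)"
  for x1 x2 z1 z2
  by (rule C_omega_tensor_inject[OF that(1,3) linearly_homeomorphic_trans[OF n nT n linearly_homeomorphic_sym[OF nT n that(2)] that(4)]])
 have "p = q"
  if p: "case p of (\<xi>, \<zeta>) => \<zeta> \<le> \<xi> \<and> linearly_homeomorphic ?T (C_omega \<xi> \<otimes>\<^sub>\<pi> C_omega \<zeta>)"
   and q: "case q of (\<xi>, \<zeta>) => \<zeta> \<le> \<xi> \<and> linearly_homeomorphic ?T (C_omega \<xi> \<otimes>\<^sub>\<pi> C_omega \<zeta>)" for p q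
 proof -
  obtain x1 z1 x2 z2 where pq: "p = (x1, z1)" "q = (x2, z2)" by (cases p, cases q)
  have 1: "z1 \<le> x1" "linearly_homeomorphic ?T (C_omega x1 \<otimes>\<^sub>\<pi> C_omega z1)" and 2: "z2 \<le> x2" "linearly_homeomorphic ?T (C_omega x2 \<otimes>\<^sub>\<pi> C_omega z2)"
   using p q unfolding pq by simp_all
  show ?thesis using le[OF 1 2] le[OF 2 1] unfolding pq by (simp add: order_antisym)
 qed
 then show ?thesis using ex by (intro ex_ex1I)
qed

theorem theorem1p1:
  fixes K :: "'a::metric_space set" and L :: "'b::metric_space set"
  assumes "infinite K" and "countable K" and "compact K"
    and "infinite L" and "countable L" and "compact L"
  shows "(\<exists>!(\<xi>, \<zeta>). \<zeta> \<le> \<xi> \<and>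
            linearly_homeomorphic
              ((continuous_functions K :: (real, 'a \<Rightarrow> real) nspace) \<otimes>\<^sub>\<pi> continuous_functions L)
              (C_omega \<xi> \<otimes>\<^sub>\<pi> C_omega \<zeta>)) \<and>
         (\<exists>!(\<xi>, \<zeta>). \<zeta> \<le> \<xi> \<and>
            linearly_homeomorphic
              ((continuous_functions K :: (complex, 'a \<Rightarrow> complex) nspace) \<otimes>\<^sub>\<pi> continuous_functions L)
              (C_omega \<xi> \<otimes>\<^sub>\<pi> C_omega \<zeta>))"
  by (intro conjI tensor_classification assms)

end
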